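(* Let $r\ge 2$ be an integer and let $\{a_k\}_{k\ge 1}$ be a deterministic real sequence. Put $A_n:=\sum_{k=1}^n a_k^2$, and suppose that $A_n\to\infty$ as $n\to\infty$ and that $a_n^2=O(A_n^{1-\delta})$ as $n\to\infty$ for some $\delta\in(0,1]$. Let $f_{r,a}$ and $V_n$ be as defined in the context, and let $\sigma_l:(0,1)\to\mathbb{R}$ be a non-increasing continuous function satisfying $\sigma_l(r^{-n})=V_n$ for each positive integer $n$. Then: (i) For every $y\in\mathbb{R}$, $$\lim_{h\to0}\mu\left(\left\{x\in\mathbb{T}^1:\ \frac{f_{r,a}(x+h)-f_{r,a}(x)}{h\sqrt{\sigma_l(|h|)}}\le y\right\}\right)=\int_{-\infty}^y\frac{1}{\sqrt{2\pi}}e^{-t^2/2}\,dt.$$ (ii) For $\mu$-a.e. $x$, for each $y\in[-1,1]$ there exists a sequence $\{h_n\}_{n\ge1}$ with $\lim_{n\to\infty}h_n=0$ such that $$\lim_{n\to\infty}\frac{f_{r,a}(x+h_n)-f_{r,a}(x)}{h_n\sqrt{2\sigma_l(|h_n|)\log\log\sigma_l(|h_n|)}}=y.$$ (iii) For $\mu$-a.e. $x$, $$\liminf_{h\downarrow0}\sqrt{\frac{\log\log\sigma_l(h)}{\sigma_l(h)}}\ \sup_{T\in(h,1)}\frac{|f_{r,a}(x+T)-f_{r,a}(x)|}{T}=\frac{\pi}{\sqrt8}.$$ (iv) Assume in addition that $\{V_n\}_{n\ge1}$ is regularly varying with index $\beta>0$, i.e. $V_{\lfloor nt\rfloor}/V_n\to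 t^\beta$ as $n\to\infty$ for all $t\in(0,\infty)$. Then, with $x$ distributed according to $\mu$ on $\mathbb{T}^1$, as $n\to\infty$, $$\left\{\frac{f_{r,a}(x+r^{-\lfloor nt^{1/\beta}\rfloor})-f_{r,a}(x)}{r^{-\lfloor nt^{1/\beta}\rfloor}\cdot\sqrt{V_n}}:\ 0\le t\le1\right\}\ \xrightarrow{\ \mathrm{d}\ }\ \{B(t):0\le t\le1\},$$ where $\{B(t):0\le t\le 1\}$ is a standard Brownian motion and $\xrightarrow{\mathrm{d}}$ denotes convergence in distribution of processes (in the Skorokhod space $D[0,1]$).
   Context: $d(x)$ denotes the distance from $x\in\mathbb{R}$ to its nearest integer. For an integer $r\ge2$ and a real sequence $\{a_k\}$, the Takagi--van der Waerden class function is $$f_{r,a}(x):=\sum_{k=1}^\infty \frac{a_k}{r^{k-1}}\,d(r^{k-1}x).$$ (The assumptions $A_n\to\infty$ and $a_n^2=O(A_n^{1-\delta})$ imply $\sum_k |a_k| r^{-(k-1)}<\infty$, so the series converges uniformly and $f_{r,a}$ is continuous.) Since $d$ is $1$-periodic, $f_{r,a}$ is regarded as a function on $\mathbb{T}^1:=\mathbb{R}/\mathbb{Z}$, equipped with the Lebesgue measure $\mu$. Let $\psi_k(x):=r^{-(k-1)}d(r^{k-1}x)$, let $\psi_k^+(x)$ be the right-hand derivative of $\psi_k$ at $x$, and let $w_n(x):=\sum_{k=1}^n a_k\psi_k^+(x)$ for $x\in[0,1)$. Set $V_n:=\int_0^1 (w_n(x))^2\,\mu(dx)$, and $V_0:=0$.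 *)

theory Defs
  imports "HOL-Probability.Probability"
begin

section \<open>Takagi--van der Waerden class functions\<close>

definition nearest_int_dist :: "real \<Rightarrow> real" where
  "nearest_int_dist x = \<bar>x - of_int (round x)\<bar>"

text \<open>Coefficient sequences are indexed by \<open>k \<ge> 1\<close>; the entry \<open>a 0\<close> is never used, whence the
  shift in the series.\<close>

definition takagi_vdw :: "nat \<Rightarrow> (nat \<Rightarrow> real) \<Rightarrow> real \<Rightarrow> real" where
  "takagi_vdw r a x = (\<Sum>k. a (Suc k) / real r ^ k * nearest_int_dist (real r ^ k * x))"

text \<open>The circle \<open>\<real>/\<int>\<close> is represented by its fundamental domain \<open>[0,1)\<close>; functions on it are
  1-periodic functions on \<open>\<real>\<close>, so that shifts of the argument need no reduction modulo 1.\<close>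

definition circle_measure :: "real measure" where
  "circle_measure = lebesgue_on {0..<1}"

definition psi :: "nat \<Rightarrow> nat \<Rightarrow> real \<Rightarrow> real" where
  "psi r k x = nearest_int_dist (real r ^ (k - 1) * x) / real r ^ (k - 1)"

definition psi_right_deriv :: "nat \<Rightarrow> nat \<Rightarrow> real \<Rightarrow> real" where
  "psi_right_deriv r k x = vector_derivative (psi r k) (at_right x)"

definition w_sum :: "nat \<Rightarrow> (nat \<Rightarrow> real) \<Rightarrow> nat \<Rightarrow> real \<Rightarrow> real" where
  "w_sum r a n x = (\<Sum>k=1..n. a k * psi_right_deriv r k x)"

definition V_seq :: "nat \<Rightarrow> (nat \<Rightarrow> real) \<Rightarrow> nat \<Rightarrow> real" where
  "V_seq r a n = (\<integral>x. (w_sum r a n x)\<^sup>2 \<partial>circle_measure)"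

definition regularly_varying_seq :: "(nat \<Rightarrow> real) \<Rightarrow> real \<Rightarrow> bool" where
  "regularly_varying_seq v \<beta> \<longleftrightarrow>
     (\<forall>t>0. (\<lambda>n. v (nat \<lfloor>real n * t\<rfloor>) / v n) \<longlonglongrightarrow> t powr \<beta>)"


section \<open>The Skorokhod space \<open>D[0,1]\<close>\<close>

text \<open>Paths are functions on \<open>\<real>\<close> that are \<open>undefined\<close> outside \<open>[0,1]\<close>, so that equality of paths is
  equality on \<open>[0,1]\<close>.\<close>

definition skorokhod_space :: "(real \<Rightarrow> real) set" where
  "skorokhod_space = {x \<in> extensional {0..1}.
     (\<forall>t\<in>{0..<1}. (x \<longlongrightarrow> x t) (at_right t)) \<and>
     (\<forall>t\<in>{0<..1}. \<exists>l. (x \<longlongrightarrow> l) (at_left t))}"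

definition time_changes :: "(real \<Rightarrow> real) set" where
  "time_changes = {l. strict_mono_on {0..1} l \<and> continuous_on {0..1} l \<and> l ` {0..1} = {0..1}}"

text \<open>The Skorokhod (J1) metric
  \<open>inf\<^sub>\<lambda> max (sup\<^sub>t \<bar>\<lambda> t - t\<bar>) (sup\<^sub>t \<bar>x t - y (\<lambda> t)\<bar>)\<close>. The infimum is taken in the extended
  non-negative reals; it is finite on the Skorokhod space, whose elements are bounded.\<close>

definition skorokhod_edist :: "(real \<Rightarrow> real) \<Rightarrow> (real \<Rightarrow> real) \<Rightarrow> ennreal" where
  "skorokhod_edist x y = (INF l\<in>time_changes.
     max (SUP t\<in>{0..1}. ennreal \<bar>l t - t\<bar>) (SUP t\<in>{0..1}. ennreal \<bar>x t - y (l t)\<bar>))"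

definition skorokhod_dist :: "(real \<Rightarrow> real) \<Rightarrow> (real \<Rightarrow> real) \<Rightarrow> real" where
  "skorokhod_dist x y = enn2real (skorokhod_edist x y)"

lemma skorokhod_edist_leI:
  assumes "l \<in> time_changes" "\<And>t. t \<in> {0..1} \<Longrightarrow> ennreal \<bar>l t - t\<bar> \<le> e"
    "\<And>t. t \<in> {0..1} \<Longrightarrow> ennreal \<bar>x t - y (l t)\<bar> \<le> e"
  shows "skorokhod_edist x y \<le> e"
  unfolding skorokhod_edist_def using assms
  by (intro INF_lower2[OF assms(1)] max.boundedI SUP_least) auto

lemma skorokhod_edist_lessE:
  assumes "skorokhod_edist x y < e"
  obtains l c where "l \<in> time_changes" "c < e" "\<And>t. t \<in> {0..1} \<Longrightarrow> ennreal \<bar>l t - t\<bar> \<le> c"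
    "\<And>t. t \<in> {0..1} \<Longrightarrow> ennreal \<bar>x t - y (l t)\<bar> \<le> c"
proof -
  obtain l where l: "l \<in> time_changes" and less:
    "max (SUP t\<in>{0..1}. ennreal \<bar>l t - t\<bar>) (SUP t\<in>{0..1}. ennreal \<bar>x t - y (l t)\<bar>) < e"
    using assms unfolding skorokhod_edist_def INF_less_iff by auto
  show thesis
  proof (rule that[OF l less])
    fix t :: real assume t: "t \<in> {0..1}"
    show "ennreal \<bar>l t - t\<bar> \<le> max (SUP t\<in>{0..1}. ennreal \<bar>l t - t\<bar>) (SUP t\<in>{0..1}. ennreal \<bar>x t - y (l t)\<bar>)"
      by (rule max.coboundedI1) (rule SUP_upper[OF t])
    show "ennreal \<bar>x t - y (l t)\<bar> \<le> max (SUP t\<in>{0..1}. ennreal \<bar>l t - t\<bar>) (SUP t\<in>{0..1}. ennreal \<bar>x t - y (l t)\<bar>)"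
      by (rule max.coboundedI2) (rule SUP_upper[OF t])
  qed
qed

lemma time_changes_in: "l \<in> time_changes \<Longrightarrow> t \<in> {0..1} \<Longrightarrow> l t \<in> {0..1}"
  unfolding time_changes_def by blast

lemma time_changes_id: "(\<lambda>t. t) \<in> time_changes"
  unfolding time_changes_def by (auto simp: strict_mono_on_def)

lemma time_changes_compose:
  assumes "l \<in> time_changes" "m \<in> time_changes"
  shows "(\<lambda>t. m (l t)) \<in> time_changes"
proof -
  have im: "l ` {0..1} = {0..1}" "m ` {0..1} = {0..1}"
    using assms by (auto simp: time_changes_def)
  have "strict_mono_on {0..1} (\<lambda>t. m (l t))"
    using assms time_changes_in[OF assms(1)] unfolding time_changes_def strict_mono_on_def by auto
  moreover have "continuous_on {0..1} (\<lambda>t. m (l t))"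
    using assms by (intro continuous_on_compose2[of "{0..1}" m "{0..1}" l]) (auto simp: time_changes_def)
  moreover have "(\<lambda>t. m (l t)) ` {0..1} = {0..1}"
    using im by (simp flip: image_image)
  ultimately show ?thesis by (simp add: time_changes_def)
qed

lemma time_changes_inverse:
  assumes "l \<in> time_changes"
  obtains m where "m \<in> time_changes" "\<And>t. t \<in> {0..1} \<Longrightarrow> m (l t) = t"
    "\<And>t. t \<in> {0..1} \<Longrightarrow> l (m t) = t"
proof -
  define m where "m = inv_into {0..1} l"
  have mono: "strict_mono_on {0..1} l" and cont: "continuous_on {0..1} l"
    and im: "l ` {0..1} = {0..1}"
    using assms by (auto simp: time_changes_def)
  have inj: "inj_on l {0..1}"
    using mono by (rule strict_mono_on_imp_inj_on)
  have ml: "m (l t) = t" if "t \<in> {0..1}" for t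
    using inj that by (simp add: m_def)
  have lm: "l (m t) = t" if "t \<in> {0..1}" for t
    using im that by (simp add: m_def f_inv_into_f)
  have m_in: "m t \<in> {0..1}" if "t \<in> {0..1}" for t
    using im that by (metis inv_into_into m_def)
  have "continuous_on {0..1} m"
    using continuous_on_inv[OF cont _ ] ml im by (metis compact_Icc)
  moreover have "strict_mono_on {0..1} m"
  proof (rule strict_mono_onI)
    fix s t :: real assume st: "s \<in> {0..1}" "t \<in> {0..1}" "s < t"
    show "m s < m t"
    proof (rule ccontr)
      assume "\<not> m s < m t"
      then have "l (m t) \<le> l (m s)"
        using strict_mono_on_leD[OF mono m_in[OF st(2)] m_in[OF st(1)]] by simp
      then show False using lm st by simp
    qed
  qed
  moreover have "m ` {0..1} = {0..1}"
  proof
    show "m ` {0..1} \<subseteq> {0..1}" using m_in by blast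
    show "{0..1} \<subseteq> m ` {0..1}"
      using ml time_changes_in[OF assms] by (metis imageI subsetI)
  qed
  ultimately have "m \<in> time_changes" by (simp add: time_changes_def)
  then show thesis using that ml lm by blast
qed

lemma time_changes_1:
  assumes "l \<in> time_changes" shows "l 1 = 1"
proof -
  have mono: "strict_mono_on {0..1} l" and im: "l ` {0..1} = {0..1}"
    using assms by (auto simp: time_changes_def)
  then obtain t where t: "t \<in> {0..1}" "l t = 1" by (metis atLeastAtMost_iff imageE order_refl zero_le_one)
  have "l t \<le> l 1" using strict_mono_on_leD[OF mono t(1), of 1] t(1) by auto
  moreover have "l 1 \<in> {0..1}" using time_changes_in[OF assms, of 1] by simp
  ultimately show ?thesis using t by simp
qed

lemma skorokhod_edist_commute_le: "skorokhod_edist y x \<le> skorokhod_edist x y"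
proof (rule dense_ge)
  fix e assume "skorokhod_edist x y < e"
  then obtain l c where l: "l \<in> time_changes" "c < e" "\<And>t. t \<in> {0..1} \<Longrightarrow> ennreal \<bar>l t - t\<bar> \<le> c"
    "\<And>t. t \<in> {0..1} \<Longrightarrow> ennreal \<bar>x t - y (l t)\<bar> \<le> c"
    using skorokhod_edist_lessE[of x y e] by blast
  obtain m where m: "m \<in> time_changes" "\<And>t. t \<in> {0..1} \<Longrightarrow> m (l t) = t"
    "\<And>t. t \<in> {0..1} \<Longrightarrow> l (m t) = t"
    using time_changes_inverse[OF l(1)] by blast
  have "skorokhod_edist y x \<le> c"
  proof (rule skorokhod_edist_leI[OF m(1)])
    fix t :: real assume t: "t \<in> {0..1}"
    have mt: "m t \<in> {0..1}" using time_changes_in[OF m(1) t] .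
    show "ennreal \<bar>m t - t\<bar> \<le> c"
      using l(3)[OF mt] m(3)[OF t] by (simp add: abs_minus_commute)
    show "ennreal \<bar>y t - x (m t)\<bar> \<le> c"
      using l(4)[OF mt] m(3)[OF t] by (simp add: abs_minus_commute)
  qed
  then show "skorokhod_edist y x \<le> e" using l(2) by simp
qed

lemma skorokhod_edist_triangle:
  "skorokhod_edist x z \<le> skorokhod_edist x y + skorokhod_edist y z"
proof (cases "skorokhod_edist x y = \<top> \<or> skorokhod_edist y z = \<top>")
  case True
  then show ?thesis by auto
next
  case False
  show ?thesis
  proof (rule ennreal_le_epsilon)
    fix e :: real assume e: "e > 0"
    define e' where "e' = ennreal (e / 2)"
    have e'pos: "e' > 0" and ee: "e' + e' = ennreal e"
      using e by (auto simp: e'_def simp flip: ennreal_plus)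
    have "skorokhod_edist x y < skorokhod_edist x y + e'" "skorokhod_edist y z < skorokhod_edist y z + e'"
      using False e'pos by (auto simp: ennreal_add_left_cancel_less[where b = 0, simplified] less_top)
    then obtain l c m b where
      l: "l \<in> time_changes" "c < skorokhod_edist x y + e'" "\<And>t. t \<in> {0..1} \<Longrightarrow> ennreal \<bar>l t - t\<bar> \<le> c"
      "\<And>t. t \<in> {0..1} \<Longrightarrow> ennreal \<bar>x t - y (l t)\<bar> \<le> c" and
      m: "m \<in> time_changes" "b < skorokhod_edist y z + e'" "\<And>t. t \<in> {0..1} \<Longrightarrow> ennreal \<bar>m t - t\<bar> \<le> b"
      "\<And>t. t \<in> {0..1} \<Longrightarrow> ennreal \<bar>y t - z (m t)\<bar> \<le> b"
      by (metis skorokhod_edist_lessE)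
    have "skorokhod_edist x z \<le> c + b"
    proof (rule skorokhod_edist_leI[OF time_changes_compose[OF l(1) m(1)]])
      fix t :: real assume t: "t \<in> {0..1}"
      have lt: "l t \<in> {0..1}" using time_changes_in[OF l(1) t] .
      have "ennreal \<bar>m (l t) - t\<bar> \<le> ennreal (\<bar>l t - t\<bar> + \<bar>m (l t) - l t\<bar>)"
        by (rule ennreal_leI) linarith
      also have "\<dots> = ennreal \<bar>l t - t\<bar> + ennreal \<bar>m (l t) - l t\<bar>" by simp
      also have "\<dots> \<le> c + b" by (intro add_mono l m t lt)
      finally show "ennreal \<bar>m (l t) - t\<bar> \<le> c + b" .
      have "ennreal \<bar>x t - z (m (l t))\<bar> \<le> ennreal (\<bar>x t - y (l t)\<bar> + \<bar>y (l t) - z (m (l t))\<bar>)"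
        by (rule ennreal_leI) linarith
      also have "\<dots> = ennreal \<bar>x t - y (l t)\<bar> + ennreal \<bar>y (l t) - z (m (l t))\<bar>" by simp
      also have "\<dots> \<le> c + b" by (intro add_mono l m t lt)
      finally show "ennreal \<bar>x t - z (m (l t))\<bar> \<le> c + b" .
    qed
    also have "\<dots> \<le> (skorokhod_edist x y + e') + (skorokhod_edist y z + e')"
      using l(2) m(2) by (intro add_mono) auto
    also have "\<dots> = skorokhod_edist x y + skorokhod_edist y z + ennreal e"
      by (simp add: ac_simps flip: ee)
    finally show "skorokhod_edist x z \<le> skorokhod_edist x y + skorokhod_edist y z + ennreal e" .
  qed
qed

lemma skorokhod_space_bounded:
  assumes "x \<in> skorokhod_space"
  shows "\<exists>K. \<forall>t\<in>{0..1}. \<bar>x t\<bar> \<le> K"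
proof -
  have "\<exists>K. \<forall>t\<in>{0..1} \<inter> {0..1}. \<bar>x t\<bar> \<le> K"
  proof (rule Bolzano[of 0 1 "\<lambda>u v. \<exists>K. \<forall>t\<in>{u..v} \<inter> {0..1}. \<bar>x t\<bar> \<le> K"])
    fix u v w :: real
    assume "\<exists>K. \<forall>t\<in>{u..v} \<inter> {0..1}. \<bar>x t\<bar> \<le> K" "\<exists>K. \<forall>t\<in>{v..w} \<inter> {0..1}. \<bar>x t\<bar> \<le> K"
    then obtain K L where "\<forall>t\<in>{u..v} \<inter> {0..1}. \<bar>x t\<bar> \<le> K" "\<forall>t\<in>{v..w} \<inter> {0..1}. \<bar>x t\<bar> \<le> L"
      by blast
    then show "\<exists>K. \<forall>t\<in>{u..w} \<inter> {0..1}. \<bar>x t\<bar> \<le> K"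
      by (intro exI[of _ "max K L"] ballI) (metis IntD1 IntD2 IntI atLeastAtMost_iff linear max.coboundedI1 max.coboundedI2)
  next
    fix s :: real assume s: "0 \<le> s" "s \<le> 1"
    have "\<exists>K c. c > s \<and> (\<forall>t\<in>{s<..<c} \<inter> {0..1}. \<bar>x t\<bar> \<le> K)"
    proof (cases "s < 1")
      case True
      then have "(x \<longlongrightarrow> x s) (at_right s)" using assms s by (simp add: skorokhod_space_def)
      then have "\<forall>\<^sub>F t in at_right s. dist (x t) (x s) < 1" by (rule tendstoD) simp
      then obtain c where "c > s" "\<And>t. t > s \<Longrightarrow> t < c \<Longrightarrow> dist (x t) (x s) < 1"
        unfolding eventually_at_right_field by blast
      then show ?thesis
        by (intro exI[of _ "\<bar>x s\<bar> + 1"] exI[of _ c]) (force simp: dist_real_def)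
    next
      case False
      then show ?thesis by (intro exI[of _ 0] exI[of _ "s + 1"]) auto
    qed
    then obtain K c where K: "c > s" "\<forall>t\<in>{s<..<c} \<inter> {0..1}. \<bar>x t\<bar> \<le> K" by blast
    have "\<exists>L b. b < s \<and> (\<forall>t\<in>{b<..<s} \<inter> {0..1}. \<bar>x t\<bar> \<le> L)"
    proof (cases "s > 0")
      case True
      then obtain l where "(x \<longlongrightarrow> l) (at_left s)" using assms s by (force simp: skorokhod_space_def)
      then have "\<forall>\<^sub>F t in at_left s. dist (x t) l < 1" by (rule tendstoD) simp
      then obtain b where "b < s" "\<And>t. t > b \<Longrightarrow> t < s \<Longrightarrow> dist (x t) l < 1"
        unfolding eventually_at_left_field by blast
      then show ?thesis
        by (intro exI[of _ "\<bar>l\<bar> + 1"] exI[of _ b]) (force simp: dist_real_def)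
    next
      case False
      then show ?thesis by (intro exI[of _ 0] exI[of _ "s - 1"]) auto
    qed
    then obtain L b where L: "b < s" "\<forall>t\<in>{b<..<s} \<inter> {0..1}. \<bar>x t\<bar> \<le> L" by blast
    show "\<exists>d>0. \<forall>u v. u \<le> s \<and> s \<le> v \<and> v - u < d \<longrightarrow> (\<exists>K. \<forall>t\<in>{u..v} \<inter> {0..1}. \<bar>x t\<bar> \<le> K)"
    proof (rule exI[of _ "min (c - s) (s - b)"], intro conjI allI impI)
      show "0 < min (c - s) (s - b)" using K L by simp
      fix u v assume uv: "u \<le> s \<and> s \<le> v \<and> v - u < min (c - s) (s - b)"
      show "\<exists>K. \<forall>t\<in>{u..v} \<inter> {0..1}. \<bar>x t\<bar> \<le> K"
      proof (intro exI[of _ "max (max K L) \<bar>x s\<bar>"] ballI)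
        fix t assume t: "t \<in> {u..v} \<inter> {0..1}"
        consider "t < s" | "t = s" | "t > s" by linarith
        then show "\<bar>x t\<bar> \<le> max (max K L) \<bar>x s\<bar>"
        proof cases
          case 1
          then have "\<bar>x t\<bar> \<le> L" using L t uv by auto
          then show ?thesis by simp
        next
          case 3
          then have "\<bar>x t\<bar> \<le> K" using K t uv by auto
          then show ?thesis by simp
        qed simp
      qed
    qed
  qed simp
  then show ?thesis by simp
qed

lemma skorokhod_edist_finite:
  assumes "x \<in> skorokhod_space" "y \<in> skorokhod_space"
  shows "skorokhod_edist x y < \<top>"
proof -
  obtain K L where K: "\<forall>t\<in>{0..1}. \<bar>x t\<bar> \<le> K" and L: "\<forall>t\<in>{0..1}. \<bar>y t\<bar> \<le> L"
    using skorokhod_space_bounded assms by metis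
  have "skorokhod_edist x y \<le> ennreal (K + L)"
  proof (rule skorokhod_edist_leI[OF time_changes_id])
    fix t :: real assume t: "t \<in> {0..1}"
    show "ennreal \<bar>t - t\<bar> \<le> ennreal (K + L)" by simp
    have "\<bar>x t\<bar> \<le> K" "\<bar>y t\<bar> \<le> L" using K L t by auto
    then show "ennreal \<bar>x t - y t\<bar> \<le> ennreal (K + L)" by (intro ennreal_leI) linarith
  qed
  then show ?thesis by (metis ennreal_less_top order_le_less_trans)
qed

lemma skorokhod_edist_zero_imp_close:
  assumes "skorokhod_edist x y = 0" "e > 0" "t \<in> {0..1}"
  obtains l where "l \<in> time_changes" "\<bar>l t - t\<bar> < e" "\<bar>y t - x (l t)\<bar> < e"
proof -
  have "skorokhod_edist y x < ennreal e"
    using skorokhod_edist_commute_le[of y x] assms by simp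
  then obtain l c where l: "l \<in> time_changes" "c < ennreal e" "ennreal \<bar>l t - t\<bar> \<le> c"
    "ennreal \<bar>y t - x (l t)\<bar> \<le> c"
    using assms(3) by (metis skorokhod_edist_lessE)
  then have "ennreal \<bar>l t - t\<bar> < ennreal e" "ennreal \<bar>y t - x (l t)\<bar> < ennreal e" by auto
  then show thesis using that l(1) by (simp add: ennreal_less_iff)
qed

lemma skorokhod_edist_zero_imp_eq:
  assumes x: "x \<in> skorokhod_space" and y: "y \<in> skorokhod_space" and 0: "skorokhod_edist x y = 0"
  shows "x = y"
proof (rule extensionalityI[of _ "{0..1}"])
  show "x \<in> extensional {0..1}" "y \<in> extensional {0..1}"
    using x y by (auto simp: skorokhod_space_def)
  fix t :: real assume t: "t \<in> {0..1}"
  show "x t = y t"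
  proof (cases "t < 1")
    case True
    have lx: "(x \<longlongrightarrow> x t) (at_right t)" and ly: "(y \<longlongrightarrow> y t) (at_right t)"
      using x y t True by (auto simp: skorokhod_space_def)
    show ?thesis
    proof (rule ccontr)
      assume ne: "x t \<noteq> y t"
      define e where "e = \<bar>x t - y t\<bar> / 3"
      have e: "e > 0" using ne by (simp add: e_def)
      obtain c where c: "c > t" "\<And>s. s > t \<Longrightarrow> s < c \<Longrightarrow> dist (x s) (x t) < e"
        using tendstoD[OF lx e] unfolding eventually_at_right_field by blast
      obtain b where b: "b > t" "\<And>s. s > t \<Longrightarrow> s < b \<Longrightarrow> dist (y s) (y t) < e"
        using tendstoD[OF ly e] unfolding eventually_at_right_field by blast
      define u where "u = min (min b c) 1"
      define s where "s = (t + u) / 2"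
      have s: "t < s" "s < c" "s < b" "s < 1" "0 < s"
        using b(1) c(1) True t by (auto simp: s_def u_def)
      have "min e (min (s - t) (c - s)) > 0" "s \<in> {0..1}" using e s by auto
      then obtain l where l: "\<bar>l s - s\<bar> < min e (min (s - t) (c - s))"
        "\<bar>y s - x (l s)\<bar> < min e (min (s - t) (c - s))"
        using skorokhod_edist_zero_imp_close[OF 0] by metis
      have "\<bar>x (l s) - x t\<bar> < e" "\<bar>y s - y t\<bar> < e" "\<bar>y s - x (l s)\<bar> < e"
        using c(2)[of "l s"] b(2)[of s] s l by (auto simp: dist_real_def)
      then have "\<bar>x t - y t\<bar> < 3 * e" by linarith
      then show False by (simp add: e_def)
    qed
  next
    case False
    then have t1: "t = 1" using t by simp
    have "\<bar>x 1 - y 1\<bar> < e" if e: "e > 0" for e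
    proof -
      obtain l where "l \<in> time_changes" "\<bar>y 1 - x (l 1)\<bar> < e"
        using skorokhod_edist_zero_imp_close[OF 0 e, where t = 1] by auto
      then show ?thesis using time_changes_1[of l] by (simp add: abs_minus_commute)
    qed
    then show ?thesis
      unfolding t1 by (metis eq_iff_diff_eq_0 less_irrefl zero_less_abs_iff)
  qed
qed

interpretation skorokhod: Metric_space skorokhod_space skorokhod_dist
proof
  fix x y z
  show "0 \<le> skorokhod_dist x y" by (simp add: skorokhod_dist_def)
  show "skorokhod_dist x y = skorokhod_dist y x"
    unfolding skorokhod_dist_def by (metis antisym skorokhod_edist_commute_le)
  assume xy: "x \<in> skorokhod_space" "y \<in> skorokhod_space"
  have fin: "skorokhod_edist x y < \<top>" using xy by (rule skorokhod_edist_finite)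
  have "skorokhod_edist x x = 0"
    using skorokhod_edist_leI[OF time_changes_id, of 0 x x] by simp
  then show "(skorokhod_dist x y = 0) = (x = y)"
    using fin skorokhod_edist_zero_imp_eq[OF xy]
    by (auto simp: skorokhod_dist_def enn2real_eq_0_iff)
  assume z: "z \<in> skorokhod_space"
  have fin': "skorokhod_edist y z < \<top>" using xy z skorokhod_edist_finite by blast
  have "skorokhod_dist x z \<le> enn2real (skorokhod_edist x y + skorokhod_edist y z)"
    unfolding skorokhod_dist_def using fin fin'
    by (intro enn2real_mono skorokhod_edist_triangle) simp
  also have "\<dots> = skorokhod_dist x y + skorokhod_dist y z"
    unfolding skorokhod_dist_def using fin fin' by (intro enn2real_plus)
  finally show "skorokhod_dist x z \<le> skorokhod_dist x y + skorokhod_dist y z" .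
qed


section \<open>Convergence in distribution and Brownian motion\<close>

definition borel_algebra :: "'a topology \<Rightarrow> 'a measure" where
  "borel_algebra T = sigma (topspace T) {U. openin T U}"

text \<open>Weak convergence of random elements of a topological space. Measurability is part of the
  notion, so the integrals below are genuine expectations.\<close>

definition converges_in_distribution ::
    "'a topology \<Rightarrow> 'b measure \<Rightarrow> (nat \<Rightarrow> 'b \<Rightarrow> 'a) \<Rightarrow> 'c measure \<Rightarrow> ('c \<Rightarrow> 'a) \<Rightarrow> bool" where
  "converges_in_distribution T M X N Y \<longleftrightarrow>
     (\<forall>n. X n \<in> M \<rightarrow>\<^sub>M borel_algebra T) \<and> Y \<in> N \<rightarrow>\<^sub>M borel_algebra T \<and>
     (\<forall>\<Phi> :: 'a \<Rightarrow> real. continuous_map T euclidean \<Phi> \<and> bounded (\<Phi> ` topspace T) \<longrightarrow>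
        (\<lambda>n. \<integral>\<omega>. \<Phi> (X n \<omega>) \<partial>M) \<longlonglongrightarrow> (\<integral>\<omega>. \<Phi> (Y \<omega>) \<partial>N))"

definition sample_path :: "(real \<Rightarrow> 'b \<Rightarrow> real) \<Rightarrow> 'b \<Rightarrow> real \<Rightarrow> real" where
  "sample_path X \<omega> = (\<lambda>t\<in>{0..1}. X t \<omega>)"

text \<open>Standard Brownian motion with time parameter in \<open>[0,1]\<close>; all sample paths are continuous on
  \<open>[0,1]\<close>, so that they lie in the Skorokhod space.\<close>

definition standard_brownian_motion :: "'b measure \<Rightarrow> (real \<Rightarrow> 'b \<Rightarrow> real) \<Rightarrow> bool" where
  "standard_brownian_motion M B \<longleftrightarrow>
     prob_space M \<and>
     (\<forall>t\<in>{0..1}. B t \<in> borel_measurable M) \<and>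
     (AE \<omega> in M. B 0 \<omega> = 0) \<and>
     (\<forall>\<omega>\<in>space M. continuous_on {0..1} (\<lambda>t. B t \<omega>)) \<and>
     (\<forall>s t. 0 \<le> s \<and> s < t \<and> t \<le> 1 \<longrightarrow>
        distributed M lborel (\<lambda>\<omega>. B t \<omega> - B s \<omega>) (normal_density 0 (sqrt (t - s)))) \<and>
     (\<forall>m (t :: nat \<Rightarrow> real). mono_on {..m} t \<and> t ` {..m} \<subseteq> {0..1} \<longrightarrow>
        prob_space.indep_vars M (\<lambda>_. borel) (\<lambda>i \<omega>. B (t (Suc i)) \<omega> - B (t i) \<omega>) {..<m})"

end

theory Submission
  imports Defs "HOL-Real_Asymp.Real_Asymp"
begin

text \<open>The slopes of the functions \<open>\<psi>\<^sub>k\<close> at a uniform point form a stationary Markov chain with values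
  \<open>\<plusminus>1\<close> and correlation \<open>\<rho>\<close> (\<open>0\<close> for even \<open>r\<close>, \<open>1/r\<close> for odd \<open>r\<close>). With \<open>b\<^sub>n = \<Sum>\<^sub>j a\<^sub>n\<^sub>+\<^sub>j \<rho>\<^sup>j\<close>, the sum \<open>w\<^sub>n\<close>
  is, up to the single term \<open>\<rho> b\<^sub>n\<^sub>+\<^sub>1 s\<^sub>n\<close>, the martingale \<open>W\<^sub>n = \<Sum> b\<^sub>k (s\<^sub>k - \<rho> s\<^sub>k\<^sub>-\<^sub>1)\<close>, whose
  conditional variances are deterministic; let \<open>U\<^sub>n\<close> be their sum. Hence
  \<open>exp (z W\<^sub>n - z\<^sup>2 U\<^sub>n / 2)\<close> is nearly a martingale for complex \<open>z\<close>. Imaginary \<open>z\<close> gives the central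
  limit theorem, jointly for increments over disjoint blocks, and the real part of a suitable combination gives two-sided bounds for the probability
  that \<open>W - l U\<close> stays within \<open>[-L, L]\<close>, namely \<open>exp (- (\<pi>\<^sup>2 / (8 L\<^sup>2) + l\<^sup>2 / 2) U)\<close> to leading order.
  With \<open>l = 0\<close> and a Borel--Cantelli argument conditional on the past, this yields Chung's law; with
  \<open>l\<close> of order \<open>\<surd>(log log U / U)\<close> it yields the lower half of the law of the iterated logarithm, which
  suffices for (ii) by the intermediate value theorem. All of it transfers to \<open>f\<close> because for almost
  every \<open>x\<close> the difference quotient over a step of size about \<open>r\<^sup>-\<^sup>n\<close> differs from \<open>W\<^sub>n\<close> by
  \<open>O(U\<^sub>n\<^sup>\<gamma>)\<close> for some \<open>\<gamma> < 1/2\<close>.\<close>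

section \<open>Martingales over a stationary chain of signs\<close>

text \<open>No approximation by Brownian motion is used: because a sign squares to 1, the
  conditional variances carry no randomness, and every limit law is read off from the exponentials
  alone. The rate of the tube bound comes from \<open>cos (pi * y / (2 * L))\<close>, the ground
  state of the interval \<open>[-L, L]\<close>: its decay per unit of the clock \<open>U\<close> is
  \<open>pi\<^sup>2 / (8 * L\<^sup>2)\<close>, the source of the constant in Chung's law. A real
  part \<open>l\<close> of \<open>z\<close> adds a drift, as in Girsanov's theorem, at the price
  \<open>l\<^sup>2 / 2\<close>.

  The obstacle is that \<open>A\<close> tends to infinity without any rate: it may stand still over
  arbitrarily long stretches of indices. Hence blocks are cut by the values of \<open>U\<close> and
  not by the index, and the transfer to \<open>f\<close> cannot sum error probabilities over the
  scales \<open>n\<close>. Instead the tents with a kink inside the step are weighted so that one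
  random series of finite mean dominates the error at all scales together. Fourth powers and weights
  of Abel-Dini type make this series converge and still leave an exponent below 1/2.\<close>

text \<open>\<open>past s k G\<close>: the value \<open>G x\<close> depends on \<open>s\<^sub>0 x, \<dots>, s\<^sub>k x\<close> only. This replaces measurability with
  respect to the \<open>k\<close>-th element of the natural filtration.\<close>

definition past :: "(nat \<Rightarrow> 'a \<Rightarrow> real) \<Rightarrow> nat \<Rightarrow> ('a \<Rightarrow> 'b) \<Rightarrow> bool" where
  "past s k G \<longleftrightarrow> (\<forall>x y. (\<forall>i\<le>k. s i x = s i y) \<longrightarrow> G x = G y)"

lemma past_mono: "past s k G \<Longrightarrow> k \<le> l \<Longrightarrow> past s l G"
  unfolding past_def by (meson order_trans)

lemma past_const: "past s k (\<lambda>_. c)"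
  by (simp add: past_def)

lemma past_s: "i \<le> k \<Longrightarrow> past s k (s i)"
  by (simp add: past_def)

lemma past_comp: "past s k G \<Longrightarrow> past s k (\<lambda>x. f (G x))"
  unfolding past_def by metis

lemma past_comp2: "past s k G \<Longrightarrow> past s k H \<Longrightarrow> past s k (\<lambda>x. f (G x) (H x))"
  unfolding past_def by metis

lemma past_sum: "(\<And>i. i \<in> I \<Longrightarrow> past s k (G i)) \<Longrightarrow> past s k (\<lambda>x. \<Sum>i\<in>I. G i x)"
  unfolding past_def by (intro allI impI sum.cong) auto

lemma past_all: "(\<And>i. i \<in> I \<Longrightarrow> past s k (P i)) \<Longrightarrow> past s k (\<lambda>x. \<forall>i\<in>I. P i x)"
  unfolding past_def by (intro allI impI ball_cong) auto

lemma norm_exp_minus_quadratic: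
  fixes u :: complex assumes "norm u \<le> 1"
  shows "norm (exp u - (1 + u + u\<^sup>2 / 2)) \<le> 2 * norm u ^ 3"
proof -
  have "norm (exp u - (\<Sum>i\<le>2. u ^ i / fact i)) \<le> exp (norm u) * norm u ^ Suc 2 / fact 2"
    by (rule Taylor_exp_field)
  also have "(\<Sum>i\<le>2. u ^ i / fact i) = 1 + u + u\<^sup>2 / 2"
    by (simp add: numeral_2_eq_2)
  also have "exp (norm u) * norm u ^ Suc 2 / fact 2 \<le> 4 * norm u ^ 3 / 2"
  proof -
    have "exp (norm u) \<le> exp 1" using assms by simp
    also have "exp (1::real) \<le> 4" using exp_le by simp
    finally show ?thesis by (simp add: eval_nat_numeral mult_right_mono)
  qed
  finally show ?thesis by simp
qed

lemma norm_exp_minus_linear: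
  fixes u :: complex assumes "norm u \<le> 1"
  shows "norm (exp u - (1 + u)) \<le> 4 * norm u ^ 2"
proof -
  have "norm (exp u - (\<Sum>i\<le>1. u ^ i / fact i)) \<le> exp (norm u) * norm u ^ Suc 1 / fact 1"
    by (rule Taylor_exp_field)
  also have "(\<Sum>i\<le>1. u ^ i / fact i) = 1 + u"
    by simp
  also have "exp (norm u) * norm u ^ Suc 1 / fact 1 \<le> 4 * norm u ^ 2"
  proof -
    have "exp (norm u) \<le> exp 1" using assms by simp
    also have "exp (1::real) \<le> 4" using exp_le by simp
    finally show ?thesis by (simp add: eval_nat_numeral mult_right_mono)
  qed
  finally show ?thesis by simp
qed

text \<open>The value 0 at index 0 is a fictitious initial state: the first sign has no predecessor,
  and with it the recursions hold from index 1 on. The signs are two-valued at every point, not only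
  almost everywhere, so functions of finitely many of them have finite range. \<open>chain\<close>
  is the Markov property tested against functions of the past; these are complex-valued because
  exponentials with complex parameter are put in. The bound 1/2 on \<rho> keeps the conditional
  variances above 3/4.\<close>

locale sign_chain = prob_space M for M :: "'a measure" +
  fixes s :: "nat \<Rightarrow> 'a \<Rightarrow> real" and \<rho> :: real
  assumes s_measurable [measurable]: "s k \<in> borel_measurable M"
    and s_0 [simp]: "s 0 x = 0"
    and s_Suc: "s (Suc k) x = 1 \<or> s (Suc k) x = -1"
    and rho: "0 \<le> \<rho>" "\<rho> \<le> 1/2"
    and chain: "past s k G \<Longrightarrow> (\<integral>x. G x * complex_of_real (s (Suc k) x - \<rho> * s k x) \<partial>M) = 0"
begin

text \<open>Induction on the last sign: a function of one more sign is a choice between two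
  functions of the earlier ones. The finite range makes every such function bounded and integrable,
  so integrability never needs an argument of its own.\<close>

lemma past_measurable_finite:
  fixes G :: "'a \<Rightarrow> 'b::topological_space"
  shows "past s k G \<Longrightarrow> G \<in> borel_measurable M \<and> finite (range G)"
proof (induction k arbitrary: G)
  case 0
  then have "G = (\<lambda>_. G undefined)" by (auto simp: past_def fun_eq_iff)
  then show ?case by (metis finite.emptyI finite_insert image_subset_iff finite_subset insertI1 measurable_const UNIV_I space_borel)
next
  case (Suc k)
  \<comment> \<open>The value of \<open>G\<close> at some point with the same signs up to
    \<open>k\<close> and last sign \<open>e\<close>. If there is no such point the value is
    arbitrary; \<open>H e\<close> is only read where \<open>e\<close> is the actual last
    sign.\<close>
  define H where "H e x = (let y = (SOME y. (\<forall>i\<le>k. s i y = s i x) \<and> s (Suc k) y = e) in G y)" for e :: real and x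
  have pH: "past s k (H e)" for e
    unfolding past_def
  proof (intro allI impI)
    fix x y assume "\<forall>i\<le>k. s i x = s i y"
    then have "(\<lambda>z. (\<forall>i\<le>k. s i z = s i x) \<and> s (Suc k) z = e) = (\<lambda>z. (\<forall>i\<le>k. s i z = s i y) \<and> s (Suc k) z = e)"
      by auto
    then show "H e x = H e y" unfolding H_def by simp
  qed
  have G: "G x = H (s (Suc k) x) x" for x
  proof -
    let ?P = "\<lambda>y. (\<forall>i\<le>k. s i y = s i x) \<and> s (Suc k) y = s (Suc k) x"
    have "?P (SOME y. ?P y)" by (rule someI[of ?P x]) simp
    then have "\<forall>i\<le>Suc k. s i (SOME y. ?P y) = s i x"
      by (auto simp only: le_Suc_eq)
    then have "G (SOME y. ?P y) = G x"
      using Suc.prems unfolding past_def by blast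
    then show ?thesis by (simp add: H_def)
  qed
  then have G': "G = (\<lambda>x. if s (Suc k) x = 1 then H 1 x else H (-1) x)"
    using s_Suc[of k] by (metis (no_types, opaque_lifting))
  have m: "H 1 \<in> borel_measurable M" "H (-1) \<in> borel_measurable M"
    and f: "finite (range (H 1))" "finite (range (H (-1)))"
    using Suc.IH[OF pH] by auto
  have "G \<in> borel_measurable M"
    unfolding G' using m by measurable
  moreover have "range G \<subseteq> range (H 1) \<union> range (H (-1))"
    unfolding G' by auto
  ultimately show ?case using f by (meson finite_UnI finite_subset)
qed

lemma past_measurable: "past s k G \<Longrightarrow> (G :: 'a \<Rightarrow> 'b::topological_space) \<in> borel_measurable M"
  using past_measurable_finite by blast

lemma past_bounded:
  fixes G :: "'a \<Rightarrow> 'b::real_normed_vector"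
  assumes "past s k G" shows "\<exists>B. \<forall>x. norm (G x) \<le> B"
proof -
  have "finite (range (\<lambda>x. norm (G x)))"
    using past_measurable_finite[OF past_comp[OF assms, of norm]] by simp
  then show ?thesis by (intro exI[of _ "Max (range (\<lambda>x. norm (G x)))"]) simp
qed

lemma past_integrable:
  fixes G :: "'a \<Rightarrow> 'b::{banach,second_countable_topology}"
  assumes "past s k G" shows "integrable M G"
proof -
  obtain B where "\<And>x. norm (G x) \<le> B" using past_bounded[OF assms] by blast
  then show ?thesis using past_measurable[OF assms]
    by (intro integrable_const_bound[of _ B]) auto
qed

definition mdiff :: "nat \<Rightarrow> 'a \<Rightarrow> real" where
  "mdiff k x = s k x - \<rho> * s (k - 1) x"

text \<open>The conditional variance of \<open>mdiff k\<close> for \<open>k \<ge> 1\<close>; index 1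
  is special because \<open>s 0\<close> vanishes.\<close>

definition cvar :: "nat \<Rightarrow> real" where
  "cvar k = (if k = 1 then 1 else 1 - \<rho>\<^sup>2)"

lemma rho_sq: "0 \<le> \<rho>\<^sup>2" "\<rho>\<^sup>2 \<le> 1/4"
  using rho power_mono[of \<rho> "1/2" 2] by (auto simp: power_divide)

lemma cvar_bounds: "3/4 \<le> cvar k" "cvar k \<le> 1"
  using rho_sq by (auto simp: cvar_def)

lemma past_mdiff: "k \<le> l \<Longrightarrow> past s l (mdiff k)"
  unfolding mdiff_def by (intro past_comp2[of s l _ _ "\<lambda>u v. u - \<rho> * v"] past_s) auto

lemma s_sq: "k \<ge> 1 \<Longrightarrow> (s k x)\<^sup>2 = 1"
  using s_Suc[of "k - 1" x] by auto

lemma s_cases: "s k x = 0 \<or> s k x = 1 \<or> s k x = -1"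
  using s_Suc[of "k - 1" x] by (cases k) auto

lemma cvar_eq: "cvar (Suc k) = 1 - \<rho>\<^sup>2 * (s k x)\<^sup>2"
  using s_sq[of k x] by (cases k) (auto simp: cvar_def)

lemma mdiff_bound: "\<bar>mdiff k x\<bar> \<le> 3/2"
proof -
  have "\<bar>s k x\<bar> \<le> 1" "\<bar>s (k-1) x\<bar> \<le> 1" using s_cases[of k x] s_cases[of "k-1" x] by auto
  then have "\<bar>\<rho> * s (k-1) x\<bar> \<le> 1/2" using rho by (simp add: abs_mult) (smt (verit) mult_left_le)
  with \<open>\<bar>s k x\<bar> \<le> 1\<close> show ?thesis unfolding mdiff_def by linarith
qed

text \<open>The expectation of \<open>\<phi>\<close> of the next martingale difference, given that the current sign is \<open>e\<close>.\<close>

definition next_exp :: "(real \<Rightarrow> complex) \<Rightarrow> real \<Rightarrow> complex" where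
  "next_exp \<phi> e = of_real ((1 + \<rho> * e) / 2) * \<phi> (1 - \<rho> * e) + of_real ((1 - \<rho> * e) / 2) * \<phi> (- 1 - \<rho> * e)"

text \<open>A function of a two-valued variable is affine in it, so the single conditional moment
  given by \<open>chain\<close> fixes the whole conditional law: the next sign is 1 or -1 with
  weights \<open>(1 + \<rho> * s k x) / 2\<close> and
  \<open>(1 - \<rho> * s k x) / 2\<close>.\<close>

lemma integral_next:
  assumes G: "past s k G"
  shows "(\<integral>x. G x * \<phi> (mdiff (Suc k) x) \<partial>M) = (\<integral>x. G x * next_exp \<phi> (s k x) \<partial>M)"
proof -
  \<comment> \<open>Half the difference of the two values: the slope of \<phi> as an affine function
    of the next sign.\<close>
  define \<beta> where "\<beta> e = (\<phi> (1 - \<rho> * e) - \<phi> (- 1 - \<rho> * e)) / 2" for e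
  have *: "G x * \<phi> (mdiff (Suc k) x) = G x * next_exp \<phi> (s k x) + (G x * \<beta> (s k x)) * complex_of_real (s (Suc k) x - \<rho> * s k x)" for x
    using s_Suc[of k x] by (auto simp: mdiff_def next_exp_def \<beta>_def field_simps)
  have p: "past s k (\<lambda>x. G x * \<beta> (s k x))"
    by (rule past_comp2[OF G past_s]) simp
  have p2: "past s (Suc k) (\<lambda>x. (G x * \<beta> (s k x)) * complex_of_real (s (Suc k) x - \<rho> * s k x))"
    unfolding past_def
  proof (intro allI impI)
    fix x y assume eq: "\<forall>i\<le>Suc k. s i x = s i y"
    then have "G x = G y" using G unfolding past_def by simp
    moreover have "s k x = s k y" "s (Suc k) x = s (Suc k) y" using eq by auto
    ultimately show "(G x * \<beta> (s k x)) * complex_of_real (s (Suc k) x - \<rho> * s k x) = (G y * \<beta> (s k y)) * complex_of_real (s (Suc k) y - \<rho> * s k y)"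
      by simp
  qed
  have p3: "past s k (\<lambda>x. G x * next_exp \<phi> (s k x))"
    by (rule past_comp2[OF G past_s]) simp
  have "(\<integral>x. G x * \<phi> (mdiff (Suc k) x) \<partial>M) = (\<integral>x. G x * next_exp \<phi> (s k x) \<partial>M) + (\<integral>x. (G x * \<beta> (s k x)) * complex_of_real (s (Suc k) x - \<rho> * s k x) \<partial>M)"
    unfolding * by (intro Bochner_Integration.integral_add past_integrable[OF p2] past_integrable[OF p3])
  then show ?thesis using chain[OF p] by simp
qed

text \<open>The two-point law has mean 0 and variance \<open>cvar (Suc k)\<close>, so the
  compensated exponential has conditional mean 1 up to a cubic error. The constant collects 8 from
  the Taylor remainders and 3 from \<open>exp (- c)\<close>; 30 is 24 rounded up.\<close>

lemma next_exp_exp: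
  fixes w :: complex
  assumes w: "norm w \<le> 1/4"
  shows "norm (next_exp (\<lambda>m. exp (w * of_real m - w\<^sup>2 * of_real (cvar (Suc k)) / 2) - 1) (s k x)) \<le> 30 * norm w ^ 3"
proof -
  let ?e = "s k x" and ?v = "cvar (Suc k)"
  define p q m1 m2 where "p = (1 + \<rho> * ?e) / 2" and "q = (1 - \<rho> * ?e) / 2"
    and "m1 = 1 - \<rho> * ?e" and "m2 = - 1 - \<rho> * ?e"
  have re: "\<bar>\<rho> * ?e\<bar> \<le> 1/2" using rho s_cases[of k x] by auto
  then have pq: "p \<ge> 0" "q \<ge> 0" "p + q = 1" by (auto simp: p_def q_def field_simps abs_le_iff)
  have mean: "p * m1 + q * m2 = 0" by (simp add: p_def q_def m1_def m2_def field_simps)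
  have var: "p * m1\<^sup>2 + q * m2\<^sup>2 = ?v"
    unfolding cvar_eq[of k x] by (simp add: p_def q_def m1_def m2_def field_simps power2_eq_square)
  have mb: "\<bar>m1\<bar> \<le> 3/2" "\<bar>m2\<bar> \<le> 3/2" using re by (auto simp: m1_def m2_def)
  define c where "c = w\<^sup>2 * of_real ?v / 2"
  have nc: "norm c \<le> norm w ^ 2 / 2"
    using cvar_bounds[of "Suc k"] by (simp add: c_def norm_mult norm_power norm_divide mult_left_le)
  have nw2: "norm w ^ 2 \<le> 1/16" using power_mono[OF w, of 2] by (simp add: power_divide)
  have b: "norm (exp (w * of_real m) - (1 + w * of_real m + (w * of_real m)\<^sup>2 / 2)) \<le> 7 * norm w ^ 3" if "\<bar>m\<bar> \<le> 3/2" for m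
  proof -
    have n: "norm (w * of_real m) \<le> norm w * (3/2)" using that by (simp add: norm_mult mult_left_mono del: times_divide_eq_right)
    have "norm (w * of_real m) \<le> 1" using n w by linarith
    then have "norm (exp (w * of_real m) - (1 + w * of_real m + (w * of_real m)\<^sup>2 / 2)) \<le> 2 * norm (w * of_real m) ^ 3"
      by (rule norm_exp_minus_quadratic)
    also have "norm (w * of_real m) ^ 3 \<le> (norm w * (3/2)) ^ 3" by (rule power_mono[OF n]) simp
    finally show ?thesis by (simp add: power_mult_distrib power_divide) (smt (verit) zero_le_power norm_ge_zero)
  qed
  have "norm (exp c - (1 + c)) \<le> 4 * norm c ^ 2"
    using nc nw2 by (intro norm_exp_minus_linear) linarith
  also have "norm c ^ 2 \<le> (norm w ^ 2 / 2) ^ 2" by (rule power_mono[OF nc]) simp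
  also have "4 * (norm w ^ 2 / 2) ^ 2 = norm w * norm w ^ 3" by (simp add: eval_nat_numeral)
  also have "\<dots> \<le> 1 * norm w ^ 3" using w by (intro mult_right_mono) auto
  finally have ec: "norm (exp c - (1 + c)) \<le> norm w ^ 3" by simp
  \<comment> \<open>The quadratic Taylor polynomials average to \<open>1 + c\<close>, because total
    mass, mean and variance match; only the three remainders are left.\<close>
  have expand: "of_real p * exp (w * of_real m1) + of_real q * exp (w * of_real m2) - exp c =
     of_real p * (exp (w * of_real m1) - (1 + w * of_real m1 + (w * of_real m1)\<^sup>2 / 2)) +
     of_real q * (exp (w * of_real m2) - (1 + w * of_real m2 + (w * of_real m2)\<^sup>2 / 2)) - (exp c - (1 + c))"
  proof -
    have "of_real p * (1 + w * of_real m1 + (w * of_real m1)\<^sup>2 / 2) + of_real q * (1 + w * of_real m2 + (w * of_real m2)\<^sup>2 / 2)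
      = of_real (p + q) + w * of_real (p * m1 + q * m2) + w\<^sup>2 / 2 * of_real (p * m1\<^sup>2 + q * m2\<^sup>2)"
      by (simp add: field_simps power2_eq_square)
    also have "\<dots> = 1 + c" unfolding pq mean var by (simp add: c_def)
    finally show ?thesis by (simp add: algebra_simps)
  qed
  have "norm (of_real p * exp (w * of_real m1) + of_real q * exp (w * of_real m2) - exp c)
     \<le> p * (7 * norm w ^ 3) + q * (7 * norm w ^ 3) + norm w ^ 3"
    unfolding expand
    by (rule order_trans[OF norm_triangle_ineq4] add_mono order_trans[OF norm_triangle_ineq])+
      (use b[OF mb(1)] b[OF mb(2)] ec pq in \<open>simp_all add: norm_mult mult_left_mono\<close>)
  also have "\<dots> = 8 * norm w ^ 3" using pq(3) by (simp flip: distrib_right)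
  finally have main: "norm (of_real p * exp (w * of_real m1) + of_real q * exp (w * of_real m2) - exp c) \<le> 8 * norm w ^ 3" .
  have ne: "norm (exp (- c)) \<le> 3"
  proof -
    have "norm (exp (- c)) \<le> exp (norm (- c))" by (rule norm_exp)
    also have "\<dots> \<le> exp 1" using nc nw2 by simp
    also have "\<dots> \<le> 3" by (rule exp_le)
    finally show ?thesis .
  qed
  have "next_exp (\<lambda>m. exp (w * of_real m - w\<^sup>2 * of_real ?v / 2) - 1) ?e
     = exp (- c) * (of_real p * exp (w * of_real m1) + of_real q * exp (w * of_real m2) - exp c)"
  proof -
    have ne_eq: "next_exp \<phi> ?e = of_real p * \<phi> m1 + of_real q * \<phi> m2" for \<phi>
      by (simp add: next_exp_def p_def q_def m1_def m2_def)
    have e: "exp (u - c) = exp u * exp (- c)" for u by (simp flip: exp_add)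
    have "next_exp (\<lambda>m. exp (w * of_real m - w\<^sup>2 * of_real ?v / 2) - 1) ?e
      = of_real p * exp (w * of_real m1) * exp (- c) + of_real q * exp (w * of_real m2) * exp (- c) - of_real (p + q)"
      unfolding ne_eq c_def[symmetric] e of_real_add by (simp add: ring_distribs mult.assoc)
    then show ?thesis unfolding pq by (simp add: ring_distribs mult_ac flip: exp_add)
  qed
  then have "norm (next_exp (\<lambda>m. exp (w * of_real m - w\<^sup>2 * of_real ?v / 2) - 1) ?e)
     \<le> 3 * (8 * norm w ^ 3)"
    by (simp only: norm_mult) (intro mult_mono ne main, auto)
  then show ?thesis by (smt (verit) zero_le_power norm_ge_zero)
qed

text \<open>The majorant \<open>G\<close> stays in the error term instead of being replaced by a
  constant: the error is then proportional to the mass of a past event, which is what estimates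
  conditional on the past require.\<close>

lemma exp_step:
  fixes z :: complex and Q :: "'a \<Rightarrow> complex"
  assumes Q: "past s k Q" and G: "past s k G" and le: "\<And>x. norm (Q x) \<le> K * G x"
    and zb: "norm (z * of_real b) \<le> 1/4"
  shows "norm (\<integral>x. Q x * (exp (z * of_real (b * mdiff (Suc k) x) - z\<^sup>2 * of_real (b\<^sup>2 * cvar (Suc k)) / 2) - 1) \<partial>M)
     \<le> K * (30 * norm (z * of_real b) ^ 3) * (\<integral>x. G x \<partial>M)"
proof -
  let ?w = "z * of_real b"
  let ?\<phi> = "\<lambda>m. exp (?w * of_real m - ?w\<^sup>2 * of_real (cvar (Suc k)) / 2) - 1"
  have "(\<integral>x. Q x * (exp (z * of_real (b * mdiff (Suc k) x) - z\<^sup>2 * of_real (b\<^sup>2 * cvar (Suc k)) / 2) - 1) \<partial>M)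
     = (\<integral>x. Q x * ?\<phi> (mdiff (Suc k) x) \<partial>M)"
    by (simp add: power_mult_distrib mult.assoc)
  also have "\<dots> = (\<integral>x. Q x * next_exp ?\<phi> (s k x) \<partial>M)" by (rule integral_next[OF Q])
  finally have eq: "(\<integral>x. Q x * (exp (z * of_real (b * mdiff (Suc k) x) - z\<^sup>2 * of_real (b\<^sup>2 * cvar (Suc k)) / 2) - 1) \<partial>M)
     = (\<integral>x. Q x * next_exp ?\<phi> (s k x) \<partial>M)" .
  have p: "past s k (\<lambda>x. Q x * next_exp ?\<phi> (s k x))" by (rule past_comp2[OF Q past_s]) simp
  have "norm (\<integral>x. Q x * next_exp ?\<phi> (s k x) \<partial>M) \<le> (\<integral>x. norm (Q x * next_exp ?\<phi> (s k x)) \<partial>M)"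
    by (rule integral_norm_bound)
  also have "\<dots> \<le> (\<integral>x. (K * G x) * (30 * norm ?w ^ 3) \<partial>M)"
  proof (intro integral_mono)
    show "integrable M (\<lambda>x. norm (Q x * next_exp ?\<phi> (s k x)))"
      by (rule integrable_norm[OF past_integrable[OF p]])
    show "integrable M (\<lambda>x. K * G x * (30 * norm ?w ^ 3))"
      by (rule past_integrable[OF past_comp[OF G]])
    fix x
    have "0 \<le> K * G x" using le[of x] norm_ge_zero order_trans by blast
    then show "norm (Q x * next_exp ?\<phi> (s k x)) \<le> (K * G x) * (30 * norm ?w ^ 3)"
      unfolding norm_mult[of "Q x"] by (intro mult_mono le next_exp_exp[OF zb]) auto
  qed
  also have "\<dots> = K * (30 * norm ?w ^ 3) * (\<integral>x. G x \<partial>M)" by (simp add: mult_ac)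
  finally show ?thesis unfolding eq .
qed

end

section \<open>Exponential martingales and tubes around a drift\<close>

lemma Re_ge_of_norm_diff: "norm (A - B :: complex) \<le> c \<Longrightarrow> Re B - c \<le> Re A"
  and Re_le_of_norm_diff: "norm (A - B :: complex) \<le> c \<Longrightarrow> Re A \<le> Re B + c"
  using abs_Re_le_cmod[of "A - B"] by auto

context sign_chain begin

definition mart :: "(nat \<Rightarrow> real) \<Rightarrow> nat \<Rightarrow> 'a \<Rightarrow> real" where
  "mart b n x = (\<Sum>k=1..n. b k * mdiff k x)"

definition quad :: "(nat \<Rightarrow> real) \<Rightarrow> nat \<Rightarrow> real" where
  "quad b n = (\<Sum>k=1..n. (b k)\<^sup>2 * cvar k)"

lemma mart_0 [simp]: "mart b 0 x = 0" and quad_0 [simp]: "quad b 0 = 0"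
  by (simp_all add: mart_def quad_def)

lemma mart_Suc: "mart b (Suc n) x = mart b n x + b (Suc n) * mdiff (Suc n) x"
  by (simp add: mart_def)

lemma quad_Suc: "quad b (Suc n) = quad b n + (b (Suc n))\<^sup>2 * cvar (Suc n)"
  by (simp add: quad_def)

lemma quad_mono: "m \<le> n \<Longrightarrow> quad b m \<le> quad b n"
  using cvar_bounds(1) unfolding quad_def
  by (intro sum_mono2) (auto intro!: mult_nonneg_nonneg intro: order_trans[of 0 "3/4"])

lemma quad_nonneg: "0 \<le> quad b n"
  using quad_mono[of 0 n b] by simp

lemma quad_lower: "3/4 * (\<Sum>k=1..n. (b k)\<^sup>2) \<le> quad b n"
proof -
  have "(b k)\<^sup>2 * (3/4) \<le> (b k)\<^sup>2 * cvar k" for k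
    by (intro mult_left_mono cvar_bounds) simp
  then have "(\<Sum>k=1..n. (b k)\<^sup>2 * (3/4)) \<le> quad b n"
    unfolding quad_def by (rule sum_mono)
  then show ?thesis by (simp only: sum_distrib_left mult.commute)
qed

lemma quad_upper: "quad b n \<le> (\<Sum>k=1..n. (b k)\<^sup>2)"
  using cvar_bounds(2) unfolding quad_def by (intro sum_mono) (simp add: mult_left_le)

lemma past_mart: "k \<le> l \<Longrightarrow> past s l (mart b k)"
  unfolding mart_def
  by (intro past_sum past_comp[OF past_mdiff, of _ l "\<lambda>u. b _ * u"]) auto

lemma mart_measurable [measurable]: "mart b k \<in> borel_measurable M"
  by (rule past_measurable[OF past_mart[OF order_refl]])

text \<open>Restarted at \<open>m\<close>: it equals 1 there and can be multiplied by any function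
  of the past up to \<open>m\<close>.\<close>

definition exp_mart :: "complex \<Rightarrow> (nat \<Rightarrow> real) \<Rightarrow> nat \<Rightarrow> nat \<Rightarrow> 'a \<Rightarrow> complex" where
  "exp_mart z b m k x = exp (z * of_real (mart b k x - mart b m x) - z\<^sup>2 * of_real (quad b k - quad b m) / 2)"

lemma past_exp_mart: "m \<le> k \<Longrightarrow> past s k (exp_mart z b m k)"
  unfolding exp_mart_def
  by (rule past_comp2[of s k "mart b k" "mart b m" "\<lambda>u v. exp (z * of_real (u - v) - _)"]) (auto intro: past_mart)

lemma exp_mart_Suc: "exp_mart z b m (Suc k) x = exp_mart z b m k x *
    exp (z * of_real (b (Suc k) * mdiff (Suc k) x) - z\<^sup>2 * of_real ((b (Suc k))\<^sup>2 * cvar (Suc k)) / 2)"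
  unfolding exp_mart_def mart_Suc quad_Suc exp_add[symmetric]
  by (rule arg_cong[where f = exp]) (simp add: field_simps)

lemma exp_mart_step:
  fixes z :: complex and Q :: "'a \<Rightarrow> complex"
  assumes Q: "past s k Q" and G: "past s k G" and "m \<le> k"
    and le: "\<And>x. norm (Q x * exp_mart z b m k x) \<le> K * G x"
    and zb: "norm z * \<bar>b (Suc k)\<bar> \<le> 1/4"
  shows "norm ((\<integral>x. Q x * exp_mart z b m (Suc k) x \<partial>M) - (\<integral>x. Q x * exp_mart z b m k x \<partial>M))
     \<le> K * (30 * (norm z * \<bar>b (Suc k)\<bar>) ^ 3) * (\<integral>x. G x \<partial>M)"
proof -
  have p: "past s k (\<lambda>x. Q x * exp_mart z b m k x)"
    by (rule past_comp2[OF Q past_exp_mart[OF \<open>m \<le> k\<close>]])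
  have p': "past s (Suc k) (\<lambda>x. Q x * exp_mart z b m (Suc k) x)"
    using \<open>m \<le> k\<close> by (intro past_comp2[OF past_mono[OF Q] past_exp_mart]) auto
  have "(\<integral>x. Q x * exp_mart z b m (Suc k) x \<partial>M) - (\<integral>x. Q x * exp_mart z b m k x \<partial>M)
    = (\<integral>x. Q x * exp_mart z b m (Suc k) x - Q x * exp_mart z b m k x \<partial>M)"
    by (rule Bochner_Integration.integral_diff[symmetric]) (rule past_integrable[OF p'] past_integrable[OF p])+
  also have "\<dots> = (\<integral>x. (Q x * exp_mart z b m k x) *
    (exp (z * of_real (b (Suc k) * mdiff (Suc k) x) - z\<^sup>2 * of_real ((b (Suc k))\<^sup>2 * cvar (Suc k)) / 2) - 1) \<partial>M)"
    unfolding exp_mart_Suc by (simp only: right_diff_distrib mult.assoc mult_1_right)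
  also have "norm \<dots> \<le> K * (30 * norm (z * of_real (b (Suc k))) ^ 3) * (\<integral>x. G x \<partial>M)"
    using zb by (intro exp_step[OF p G le]) (simp add: norm_mult)
  finally show ?thesis by (simp add: norm_mult)
qed

definition tube :: "(nat \<Rightarrow> real) \<Rightarrow> real \<Rightarrow> real \<Rightarrow> nat \<Rightarrow> nat \<Rightarrow> 'a \<Rightarrow> bool" where
  "tube b l L m n x \<longleftrightarrow> (\<forall>k\<in>{m..n}. \<bar>mart b k x - mart b m x - l * (quad b k - quad b m)\<bar> \<le> L)"

lemma past_tube: "n \<le> p \<Longrightarrow> past s p (tube b l L m n)"
proof -
  assume np: "n \<le> p"
  have "past s p (\<lambda>x. \<forall>k\<in>{m..n}. \<bar>mart b k x - mart b m x - l * (quad b k - quad b m)\<bar> \<le> L)"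
  proof (rule past_all)
    fix k assume "k \<in> {m..n}"
    then show "past s p (\<lambda>x. \<bar>mart b k x - mart b m x - l * (quad b k - quad b m)\<bar> \<le> L)"
      using np by (intro past_comp2[of s p "mart b k" "mart b m" "\<lambda>u v. \<bar>u - v - l * (quad b k - quad b m)\<bar> \<le> L"] past_mart) auto
  qed
  then show ?thesis by (simp add: tube_def[abs_def])
qed

lemma tube_Suc: "m \<le> n \<Longrightarrow> tube b l L m (Suc n) x \<longleftrightarrow> tube b l L m n x \<and>
    \<bar>mart b (Suc n) x - mart b m x - l * (quad b (Suc n) - quad b m)\<bar> \<le> L"
  by (auto simp: tube_def atLeastAtMostSuc_conv le_Suc_eq)

lemma tube_last: "tube b l L m n x \<Longrightarrow> m \<le> n \<Longrightarrow> \<bar>mart b n x - mart b m x - l * (quad b n - quad b m)\<bar> \<le> L"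
  by (auto simp: tube_def)

text \<open>For \<open>z = Complex l t\<close> the exponent separates in terms of the distance
  \<open>Y\<close> from the drift line: its imaginary part is \<open>t * Y\<close>, its real part
  \<open>l * Y\<close> plus a deterministic term. Hence the real part of the exponential has the
  sign of \<open>cos (t * Y)\<close> and can serve as a barrier for the modulus of
  \<open>Y\<close>.\<close>

lemma Re_exp_mart:
  "exp_mart (Complex l t) b m k x = of_real (exp (l * (mart b k x - mart b m x - l * (quad b k - quad b m)) + (l\<^sup>2 + t\<^sup>2) * (quad b k - quad b m) / 2))
    * cis (t * (mart b k x - mart b m x - l * (quad b k - quad b m)))"
  by (simp add: exp_mart_def exp_eq_polar Re_power2 Im_power2 complex_eq_iff)
     (simp add: field_simps power2_eq_square)

text \<open>With \<open>t = pi / (2 * L)\<close> the cosine vanishes on the boundary of the tube and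
  is not positive just outside, so discarding paths at their exit can only increase the expectation
  of the real part. That expectation starts as the mass of \<open>G\<close> and loses little in each
  step, while on the tube the process is at most \<open>K\<close>; dividing by \<open>K\<close>
  gives the bound. The factor \<open>G\<close> makes it a bound conditional on the past.\<close>

lemma tube_lower:
  assumes mn: "m \<le> n" and G: "past s m G" and G0: "\<And>x. 0 \<le> G x" and l: "0 \<le> l" and L: "0 < L"
    and t_def: "t = pi / (2 * L)"
    and small: "\<And>k. k \<in> {m<..n} \<Longrightarrow> (l + t) * \<bar>b k\<bar> \<le> 1/4"
  shows "(\<integral>x. G x * of_bool (tube b l L m n x) \<partial>M) \<ge>
    (exp (- (l * L + (l\<^sup>2 + t\<^sup>2) * (quad b n - quad b m) / 2)) - (\<Sum>k\<in>{m<..n}. 30 * ((l + t) * \<bar>b k\<bar>) ^ 3)) * (\<integral>x. G x \<partial>M)"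
proof -
  have t: "0 < t" using L by (simp add: t_def)
  define z where "z = Complex l t"
  have nz: "norm z \<le> l + t" unfolding z_def using l t by (intro order_trans[OF cmod_le]) auto
  \<comment> \<open>A bound for the modulus of the exponential on the tube, from its upper edge and
    the final time.\<close>
  define K where "K = exp (l * L + (l\<^sup>2 + t\<^sup>2) * (quad b n - quad b m) / 2)"
  define Y where "Y k x = mart b k x - mart b m x - l * (quad b k - quad b m)" for k x
  define I :: "nat \<Rightarrow> 'a \<Rightarrow> real" where "I k x = of_bool (tube b l L m k x)" for k x
  define E where "E k x = exp_mart z b m k x" for k x
  have E: "E k x = of_real (exp (l * Y k x + (l\<^sup>2 + t\<^sup>2) * (quad b k - quad b m) / 2)) * cis (t * Y k x)" for k x
    unfolding E_def z_def Re_exp_mart Y_def ..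
  have ReE: "Re (E k x) = exp (l * Y k x + (l\<^sup>2 + t\<^sup>2) * (quad b k - quad b m) / 2) * cos (t * Y k x)" for k x
    unfolding E by simp
  have bound: "norm (I k x * E k x) \<le> K * I k x" if "m \<le> k" "k \<le> n" for k x
  proof (cases "tube b l L m k x")
    case True
    have "Y k x \<le> L" using tube_last[OF True that(1)] by (simp add: Y_def)
    then have "l * Y k x + (l\<^sup>2 + t\<^sup>2) * (quad b k - quad b m) / 2 \<le> l * L + (l\<^sup>2 + t\<^sup>2) * (quad b n - quad b m) / 2"
      using quad_mono[OF that(2), of b] l by (intro add_mono mult_left_mono divide_right_mono) auto
    then show ?thesis unfolding E K_def by (simp add: norm_mult I_def True)
  qed (simp add: I_def)
  have pI: "past s k (I k)" for k
    unfolding I_def by (rule past_comp[OF past_tube]) simp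
  have pG: "past s k G" if "m \<le> k" for k by (rule past_mono[OF G that])
  have pE: "past s k (E k)" if "m \<le> k" for k unfolding E_def by (rule past_exp_mart[OF that])
  define S where "S k = (\<Sum>j\<in>{m<..k}. 30 * ((l + t) * \<bar>b j\<bar>) ^ 3)" for k
  have ind: "(\<integral>x. G x * I k x * Re (E k x) \<partial>M) \<ge> (1 - K * S k) * (\<integral>x. G x \<partial>M)" if "m \<le> k" "k \<le> n" for k
    using that
  proof (induction k rule: dec_induct)
    case base
    have "I m x = 1" "E m x = 1" for x using L by (auto simp: I_def tube_def E_def exp_mart_def)
    then show ?case by (simp add: S_def)
  next
    case (step k)
    have mk: "m \<le> k" and kn: "k \<le> n" using step by auto
    have bk: "(l + t) * \<bar>b (Suc k)\<bar> \<le> 1/4" using small[of "Suc k"] step.prems mk by simp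
    have zb: "norm z * \<bar>b (Suc k)\<bar> \<le> (l + t) * \<bar>b (Suc k)\<bar>" using nz by (intro mult_right_mono) auto
    have pQ: "past s k (\<lambda>x. complex_of_real (G x * I k x))"
      by (rule past_comp2[OF pG[OF mk] pI])
    have le: "norm (complex_of_real (G x * I k x) * exp_mart z b m k x) \<le> K * G x" for x
    proof -
      have "norm (complex_of_real (G x * I k x) * exp_mart z b m k x) = G x * norm (I k x * E k x)"
        using G0[of x] by (simp add: norm_mult E_def)
      also have "\<dots> \<le> G x * (K * I k x)" by (intro mult_left_mono bound mk kn G0)
      also have "\<dots> \<le> G x * (K * 1)" using G0[of x] by (intro mult_left_mono) (auto simp: K_def I_def)
      finally show ?thesis by (simp add: mult.commute)
    qed
    have pR: "past s j (\<lambda>x. complex_of_real (G x * I k x) * E j x)" if "k \<le> j" for j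
      using that mk by (intro past_comp2[OF past_mono[OF pQ] pE]) auto
    have intRe: "(\<integral>x. G x * I k x * Re (E j x) \<partial>M) = Re (\<integral>x. complex_of_real (G x * I k x) * E j x \<partial>M)" if "k \<le> j" for j
    proof -
      have "(\<integral>x. G x * I k x * Re (E j x) \<partial>M) = (\<integral>x. Re (complex_of_real (G x * I k x) * E j x) \<partial>M)" by simp
      also have "\<dots> = Re (\<integral>x. complex_of_real (G x * I k x) * E j x \<partial>M)"
        by (rule integral_Re[OF past_integrable[OF pR[OF that]]])
      finally show ?thesis .
    qed
    have "norm ((\<integral>x. complex_of_real (G x * I k x) * E (Suc k) x \<partial>M) - (\<integral>x. complex_of_real (G x * I k x) * E k x \<partial>M))
      \<le> K * (30 * (norm z * \<bar>b (Suc k)\<bar>) ^ 3) * (\<integral>x. G x \<partial>M)"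
      unfolding E_def
      by (rule exp_mart_step[OF pQ pG[OF mk] mk le]) (use zb bk in linarith)
    also have "\<dots> \<le> K * (30 * ((l + t) * \<bar>b (Suc k)\<bar>) ^ 3) * (\<integral>x. G x \<partial>M)"
      using G0 by (intro zb mult_right_mono mult_left_mono power_mono mult_nonneg_nonneg) (auto simp: K_def)
    finally have "norm ((\<integral>x. complex_of_real (G x * I k x) * E (Suc k) x \<partial>M) - (\<integral>x. complex_of_real (G x * I k x) * E k x \<partial>M))
      \<le> K * (30 * ((l + t) * \<bar>b (Suc k)\<bar>) ^ 3) * (\<integral>x. G x \<partial>M)" .
    then have "(\<integral>x. G x * I k x * Re (E (Suc k) x) \<partial>M) \<ge> (\<integral>x. G x * I k x * Re (E k x) \<partial>M)
       - K * (30 * ((l + t) * \<bar>b (Suc k)\<bar>) ^ 3) * (\<integral>x. G x \<partial>M)"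
      unfolding intRe[OF order_refl] intRe[OF le_SucI[OF order_refl]] by (rule Re_ge_of_norm_diff)
    \<comment> \<open>Paths that leave the tube in this step stop counting; they land where the
      cosine is not positive, so omitting them does not lower the integral.\<close>
    moreover have "(\<integral>x. G x * I (Suc k) x * Re (E (Suc k) x) \<partial>M) \<ge> (\<integral>x. G x * I k x * Re (E (Suc k) x) \<partial>M)"
    proof (rule integral_mono)
      have pGS: "past s (Suc k) G" using mk by (intro pG) simp
      have pES: "past s (Suc k) (\<lambda>x. Re (E (Suc k) x))" using mk by (intro past_comp[OF pE]) simp
      show "integrable M (\<lambda>x. G x * I k x * Re (E (Suc k) x))"
        by (rule past_integrable[OF past_comp2[OF past_comp2[OF pGS past_mono[OF pI]] pES]]) simp
      show "integrable M (\<lambda>x. G x * I (Suc k) x * Re (E (Suc k) x))"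
        by (rule past_integrable[OF past_comp2[OF past_comp2[OF pGS pI] pES]])
      fix x
      show "G x * I k x * Re (E (Suc k) x) \<le> G x * I (Suc k) x * Re (E (Suc k) x)"
      proof (cases "tube b l L m k x \<and> \<not> tube b l L m (Suc k) x")
        case True
        then have Yk: "\<bar>Y k x\<bar> \<le> L" and YS: "L < \<bar>Y (Suc k) x\<bar>"
          using tube_last[OF _ mk, of b l L x] tube_Suc[OF mk, of b l L x] by (auto simp: Y_def)
        have lb: "l * \<bar>b (Suc k)\<bar> \<le> 1/4" "t * \<bar>b (Suc k)\<bar> \<le> 1/4"
          using bk l t by (smt (verit) distrib_right abs_ge_zero mult_nonneg_nonneg)+
        have "Y (Suc k) x - Y k x = b (Suc k) * mdiff (Suc k) x - l * ((b (Suc k))\<^sup>2 * cvar (Suc k))"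
          by (simp add: Y_def mart_Suc quad_Suc algebra_simps)
        also have "\<bar>\<dots>\<bar> \<le> \<bar>b (Suc k)\<bar> * (3/2) + \<bar>b (Suc k)\<bar> * (1/4)"
        proof (rule order_trans[OF abs_triangle_ineq4 add_mono])
          show "\<bar>b (Suc k) * mdiff (Suc k) x\<bar> \<le> \<bar>b (Suc k)\<bar> * (3/2)"
            unfolding abs_mult by (intro mult_left_mono mdiff_bound) auto
          have "\<bar>l * ((b (Suc k))\<^sup>2 * cvar (Suc k))\<bar> = \<bar>b (Suc k)\<bar> * (l * \<bar>b (Suc k)\<bar> * cvar (Suc k))"
            using l cvar_bounds(1)[of "Suc k"] by (simp add: abs_mult power2_eq_square)
          also have "\<dots> \<le> \<bar>b (Suc k)\<bar> * ((1/4) * 1)"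
            using lb l cvar_bounds[of "Suc k"] by (intro mult_left_mono mult_mono) auto
          finally show "\<bar>l * ((b (Suc k))\<^sup>2 * cvar (Suc k))\<bar> \<le> \<bar>b (Suc k)\<bar> * (1/4)" by simp
        qed
        also have "\<dots> \<le> 2 * \<bar>b (Suc k)\<bar>" by simp
        finally have dY: "\<bar>Y (Suc k) x - Y k x\<bar> \<le> 2 * \<bar>b (Suc k)\<bar>" .
        \<comment> \<open>A change of at most \<open>2 * \<bar>b (Suc k)\<bar>\<close> is less than
          \<open>L\<close> by the bound on \<open>t * \<bar>b (Suc k)\<bar>\<close>, so at the exit
          \<open>t * \<bar>Y (Suc k) x\<bar>\<close> lies between \<open>pi / 2\<close> and
          \<open>pi\<close>.\<close>
        have "pi * \<bar>b (Suc k)\<bar> \<le> L / 2" using lb(2) L by (simp add: t_def field_simps)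
        moreover have "3 * \<bar>b (Suc k)\<bar> \<le> pi * \<bar>b (Suc k)\<bar>" using pi_gt3 by (intro mult_right_mono) auto
        ultimately have "\<bar>Y (Suc k) x\<bar> \<le> 2 * L" using dY Yk L by linarith
        then have "t * \<bar>Y (Suc k) x\<bar> \<le> t * (2 * L)" using t by (intro mult_left_mono) auto
        then have up: "t * \<bar>Y (Suc k) x\<bar> \<le> pi" using L by (simp add: t_def)
        have "t * L \<le> t * \<bar>Y (Suc k) x\<bar>" using t YS by (intro mult_left_mono) auto
        then have lo: "pi / 2 \<le> t * \<bar>Y (Suc k) x\<bar>" using L by (simp add: t_def)
        have "cos (t * Y (Suc k) x) = cos (t * \<bar>Y (Suc k) x\<bar>)" by (simp add: abs_if)
        also have "\<dots> \<le> cos (pi / 2)" using lo up by (intro cos_monotone_0_pi_le) auto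
        finally have "Re (E (Suc k) x) \<le> 0" unfolding ReE by (simp add: mult_nonneg_nonpos)
        then have "G x * Re (E (Suc k) x) \<le> 0" using G0[of x] by (simp add: mult_nonneg_nonpos)
        then show ?thesis using True by (simp add: I_def)
      next
        case False
        then have "I (Suc k) x = I k x" using tube_Suc[OF mk, of b l L x] by (auto simp: I_def)
        then show ?thesis by simp
      qed
    qed
    moreover have "S (Suc k) = S k + 30 * ((l + t) * \<bar>b (Suc k)\<bar>) ^ 3"
    proof -
      have "{m<..Suc k} = insert (Suc k) {m<..k}" using mk by auto
      then show ?thesis by (simp add: S_def)
    qed
    ultimately show ?case using step.IH kn by (simp add: algebra_simps)
  qed
  have "(1 - K * S n) * (\<integral>x. G x \<partial>M) \<le> (\<integral>x. G x * I n x * Re (E n x) \<partial>M)" by (rule ind[OF mn order_refl])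
  also have "\<dots> \<le> (\<integral>x. K * (G x * I n x) \<partial>M)"
  proof (rule integral_mono)
    show "integrable M (\<lambda>x. G x * I n x * Re (E n x))"
      by (rule past_integrable[OF past_comp2[OF past_comp2[OF pG pI] past_comp[OF pE]]]) (use mn in auto)
    show "integrable M (\<lambda>x. K * (G x * I n x))"
      by (rule past_integrable[OF past_comp2[OF pG[OF mn] pI]])
    fix x
    have "I n x * Re (E n x) \<le> norm (I n x * E n x)" by (metis complex_Re_le_cmod scaleR_complex.sel(1) scaleR_conv_of_real)
    also have "\<dots> \<le> K * I n x" by (rule bound[OF mn order_refl])
    finally show "G x * I n x * Re (E n x) \<le> K * (G x * I n x)"
      using mult_left_mono[of _ _ "G x"] G0[of x] by (simp only: mult.left_commute[of K] mult.assoc)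
  qed
  also have "\<dots> = K * (\<integral>x. G x * I n x \<partial>M)" by simp
  finally have "(1 - K * S n) * (\<integral>x. G x \<partial>M) / K \<le> (\<integral>x. G x * I n x \<partial>M)"
    by (simp add: K_def pos_divide_le_eq mult.commute)
  moreover have "(1 - K * S n) * (\<integral>x. G x \<partial>M) / K = (1 / K - S n) * (\<integral>x. G x \<partial>M)"
    by (simp add: K_def field_simps)
  moreover have "1 / K = exp (- (l * L + (l\<^sup>2 + t\<^sup>2) * (quad b n - quad b m) / 2))"
    unfolding K_def exp_minus by (simp add: inverse_eq_divide)
  ultimately show ?thesis by (simp add: S_def I_def)
qed

lemma past_pred:
  assumes "past s k P" shows "Measurable.pred M P"
proof -
  have [measurable]: "(\<lambda>x. of_bool (P x) :: real) \<in> borel_measurable M"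
    by (rule past_measurable[OF past_comp[OF assms]])
  have "Measurable.pred M (\<lambda>x. (of_bool (P x) :: real) = 1)" by measurable
  then show ?thesis by simp
qed

lemma tube_pred: "Measurable.pred M (tube b l L m n)"
  by (rule past_pred[OF past_tube[OF order_refl]])

text \<open>The opposite barrier: now \<open>t\<close> is so small that the cosine is still
  nonnegative after the exit jump (\<open>jump\<close>) and at least \<open>cos (t * L)\<close> on
  the tube. Discarding the paths that exit then lowers the expectation.\<close>

lemma tube_upper:
  assumes mn: "m \<le> n" and G: "past s m G" and G0: "\<And>x. 0 \<le> G x" and L: "0 \<le> L" and t: "0 < t"
    and small: "\<And>k. k \<in> {m<..n} \<Longrightarrow> t * \<bar>b k\<bar> \<le> 1/4"
    and jump: "\<And>k. k \<in> {m<..n} \<Longrightarrow> t * (L + 3/2 * \<bar>b k\<bar>) \<le> pi / 2" and tL: "t * L \<le> pi / 2"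
  shows "cos (t * L) * (\<integral>x. G x * of_bool (tube b 0 L m n x) \<partial>M) \<le>
    (exp (- (t\<^sup>2 * (quad b n - quad b m) / 2)) + (\<Sum>k\<in>{m<..n}. 30 * (t * \<bar>b k\<bar>) ^ 3)) * (\<integral>x. G x \<partial>M)"
proof -
  define z where "z = Complex 0 t"
  have nz: "norm z = t" unfolding z_def using t by (simp add: cmod_def)
  define K where "K = exp (t\<^sup>2 * (quad b n - quad b m) / 2)"
  define Y where "Y k x = mart b k x - mart b m x" for k x
  define I :: "nat \<Rightarrow> 'a \<Rightarrow> real" where "I k x = of_bool (tube b 0 L m k x)" for k x
  define E where "E k x = exp_mart z b m k x" for k x
  have E: "E k x = of_real (exp (t\<^sup>2 * (quad b k - quad b m) / 2)) * cis (t * Y k x)" for k x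
    unfolding E_def z_def Re_exp_mart Y_def by simp
  have ReE: "Re (E k x) = exp (t\<^sup>2 * (quad b k - quad b m) / 2) * cos (t * Y k x)" for k x
    unfolding E by simp
  have bound: "norm (E k x) \<le> K" if "m \<le> k" "k \<le> n" for k x
    unfolding E K_def using quad_mono[OF that(2), of b] by (simp add: norm_mult mult_left_mono)
  have pI: "past s k (I k)" for k
    unfolding I_def by (rule past_comp[OF past_tube]) simp
  have pG: "past s k G" if "m \<le> k" for k by (rule past_mono[OF G that])
  have pE: "past s k (E k)" if "m \<le> k" for k unfolding E_def by (rule past_exp_mart[OF that])
  define S where "S k = (\<Sum>j\<in>{m<..k}. 30 * (t * \<bar>b j\<bar>) ^ 3)" for k
  have ind: "(\<integral>x. G x * I k x * Re (E k x) \<partial>M) \<le> (1 + K * S k) * (\<integral>x. G x \<partial>M)" if "m \<le> k" "k \<le> n" for k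
    using that
  proof (induction k rule: dec_induct)
    case base
    have "I m x = 1" "E m x = 1" for x using L by (auto simp: I_def tube_def E_def exp_mart_def)
    then show ?case by (simp add: S_def)
  next
    case (step k)
    have mk: "m \<le> k" and kn: "k \<le> n" using step by auto
    have pQ: "past s k (\<lambda>x. complex_of_real (G x * I k x))"
      by (rule past_comp2[OF pG[OF mk] pI])
    have le: "norm (complex_of_real (G x * I k x) * exp_mart z b m k x) \<le> K * G x" for x
    proof -
      have "norm (complex_of_real (G x * I k x) * exp_mart z b m k x) = G x * I k x * norm (E k x)"
        using G0[of x] by (simp add: norm_mult E_def I_def)
      also have "\<dots> \<le> G x * 1 * K" by (intro mult_mono bound mk kn G0 mult_left_mono) (auto simp: G0 I_def)
      finally show ?thesis by (simp add: mult.commute)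
    qed
    have pR: "past s j (\<lambda>x. complex_of_real (G x * I k x) * E j x)" if "k \<le> j" for j
      using that mk by (intro past_comp2[OF past_mono[OF pQ] pE]) auto
    have intRe: "(\<integral>x. G x * I k x * Re (E j x) \<partial>M) = Re (\<integral>x. complex_of_real (G x * I k x) * E j x \<partial>M)" if "k \<le> j" for j
    proof -
      have "(\<integral>x. G x * I k x * Re (E j x) \<partial>M) = (\<integral>x. Re (complex_of_real (G x * I k x) * E j x) \<partial>M)" by simp
      also have "\<dots> = Re (\<integral>x. complex_of_real (G x * I k x) * E j x \<partial>M)"
        by (rule integral_Re[OF past_integrable[OF pR[OF that]]])
      finally show ?thesis .
    qed
    have "norm ((\<integral>x. complex_of_real (G x * I k x) * E (Suc k) x \<partial>M) - (\<integral>x. complex_of_real (G x * I k x) * E k x \<partial>M))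
      \<le> K * (30 * (norm z * \<bar>b (Suc k)\<bar>) ^ 3) * (\<integral>x. G x \<partial>M)"
      unfolding E_def
      by (rule exp_mart_step[OF pQ pG[OF mk] mk le]) (use small[of "Suc k"] step.prems mk nz in auto)
    then have "(\<integral>x. G x * I k x * Re (E (Suc k) x) \<partial>M) \<le> (\<integral>x. G x * I k x * Re (E k x) \<partial>M)
       + K * (30 * (t * \<bar>b (Suc k)\<bar>) ^ 3) * (\<integral>x. G x \<partial>M)"
      unfolding intRe[OF order_refl] intRe[OF le_SucI[OF order_refl]] nz by (rule Re_le_of_norm_diff)
    moreover have "(\<integral>x. G x * I (Suc k) x * Re (E (Suc k) x) \<partial>M) \<le> (\<integral>x. G x * I k x * Re (E (Suc k) x) \<partial>M)"
    proof (rule integral_mono)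
      have pGS: "past s (Suc k) G" using mk by (intro pG) simp
      have pES: "past s (Suc k) (\<lambda>x. Re (E (Suc k) x))" using mk by (intro past_comp[OF pE]) simp
      show "integrable M (\<lambda>x. G x * I k x * Re (E (Suc k) x))"
        by (rule past_integrable[OF past_comp2[OF past_comp2[OF pGS past_mono[OF pI]] pES]]) simp
      show "integrable M (\<lambda>x. G x * I (Suc k) x * Re (E (Suc k) x))"
        by (rule past_integrable[OF past_comp2[OF past_comp2[OF pGS pI] pES]])
      fix x
      show "G x * I (Suc k) x * Re (E (Suc k) x) \<le> G x * I k x * Re (E (Suc k) x)"
      proof (cases "tube b 0 L m k x")
        case True
        then have Yk: "\<bar>Y k x\<bar> \<le> L"
          using tube_last[OF _ mk, of b 0 L x] by (auto simp: Y_def)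
        have "\<bar>Y (Suc k) x - Y k x\<bar> \<le> \<bar>b (Suc k)\<bar> * (3/2)"
          unfolding Y_def mart_Suc using mult_left_mono[OF mdiff_bound[of "Suc k" x], of "\<bar>b (Suc k)\<bar>"] by (simp add: abs_mult)
        then have "t * \<bar>Y (Suc k) x\<bar> \<le> t * (L + 3/2 * \<bar>b (Suc k)\<bar>)" using t Yk by (intro mult_left_mono) linarith+
        also have "\<dots> \<le> pi / 2" using jump[of "Suc k"] step.prems mk by simp
        finally have "0 \<le> cos (t * \<bar>Y (Suc k) x\<bar>)" using t
          by (intro cos_ge_zero) (auto intro: order_trans[of _ 0])
        also have "cos (t * \<bar>Y (Suc k) x\<bar>) = cos (t * Y (Suc k) x)" by (simp add: abs_if)
        finally have "0 \<le> G x * Re (E (Suc k) x)" unfolding ReE using G0[of x] by simp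
        then show ?thesis using True by (simp add: I_def)
      next
        case False
        then show ?thesis using tube_Suc[OF mk, of b 0 L x] by (simp add: I_def)
      qed
    qed
    moreover have "S (Suc k) = S k + 30 * (t * \<bar>b (Suc k)\<bar>) ^ 3"
    proof -
      have "{m<..Suc k} = insert (Suc k) {m<..k}" using mk by auto
      then show ?thesis by (simp add: S_def)
    qed
    ultimately show ?case using step.IH kn by (simp add: algebra_simps)
  qed
  have "K * (cos (t * L) * (\<integral>x. G x * I n x \<partial>M)) = (\<integral>x. K * cos (t * L) * (G x * I n x) \<partial>M)" by simp
  also have "\<dots> \<le> (\<integral>x. G x * I n x * Re (E n x) \<partial>M)"
  proof (rule integral_mono)
    show "integrable M (\<lambda>x. G x * I n x * Re (E n x))"
      by (rule past_integrable[OF past_comp2[OF past_comp2[OF pG pI] past_comp[OF pE]]]) (use mn in auto)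
    show "integrable M (\<lambda>x. K * cos (t * L) * (G x * I n x))"
      by (rule past_integrable[OF past_comp2[OF pG[OF mn] pI]])
    fix x
    show "K * cos (t * L) * (G x * I n x) \<le> G x * I n x * Re (E n x)"
    proof (cases "tube b 0 L m n x")
      case True
      have "\<bar>Y n x\<bar> \<le> L" using tube_last[OF True mn] by (simp add: Y_def)
      then have "cos (t * L) \<le> cos (t * \<bar>Y n x\<bar>)"
        using t order_trans[OF tL, of pi] by (intro cos_monotone_0_pi_le mult_left_mono) auto
      also have "\<dots> = cos (t * Y n x)" by (simp add: abs_if)
      finally show ?thesis using True G0[of x]
        by (simp add: I_def ReE K_def mult_left_mono mult.commute)
    qed (simp add: I_def)
  qed
  also have "\<dots> \<le> (1 + K * S n) * (\<integral>x. G x \<partial>M)" by (rule ind[OF mn order_refl])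
  finally have "cos (t * L) * (\<integral>x. G x * I n x \<partial>M) \<le> (1 + K * S n) * (\<integral>x. G x \<partial>M) / K"
    by (simp add: K_def pos_le_divide_eq mult.commute)
  moreover have "(1 + K * S n) * (\<integral>x. G x \<partial>M) / K = (1 / K + S n) * (\<integral>x. G x \<partial>M)"
    by (simp add: K_def field_simps)
  moreover have "1 / K = exp (- (t\<^sup>2 * (quad b n - quad b m) / 2))"
    unfolding K_def exp_minus by (simp add: inverse_eq_divide)
  ultimately show ?thesis by (simp add: S_def I_def)
qed

text \<open>The error is proportional to the integral of the majorant \<open>G\<close>. For
  \<open>Q\<close> the indicator of a past event this is an estimate of the conditional
  characteristic function whose error does not depend on the event.\<close>

lemma mart_char:
  fixes Q :: "'a \<Rightarrow> complex"
  assumes mn: "m \<le> n" and Q: "past s m Q" and G: "past s m G" and QG: "\<And>x. norm (Q x) \<le> G x"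
    and small: "\<And>k. k \<in> {m<..n} \<Longrightarrow> \<bar>t\<bar> * \<bar>b k\<bar> \<le> 1/4"
  shows "norm ((\<integral>x. Q x * exp (\<i> * of_real (t * (mart b n x - mart b m x))) \<partial>M)
      - exp (- of_real (t\<^sup>2 * (quad b n - quad b m) / 2)) * (\<integral>x. Q x \<partial>M))
    \<le> (\<Sum>k\<in>{m<..n}. 30 * (\<bar>t\<bar> * \<bar>b k\<bar>) ^ 3) * (\<integral>x. G x \<partial>M)"
proof -
  define z where "z = Complex 0 t"
  have nz: "norm z = \<bar>t\<bar>" unfolding z_def by (simp add: cmod_def)
  define K where "K = exp (t\<^sup>2 * (quad b n - quad b m) / 2)"
  define E where "E k x = exp_mart z b m k x" for k x
  have E: "E k x = of_real (exp (t\<^sup>2 * (quad b k - quad b m) / 2)) * cis (t * (mart b k x - mart b m x))" for k x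
    unfolding E_def z_def Re_exp_mart by simp
  have bound: "norm (E k x) \<le> K" if "m \<le> k" "k \<le> n" for k x
    unfolding E K_def using quad_mono[OF that(2), of b] by (simp add: norm_mult mult_left_mono)
  have pG: "past s k G" if "m \<le> k" for k by (rule past_mono[OF G that])
  have pQ: "past s k Q" if "m \<le> k" for k by (rule past_mono[OF Q that])
  define S where "S k = (\<Sum>j\<in>{m<..k}. 30 * (\<bar>t\<bar> * \<bar>b j\<bar>) ^ 3)" for k
  have "norm ((\<integral>x. Q x * E k x \<partial>M) - (\<integral>x. Q x \<partial>M)) \<le> K * S k * (\<integral>x. G x \<partial>M)" if "m \<le> k" "k \<le> n" for k
    using that
  proof (induction k rule: dec_induct)
    case base
    have "E m x = 1" for x by (auto simp: E_def exp_mart_def)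
    then show ?case by (simp add: S_def)
  next
    case (step k)
    have mk: "m \<le> k" and kn: "k \<le> n" using step by auto
    have le: "norm (Q x * exp_mart z b m k x) \<le> K * G x" for x
    proof -
      have "norm (Q x * exp_mart z b m k x) = norm (Q x) * norm (E k x)" by (simp add: norm_mult E_def)
      also have "\<dots> \<le> G x * K" using order_trans[OF norm_ge_zero QG] by (intro mult_mono bound mk kn QG) auto
      finally show ?thesis by (simp add: mult.commute)
    qed
    have "norm ((\<integral>x. Q x * E (Suc k) x \<partial>M) - (\<integral>x. Q x * E k x \<partial>M))
      \<le> K * (30 * (norm z * \<bar>b (Suc k)\<bar>) ^ 3) * (\<integral>x. G x \<partial>M)"
      unfolding E_def
      by (rule exp_mart_step[OF pQ[OF mk] pG[OF mk] mk le]) (use small[of "Suc k"] step.prems mk nz in auto)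
    moreover have "S (Suc k) = S k + 30 * (\<bar>t\<bar> * \<bar>b (Suc k)\<bar>) ^ 3"
    proof -
      have "{m<..Suc k} = insert (Suc k) {m<..k}" using mk by auto
      then show ?thesis by (simp add: S_def)
    qed
    ultimately show ?case using step.IH kn nz
      by (simp add: ring_distribs) (smt (verit) norm_diff_triangle_ineq norm_triangle_sub norm_minus_commute norm_diff_triangle_le)
  qed
  from this[OF mn order_refl]
  have *: "norm ((\<integral>x. Q x * E n x \<partial>M) - (\<integral>x. Q x \<partial>M)) \<le> K * S n * (\<integral>x. G x \<partial>M)" .
  have "(\<integral>x. Q x * E n x \<partial>M) = of_real K * (\<integral>x. Q x * exp (\<i> * of_real (t * (mart b n x - mart b m x))) \<partial>M)"
    unfolding E K_def cis_conv_exp integral_mult_right_zero[symmetric] by (simp add: mult_ac)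
  then have "norm (of_real K * ((\<integral>x. Q x * exp (\<i> * of_real (t * (mart b n x - mart b m x))) \<partial>M) - of_real (1/K) * (\<integral>x. Q x \<partial>M))) \<le> K * S n * (\<integral>x. G x \<partial>M)"
    using * by (simp add: K_def right_diff_distrib)
  then have "norm ((\<integral>x. Q x * exp (\<i> * of_real (t * (mart b n x - mart b m x))) \<partial>M) - of_real (1/K) * (\<integral>x. Q x \<partial>M)) \<le> S n * (\<integral>x. G x \<partial>M)"
    unfolding norm_mult norm_of_real by (simp add: K_def mult.assoc)
  moreover have "complex_of_real (1/K) = exp (- of_real (t\<^sup>2 * (quad b n - quad b m) / 2))"
    unfolding of_real_minus[symmetric] exp_of_real exp_minus K_def by (simp add: inverse_eq_divide)
  ultimately show ?thesis unfolding S_def by (simp only:)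
qed

lemma integral_next_real:
  assumes G: "past s k G"
  shows "(\<integral>x. G x * \<phi> (mdiff (Suc k) x) \<partial>M) =
    (\<integral>x. G x * ((1 + \<rho> * s k x) / 2 * \<phi> (1 - \<rho> * s k x) + (1 - \<rho> * s k x) / 2 * \<phi> (- 1 - \<rho> * s k x)) \<partial>M)"
    (is "?l = ?r")
proof -
  have "complex_of_real ?l = (\<integral>x. of_real (G x) * of_real (\<phi> (mdiff (Suc k) x)) \<partial>M)"
    by (simp flip: integral_complex_of_real of_real_mult)
  also have "\<dots> = (\<integral>x. of_real (G x) * next_exp (\<lambda>u. of_real (\<phi> u)) (s k x) \<partial>M)"
    by (rule integral_next[OF past_comp[OF G]])
  also have "\<dots> = of_real ?r"
    unfolding integral_complex_of_real[symmetric] next_exp_def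
    by (intro Bochner_Integration.integral_cong) auto
  finally show ?thesis by (simp only: of_real_eq_iff)
qed

lemma exp_upper_quadratic:
  fixes w :: real assumes "\<bar>w\<bar> \<le> 1" shows "exp w \<le> 1 + w + 3 * w\<^sup>2"
proof -
  have "\<bar>exp w - (\<Sum>i\<le>1. w ^ i / fact i)\<bar> \<le> exp \<bar>w\<bar> * \<bar>w\<bar> ^ Suc 1 / fact 1"
    using Taylor_exp_field[of w 1] by simp
  also have "\<dots> \<le> 3 * w\<^sup>2"
  proof -
    have "exp \<bar>w\<bar> \<le> exp 1" using assms by simp
    also have "\<dots> \<le> (3::real)" by (rule exp_le)
    finally show ?thesis by (simp add: numeral_2_eq_2 mult_right_mono flip: power2_abs)
  qed
  finally show ?thesis by simp
qed

lemma mdiff_exp_le: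
  assumes G: "past s k G" and G0: "\<And>x. 0 \<le> G x" and c: "\<bar>c\<bar> * 3/2 \<le> 1"
  shows "(\<integral>x. G x * exp (c * mdiff (Suc k) x) \<partial>M) \<le> exp (3 * c\<^sup>2 * cvar (Suc k)) * (\<integral>x. G x \<partial>M)"
proof -
  have *: "(1 + \<rho> * e) / 2 * exp (c * (1 - \<rho> * e)) + (1 - \<rho> * e) / 2 * exp (c * (- 1 - \<rho> * e)) \<le> exp (3 * c\<^sup>2 * cvar (Suc k))"
    if "e = s k x" for e x
  proof -
    have re: "\<bar>\<rho> * e\<bar> \<le> 1/2" using rho s_cases[of k x] that by auto
    have b: "exp (c * u) \<le> 1 + c * u + 3 * (c * u)\<^sup>2" if "\<bar>u\<bar> \<le> 3/2" for u
    proof (rule exp_upper_quadratic)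
      have "\<bar>c * u\<bar> \<le> \<bar>c\<bar> * (3/2)" unfolding abs_mult using that by (intro mult_left_mono) auto
      then show "\<bar>c * u\<bar> \<le> 1" using c by simp
    qed
    have "(1 + \<rho> * e) / 2 * exp (c * (1 - \<rho> * e)) + (1 - \<rho> * e) / 2 * exp (c * (- 1 - \<rho> * e))
      \<le> (1 + \<rho> * e) / 2 * (1 + c * (1 - \<rho> * e) + 3 * (c * (1 - \<rho> * e))\<^sup>2) + (1 - \<rho> * e) / 2 * (1 + c * (- 1 - \<rho> * e) + 3 * (c * (- 1 - \<rho> * e))\<^sup>2)"
      using re by (intro add_mono mult_left_mono b) (auto simp: abs_le_iff)
    also have "\<dots> = 1 + 3 * c\<^sup>2 * (1 - \<rho>\<^sup>2 * e\<^sup>2)"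
      by (simp add: field_simps power2_eq_square)
    also have "\<dots> = 1 + 3 * c\<^sup>2 * cvar (Suc k)" unfolding cvar_eq[of k x] that ..
    also have "\<dots> \<le> exp (3 * c\<^sup>2 * cvar (Suc k))" by (rule exp_ge_add_one_self)
    finally show ?thesis .
  qed
  have "(\<integral>x. G x * exp (c * mdiff (Suc k) x) \<partial>M) =
    (\<integral>x. G x * ((1 + \<rho> * s k x) / 2 * exp (c * (1 - \<rho> * s k x)) + (1 - \<rho> * s k x) / 2 * exp (c * (- 1 - \<rho> * s k x))) \<partial>M)"
    by (rule integral_next_real[OF G])
  also have "\<dots> \<le> (\<integral>x. exp (3 * c\<^sup>2 * cvar (Suc k)) * G x \<partial>M)"
  proof (rule integral_mono)
    show "integrable M (\<lambda>x. G x * ((1 + \<rho> * s k x) / 2 * exp (c * (1 - \<rho> * s k x)) + (1 - \<rho> * s k x) / 2 * exp (c * (- 1 - \<rho> * s k x))))"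
      by (rule past_integrable[OF past_comp2[OF G past_s]]) simp
    show "integrable M (\<lambda>x. exp (3 * c\<^sup>2 * cvar (Suc k)) * G x)" by (rule past_integrable[OF past_comp[OF G]])
    fix x
    show "G x * ((1 + \<rho> * s k x) / 2 * exp (c * (1 - \<rho> * s k x)) + (1 - \<rho> * s k x) / 2 * exp (c * (- 1 - \<rho> * s k x))) \<le> exp (3 * c\<^sup>2 * cvar (Suc k)) * G x"
      using mult_left_mono[OF *[OF refl] G0[of x]] by (simp add: mult.commute)
  qed
  finally show ?thesis by simp
qed

text \<open>Doob's maximal inequality for the supermartingale \<open>H\<close>, which combines the
  parameters \<open>l\<close> and \<open>- l\<close> and so bounds both sides at once. The factor 3
  in place of 1/2 comes from the crude bound
  \<open>exp w \<le> 1 + w + 3 * w\<^sup>2\<close>.\<close>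

lemma mart_maximal:
  assumes mn: "m \<le> n" and l: "0 < l"
    and small: "\<And>k. k \<in> {m<..n} \<Longrightarrow> l * \<bar>b k\<bar> * 3/2 \<le> 1"
  shows "\<P>(x in M. \<not> tube b 0 L m n x) \<le> 2 * exp (3 * l\<^sup>2 * (quad b n - quad b m) - l * L)"
proof -
  define D where "D k = exp (- 3 * l\<^sup>2 * (quad b k - quad b m))" for k
  define H where "H k x = D k * (exp (l * (mart b k x - mart b m x)) + exp ((- l) * (mart b k x - mart b m x)))" for k x
  define I :: "nat \<Rightarrow> 'a \<Rightarrow> real" where "I k x = of_bool (tube b 0 L m k x)" for k x
  define c where "c = exp (l * L - 3 * l\<^sup>2 * (quad b n - quad b m))"
  have pI: "past s k (I k)" for k
    unfolding I_def by (rule past_comp[OF past_tube]) simp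
  have pH: "past s k (H k)" if "m \<le> k" for k
    unfolding H_def using that
    by (intro past_comp2[of s k "mart b k" "mart b m" "\<lambda>u v. D k * (exp (l * (u - v)) + exp (- l * (u - v)))"] past_mart) auto
  have exit: "c \<le> H k x" if "\<bar>mart b k x - mart b m x\<bar> > L" "k \<le> n" for k x
  proof -
    have "exp (l * L) \<le> exp (l * \<bar>mart b k x - mart b m x\<bar>)" using that l by simp
    also have "\<dots> \<le> exp (l * (mart b k x - mart b m x)) + exp ((- l) * (mart b k x - mart b m x))"
    proof -
      have "l * \<bar>d\<bar> = l * d \<or> l * \<bar>d\<bar> = (- l) * d" for d by (auto simp: abs_if)
      from this[of "mart b k x - mart b m x"] show ?thesis
        by (rule disjE) (simp_all only: add_increasing add_increasing2 exp_ge_zero order_refl)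
    qed
    finally have 1: "exp (l * L) \<le> exp (l * (mart b k x - mart b m x)) + exp ((- l) * (mart b k x - mart b m x))" .
    have "exp (- 3 * l\<^sup>2 * (quad b n - quad b m)) \<le> D k"
      unfolding D_def using quad_mono[OF that(2), of b] l by (simp add: mult_left_mono)
    then have "exp (- 3 * l\<^sup>2 * (quad b n - quad b m)) * exp (l * L) \<le> H k x"
      unfolding H_def using 1 by (intro mult_mono) (auto simp: D_def)
    then show ?thesis by (simp add: c_def flip: exp_add)
  qed
  \<comment> \<open>The process stopped at the exit from the tube and set to the constant
    \<open>c\<close> from then on; its integral does not increase. For negative \<open>L\<close> the
    exit happens at time \<open>m\<close> already, which the extra \<open>c\<close> on the right
    allows for.\<close>
  have ind: "(\<integral>x. I k x * H k x + c * (1 - I k x) \<partial>M) \<le> 2 + (if L < 0 then c else 0)" if "m \<le> k" "k \<le> n" for k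
    using that
  proof (induction k rule: dec_induct)
    case base
    have "H m x = 2" for x by (simp add: H_def D_def)
    then have "I m x * H m x + c * (1 - I m x) \<le> 2 + (if L < 0 then c else 0)" for x by (auto simp: I_def tube_def)
    then show ?case
      by (intro integral_le_const past_integrable[of m] past_comp2[OF pI pH]) auto
  next
    case (step k)
    have mk: "m \<le> k" and kn: "k \<le> n" using step by auto
    have ls: "l * \<bar>b (Suc k)\<bar> * 3/2 \<le> 1" using small[of "Suc k"] step.prems mk by simp
    have pIS: "past s (Suc k) (I k)" by (rule past_mono[OF pI]) simp
    have pHS: "past s (Suc k) (H (Suc k))" using mk by (intro pH) simp
    have 1: "I (Suc k) x * H (Suc k) x + c * (1 - I (Suc k) x) \<le> I k x * H (Suc k) x + c * (1 - I k x)" for x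
    proof (cases "tube b 0 L m k x \<and> \<not> tube b 0 L m (Suc k) x")
      case True
      then have "c \<le> H (Suc k) x" using tube_Suc[OF mk, of b 0 L x] step.prems by (intro exit) auto
      then show ?thesis using True by (simp add: I_def)
    next
      case False
      then have "I (Suc k) x = I k x" using tube_Suc[OF mk, of b 0 L x] by (auto simp: I_def)
      then show ?thesis by simp
    qed
    have "(\<integral>x. I (Suc k) x * H (Suc k) x + c * (1 - I (Suc k) x) \<partial>M) \<le> (\<integral>x. I k x * H (Suc k) x + c * (1 - I k x) \<partial>M)"
      by (intro integral_mono 1 past_integrable[OF past_comp2[OF pI pHS]] past_integrable[OF past_comp2[OF pIS pHS]])
    also have "\<dots> = (\<integral>x. I k x * H (Suc k) x \<partial>M) + (\<integral>x. c * (1 - I k x) \<partial>M)"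
      by (intro Bochner_Integration.integral_add past_integrable[OF past_comp2[OF pIS pHS]] past_integrable[OF past_comp[OF pI]])
    also have "(\<integral>x. I k x * H (Suc k) x \<partial>M) \<le> (\<integral>x. I k x * H k x \<partial>M)"
    proof -
      define q where "q = 3 * (l * b (Suc k))\<^sup>2 * cvar (Suc k)"
      define P where "P e x = I k x * D k * exp (e * (mart b k x - mart b m x))" for e x
      have pP: "past s k (P e)" for e
      proof -
        have "past s k (\<lambda>x. I k x * (D k * exp (e * (mart b k x - mart b m x))))"
          by (rule past_comp2[OF pI past_comp2[of s k "mart b k" "mart b m" "\<lambda>u v. D k * exp (e * (u - v))"]])
            (use mk past_mart in auto)
        then show ?thesis by (simp add: P_def[abs_def] mult.assoc)
      qed
      have P0: "0 \<le> P e x" for e x by (simp add: P_def I_def D_def)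
      have DS: "D (Suc k) = D k * exp (- q)"
        unfolding D_def q_def quad_Suc exp_add[symmetric] by (rule arg_cong[where f = exp]) (simp add: algebra_simps)
      have eP: "(\<integral>x. P e x * exp ((e * b (Suc k)) * mdiff (Suc k) x) \<partial>M) \<le> exp q * (\<integral>x. P e x \<partial>M)" if "e = l \<or> e = - l" for e
      proof -
        have "(\<integral>x. P e x * exp ((e * b (Suc k)) * mdiff (Suc k) x) \<partial>M) \<le> exp (3 * (e * b (Suc k))\<^sup>2 * cvar (Suc k)) * (\<integral>x. P e x \<partial>M)"
          using ls l that by (intro mdiff_exp_le[OF pP P0]) (auto simp: abs_mult)
        also have "(e * b (Suc k))\<^sup>2 = (l * b (Suc k))\<^sup>2" using that by (auto simp: power_mult_distrib)
        finally show ?thesis by (simp add: q_def)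
      qed
      have pPm: "past s (Suc k) (\<lambda>x. P e x * exp ((e * b (Suc k)) * mdiff (Suc k) x))" for e
        by (rule past_comp2[OF past_mono[OF pP] past_mdiff]) auto
      have HS: "I k x * H (Suc k) x = exp (- q) * (P l x * exp ((l * b (Suc k)) * mdiff (Suc k) x) + P (- l) x * exp ((- l * b (Suc k)) * mdiff (Suc k) x))" for x
      proof -
        have "exp (e * (mart b (Suc k) x - mart b m x)) = exp (e * (mart b k x - mart b m x)) * exp ((e * b (Suc k)) * mdiff (Suc k) x)" for e
          unfolding mart_Suc exp_add[symmetric] by (simp add: algebra_simps)
        note this[of l] this[of "- l"]
        then show ?thesis unfolding H_def DS P_def by (simp only: distrib_left mult_ac)
      qed
      have "(\<integral>x. I k x * H (Suc k) x \<partial>M) = exp (- q) * ((\<integral>x. P l x * exp ((l * b (Suc k)) * mdiff (Suc k) x) \<partial>M) + (\<integral>x. P (- l) x * exp ((- l * b (Suc k)) * mdiff (Suc k) x) \<partial>M))"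
        unfolding HS using past_integrable[OF pPm[of l]] past_integrable[OF pPm[of "- l"]]
        by (subst integral_mult_right_zero, subst Bochner_Integration.integral_add) auto
      also have "\<dots> \<le> exp (- q) * (exp q * (\<integral>x. P l x \<partial>M) + exp q * (\<integral>x. P (- l) x \<partial>M))"
        by (intro mult_left_mono add_mono eP) auto
      also have "\<dots> = (\<integral>x. P l x \<partial>M) + (\<integral>x. P (- l) x \<partial>M)" by (simp add: distrib_left mult.assoc[symmetric] flip: exp_add)
      also have "\<dots> = (\<integral>x. P l x + P (- l) x \<partial>M)"
        by (rule Bochner_Integration.integral_add[symmetric]) (rule past_integrable[OF pP])+
      also have "\<dots> = (\<integral>x. I k x * H k x \<partial>M)" by (simp add: P_def H_def algebra_simps)
      finally show ?thesis .
    qed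
    also have "(\<integral>x. I k x * H k x \<partial>M) + (\<integral>x. c * (1 - I k x) \<partial>M) = (\<integral>x. I k x * H k x + c * (1 - I k x) \<partial>M)"
      by (intro Bochner_Integration.integral_add[symmetric] past_integrable[OF past_comp2[OF pI pH[OF mk]]] past_integrable[OF past_comp[OF pI]])
    also have "\<dots> \<le> 2 + (if L < 0 then c else 0)" using step.IH kn by simp
    finally show ?case by simp
  qed
  show ?thesis
  proof (cases "L < 0")
    case True
    have "0 \<le> 3 * l\<^sup>2 * (quad b n - quad b m)" using quad_mono[OF mn, of b] by (intro mult_nonneg_nonneg) auto
    moreover have "l * L \<le> 0" using l True by (simp add: mult_nonneg_nonpos)
    ultimately have "0 \<le> 3 * l\<^sup>2 * (quad b n - quad b m) - l * L" by linarith
    then have "1 \<le> exp (3 * l\<^sup>2 * (quad b n - quad b m) - l * L)" by simp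
    then have "1 \<le> 2 * exp (3 * l\<^sup>2 * (quad b n - quad b m) - l * L)" by linarith
    then show ?thesis using prob_le_1 order_trans by blast
  next
    case False
    have "c * \<P>(x in M. \<not> tube b 0 L m n x) = (\<integral>x. c * (1 - I n x) \<partial>M)"
    proof -
      note tube_pred[measurable]
      have "\<P>(x in M. \<not> tube b 0 L m n x) = (\<integral>x. indicator {x\<in>space M. \<not> tube b 0 L m n x} x \<partial>M)"
        by simp
      also have "\<dots> = (\<integral>x. 1 - I n x \<partial>M)"
        by (intro Bochner_Integration.integral_cong) (auto simp: I_def indicator_def)
      finally show ?thesis by simp
    qed
    also have "\<dots> \<le> (\<integral>x. I n x * H n x + c * (1 - I n x) \<partial>M)"
      by (intro integral_mono past_integrable[OF past_comp2[OF pI pH[OF mn]]] past_integrable[OF past_comp[OF pI]])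
        (simp add: I_def H_def D_def)
    also have "\<dots> \<le> 2" using ind[OF mn order_refl] False by simp
    finally have "\<P>(x in M. \<not> tube b 0 L m n x) \<le> 2 / c" by (simp add: c_def pos_le_divide_eq mult.commute)
    also have "2 / c = 2 * exp (3 * l\<^sup>2 * (quad b n - quad b m) - l * L)"
      unfolding c_def using exp_minus[of "l * L - 3 * l\<^sup>2 * (quad b n - quad b m)"] by (simp add: divide_inverse)
    finally show ?thesis .
  qed
qed

text \<open>\<open>low\<close> says that \<open>P j\<close> has conditional probability at least
  \<open>p j\<close> given the past, expressed without conditional expectations by testing against
  nonnegative past functions. The test function used is the indicator that none of the events from
  \<open>i\<close> to \<open>j - 1\<close> has occurred; its probability is therefore at most the
  product of the factors \<open>1 - p j\<close>.\<close>

lemma conditional_Borel_Cantelli: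
  fixes p :: "nat \<Rightarrow> real"
  assumes mono: "incseq nn" and P: "\<And>j. past s (nn (Suc j)) (P j)"
    and low: "\<And>j (G :: 'a \<Rightarrow> real). J \<le> j \<Longrightarrow> past s (nn j) G \<Longrightarrow> (\<And>x. 0 \<le> G x) \<Longrightarrow>
      p j * (\<integral>x. G x \<partial>M) \<le> (\<integral>x. G x * of_bool (P j x) \<partial>M)"
    and p0: "\<And>j. 0 \<le> p j" and div: "\<not> summable p"
  shows "AE x in M. \<exists>\<^sub>F j in sequentially. P j x"
proof -
  have "AE x in M. \<exists>j\<ge>i. P j x" if i: "J \<le> i" for i
  proof -
    define G :: "nat \<Rightarrow> 'a \<Rightarrow> real" where "G k x = of_bool (\<forall>j\<in>{i..<k}. \<not> P j x)" for k x
    have pG: "past s (nn k) (G k)" for k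
      unfolding G_def
    proof (rule past_comp[OF past_all])
      fix j assume "j \<in> {i..<k}"
      then have "nn (Suc j) \<le> nn k" by (intro incseqD[OF mono]) auto
      then show "past s (nn k) (\<lambda>x. \<not> P j x)" by (rule past_comp[OF past_mono[OF P]])
    qed
    have le: "(\<integral>x. G k x \<partial>M) \<le> exp (- (\<Sum>j\<in>{i..<k}. p j))" if "i \<le> k" for k
      using that
    proof (induction k rule: dec_induct)
      case base show ?case by (simp add: G_def prob_space)
    next
      case (step k)
      have GS: "G (Suc k) x = G k x - G k x * of_bool (P k x)" for x
        using step by (auto simp: G_def less_Suc_eq)
      have "past s (nn (Suc k)) (\<lambda>x. G k x * of_bool (P k x))"
        using past_comp2[OF past_mono[OF pG[of k]] P[of k], of "\<lambda>u v. u * of_bool v"] incseqD[OF mono, of k "Suc k"] by simp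
      then have "(\<integral>x. G (Suc k) x \<partial>M) = (\<integral>x. G k x \<partial>M) - (\<integral>x. G k x * of_bool (P k x) \<partial>M)"
        unfolding GS by (intro Bochner_Integration.integral_diff past_integrable[OF pG] past_integrable)
      also have "\<dots> \<le> (\<integral>x. G k x \<partial>M) - p k * (\<integral>x. G k x \<partial>M)"
        using step i by (intro diff_left_mono low pG) (auto simp: G_def)
      also have "\<dots> = (1 + - p k) * (\<integral>x. G k x \<partial>M)" by (simp add: algebra_simps)
      also have "\<dots> \<le> exp (- p k) * (\<integral>x. G k x \<partial>M)"
        by (intro mult_right_mono exp_ge_add_one_self integral_nonneg) (simp add: G_def)
      also have "\<dots> \<le> exp (- p k) * exp (- (\<Sum>j\<in>{i..<k}. p j))"
        by (intro mult_left_mono step.IH) auto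
      also have "\<dots> = exp (- (\<Sum>j\<in>{i..<Suc k}. p j))"
        using step by (simp flip: exp_add)
      finally show ?case .
    qed
    have "filterlim (\<lambda>k. \<Sum>j<k. p j) at_top sequentially"
      unfolding filterlim_at_top
    proof
      fix Z :: real
      have "\<not> (\<forall>k. (\<Sum>j<k. p j) \<le> Z)" using summableI_nonneg_bounded[of p Z] p0 div by blast
      then obtain k where k: "Z \<le> (\<Sum>j<k. p j)" by (meson linear)
      show "\<forall>\<^sub>F k in sequentially. Z \<le> (\<Sum>j<k. p j)"
        using eventually_ge_at_top[of k]
      proof eventually_elim
        case (elim l)
        have "(\<Sum>j<k. p j) \<le> (\<Sum>j<l. p j)" using elim p0 by (intro sum_mono2) auto
        then show ?case using k by linarith
      qed
    qed
    then have "filterlim (\<lambda>k. \<Sum>j\<in>{i..<k}. p j) at_top sequentially"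
    proof -
      assume top: "filterlim (\<lambda>k. \<Sum>j<k. p j) at_top sequentially"
      have "\<forall>\<^sub>F k in sequentially. - (\<Sum>j<i. p j) + (\<Sum>j<k. p j) = (\<Sum>j\<in>{i..<k}. p j)"
        using eventually_ge_at_top[of i]
      proof eventually_elim
        case (elim k)
        have "(\<Sum>j<i. p j) + (\<Sum>j\<in>{i..<k}. p j) = (\<Sum>j<k. p j)"
          using elim by (simp add: lessThan_atLeast0 sum.atLeastLessThan_concat)
        then show ?case by linarith
      qed
      then show ?thesis
        using filterlim_tendsto_add_at_top[OF tendsto_const top, of "- (\<Sum>j<i. p j)"] filterlim_cong by fast
    qed
    then have lim: "(\<lambda>k. exp (- (\<Sum>j\<in>{i..<k}. p j))) \<longlonglongrightarrow> 0"
      by (intro filterlim_compose[OF exp_at_bot] filterlim_compose[OF filterlim_uminus_at_bot_at_top])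
    have m: "{x \<in> space M. \<forall>j\<in>{i..}. \<not> P j x} \<in> sets M"
    proof -
      have [measurable]: "Measurable.pred M (P j)" for j by (rule past_pred[OF P])
      show ?thesis by measurable
    qed
    have "\<P>(x in M. \<forall>j\<in>{i..}. \<not> P j x) \<le> exp (- (\<Sum>j\<in>{i..<k}. p j))" if "i \<le> k" for k
    proof -
      have "\<P>(x in M. \<forall>j\<in>{i..}. \<not> P j x) = (\<integral>x. indicator {x \<in> space M. \<forall>j\<in>{i..}. \<not> P j x} x \<partial>M)"
        using m by simp
      also have "\<dots> \<le> (\<integral>x. G k x \<partial>M)"
        by (intro integral_mono past_integrable[OF pG] integrable_real_indicator m)
          (auto simp: G_def indicator_def emeasure_eq_measure)
      finally show ?thesis using le[OF that] by simp
    qed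
    then have "\<P>(x in M. \<forall>j\<in>{i..}. \<not> P j x) \<le> 0"
      by (intro tendsto_lowerbound[OF lim]) (auto intro!: eventually_sequentiallyI[of i])
    then have "\<P>(x in M. \<forall>j\<in>{i..}. \<not> P j x) = 0" by (simp add: measure_le_0_iff)
    then have "AE x in M. x \<notin> {x \<in> space M. \<forall>j\<in>{i..}. \<not> P j x}"
      using m by (intro AE_not_in) (simp add: emeasure_eq_measure null_sets_def)
    then show ?thesis using AE_space by eventually_elim auto
  qed
  then have "AE x in M. \<forall>i\<in>{J..}. \<exists>j\<ge>i. P j x" by (subst AE_ball_countable) auto
  then show ?thesis
  proof eventually_elim
    case (elim x)
    show ?case unfolding frequently_sequentially
    proof
      fix i
      obtain j where "j \<ge> max i J" "P j x" using elim by (metis atLeast_iff max.cobounded2)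
      then show "\<exists>n\<ge>i. P n x" by auto
    qed
  qed
qed

end

section \<open>The clock U and its division into blocks\<close>

locale mart_growth = sign_chain +
  fixes b :: "nat \<Rightarrow> real" and C \<gamma> :: real
  assumes U_top: "filterlim (quad b) at_top sequentially"
    and C_pos: "0 < C" and gamma: "0 \<le> \<gamma>" "\<gamma> < 1/2"
    and b_small: "\<forall>\<^sub>F n in sequentially. \<forall>k\<in>{1..n}. \<bar>b k\<bar> \<le> C * quad b n powr \<gamma>"
begin

abbreviation "U \<equiv> quad b"
abbreviation "W \<equiv> mart b"

definition level :: "real \<Rightarrow> nat" where "level t = (LEAST n. t \<le> U n)"

lemma U_level: "t \<le> U (level t)"
proof -
  have "\<exists>n. t \<le> U n" using U_top unfolding filterlim_at_top eventually_sequentially by blast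
  then show ?thesis unfolding level_def by (rule LeastI_ex)
qed

lemma U_less_level: "n < level t \<Longrightarrow> U n < t"
  unfolding level_def using not_less_Least by force

lemma level_mono: "t \<le> u \<Longrightarrow> level t \<le> level u"
  using U_less_level[of "level u" t] U_level[of u] by (cases "level u < level t") auto

lemma level_top: "filterlim level at_top at_top"
  unfolding filterlim_at_top
proof
  fix n
  show "\<forall>\<^sub>F t in at_top. n \<le> level t"
    using eventually_gt_at_top[of "U n"]
  proof eventually_elim
    case (elim t)
    show ?case
    proof (rule ccontr)
      assume "\<not> n \<le> level t"
      then have "U (level t) \<le> U n" by (intro quad_mono) simp
      with elim U_level[of t] show False by simp
    qed
  qed
qed

lemma b_small_U: 
  assumes "0 < c" shows "\<forall>\<^sub>F n in sequentially. \<forall>k\<in>{1..n}. \<bar>b k\<bar> \<le> c * sqrt (U n)"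
proof -
  have "\<forall>\<^sub>F u in at_top. C * u powr \<gamma> \<le> c * sqrt u"
    using assms C_pos gamma by real_asymp
  from filterlim_iff[THEN iffD1, OF U_top, rule_format, OF this] b_small
  show ?thesis by eventually_elim force
qed

text \<open>Before the level is reached the clock is below \<open>t\<close>, and the last step adds
  at most a quarter of the new value.\<close>

lemma U_level_le: "\<forall>\<^sub>F t in at_top. U (level t) \<le> 2 * t"
proof -
  have "\<forall>\<^sub>F n in sequentially. \<forall>k\<in>{1..n}. \<bar>b k\<bar> \<le> 1/2 * sqrt (U n)" by (rule b_small_U) simp
  from filterlim_iff[THEN iffD1, OF level_top, rule_format, OF this]
    filterlim_iff[THEN iffD1, OF level_top, rule_format, OF eventually_ge_at_top[of 1]] eventually_gt_at_top[of 0]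
  show ?thesis
  proof eventually_elim
    case (elim t)
    obtain n where n: "level t = Suc n" using elim(2) by (metis One_nat_def Suc_le_D)
    have "\<bar>b (Suc n)\<bar> \<le> 1/2 * sqrt (U (Suc n))" using elim(1) by (simp add: n)
    then have "(b (Suc n))\<^sup>2 \<le> (1/2 * sqrt (U (Suc n)))\<^sup>2" using abs_le_square_iff[of "b (Suc n)" "1/2 * sqrt (U (Suc n))"] quad_nonneg[of b "Suc n"] by simp
    also have "\<dots> = U (Suc n) / 4" using quad_nonneg[of b "Suc n"] by (simp add: power_mult_distrib power_divide)
    finally have "(b (Suc n))\<^sup>2 * cvar (Suc n) \<le> U (Suc n) / 4 * 1"
      using cvar_bounds[of "Suc n"] quad_nonneg[of b "Suc n"] by (intro mult_mono) auto
    moreover have "U n < t" using n by (intro U_less_level) simp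
    ultimately show ?case using elim(3) quad_Suc[of b n] unfolding n by linarith
  qed
qed

text \<open>One of the three factors \<open>\<bar>b k\<bar>\<close> is bounded by \<open>c\<close>,
  the squares of the others sum to at most \<open>4/3 * U n\<close>. With \<open>d\<close> of order
  \<open>1 / sqrt (U n)\<close> and \<open>c\<close> of order \<open>U n powr \<gamma>\<close>, both
  up to double logarithms, the total is of order \<open>U n powr (\<gamma> - 1/2)\<close>: this is
  where \<open>\<gamma> < 1/2\<close> enters.\<close>

lemma cube_sum_le:
  assumes "\<And>k. k \<in> {1..n} \<Longrightarrow> \<bar>b k\<bar> \<le> c" "0 \<le> c" "0 \<le> d"
  shows "(\<Sum>k\<in>{m<..n}. 30 * (d * \<bar>b k\<bar>) ^ 3) \<le> 40 * d ^ 3 * c * U n"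
proof -
  have "(\<Sum>k\<in>{m<..n}. 30 * (d * \<bar>b k\<bar>) ^ 3) \<le> (\<Sum>k\<in>{1..n}. 30 * (d * \<bar>b k\<bar>) ^ 3)"
    using assms by (intro sum_mono2) auto
  also have "\<dots> \<le> (\<Sum>k\<in>{1..n}. 30 * d ^ 3 * c * (b k)\<^sup>2)"
  proof (rule sum_mono)
    fix k assume k: "k \<in> {1..n}"
    have "30 * (d * \<bar>b k\<bar>) ^ 3 = 30 * d ^ 3 * \<bar>b k\<bar> * (b k)\<^sup>2"
      by (simp add: power_mult_distrib power3_eq_cube power2_eq_square)
    also have "\<dots> \<le> 30 * d ^ 3 * c * (b k)\<^sup>2"
      using assms k by (intro mult_right_mono mult_left_mono) auto
    finally show "30 * (d * \<bar>b k\<bar>) ^ 3 \<le> 30 * d ^ 3 * c * (b k)\<^sup>2" .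
  qed
  also have "\<dots> = 30 * d ^ 3 * c * (\<Sum>k\<in>{1..n}. (b k)\<^sup>2)" by (simp add: sum_distrib_left)
  also have "\<dots> \<le> 30 * d ^ 3 * c * (4/3 * U n)"
    using quad_lower[of b n] assms by (intro mult_left_mono) auto
  finally show ?thesis by (simp add: mult_ac)
qed

text \<open>Two demands meet here. The clock at the start of a block must be negligible against its
  end: the square root of the ratio is of order \<open>1 / j\<^sup>2\<close>, which beats every
  power of \<open>ln j\<close>. And \<open>ln U\<close> at the end of block \<open>j\<close> may
  grow only like \<open>j * ln j\<close>, so that tubes of probability about
  \<open>ln U powr (- \<kappa>)\<close> with \<open>\<kappa> < 1\<close> still occur infinitely
  often.\<close>

definition block :: "nat \<Rightarrow> nat" where "block j = level (fact j ^ 4)"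

lemma block_mono: "incseq block"
  unfolding block_def by (intro monoI level_mono power_mono fact_mono) auto

lemma fact4_top: "filterlim (\<lambda>j. fact j ^ 4 :: real) at_top sequentially"
proof (rule filterlim_at_top_mono[OF filterlim_real_sequentially])
  show "\<forall>\<^sub>F j in sequentially. real j \<le> fact j ^ 4"
  proof (intro always_eventually allI)
    fix j
    have "real j \<le> fact j" using fact_ge_self[of j] by (metis of_nat_fact of_nat_le_iff)
    also have "(fact j :: real) \<le> fact j ^ 4" by (intro self_le_power) auto
    finally show "real j \<le> fact j ^ 4" .
  qed
qed

lemma block_top: "filterlim block at_top sequentially"
  unfolding block_def by (rule filterlim_compose[OF level_top fact4_top])

lemma U_block_top: "filterlim (\<lambda>j. U (block j)) at_top sequentially"
  by (rule filterlim_compose[OF U_top block_top])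

lemma U_block_le: "\<forall>\<^sub>F j in sequentially. U (block j) \<le> 2 * fact j ^ 4"
  unfolding block_def by (rule filterlim_iff[THEN iffD1, OF fact4_top, rule_format, OF U_level_le])

lemma U_block_ge: "fact j ^ 4 \<le> U (block j)"
  unfolding block_def by (rule U_level)

lemma ln_U_block: "\<forall>\<^sub>F j in sequentially. ln (U (block (Suc j))) \<le> ln 2 + 4 * (real j + 1) * ln (real j + 1)"
proof -
  have "\<forall>\<^sub>F j in sequentially. U (block (Suc j)) \<le> 2 * fact (Suc j) ^ 4" using U_block_le by (subst eventually_sequentially_Suc)
  then show ?thesis
proof eventually_elim
  case (elim j)
  have pos: "0 < U (block (Suc j))" by (rule less_le_trans[OF _ U_block_ge]) simp
  have "ln (U (block (Suc j))) \<le> ln (2 * fact (Suc j) ^ 4)" using elim pos by (rule ln_mono)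
  also have "\<dots> = ln 2 + 4 * ln (fact (Suc j))" by (simp add: ln_mult ln_realpow del: fact_Suc)
  also have "ln (fact (Suc j)) \<le> (real j + 1) * ln (real j + 1)"
  proof -
    have "(fact (Suc j) :: real) \<le> of_nat (Suc j ^ Suc j)" by (rule fact_le_power)
    then have "(fact (Suc j) :: real) \<le> (real j + 1) ^ Suc j" by (simp only: of_nat_power of_nat_Suc add.commute[of 1])
    then have "ln (fact (Suc j)) \<le> ln ((real j + 1) ^ Suc j)" by (rule ln_mono) simp
    also have "\<dots> = (real j + 1) * ln (real j + 1)"
      by (subst ln_realpow) (auto simp: add.commute)
    finally show ?thesis .
  qed
  finally show ?case by (simp only: mult.assoc)
qed
qed

end

section \<open>Law of the iterated logarithm and Chung's law for the martingale\<close>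

lemma frequently_compose: "\<exists>\<^sub>F j in F. P (f j) \<Longrightarrow> filterlim f G F \<Longrightarrow> \<exists>\<^sub>F n in G. P n"
  unfolding frequently_def filterlim_iff by blast

context mart_growth begin

text \<open>The bound by \<open>\<kappa> * ln (ln u) + 1\<close> in \<open>ev\<close> is the price
  of the tube in the exponent; the bound with the factor \<open>D\<close> keeps \<open>l + t\<close>
  so small that the cubic errors stay below the main term. Since \<open>\<kappa> < 1\<close>, the
  probabilities dominate a harmonic series and the conditional Borel-Cantelli lemma applies.\<close>

lemma tube_io:
  assumes kappa: "0 \<le> \<kappa>" "\<kappa> < 1" and D: "0 < D"
    and ev: "\<forall>\<^sub>F u in at_top. 0 \<le> lf u \<and> 0 < Lf u
      \<and> lf u * Lf u + ((lf u)\<^sup>2 + (pi / (2 * Lf u))\<^sup>2) * u / 2 \<le> \<kappa> * ln (ln u) + 1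
      \<and> (lf u + pi / (2 * Lf u)) * sqrt u \<le> D * ln (ln u)"
  shows "AE x in M. \<exists>\<^sub>F j in sequentially.
    tube b (lf (U (block (Suc j)))) (Lf (U (block (Suc j)))) (block j) (block (Suc j)) x"
proof -
  \<comment> \<open>The cubic error takes at most half of
    \<open>exp (-1) * ln u powr (- \<kappa>)\<close> by \<open>e1\<close>; the other half is at
    least \<open>p j\<close> by \<open>e4\<close> and \<open>ln_U_block\<close>.\<close>
  define p where "p j = exp (-1) / 2 * (1 / (real j + 1))" for j
  have e1: "\<forall>\<^sub>F u in at_top. 40 * C * (D * ln (ln u) / sqrt u) ^ 3 * u powr \<gamma> * u \<le> exp (-1) / 2 * ln u powr (- \<kappa>)"
    using kappa D C_pos gamma by real_asymp
  have e2: "\<forall>\<^sub>F u in at_top. D * ln (ln u) / sqrt u * (C * u powr \<gamma>) \<le> 1/4"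
    using D C_pos gamma by real_asymp
  have e3: "\<forall>\<^sub>F u::real in at_top. 1 < u \<and> 1 < ln u" by (intro eventually_conj) real_asymp+
  have e4: "\<forall>\<^sub>F j::nat in sequentially. 1 / (real j + 1) \<le> (ln 2 + 4 * (real j + 1) * ln (real j + 1)) powr (- \<kappa>)"
    using kappa by real_asymp
  have "filterlim (\<lambda>j. U (block (Suc j))) at_top sequentially"
    using U_block_top by (rule filterlim_compose[OF _ filterlim_Suc])
  note Utop = filterlim_iff[THEN iffD1, OF this, rule_format]
  have bs: "filterlim (\<lambda>j. block (Suc j)) at_top sequentially"
    using block_top by (rule filterlim_compose[OF _ filterlim_Suc])
  have "\<forall>\<^sub>F j in sequentially. \<forall>G::'a\<Rightarrow>real. past s (block j) G \<longrightarrow> (\<forall>x. 0 \<le> G x) \<longrightarrow>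
      p j * (\<integral>x. G x \<partial>M) \<le> (\<integral>x. G x * of_bool (tube b (lf (U (block (Suc j)))) (Lf (U (block (Suc j)))) (block j) (block (Suc j)) x) \<partial>M)"
    using Utop[OF ev] Utop[OF e1] Utop[OF e2] Utop[OF e3] e4 ln_U_block
      filterlim_iff[THEN iffD1, OF bs, rule_format, OF b_small]
  proof eventually_elim
    case (elim j)
    define u where "u = U (block (Suc j))"
    define l L t where "l = lf u" and "L = Lf u" and "t = pi / (2 * L)"
    have l: "0 \<le> l" and L: "0 < L" and a: "l * L + (l\<^sup>2 + t\<^sup>2) * u / 2 \<le> \<kappa> * ln (ln u) + 1"
      and d: "(l + t) * sqrt u \<le> D * ln (ln u)"
      using elim(1) by (auto simp: u_def l_def L_def t_def)
    have u: "1 < u" "1 < ln u" using elim(4) by (auto simp: u_def)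
    have t: "0 < t" using L by (simp add: t_def)
    have d': "l + t \<le> D * ln (ln u) / sqrt u" using d u by (simp add: pos_le_divide_eq)
    have bk: "\<bar>b k\<bar> \<le> C * u powr \<gamma>" if "k \<in> {1..block (Suc j)}" for k
      using elim(7) that by (simp add: u_def)
    have Cu: "0 \<le> C * u powr \<gamma>" using C_pos by simp
    have small: "(l + t) * \<bar>b k\<bar> \<le> 1/4" if "k \<in> {block j<..block (Suc j)}" for k
    proof -
      have "(l + t) * \<bar>b k\<bar> \<le> D * ln (ln u) / sqrt u * (C * u powr \<gamma>)"
        using d' bk[of k] that l t by (intro mult_mono) auto
      then show ?thesis using elim(3) unfolding u_def by linarith
    qed
    have Ule: "U (block j) \<le> u" unfolding u_def by (intro quad_mono incseqD[OF block_mono]) simp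
    have "(l\<^sup>2 + t\<^sup>2) * (u - U (block j)) / 2 \<le> (l\<^sup>2 + t\<^sup>2) * u / 2"
      using quad_nonneg[of b "block j"] by (intro divide_right_mono mult_left_mono) auto
    with a have "l * L + (l\<^sup>2 + t\<^sup>2) * (u - U (block j)) / 2 \<le> \<kappa> * ln (ln u) + 1" by linarith
    then have "exp (- (\<kappa> * ln (ln u) + 1)) \<le> exp (- (l * L + (l\<^sup>2 + t\<^sup>2) * (u - U (block j)) / 2))" by simp
    moreover have "exp (- (\<kappa> * ln (ln u) + 1)) = exp (-1) * ln u powr (- \<kappa>)"
      using u by (simp add: powr_def flip: exp_add)
    moreover have "(\<Sum>k\<in>{block j<..block (Suc j)}. 30 * ((l + t) * \<bar>b k\<bar>) ^ 3) \<le> exp (-1) / 2 * ln u powr (- \<kappa>)"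
    proof -
      have "(\<Sum>k\<in>{block j<..block (Suc j)}. 30 * ((l + t) * \<bar>b k\<bar>) ^ 3) \<le> 40 * (l + t) ^ 3 * (C * u powr \<gamma>) * U (block (Suc j))"
        using bk Cu l t by (intro cube_sum_le) auto
      also have "\<dots> = 40 * C * (l + t) ^ 3 * u powr \<gamma> * u" by (simp add: u_def)
      also have "\<dots> \<le> 40 * C * (D * ln (ln u) / sqrt u) ^ 3 * u powr \<gamma> * u"
        using C_pos u l t d' by (intro mult_right_mono mult_left_mono power_mono) auto
      also have "\<dots> \<le> exp (-1) / 2 * ln u powr (- \<kappa>)" using elim(2) by (simp add: u_def)
      finally show ?thesis .
    qed
    moreover have "p j \<le> exp (-1) / 2 * ln u powr (- \<kappa>)"
    proof -
      have "1 / (real j + 1) \<le> (ln 2 + 4 * (real j + 1) * ln (real j + 1)) powr (- \<kappa>)" by (rule elim(5))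
      also have "\<dots> \<le> ln u powr (- \<kappa>)" using elim(6) u kappa by (intro powr_mono2') (auto simp: u_def)
      finally show ?thesis unfolding p_def by (intro mult_left_mono) auto
    qed
    ultimately have pj: "p j \<le> exp (- (l * L + (l\<^sup>2 + t\<^sup>2) * (u - U (block j)) / 2)) - (\<Sum>k\<in>{block j<..block (Suc j)}. 30 * ((l + t) * \<bar>b k\<bar>) ^ 3)"
      by linarith
    show ?case
    proof (intro allI impI)
      fix G :: "'a \<Rightarrow> real" assume G: "past s (block j) G" and G0: "\<forall>x. 0 \<le> G x"
      have "p j * (\<integral>x. G x \<partial>M) \<le> (exp (- (l * L + (l\<^sup>2 + t\<^sup>2) * (u - U (block j)) / 2)) - (\<Sum>k\<in>{block j<..block (Suc j)}. 30 * ((l + t) * \<bar>b k\<bar>) ^ 3)) * (\<integral>x. G x \<partial>M)"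
        using G0 by (intro mult_right_mono pj) auto
      also have "\<dots> \<le> (\<integral>x. G x * of_bool (tube b l L (block j) (block (Suc j)) x) \<partial>M)"
        unfolding u_def by (rule tube_lower[OF incseqD[OF block_mono] G _ l L t_def small]) (use G0 in auto)
      finally show "p j * (\<integral>x. G x \<partial>M) \<le> (\<integral>x. G x * of_bool (tube b (lf (U (block (Suc j)))) (Lf (U (block (Suc j)))) (block j) (block (Suc j)) x) \<partial>M)"
        by (simp add: l_def L_def u_def)
    qed
  qed
  then obtain J where J: "\<And>j G. J \<le> j \<Longrightarrow> past s (block j) (G::'a\<Rightarrow>real) \<Longrightarrow> (\<And>x. 0 \<le> G x) \<Longrightarrow>
      p j * (\<integral>x. G x \<partial>M) \<le> (\<integral>x. G x * of_bool (tube b (lf (U (block (Suc j)))) (Lf (U (block (Suc j)))) (block j) (block (Suc j)) x) \<partial>M)"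
    unfolding eventually_sequentially by metis
  have "\<not> summable p"
  proof
    assume "summable p"
    then have "summable (\<lambda>j. 2 * exp 1 * p j)" by (rule summable_mult)
    moreover have "2 * exp 1 * p j = inverse (of_nat (Suc j))" for j
      unfolding p_def exp_minus by (simp add: inverse_eq_divide add.commute)
    ultimately have "summable (\<lambda>j. inverse (of_nat (Suc j) :: real))" by simp
    then show False using not_summable_harmonic[where 'a = real] summable_Suc_iff[of "\<lambda>n. inverse (of_nat n :: real)"] by blast
  qed
  then show ?thesis
    by (intro conditional_Borel_Cantelli[OF block_mono past_tube[OF order_refl], of J p] J) (auto simp: p_def)
qed

text \<open>The maximal inequality with \<open>l = 1 / sqrt (U (block j))\<close>; a radius of
  \<open>2 * ln (j + 1)\<close> in these units makes the probabilities of order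
  \<open>1 / j\<^sup>2\<close>. The bound disposes of the path before the block in which a tube is
  followed.\<close>

lemma crude_bound:
  "AE x in M. \<forall>\<^sub>F j in sequentially. tube b 0 (2 * ln (real j + 1) * sqrt (U (block j))) 0 (block j) x"
proof -
  define A where "A j = {x \<in> space M. \<not> tube b 0 (2 * ln (real j + 1) * sqrt (U (block j))) 0 (block j) x}" for j
  have Am: "A j \<in> sets M" for j
    unfolding A_def using tube_pred by measurable
  have "\<forall>\<^sub>F j in sequentially. \<forall>k\<in>{1..block j}. \<bar>b k\<bar> \<le> 1/2 * sqrt (U (block j))"
    by (rule filterlim_iff[THEN iffD1, OF block_top, rule_format, OF b_small_U]) simp
  then have "\<forall>\<^sub>F j in sequentially. norm (prob (A j)) \<le> 2 * exp 3 * (1 / (real j + 1) ^ 2)"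
  proof eventually_elim
    case (elim j)
    have Up: "0 < U (block j)" by (rule less_le_trans[OF _ U_block_ge]) simp
    let ?l = "1 / sqrt (U (block j))"
    have "prob (A j) \<le> 2 * exp (3 * ?l\<^sup>2 * (U (block j) - U 0) - ?l * (2 * ln (real j + 1) * sqrt (U (block j))))"
      unfolding A_def
    proof (rule mart_maximal)
      fix k assume "k \<in> {0<..block j}"
      then have "\<bar>b k\<bar> \<le> 1/2 * sqrt (U (block j))" using elim by auto
      then show "?l * \<bar>b k\<bar> * 3 / 2 \<le> 1" using Up by (simp add: field_simps)
    qed (use Up in auto)
    also have "\<dots> = 2 * exp (3 - 2 * ln (real j + 1))"
      using Up by (simp add: power_divide)
    also have "\<dots> = 2 * exp 3 * (1 / (real j + 1) ^ 2)"
      by (simp add: exp_diff exp_double power2_eq_square mult_exp_exp[symmetric] flip: mult_2)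
    finally show ?case by simp
  qed
  moreover have "summable (\<lambda>j. 2 * exp 3 * (1 / (real j + 1) ^ 2))"
  proof (rule summable_mult)
    have "summable (\<lambda>j. 1 / real (Suc j) ^ 2)"
      using inverse_power_summable[of 2, where 'a = real] by (subst summable_Suc_iff) (simp add: inverse_eq_divide)
    then show "summable (\<lambda>j. 1 / (real j + 1) ^ 2)" by (simp add: add.commute)
  qed
  ultimately have "summable (\<lambda>j. prob (A j))" by (rule summable_comparison_test_ev)
  then have "AE x in M. \<forall>\<^sub>F j in sequentially. x \<in> space M - A j"
    by (intro borel_cantelli_AE1 Am) (auto simp: emeasure_eq_measure)
  then show ?thesis by eventually_elim (auto simp: A_def elim: eventually_mono)
qed

lemma sqrt_U_block_ratio:
  "\<forall>\<^sub>F j in sequentially. sqrt (U (block j)) \<le> sqrt 2 / (real j + 1)\<^sup>2 * sqrt (U (block (Suc j)))"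
  using U_block_le
proof eventually_elim
  case (elim j)
  have "(real j + 1) ^ 4 * U (block j) \<le> (real j + 1) ^ 4 * (2 * fact j ^ 4)"
    using elim by (intro mult_left_mono) auto
  also have "\<dots> = 2 * fact (Suc j) ^ 4" by (simp add: power_mult_distrib add.commute)
  also have "\<dots> \<le> 2 * U (block (Suc j))" using U_block_ge[of "Suc j"] by simp
  finally have "sqrt ((real j + 1) ^ 4 * U (block j)) \<le> sqrt (2 * U (block (Suc j)))" by simp
  moreover have "sqrt ((real j + 1) ^ 4) = (real j + 1)\<^sup>2"
    by (intro real_sqrt_unique) auto
  ultimately show ?case by (simp add: real_sqrt_mult pos_le_divide_eq mult.commute)
qed

text \<open>A tube of radius \<open>e / 4 * sqrt (u * ln (ln u))\<close> around the drift
  \<open>lf u\<close> forces the value at the end of the block. The drift costs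
  \<open>(1 - e)\<^sup>2 * ln (ln u)\<close>, the tilt across the width of the tube
  \<open>(1 - e) * (e / 4) * sqrt 2 * ln (ln u)\<close>, and the price of confinement tends to 0.
  The first two coefficients add up to \<kappa>, which is below 1.\<close>

theorem LIL_lower:
  "AE x in M. \<forall>e>0. \<exists>\<^sub>F n in sequentially. (1 - e) * sqrt (2 * U n * ln (ln (U n))) \<le> W n x"
proof -
  have main: "AE x in M. \<exists>\<^sub>F n in sequentially. (1 - 2 * e) * sqrt (2 * U n * ln (ln (U n))) \<le> W n x" if e: "0 < e" "e < 1" for e :: real
  proof -
    define lf where "lf u = (1 - e) * sqrt (2 * ln (ln u) / u)" for u
    define Lf where "Lf u = e / 4 * sqrt (u * ln (ln u))" for u
    define \<kappa> where "\<kappa> = (1 - e)\<^sup>2 + (1 - e) * (e / 4) * sqrt 2"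
    have kappa: "0 \<le> \<kappa>" "\<kappa> < 1"
    proof -
      show "0 \<le> \<kappa>" using e by (simp add: \<kappa>_def)
      have "sqrt 2 \<le> 2" by (rule real_le_lsqrt) auto
      then have "(1 - e) * (e / 4) * sqrt 2 \<le> (1 - e) * (e / 4) * 2" using e by (intro mult_left_mono) auto
      then have "\<kappa> \<le> (1 - e)\<^sup>2 + (1 - e) * (e / 4) * 2" unfolding \<kappa>_def by linarith
      also have "\<dots> = (1 - e) * (1 - e / 2)" by (simp add: power2_eq_square field_simps)
      also have "\<dots> < 1 * 1" using e by (intro mult_strict_mono) auto
      finally show "\<kappa> < 1" by simp
    qed
    have e0: "\<forall>\<^sub>F u in at_top. 0 < ln (ln (u::real)) \<and> 0 < u" by (intro eventually_conj) real_asymp+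
    have e1: "\<forall>\<^sub>F u in at_top. pi\<^sup>2 / (8 * (e/4)\<^sup>2 * ln (ln u)) \<le> (1::real)" using e by real_asymp
    have e2: "\<forall>\<^sub>F u in at_top. (1 - e) * sqrt (2 * ln (ln u)) + pi / (2 * (e/4) * sqrt (ln (ln u))) \<le> 1 * ln (ln u)" using e by real_asymp
    have "\<forall>\<^sub>F u in at_top. 0 \<le> lf u \<and> 0 < Lf u
      \<and> lf u * Lf u + ((lf u)\<^sup>2 + (pi / (2 * Lf u))\<^sup>2) * u / 2 \<le> \<kappa> * ln (ln u) + 1
      \<and> (lf u + pi / (2 * Lf u)) * sqrt u \<le> 1 * ln (ln u)"
      using e0 e1 e2
    proof eventually_elim
      case (elim u)
      let ?l = "ln (ln u)"
      have pos: "0 < ?l" "0 < u" using elim by auto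
      have 1: "lf u * Lf u = (1 - e) * (e/4) * sqrt 2 * ?l"
      proof -
        have "sqrt (2 * ?l / u) * sqrt (u * ?l) = sqrt (2 * (?l * ?l))" using pos by (simp flip: real_sqrt_mult)
        also have "\<dots> = sqrt 2 * ?l" using pos by (simp add: real_sqrt_mult)
        finally have *: "sqrt (2 * ?l / u) * sqrt (u * ?l) = sqrt 2 * ?l" .
        have "lf u * Lf u = (1 - e) * (e/4) * (sqrt (2 * ?l / u) * sqrt (u * ?l))" by (simp add: lf_def Lf_def)
        then show ?thesis unfolding * by simp
      qed
      have 2: "(lf u)\<^sup>2 * u / 2 = (1 - e)\<^sup>2 * ?l" using pos by (simp add: lf_def power_mult_distrib)
      have 3: "(pi / (2 * Lf u))\<^sup>2 * u / 2 = pi\<^sup>2 / (8 * (e/4)\<^sup>2 * ?l)"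
        using pos e by (simp add: Lf_def power_mult_distrib power_divide field_simps)
      have 4: "lf u * sqrt u = (1 - e) * sqrt (2 * ?l)" using pos by (simp add: lf_def real_sqrt_divide)
      have 5: "pi / (2 * Lf u) * sqrt u = pi / (2 * (e/4) * sqrt ?l)" using pos e by (simp add: Lf_def real_sqrt_mult field_simps)
      have "lf u * Lf u + ((lf u)\<^sup>2 + (pi / (2 * Lf u))\<^sup>2) * u / 2 = lf u * Lf u + (lf u)\<^sup>2 * u / 2 + (pi / (2 * Lf u))\<^sup>2 * u / 2"
        by (simp add: field_simps)
      also have "\<dots> \<le> \<kappa> * ?l + 1" unfolding 1 2 3 using elim(2) by (simp add: \<kappa>_def algebra_simps)
      finally have A: "lf u * Lf u + ((lf u)\<^sup>2 + (pi / (2 * Lf u))\<^sup>2) * u / 2 \<le> \<kappa> * ?l + 1" .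
      have "(lf u + pi / (2 * Lf u)) * sqrt u \<le> 1 * ?l" unfolding distrib_right 4 5 by (rule elim(3))
      moreover have "0 \<le> lf u" "0 < Lf u" using pos e by (auto simp: lf_def Lf_def)
      ultimately show ?case using A by blast
    qed
    from tube_io[OF kappa zero_less_one this] crude_bound
    show ?thesis
    proof eventually_elim
      case (elim x)
      have "filterlim (\<lambda>j. U (block (Suc j))) at_top sequentially"
        using U_block_top by (rule filterlim_compose[OF _ filterlim_Suc])
      note Utop = filterlim_iff[THEN iffD1, OF this, rule_format]
      \<comment> \<open>Twice the loss at the start of the block, relative to
        \<open>sqrt (2 * u * ln (ln u))\<close>: the value of \<open>W\<close> there gives
        \<open>2 * c * q\<close>, the drift missing before it \<open>q\<^sup>2\<close>.\<close>
      have e4: "\<forall>\<^sub>F j::nat in sequentially. 4 * ln (real j + 1) * (sqrt 2 / (real j + 1)\<^sup>2) + (sqrt 2 / (real j + 1)\<^sup>2)\<^sup>2 * 2 \<le> e / 2" using e by real_asymp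
      have "\<exists>\<^sub>F j in sequentially. (1 - 2 * e) * sqrt (2 * U (block (Suc j)) * ln (ln (U (block (Suc j))))) \<le> W (block (Suc j)) x"
      proof (rule frequently_rev_mp[OF frequently_eventually_frequently[OF elim(1)]])
        show "\<forall>\<^sub>F j in sequentially. tube b 0 (2 * ln (real j + 1) * sqrt (U (block j))) 0 (block j) x \<and> 0 \<le> ln (real j + 1) \<and>
          sqrt (U (block j)) \<le> sqrt 2 / (real j + 1)\<^sup>2 * sqrt (U (block (Suc j))) \<and>
          4 * ln (real j + 1) * (sqrt 2 / (real j + 1)\<^sup>2) + (sqrt 2 / (real j + 1)\<^sup>2)\<^sup>2 * 2 \<le> e / 2 \<and>
          1 \<le> ln (ln (U (block (Suc j)))) \<and> 0 < U (block (Suc j))"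
          using elim(2) sqrt_U_block_ratio e4
          by (intro eventually_conj Utop) (auto intro: always_eventually, real_asymp+)
        show "\<forall>\<^sub>F j in sequentially. tube b (lf (U (block (Suc j)))) (Lf (U (block (Suc j)))) (block j) (block (Suc j)) x \<and>
          (tube b 0 (2 * ln (real j + 1) * sqrt (U (block j))) 0 (block j) x \<and> 0 \<le> ln (real j + 1) \<and>
          sqrt (U (block j)) \<le> sqrt 2 / (real j + 1)\<^sup>2 * sqrt (U (block (Suc j))) \<and>
          4 * ln (real j + 1) * (sqrt 2 / (real j + 1)\<^sup>2) + (sqrt 2 / (real j + 1)\<^sup>2)\<^sup>2 * 2 \<le> e / 2 \<and>
          1 \<le> ln (ln (U (block (Suc j)))) \<and> 0 < U (block (Suc j))) \<longrightarrow>
          (1 - 2 * e) * sqrt (2 * U (block (Suc j)) * ln (ln (U (block (Suc j))))) \<le> W (block (Suc j)) x"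
        proof (intro always_eventually allI impI, elim conjE)
          fix j
          define u l q c where "u = U (block (Suc j))" and "l = ln (ln u)" and "q = sqrt 2 / (real j + 1)\<^sup>2" and "c = ln (real j + 1)"
          assume tu: "tube b (lf (U (block (Suc j)))) (Lf (U (block (Suc j)))) (block j) (block (Suc j)) x"
            and cr: "tube b 0 (2 * ln (real j + 1) * sqrt (U (block j))) 0 (block j) x"
            and "0 \<le> ln (real j + 1)" "sqrt (U (block j)) \<le> sqrt 2 / (real j + 1)\<^sup>2 * sqrt (U (block (Suc j)))"
             "4 * ln (real j + 1) * (sqrt 2 / (real j + 1)\<^sup>2) + (sqrt 2 / (real j + 1)\<^sup>2)\<^sup>2 * 2 \<le> e / 2"
             "1 \<le> ln (ln (U (block (Suc j))))" "0 < U (block (Suc j))"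
          then have c: "0 \<le> c" and q: "sqrt (U (block j)) \<le> q * sqrt u" and qe: "4 * c * q + q\<^sup>2 * 2 \<le> e / 2"
            and l: "1 \<le> l" and u: "0 < u" by (simp_all add: u_def l_def q_def c_def)
          have q0: "0 \<le> q" by (simp add: q_def)
          define R where "R = sqrt (2 * u * l)"
          have ru: "sqrt u \<le> R" unfolding R_def using l u mult_left_mono[of 1 l "2 * u"] by (intro real_sqrt_le_mono) auto
          have R0: "0 \<le> R" using ru u by (meson order_trans real_sqrt_ge_zero less_imp_le)
          have "\<bar>W (block j) x\<bar> \<le> 2 * c * sqrt (U (block j))"
            using tube_last[OF cr] by (simp add: c_def)
          also have "\<dots> \<le> 2 * c * (q * sqrt u)" using q c by (intro mult_left_mono) auto
          also have "\<dots> \<le> 2 * c * (q * R)" using ru c q0 by (intro mult_left_mono) auto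
          finally have Wj: "\<bar>W (block j) x\<bar> \<le> 2 * c * q * R" by simp
          have "U (block j) = (sqrt (U (block j)))\<^sup>2" using quad_nonneg[of b "block j"] by simp
          also have "\<dots> \<le> (q * sqrt u)\<^sup>2" using q by (intro power_mono) (auto simp: quad_nonneg)
          also have "\<dots> = q\<^sup>2 * u" using u by (simp add: power_mult_distrib)
          finally have Uj: "U (block j) \<le> q\<^sup>2 * u" .
          have lu: "lf u * u = (1 - e) * R"
          proof -
            have "sqrt (2 * l / u) * u = sqrt (2 * l / u) * (sqrt u * sqrt u)" using u by simp
            also have "\<dots> = R" using u l by (simp add: R_def real_sqrt_mult real_sqrt_divide real_div_sqrt flip: times_divide_eq_right)
            finally show ?thesis by (simp add: lf_def l_def)
          qed
          have lf0: "0 \<le> lf u" using e u l by (simp add: lf_def l_def)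
          have "lf u * U (block j) \<le> lf u * (q\<^sup>2 * u)" by (intro mult_left_mono Uj lf0)
          also have "\<dots> = q\<^sup>2 * ((1 - e) * R)" using lu by (simp add: mult_ac)
          also have "\<dots> \<le> q\<^sup>2 * (1 * R)" using e R0 by (intro mult_left_mono mult_right_mono) auto
          finally have lUj: "lf u * U (block j) \<le> q\<^sup>2 * R" by simp
          have "Lf u \<le> e / 4 * R" unfolding Lf_def R_def l_def[symmetric] using e u l
            by (intro mult_left_mono real_sqrt_le_mono) auto
          moreover have "W (block (Suc j)) x - W (block j) x - lf u * (u - U (block j)) \<ge> - Lf u"
            using tube_last[OF tu incseqD[OF block_mono]] by (simp add: u_def abs_le_iff)
          ultimately have "W (block (Suc j)) x \<ge> (1 - e) * R - q\<^sup>2 * R - e / 4 * R - 2 * c * q * R"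
            using Wj lUj lu by (simp add: right_diff_distrib)
          moreover have "(q\<^sup>2 + 2 * c * q) * R \<le> e / 4 * R" using qe R0 by (intro mult_right_mono) auto
          moreover have "0 \<le> e * R" using e R0 by simp
          ultimately have "W (block (Suc j)) x \<ge> (1 - 2 * e) * R" by (simp add: algebra_simps)
          then show "(1 - 2 * e) * sqrt (2 * U (block (Suc j)) * ln (ln (U (block (Suc j))))) \<le> W (block (Suc j)) x"
            by (simp add: R_def u_def l_def)
        qed
      qed
      moreover have "filterlim (\<lambda>j. block (Suc j)) sequentially sequentially"
        using block_top by (rule filterlim_compose[OF _ filterlim_Suc])
      ultimately show ?case
        by (rule frequently_compose[where f = "\<lambda>j. block (Suc j)"])
    qed
  qed
  \<comment> \<open>Countably many values of \<open>e\<close> suffice because the bound is monotone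
    in \<open>e\<close>.\<close>
  have "AE x in M. \<forall>i::nat. \<exists>\<^sub>F n in sequentially. (1 - 2 * (1 / (real i + 2))) * sqrt (2 * U n * ln (ln (U n))) \<le> W n x"
    unfolding AE_all_countable by (intro allI main) auto
  then show ?thesis
  proof eventually_elim
    case (elim x)
    show ?case
    proof (intro allI impI)
      fix e :: real assume "0 < e"
      then obtain i :: nat where i: "2 / e < real i" using reals_Archimedean2 by blast
      have "2 * (1 / (real i + 2)) \<le> e" using i \<open>0 < e\<close> by (simp add: field_simps)
      then have "(1 - e) * sqrt (2 * U n * ln (ln (U n))) \<le> (1 - 2 * (1 / (real i + 2))) * sqrt (2 * U n * ln (ln (U n)))"
        if "0 \<le> ln (ln (U n))" for n using that quad_nonneg[of b n] by (intro mult_right_mono) auto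
      moreover have "\<forall>\<^sub>F n in sequentially. 0 \<le> ln (ln (U n))"
        by (rule filterlim_iff[THEN iffD1, OF U_top, rule_format]) real_asymp
      ultimately have ev: "\<forall>\<^sub>F n in sequentially. (1 - e) * sqrt (2 * U n * ln (ln (U n))) \<le> (1 - 2 * (1 / (real i + 2))) * sqrt (2 * U n * ln (ln (U n)))"
        by (auto elim: eventually_mono)
      show "\<exists>\<^sub>F n in sequentially. (1 - e) * sqrt (2 * U n * ln (ln (U n))) \<le> W n x"
        by (rule frequently_rev_mp[OF elim[rule_format, of i] eventually_mono[OF ev]]) linarith
    qed
  qed
qed

end

text \<open>Used with \<open>q = sqrt 8\<close>, \<open>s = sqrt u\<close> and
  \<open>r = sqrt (ln (ln u))\<close>: for a radius of Chung's form the frequency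
  \<open>pi / (2 * L)\<close> is free of \<open>pi\<close>.\<close>

lemma cancel_pi:
  fixes d e s r q :: real
  assumes "0 < d" "0 < s" "0 < r" "0 < q"
  shows "pi / (2 * (d * (pi / q) * (s / r))) * s = q / (2 * d) * r"
    and "0 < e \<Longrightarrow> pi / (2 * e * (d * (pi / q) * (s / r))) = q / (2 * e * d) * (r / s)"
  using assms by (simp_all add: field_simps)

context mart_growth begin

lemma sqrt_8_less_pi: "sqrt 8 < pi"
proof -
  have "sqrt 8 < sqrt (3\<^sup>2)" by (subst real_sqrt_less_iff) simp
  then show ?thesis using pi_gt3 by simp
qed

text \<open>A tube without drift of radius \<open>Lf u\<close> costs
  \<open>pi\<^sup>2 * u / (8 * (Lf u)\<^sup>2)\<close>, which equals
  \<open>ln (ln u) / (1 + e)\<^sup>2\<close>. The tube is anchored at the start of its block; the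
  path before it fits into another \<open>e\<close>, so all \<open>W k\<close> from the origin on
  are bounded.\<close>

theorem Chung_upper:
  "AE x in M. \<forall>e>0. \<exists>\<^sub>F n in sequentially. \<forall>k\<le>n. \<bar>W k x\<bar> \<le> (1 + e) * (pi / sqrt 8) * sqrt (U n / ln (ln (U n)))"
proof -
  have main: "AE x in M. \<exists>\<^sub>F n in sequentially. \<forall>k\<le>n. \<bar>W k x\<bar> \<le> (1 + 2 * e) * (pi / sqrt 8) * sqrt (U n / ln (ln (U n)))" if e: "0 < e" for e :: real
  proof -
    define Lf where "Lf u = (1 + e) * (pi / sqrt 8) * sqrt (u / ln (ln u))" for u
    define \<kappa> where "\<kappa> = 1 / (1 + e)\<^sup>2"
    have kappa: "0 \<le> \<kappa>" "\<kappa> < 1"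
      using e by (auto simp: \<kappa>_def power2_eq_square less_1_mult)
    have e0: "\<forall>\<^sub>F u in at_top. 0 < ln (ln (u::real)) \<and> 0 < u" by (intro eventually_conj) real_asymp+
    have e2: "\<forall>\<^sub>F u in at_top. sqrt 8 / (2 * (1 + e)) * sqrt (ln (ln u)) \<le> 1 * ln (ln u)" using e by real_asymp
    have "\<forall>\<^sub>F u in at_top. 0 \<le> (0::real) \<and> 0 < Lf u
      \<and> 0 * Lf u + (0\<^sup>2 + (pi / (2 * Lf u))\<^sup>2) * u / 2 \<le> \<kappa> * ln (ln u) + 1
      \<and> (0 + pi / (2 * Lf u)) * sqrt u \<le> 1 * ln (ln u)"
      using e0 e2
    proof eventually_elim
      case (elim u)
      let ?l = "ln (ln u)"
      have pos: "0 < ?l" "0 < u" using elim by auto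
      have 3: "(pi / (2 * Lf u))\<^sup>2 * u / 2 = \<kappa> * ?l"
      proof -
        have L2: "(Lf u)\<^sup>2 = (1 + e)\<^sup>2 * (pi\<^sup>2 / 8) * (u / ?l)" using pos by (simp add: Lf_def power_mult_distrib power_divide)
        have "(pi / (2 * Lf u))\<^sup>2 * u / 2 = pi\<^sup>2 / (4 * (Lf u)\<^sup>2) * u / 2" by (simp add: power_mult_distrib power_divide)
        also have "\<dots> = \<kappa> * ?l" unfolding L2 \<kappa>_def using pos e by simp
        finally show ?thesis .
      qed
      have 5: "pi / (2 * Lf u) * sqrt u = sqrt 8 / (2 * (1 + e)) * sqrt ?l" unfolding Lf_def real_sqrt_divide using pos e by (intro cancel_pi) auto
      have "0 < Lf u" using pos e by (simp add: Lf_def)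
      then show ?case using 3 5 elim by simp
    qed
    from tube_io[where lf = "\<lambda>_. 0", OF kappa zero_less_one this] crude_bound
    show ?thesis
    proof eventually_elim
      case (elim x)
      have "filterlim (\<lambda>j. U (block (Suc j))) at_top sequentially"
        using U_block_top by (rule filterlim_compose[OF _ filterlim_Suc])
      note Utop = filterlim_iff[THEN iffD1, OF this, rule_format]
      \<comment> \<open>The crude bound before the block relative to
        \<open>sqrt (u / ln (ln u))\<close>, with \<open>ln (ln u)\<close> expressed in
        \<open>j\<close> through \<open>ln_U_block\<close>.\<close>
      have e4: "\<forall>\<^sub>F j::nat in sequentially. 2 * ln (real j + 1) * (sqrt 2 / (real j + 1)\<^sup>2) * sqrt (ln (ln 2 + 4 * (real j + 1) * ln (real j + 1))) \<le> e" using e by real_asymp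
      have "\<forall>\<^sub>F u in at_top. 1 \<le> ln (ln (u::real)) \<and> 0 < u \<and> 0 < ln u" by (intro eventually_conj) real_asymp+
      from Utop[OF this] have ev1: "\<forall>\<^sub>F j in sequentially. 1 \<le> ln (ln (U (block (Suc j)))) \<and> 0 < U (block (Suc j)) \<and> 0 < ln (U (block (Suc j)))" .
      have "\<exists>\<^sub>F j in sequentially. \<forall>k\<le>block (Suc j). \<bar>W k x\<bar> \<le> (1 + 2 * e) * (pi / sqrt 8) * sqrt (U (block (Suc j)) / ln (ln (U (block (Suc j)))))"
      proof (rule frequently_rev_mp[OF elim(1)])
        show "\<forall>\<^sub>F j in sequentially. tube b 0 (Lf (U (block (Suc j)))) (block j) (block (Suc j)) x \<longrightarrow>
          (\<forall>k\<le>block (Suc j). \<bar>W k x\<bar> \<le> (1 + 2 * e) * (pi / sqrt 8) * sqrt (U (block (Suc j)) / ln (ln (U (block (Suc j))))))"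
          using elim(2) sqrt_U_block_ratio e4 ln_U_block ev1
        proof eventually_elim
          case (elim j)
          define u l q c where "u = U (block (Suc j))" and "l = ln (ln u)" and "q = sqrt 2 / (real j + 1)\<^sup>2" and "c = ln (real j + 1)"
          have c: "0 \<le> c" and q: "sqrt (U (block j)) \<le> q * sqrt u"
            and l: "1 \<le> l" and u: "0 < u" "0 < ln u" using elim by (simp_all add: u_def l_def q_def c_def)
          have q0: "0 \<le> q" by (simp add: q_def)
          have "l \<le> ln (ln 2 + 4 * (real j + 1) * ln (real j + 1))" unfolding l_def using elim(4) u by (intro ln_mono) (auto simp: u_def)
          then have "sqrt l \<le> sqrt (ln (ln 2 + 4 * (real j + 1) * ln (real j + 1)))" by simp
          then have "2 * c * q * sqrt l \<le> 2 * c * q * sqrt (ln (ln 2 + 4 * (real j + 1) * ln (real j + 1)))"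
            using c q0 by (intro mult_left_mono) auto
          also have "\<dots> \<le> e" using elim(3) by (simp add: c_def q_def)
          finally have "2 * c * q * sqrt l \<le> e" .
          then have "2 * c * q \<le> e / sqrt l" using l by (simp add: pos_le_divide_eq)
          then have "2 * c * q * sqrt u \<le> e / sqrt l * sqrt u" using u by (intro mult_right_mono) auto
          also have "\<dots> = e * sqrt (u / l)" by (simp add: real_sqrt_divide)
          finally have cq: "2 * c * q * sqrt u \<le> e * sqrt (u / l)" .
          have Wj: "\<bar>W k x\<bar> \<le> e * sqrt (u / l)" if "k \<le> block j" for k
          proof -
            have "\<bar>W k x\<bar> \<le> 2 * c * sqrt (U (block j))" using elim(1) that by (simp add: tube_def c_def)
            also have "\<dots> \<le> 2 * c * (q * sqrt u)" using q c by (intro mult_left_mono) auto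
            finally show ?thesis using cq by simp
          qed
          have s0: "0 \<le> sqrt (u / l)" using u l by simp
          \<comment> \<open>As \<open>pi / sqrt 8\<close> exceeds 1, an error of \<open>e\<close>
            times the scale fits into the factor \<open>1 + 2 * e\<close>.\<close>
          have "e * 1 \<le> e * (pi / sqrt 8)" using e sqrt_8_less_pi by (intro mult_left_mono) auto
          then have "e * sqrt (u / l) \<le> e * (pi / sqrt 8) * sqrt (u / l)" using s0 by (intro mult_right_mono) auto
          then have ee: "e * sqrt (u / l) + Lf u \<le> (1 + 2 * e) * (pi / sqrt 8) * sqrt (u / l)"
          proof -
            have "(1 + 2 * e) * c * d = e * c * d + (1 + e) * c * d" for c d :: real by (simp add: algebra_simps)
            from this[of "pi / sqrt 8" "sqrt (u / l)"] show ?thesis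
              unfolding Lf_def l_def[symmetric] using \<open>e * sqrt (u / l) \<le> e * (pi / sqrt 8) * sqrt (u / l)\<close> by linarith
          qed
          show ?case
          proof (intro impI allI)
            fix k assume tu: "tube b 0 (Lf (U (block (Suc j)))) (block j) (block (Suc j)) x" and k: "k \<le> block (Suc j)"
            have L0: "0 \<le> Lf u" unfolding Lf_def l_def[symmetric] using s0 e by (intro mult_nonneg_nonneg) auto
            have "\<bar>W k x\<bar> \<le> e * sqrt (u / l) + Lf u"
            proof (cases "k \<le> block j")
              case True
              then show ?thesis using Wj[of k] L0 by simp
            next
              case False
              then have "\<bar>W k x - W (block j) x\<bar> \<le> Lf u" using tu k by (simp add: tube_def u_def)
              then show ?thesis using Wj[of "block j"] by simp
            qed
            also note ee
            finally show "\<bar>W k x\<bar> \<le> (1 + 2 * e) * (pi / sqrt 8) * sqrt (U (block (Suc j)) / ln (ln (U (block (Suc j)))))"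
              by (simp add: u_def l_def)
          qed
        qed
      qed
      moreover have "filterlim (\<lambda>j. block (Suc j)) sequentially sequentially"
        using block_top by (rule filterlim_compose[OF _ filterlim_Suc])
      ultimately show ?case
        by (rule frequently_compose[where f = "\<lambda>j. block (Suc j)"])
    qed
  qed
  have "AE x in M. \<forall>i::nat. \<exists>\<^sub>F n in sequentially. \<forall>k\<le>n. \<bar>W k x\<bar> \<le> (1 + 2 * (1 / (real i + 1))) * (pi / sqrt 8) * sqrt (U n / ln (ln (U n)))"
    unfolding AE_all_countable by (intro allI main) auto
  then show ?thesis
  proof eventually_elim
    case (elim x)
    show ?case
    proof (intro allI impI)
      fix e :: real assume "0 < e"
      then obtain i :: nat where i: "2 / e < real i" using reals_Archimedean2 by blast
      have ie: "2 * (1 / (real i + 1)) \<le> e" using i \<open>0 < e\<close> by (simp add: field_simps)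
      have "(1 + 2 * (1 / (real i + 1))) * (pi / sqrt 8) * sqrt (U n / ln (ln (U n))) \<le> (1 + e) * (pi / sqrt 8) * sqrt (U n / ln (ln (U n)))"
        if "0 \<le> ln (ln (U n))" for n using ie that quad_nonneg[of b n] by (intro mult_right_mono) auto
      moreover have "\<forall>\<^sub>F n in sequentially. 0 \<le> ln (ln (U n))"
        by (rule filterlim_iff[THEN iffD1, OF U_top, rule_format]) real_asymp
      ultimately have ev: "\<forall>\<^sub>F n in sequentially. (1 + 2 * (1 / (real i + 1))) * (pi / sqrt 8) * sqrt (U n / ln (ln (U n))) \<le> (1 + e) * (pi / sqrt 8) * sqrt (U n / ln (ln (U n)))"
        by (auto elim: eventually_mono)
      show "\<exists>\<^sub>F n in sequentially. \<forall>k\<le>n. \<bar>W k x\<bar> \<le> (1 + e) * (pi / sqrt 8) * sqrt (U n / ln (ln (U n)))"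
        by (rule frequently_rev_mp[OF elim[rule_format, of i] eventually_mono[OF ev]]) (meson order_trans)
    qed
  qed
qed

text \<open>The probability of staying in too narrow a tube from time 0 on is summable along a
  geometric sequence of clock values, because \<open>\<kappa> > 1\<close>. Between consecutive
  values of the sequence the required radius grows by no more than the factor
  \<open>1 / (1 - e)\<close>.\<close>

theorem Chung_lower:
  "AE x in M. \<forall>e>0. \<forall>\<^sub>F n in sequentially. \<exists>k\<le>n. (1 - e) * (pi / sqrt 8) * sqrt (U n / ln (ln (U n))) \<le> \<bar>W k x\<bar>"
proof -
  have main: "AE x in M. \<forall>\<^sub>F n in sequentially. \<exists>k\<le>n. (1 - 2 * e) * (pi / sqrt 8) * sqrt (U n / ln (ln (U n))) \<le> \<bar>W k x\<bar>" if e: "0 < e" "e < 1" for e :: real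
  proof -
    define Lf where "Lf u = (1 - e) * (pi / sqrt 8) * sqrt (u / ln (ln u))" for u
    \<comment> \<open>Smaller than \<open>pi / (2 * Lf u)\<close> by the factor
      \<open>1 + e\<close>, which leaves room for an exit jump of size
      \<open>e * Lf u\<close>.\<close>
    define tf where "tf u = pi / (2 * (1 + e) * Lf u)" for u
    define \<kappa> where "\<kappa> = 1 / ((1 - e) * (1 + e))\<^sup>2"
    \<comment> \<open>Chosen so that \<open>1 / sqrt q = 1 - e\<close>, the loss in the radius
      between consecutive levels.\<close>
    define q where "q = 1 / (1 - e)\<^sup>2"
    define n where "n j = level (q ^ j)" for j
    define u where "u j = U (n j)" for j
    define A where "A j = {x \<in> space M. tube b 0 (Lf (u j)) 0 (n j) x}" for j
    have sq: "(1 - e)\<^sup>2 < 1" "0 < (1 - e)\<^sup>2" using e mult_strict_mono[of "1 - e" 1 "1 - e" 1] by (auto simp: power2_eq_square)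
    then have q: "1 < q" by (simp add: q_def)
    have kappa: "1 < \<kappa>"
    proof -
      have "(1 - e) * (1 + e) = 1 - e * e" by (simp add: algebra_simps)
      moreover have "0 < e * e" "e * e < 1 * 1" using e mult_strict_mono[of e 1 e 1] by auto
      ultimately have p: "0 < (1 - e) * (1 + e)" "(1 - e) * (1 + e) < 1" by auto
      then have "((1 - e) * (1 + e))\<^sup>2 < 1" unfolding power2_eq_square
        using mult_strict_mono[of "(1 - e) * (1 + e)" 1 "(1 - e) * (1 + e)" 1] by simp
      then show ?thesis using p unfolding \<kappa>_def by (subst less_divide_eq_1_pos) auto
    qed
    have cos0: "0 < cos (pi / (2 * (1 + e)))"
      using e by (intro cos_gt_zero) (auto simp: field_simps)
    define K where "K = 2 / cos (pi / (2 * (1 + e)))"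
    have e0: "\<forall>\<^sub>F u in at_top. 0 < ln (ln (u::real)) \<and> 0 < u \<and> 0 < ln u" by (intro eventually_conj) real_asymp+
    have e1: "\<forall>\<^sub>F u in at_top. 40 * (sqrt 8 / (2 * (1 + e) * (1 - e)) * sqrt (ln (ln u) / u)) ^ 3 * (C * u powr \<gamma>) * u \<le> ln u powr (- \<kappa>)"
      using e C_pos gamma kappa by real_asymp
    have e2: "\<forall>\<^sub>F u in at_top. sqrt 8 / (2 * (1 + e) * (1 - e)) * sqrt (ln (ln u) / u) * (C * u powr \<gamma>) \<le> 1/4"
      using e C_pos gamma by real_asymp
    have e3: "\<forall>\<^sub>F u in at_top. 3/2 * (C * u powr \<gamma>) \<le> e * ((1 - e) * (pi / sqrt 8) * sqrt (u / ln (ln u)))"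
      using e C_pos gamma by real_asymp
    have qtop: "filterlim (\<lambda>j. q ^ j) at_top sequentially"
      using q by real_asymp
    have ntop: "filterlim n at_top sequentially"
      unfolding n_def by (rule filterlim_compose[OF level_top qtop])
    have "filterlim u at_top sequentially"
      unfolding u_def by (rule filterlim_compose[OF U_top ntop])
    note utop = filterlim_iff[THEN iffD1, OF this, rule_format]
    have uq: "q ^ j \<le> u j" for j unfolding u_def n_def by (rule U_level)
    have Am: "A j \<in> sets M" for j
      unfolding A_def using tube_pred by measurable
    have "\<forall>\<^sub>F j in sequentially. norm (prob (A j)) \<le> K * ln q powr (- \<kappa>) * real j powr (- \<kappa>)"
      using utop[OF e0] utop[OF e1] utop[OF e2] utop[OF e3] eventually_gt_at_top[of 0]
        filterlim_iff[THEN iffD1, OF ntop, rule_format, OF b_small]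
    proof eventually_elim
      case (elim j)
      let ?l = "ln (ln (u j))" and ?L = "Lf (u j)" and ?t = "tf (u j)"
      have pos: "0 < ?l" "0 < u j" "0 < ln (u j)" using elim by auto
      have L: "0 < ?L" using pos e by (simp add: Lf_def)
      have t: "0 < ?t" using L e by (simp add: tf_def)
      have teq: "?t = sqrt 8 / (2 * (1 + e) * (1 - e)) * sqrt (?l / u j)"
        unfolding tf_def Lf_def real_sqrt_divide using pos e by (intro cancel_pi) auto
      have tL: "?t * ?L = pi / (2 * (1 + e))" using L by (simp add: tf_def)
      have bk: "\<bar>b k\<bar> \<le> C * u j powr \<gamma>" if "k \<in> {1..n j}" for k
        using elim(6) that by (simp add: u_def)
      have small: "?t * \<bar>b k\<bar> \<le> 1/4" if "k \<in> {0<..n j}" for k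
      proof -
        have "?t * \<bar>b k\<bar> \<le> ?t * (C * u j powr \<gamma>)" using bk[of k] that t by (intro mult_left_mono) auto
        also have "\<dots> \<le> 1/4" using elim(3) by (simp add: teq)
        finally show ?thesis .
      qed
      have jump: "?t * (?L + 3/2 * \<bar>b k\<bar>) \<le> pi / 2" if "k \<in> {0<..n j}" for k
      proof -
        have "3/2 * \<bar>b k\<bar> \<le> 3/2 * (C * u j powr \<gamma>)" using bk[of k] that by simp
        also have "\<dots> \<le> e * ?L" using elim(4) by (simp add: Lf_def)
        finally have "?t * (?L + 3/2 * \<bar>b k\<bar>) \<le> ?t * (?L + e * ?L)" using t by (intro mult_left_mono) auto
        also have "\<dots> = (?t * ?L) * (1 + e)" by (simp add: algebra_simps)
        also have "\<dots> = pi / 2" unfolding tL using e by (simp add: field_simps)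
        finally show ?thesis .
      qed
      have tL2: "?t * ?L \<le> pi / 2" unfolding tL using e by (simp add: field_simps)
      have t2: "?t\<^sup>2 * (u j - 0) / 2 = \<kappa> * ?l"
      proof -
        have "(sqrt 8 / (2 * d * d')) \<^sup>2 = 2 * (1 / (d' * d)\<^sup>2)" for d d' :: real
          by (simp add: power_mult_distrib power_divide)
        note * = this[of "1 + e" "1 - e"]
        have "?t\<^sup>2 = 2 * (1 / ((1 - e) * (1 + e))\<^sup>2) * (sqrt (?l / u j))\<^sup>2"
          unfolding teq power_mult_distrib[of _ "sqrt _"] * ..
        then have "?t\<^sup>2 = 2 * \<kappa> * (?l / u j)" unfolding \<kappa>_def using pos by simp
        then show ?thesis using pos by simp
      qed
      have "cos (?t * ?L) * (\<integral>x. (1::real) * of_bool (tube b 0 ?L 0 (n j) x) \<partial>M) \<le>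
        (exp (- (?t\<^sup>2 * (U (n j) - U 0) / 2)) + (\<Sum>k\<in>{0<..n j}. 30 * (?t * \<bar>b k\<bar>) ^ 3)) * (\<integral>x. 1 \<partial>M)"
        by (intro tube_upper past_const small jump tL2) (use L t in auto)
      also have "(\<integral>x. (1::real) * of_bool (tube b 0 ?L 0 (n j) x) \<partial>M) = (\<integral>x. (indicator (A j) x :: real) \<partial>M)"
        by (intro Bochner_Integration.integral_cong) (auto simp: A_def indicator_def)
      also have "\<dots> = prob (A j)" using Am by simp
      also have "(\<Sum>k\<in>{0<..n j}. 30 * (?t * \<bar>b k\<bar>) ^ 3) \<le> 40 * ?t ^ 3 * (C * u j powr \<gamma>) * U (n j)"
        using t C_pos bk by (intro cube_sum_le) auto
      also have "\<dots> \<le> ln (u j) powr (- \<kappa>)" using elim(2) unfolding teq by (simp add: u_def)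
      also have "exp (- (?t\<^sup>2 * (U (n j) - U 0) / 2)) = ln (u j) powr (- \<kappa>)"
        using t2 pos by (simp add: u_def powr_def)
      finally have "cos (?t * ?L) * prob (A j) \<le> 2 * ln (u j) powr (- \<kappa>)"
        by (simp add: prob_space)
      then have "prob (A j) \<le> K * ln (u j) powr (- \<kappa>)"
        unfolding tL K_def using cos0 by (simp add: field_simps)
      also have "\<dots> \<le> K * (real j * ln q) powr (- \<kappa>)"
      proof (intro mult_left_mono powr_mono2')
        have "ln (q ^ j) \<le> ln (u j)" using uq[of j] q by (intro ln_mono) auto
        then show "real j * ln q \<le> ln (u j)" using q by (simp add: ln_realpow)
      qed (use kappa cos0 q elim(5) in \<open>auto simp: K_def\<close>)
      also have "\<dots> = K * ln q powr (- \<kappa>) * real j powr (- \<kappa>)" using q by (simp add: powr_mult)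
      finally show ?case by simp
    qed
    moreover have "summable (\<lambda>j. K * ln q powr (- \<kappa>) * real j powr (- \<kappa>))"
      using kappa by (intro summable_mult) (simp add: summable_real_powr_iff)
    ultimately have "summable (\<lambda>j. prob (A j))" by (rule summable_comparison_test_ev)
    then have "AE x in M. \<forall>\<^sub>F j in sequentially. x \<in> space M - A j"
      by (intro borel_cantelli_AE1 Am) (auto simp: emeasure_eq_measure)
    then show ?thesis
    proof eventually_elim
      case (elim x)
      from eventually_conj[OF elim utop[OF e0]]
      obtain J where J: "\<And>j. J \<le> j \<Longrightarrow> x \<in> space M - A j \<and> 0 < ln (ln (u j)) \<and> 0 < u j \<and> 0 < ln (u j)"
        unfolding eventually_sequentially by blast
      have "\<forall>\<^sub>F m in sequentially. q ^ J \<le> U m" using U_top unfolding filterlim_at_top by blast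
      then show ?case
      proof eventually_elim
        case (elim m)
        \<comment> \<open>The last power of \<open>q\<close> that does not exceed
          \<open>U m\<close>.\<close>
        obtain j where j: "J \<le> j" "q ^ j \<le> U m" "U m < q ^ Suc j"
        proof -
          obtain i where i: "U m < q ^ i" using real_arch_pow[OF q] by blast
          define i0 where "i0 = (LEAST i. U m < q ^ i)"
          have i0: "U m < q ^ i0" unfolding i0_def using i by (rule LeastI)
          have "J < i0"
          proof (rule ccontr)
            assume "\<not> J < i0"
            then have "q ^ i0 \<le> q ^ J" using q by (intro power_increasing) auto
            then show False using i0 elim by simp
          qed
          then obtain j where ij: "i0 = Suc j" "J \<le> j" by (metis less_imp_Suc_add le_add1)
          have "\<not> U m < q ^ j" using not_less_Least[of j "\<lambda>i. U m < q ^ i"] ij by (simp add: i0_def)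
          then show thesis using that ij i0 by simp
        qed
        have nm: "n j \<le> m"
        proof (rule ccontr)
          assume "\<not> n j \<le> m"
          then have "U m < q ^ j" by (intro U_less_level) (simp add: n_def)
          then show False using j by simp
        qed
        then have um: "u j \<le> U m" unfolding u_def by (rule quad_mono)
        have J': "x \<in> space M" "x \<notin> A j" "0 < ln (ln (u j))" "0 < u j" "0 < ln (u j)" using J[OF j(1)] by auto
        then obtain k where k: "k \<le> n j" "Lf (u j) < \<bar>W k x\<bar>"
          by (force simp: A_def tube_def)
        have "U m * (1 - e)\<^sup>2 \<le> u j"
        proof -
          have "U m < q * u j" using j(3) uq[of j] q by (simp add: order_less_le_trans)
          then show ?thesis using e by (simp add: q_def field_simps)
        qed
        moreover have "ln (ln (u j)) \<le> ln (ln (U m))" using um J' by (intro ln_mono) auto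
        ultimately have "U m * (1 - e)\<^sup>2 / ln (ln (U m)) \<le> u j / ln (ln (u j))"
          using J' by (intro frac_le) auto
        then have "sqrt ((1 - e)\<^sup>2 * (U m / ln (ln (U m)))) \<le> sqrt (u j / ln (ln (u j)))" by (simp add: mult.commute)
        then have s: "(1 - e) * sqrt (U m / ln (ln (U m))) \<le> sqrt (u j / ln (ln (u j)))" unfolding real_sqrt_mult using e by simp
        \<comment> \<open>The two losses multiply to \<open>(1 - e)\<^sup>2\<close>, which is at
          least \<open>1 - 2 * e\<close>.\<close>
        have "(1 - 2 * e) * (pi / sqrt 8) * sqrt (U m / ln (ln (U m))) \<le> (1 - e) * (pi / sqrt 8) * ((1 - e) * sqrt (U m / ln (ln (U m))))"
        proof -
          have "0 < ln (ln (U m))" using \<open>ln (ln (u j)) \<le> ln (ln (U m))\<close> J' by linarith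
          then have "0 \<le> (pi / sqrt 8) * sqrt (U m / ln (ln (U m)))" using quad_nonneg[of b m] by simp
          then have "(1 - 2 * e) * ((pi / sqrt 8) * sqrt (U m / ln (ln (U m)))) \<le> ((1 - e) * (1 - e)) * ((pi / sqrt 8) * sqrt (U m / ln (ln (U m))))"
            by (intro mult_right_mono) (auto simp: algebra_simps)
          then show ?thesis by (simp add: mult_ac)
        qed
        also have "\<dots> \<le> Lf (u j)" unfolding Lf_def using s e by (intro mult_left_mono) auto
        finally have "(1 - 2 * e) * (pi / sqrt 8) * sqrt (U m / ln (ln (U m))) \<le> \<bar>W k x\<bar>" using k by simp
        then show ?case using k nm by (meson order_trans)
      qed
    qed
  qed
  have "AE x in M. \<forall>i::nat. \<forall>\<^sub>F n in sequentially. \<exists>k\<le>n. (1 - 2 * (1 / (real i + 2))) * (pi / sqrt 8) * sqrt (U n / ln (ln (U n))) \<le> \<bar>W k x\<bar>"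
    unfolding AE_all_countable by (intro allI main) auto
  then show ?thesis
  proof eventually_elim
    case (elim x)
    show ?case
    proof (intro allI impI)
      fix e :: real assume "0 < e"
      then obtain i :: nat where i: "2 / e < real i" using reals_Archimedean2 by blast
      have ie: "2 * (1 / (real i + 2)) \<le> e" using i \<open>0 < e\<close> by (simp add: field_simps)
      have "\<forall>\<^sub>F n in sequentially. 0 \<le> ln (ln (U n))"
        by (rule filterlim_iff[THEN iffD1, OF U_top, rule_format]) real_asymp
      with elim[rule_format, of i] show "\<forall>\<^sub>F n in sequentially. \<exists>k\<le>n. (1 - e) * (pi / sqrt 8) * sqrt (U n / ln (ln (U n))) \<le> \<bar>W k x\<bar>"
      proof eventually_elim
        case (elim n)
        have "(1 - e) * (pi / sqrt 8) * sqrt (U n / ln (ln (U n))) \<le> (1 - 2 * (1 / (real i + 2))) * (pi / sqrt 8) * sqrt (U n / ln (ln (U n)))"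
          using ie elim(2) quad_nonneg[of b n] by (intro mult_right_mono) auto
        then show ?case using elim(1) by (meson order_trans)
      qed
    qed
  qed
qed

end

section \<open>Central limit theorem conditional on the past\<close>

lemma weak_conv_Lipschitz_uniform:
  fixes \<mu> :: "nat \<Rightarrow> real measure" and h :: "nat \<Rightarrow> real \<Rightarrow> real"
  assumes \<mu>: "\<And>n. real_distribution (\<mu> n)" and N: "real_distribution N" and w: "weak_conv_m \<mu> N"
    and lip: "\<And>n x y. \<bar>h n x - h n y\<bar> \<le> K * \<bar>x - y\<bar>" and bdd: "\<And>n x. \<bar>h n x\<bar> \<le> B"
  shows "(\<lambda>n. (\<integral>x. h n x \<partial>\<mu> n) - (\<integral>x. h n x \<partial>N)) \<longlonglongrightarrow> 0"
proof -
  obtain \<Omega> :: "real measure" and Yn :: "nat \<Rightarrow> real \<Rightarrow> real" and Y where "prob_space \<Omega>"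
    and Yn [measurable]: "\<And>n. Yn n \<in> borel_measurable \<Omega>" and dn: "\<And>n. distr \<Omega> borel (Yn n) = \<mu> n"
    and Y' : "Y \<in> measurable \<Omega> lborel" and d: "distr \<Omega> borel Y = N"
    and conv: "\<And>x. x \<in> space \<Omega> \<Longrightarrow> (\<lambda>n. Yn n x) \<longlonglongrightarrow> Y x"
    using Skorohod[OF \<mu> N w] by blast
  interpret \<Omega>: prob_space \<Omega> by fact
  have Y [measurable]: "Y \<in> borel_measurable \<Omega>" using Y' by simp
  have cont: "continuous_on UNIV (h n)" for n
  proof (rule continuous_onI)
    fix x e :: real assume "e > 0"
    then show "\<exists>d>0. \<forall>y\<in>UNIV. dist y x < d \<longrightarrow> dist (h n y) (h n x) \<le> e"
    proof (intro exI[of _ "e / (\<bar>K\<bar> + 1)"] conjI ballI impI)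
      fix y assume y: "dist y x < e / (\<bar>K\<bar> + 1)"
      have "dist (h n y) (h n x) \<le> K * \<bar>y - x\<bar>" using lip by (simp add: dist_real_def)
      also have "\<dots> \<le> (\<bar>K\<bar> + 1) * \<bar>y - x\<bar>" by (intro mult_right_mono) auto
      also have "\<dots> \<le> e" using y by (simp add: dist_real_def pos_less_divide_eq mult.commute)
      finally show "dist (h n y) (h n x) \<le> e" .
    qed auto
  qed
  have [measurable]: "h n \<in> borel_measurable borel" for n
    by (rule borel_measurable_continuous_onI[OF cont])
  have int: "integrable \<Omega> (\<lambda>x. h n (X x))" if [measurable]: "X \<in> borel_measurable \<Omega>" for n X
    using bdd by (intro \<Omega>.integrable_const_bound[of _ B]) auto
  \<comment> \<open>The test functions \<open>h n\<close> may vary without converging; on Skorohod's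
    common probability space their common Lipschitz constant makes the differences vanish
    pointwise.\<close>
  have "(\<lambda>n. \<integral>x. h n (Yn n x) - h n (Y x) \<partial>\<Omega>) \<longlonglongrightarrow> (\<integral>x. 0 \<partial>\<Omega>)"
  proof (rule integral_dominated_convergence[where w = "\<lambda>_. 2 * B"])
    show "AE x in \<Omega>. (\<lambda>n. h n (Yn n x) - h n (Y x)) \<longlonglongrightarrow> 0"
    proof (rule AE_I2)
      fix x assume "x \<in> space \<Omega>"
      then have "(\<lambda>n. Yn n x - Y x) \<longlonglongrightarrow> 0" using conv LIM_zero by blast
      then have "(\<lambda>n. K * \<bar>Yn n x - Y x\<bar>) \<longlonglongrightarrow> 0" by (intro tendsto_mult_right_zero tendsto_rabs_zero)
      then show "(\<lambda>n. h n (Yn n x) - h n (Y x)) \<longlonglongrightarrow> 0"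
        by (rule Lim_null_comparison[rotated]) (use lip in auto)
    qed
    show "AE x in \<Omega>. norm (h n (Yn n x) - h n (Y x)) \<le> 2 * B" for n
      by (intro AE_I2 order_trans[OF norm_triangle_ineq4]) (use add_mono[OF bdd bdd] in simp)
  qed auto
  moreover have "(\<integral>x. h n (Yn n x) - h n (Y x) \<partial>\<Omega>) = (\<integral>x. h n x \<partial>\<mu> n) - (\<integral>x. h n x \<partial>N)" for n
  proof -
    have "(\<integral>x. h n x \<partial>\<mu> n) = (\<integral>x. h n (Yn n x) \<partial>\<Omega>)" unfolding dn[symmetric] by (rule integral_distr) auto
    moreover have "(\<integral>x. h n x \<partial>N) = (\<integral>x. h n (Y x) \<partial>\<Omega>)" unfolding d[symmetric] by (rule integral_distr) auto
    ultimately show ?thesis by (simp add: Bochner_Integration.integral_diff[OF int[OF Yn] int[OF Y]])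
  qed
  ultimately show ?thesis by simp
qed

context mart_growth begin

text \<open>The scale is \<open>U (N i)\<close> with \<open>N i\<close> beyond the block, so that
  increments over several blocks of one path share their normalisation. The error is a multiple of
  \<open>U (N i) powr (\<gamma> - 1/2)\<close>, whatever the events \<open>A i\<close> are.\<close>

lemma char_limit:
  assumes idx: "\<And>i. mi i \<le> ni i" "\<And>i. ni i \<le> N i" and N: "filterlim N at_top sequentially"
    and v: "(\<lambda>i. (U (ni i) - U (mi i)) / U (N i)) \<longlonglongrightarrow> v"
    and A: "\<And>i. past s (mi i) (A i)" and p: "\<And>i. 0 < (\<integral>x. (of_bool (A i x) :: real) \<partial>M)"
  shows "(\<lambda>i. (\<integral>x. of_bool (A i x) * iexp (t * ((W (ni i) x - W (mi i) x) / sqrt (U (N i)))) \<partial>M)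
       / complex_of_real (\<integral>x. of_bool (A i x) \<partial>M)) \<longlonglongrightarrow> exp (- of_real (t\<^sup>2 * v / 2))"
proof -
  define P where "P i = (\<integral>x. (of_bool (A i x) :: real) \<partial>M)" for i
  define F where "F i = (\<integral>x. of_bool (A i x) * iexp (t * ((W (ni i) x - W (mi i) x) / sqrt (U (N i)))) \<partial>M)" for i
  have "filterlim (\<lambda>i. U (N i)) at_top sequentially" by (rule filterlim_compose[OF U_top N])
  note Utop = filterlim_iff[THEN iffD1, OF this, rule_format]
  have "((\<lambda>u. 1 / sqrt u * u powr \<gamma>) \<longlongrightarrow> 0) at_top" using gamma by real_asymp
  then have "((\<lambda>u. \<bar>t\<bar> * C * (1 / sqrt u * u powr \<gamma>)) \<longlongrightarrow> 0) at_top" by (rule tendsto_mult_right_zero)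
  then have "\<forall>\<^sub>F u in at_top. \<bar>t\<bar> * C * (1 / sqrt u * u powr \<gamma>) < 1/4" by (rule order_tendstoD) simp
  then have e1: "\<forall>\<^sub>F u in at_top. \<bar>t\<bar> / sqrt u * (C * u powr \<gamma>) \<le> 1/4" by eventually_elim (simp add: mult_ac)
  have e0: "\<forall>\<^sub>F u::real in at_top. 0 < u" by real_asymp
  have "((\<lambda>u. (1 / sqrt u) ^ 3 * u powr \<gamma> * u) \<longlongrightarrow> 0) at_top" using gamma by real_asymp
  then have "((\<lambda>u. 40 * \<bar>t\<bar> ^ 3 * C * ((1 / sqrt u) ^ 3 * u powr \<gamma> * u)) \<longlongrightarrow> 0) at_top" by (rule tendsto_mult_right_zero)
  then have "((\<lambda>u. 40 * (\<bar>t\<bar> / sqrt u) ^ 3 * (C * u powr \<gamma>) * u) \<longlongrightarrow> 0) at_top" by (simp add: power_divide mult_ac)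
  then have lim: "(\<lambda>i. 40 * (\<bar>t\<bar> / sqrt (U (N i))) ^ 3 * (C * U (N i) powr \<gamma>) * U (N i)) \<longlonglongrightarrow> 0"
    by (rule filterlim_compose[OF _ \<open>filterlim (\<lambda>i. U (N i)) at_top sequentially\<close>])
  have "\<forall>\<^sub>F i in sequentially. norm (F i / of_real (P i) - exp (- of_real (t\<^sup>2 * ((U (ni i) - U (mi i)) / U (N i)) / 2)))
     \<le> 40 * (\<bar>t\<bar> / sqrt (U (N i))) ^ 3 * (C * U (N i) powr \<gamma>) * U (N i)"
    using Utop[OF e1] Utop[OF e0] filterlim_iff[THEN iffD1, OF N, rule_format, OF b_small]
  proof eventually_elim
    case (elim i)
    define u where "u = U (N i)"
    define q where "q = t / sqrt u"
    have u: "0 < u" using elim by (simp add: u_def)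
    have aq: "\<bar>q\<bar> = \<bar>t\<bar> / sqrt u" using u by (simp add: q_def abs_divide)
    have bk: "\<bar>b k\<bar> \<le> C * u powr \<gamma>" if "k \<in> {1..N i}" for k using elim(3) that by (simp add: u_def)
    have small: "\<bar>q\<bar> * \<bar>b k\<bar> \<le> 1/4" if "k \<in> {mi i<..ni i}" for k
    proof -
      have "\<bar>q\<bar> * \<bar>b k\<bar> \<le> \<bar>q\<bar> * (C * u powr \<gamma>)" using that idx(2)[of i] by (intro mult_left_mono bk) auto
      also have "\<dots> \<le> 1/4" using elim(1) by (simp add: aq u_def)
      finally show ?thesis .
    qed
    have "norm ((\<integral>x. of_bool (A i x) * exp (\<i> * of_real (q * (W (ni i) x - W (mi i) x))) \<partial>M)
      - exp (- of_real (q\<^sup>2 * (U (ni i) - U (mi i)) / 2)) * (\<integral>x. of_bool (A i x) \<partial>M))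
    \<le> (\<Sum>k\<in>{mi i<..ni i}. 30 * (\<bar>q\<bar> * \<bar>b k\<bar>) ^ 3) * (\<integral>x. of_bool (A i x) \<partial>M)"
      using small by (intro mart_char idx past_comp[OF A]) auto
    also have "\<dots> \<le> (40 * \<bar>q\<bar> ^ 3 * (C * u powr \<gamma>) * u) * (\<integral>x. of_bool (A i x) \<partial>M)"
    proof (rule mult_right_mono)
      have "(\<Sum>k\<in>{mi i<..ni i}. 30 * (\<bar>q\<bar> * \<bar>b k\<bar>) ^ 3) \<le> 40 * \<bar>q\<bar> ^ 3 * (C * u powr \<gamma>) * U (ni i)"
        using idx(2)[of i] C_pos by (intro cube_sum_le bk) auto
      also have "\<dots> \<le> 40 * \<bar>q\<bar> ^ 3 * (C * u powr \<gamma>) * u"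
        using quad_mono[OF idx(2)[of i], of b] C_pos by (intro mult_left_mono) (auto simp: u_def)
      finally show "(\<Sum>k\<in>{mi i<..ni i}. 30 * (\<bar>q\<bar> * \<bar>b k\<bar>) ^ 3) \<le> 40 * \<bar>q\<bar> ^ 3 * (C * u powr \<gamma>) * u" .
    qed simp
    finally have *: "norm ((\<integral>x. of_bool (A i x) * exp (\<i> * of_real (q * (W (ni i) x - W (mi i) x))) \<partial>M)
      - exp (- of_real (q\<^sup>2 * (U (ni i) - U (mi i)) / 2)) * (\<integral>x. of_bool (A i x) \<partial>M))
      \<le> (40 * \<bar>q\<bar> ^ 3 * (C * u powr \<gamma>) * u) * P i" unfolding P_def .
    have eq1: "(\<integral>x. of_bool (A i x) * exp (\<i> * of_real (q * (W (ni i) x - W (mi i) x))) \<partial>M) = F i"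
      by (simp add: F_def q_def u_def)
    have eq2: "(\<integral>x. of_bool (A i x) \<partial>M) = complex_of_real (P i)"
      unfolding P_def integral_complex_of_real[symmetric]
      by (rule Bochner_Integration.integral_cong) (auto simp: of_bool_def)
    have eq3: "q\<^sup>2 * (U (ni i) - U (mi i)) / 2 = t\<^sup>2 * ((U (ni i) - U (mi i)) / U (N i)) / 2"
      using u by (simp add: q_def power_divide u_def)
    note * = *[unfolded eq1 eq2 eq3]
    have Pi: "0 < P i" using p by (simp add: P_def)
    define E where "E = exp (- complex_of_real (t\<^sup>2 * ((U (ni i) - U (mi i)) / U (N i)) / 2))"
    have quot: "F i / of_real (P i) - E = (F i - E * of_real (P i)) / of_real (P i)"
      using Pi by (simp add: diff_divide_distrib)
    have "norm (F i / of_real (P i) - E) \<le> 40 * \<bar>q\<bar> ^ 3 * (C * u powr \<gamma>) * u"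
      unfolding quot norm_divide using *[folded E_def] Pi by (simp add: pos_divide_le_eq)
    then show ?case by (simp add: aq u_def E_def)
  qed
  then have "(\<lambda>i. F i / of_real (P i) - exp (- of_real (t\<^sup>2 * ((U (ni i) - U (mi i)) / U (N i)) / 2))) \<longlonglongrightarrow> 0"
    by (rule Lim_null_comparison[OF _ lim])
  then have "(\<lambda>i. F i / of_real (P i) - exp (- of_real (t\<^sup>2 * ((U (ni i) - U (mi i)) / U (N i)) / 2)) + exp (- of_real (t\<^sup>2 * ((U (ni i) - U (mi i)) / U (N i)) / 2))) \<longlonglongrightarrow> 0 + exp (- of_real (t\<^sup>2 * v / 2))"
  proof (rule tendsto_add)
    show "(\<lambda>i. exp (- complex_of_real (t\<^sup>2 * ((U (ni i) - U (mi i)) / U (N i)) / 2))) \<longlonglongrightarrow> exp (- of_real (t\<^sup>2 * v / 2))"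
      by (intro tendsto_intros v) auto
  qed
  then have "(\<lambda>i. F i / of_real (P i)) \<longlonglongrightarrow> exp (- of_real (t\<^sup>2 * v / 2))"
    by simp
  then show ?thesis by (simp only: F_def P_def)
qed

text \<open>Uniformity over all past events and all test functions of one Lipschitz class comes from
  a selection argument: at each \<open>i\<close> a violating pair is chosen if there is one. The
  conditional laws given the chosen events still converge to a normal law, so by
  \<open>weak_conv_Lipschitz_uniform\<close> the chosen pairs cannot violate the bound for large
  \<open>i\<close>.\<close>

lemma conditional_CLT:
  assumes idx: "\<And>i. mi i \<le> ni i" "\<And>i. ni i \<le> N i" and N: "filterlim N at_top sequentially"
    and v: "(\<lambda>i. (U (ni i) - U (mi i)) / U (N i)) \<longlonglongrightarrow> v" "0 < v" and e: "0 < e"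
  shows "\<forall>\<^sub>F i in sequentially. \<forall>A h. past s (mi i) A \<longrightarrow> (\<forall>x y. \<bar>h x - h y\<bar> \<le> K * \<bar>x - y\<bar>) \<longrightarrow> (\<forall>x. \<bar>h x\<bar> \<le> B) \<longrightarrow>
    \<bar>(\<integral>x. of_bool (A x) * h ((W (ni i) x - W (mi i) x) / sqrt (U (N i))) \<partial>M)
      - (\<integral>x. of_bool (A x) \<partial>M) * (\<integral>z. h (sqrt v * z) \<partial>std_normal_distribution)\<bar> \<le> e * (\<integral>x. of_bool (A x) \<partial>M)"
proof (cases "0 \<le> B")
  case False
  have F: "\<not> (\<forall>x. \<bar>h x\<bar> \<le> B)" for h :: "real \<Rightarrow> real"
    using False abs_ge_zero[of "h 0"] order_trans by blast
  show ?thesis by (simp only: F simp_thms eventually_True)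
next
  case B: True
  define K' where "K' = max K 0"
  define bad where "bad i A h \<longleftrightarrow> past s (mi i) A \<and> (\<forall>x y. \<bar>h x - h y\<bar> \<le> K' * \<bar>x - y\<bar>) \<and> (\<forall>x. \<bar>h x\<bar> \<le> B) \<and>
    \<bar>(\<integral>x. of_bool (A x) * h ((W (ni i) x - W (mi i) x) / sqrt (U (N i))) \<partial>M)
      - (\<integral>x. of_bool (A x) \<partial>M) * (\<integral>z. h (sqrt v * z) \<partial>std_normal_distribution)\<bar> > e * (\<integral>x. of_bool (A x) \<partial>M)" for i A and h :: "real \<Rightarrow> real"
  \<comment> \<open>Both sides of the bound vanish for null events, so a violating event has
    positive probability and can be conditioned on.\<close>
  have bad_pos: "0 < (\<integral>x. (of_bool (A x) :: real) \<partial>M)" if "bad i A h" for i A h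
  proof (rule ccontr)
    have pA: "past s (mi i) (\<lambda>x. of_bool (A x) :: real)" by (rule past_comp[where G = A]) (use that in \<open>simp add: bad_def\<close>)
    assume "\<not> 0 < (\<integral>x. (of_bool (A x) :: real) \<partial>M)"
    moreover have "0 \<le> (\<integral>x. (of_bool (A x) :: real) \<partial>M)" by simp
    ultimately have 0: "(\<integral>x. of_bool (A x) \<partial>M) = (0::real)" by linarith
    then have "AE x in M. of_bool (A x) = (0::real)"
      by (subst (asm) integral_nonneg_eq_0_iff_AE) (auto intro: past_integrable[OF pA])
    then have "(\<integral>x. of_bool (A x) * h ((W (ni i) x - W (mi i) x) / sqrt (U (N i))) \<partial>M) = (\<integral>x. 0 \<partial>M)"
      by (intro integral_cong_AE) (auto intro!: past_measurable[of "ni i"] past_comp2[OF past_mono[OF pA idx(1)] past_comp2[of s "ni i" "W (ni i)" "W (mi i)" "\<lambda>u v. h ((u - v) / sqrt (U (N i)))"]] past_mart idx(1))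
    then show False using that 0 by (simp add: bad_def)
  qed
  \<comment> \<open>Where no pair violates the bound, the sure event and the zero function serve as
    stand-ins.\<close>
  define A where "A i = (if \<exists>A h. bad i A h then (SOME A. \<exists>h. bad i A h) else (\<lambda>_. True))" for i
  define h where "h i = (if \<exists>A h. bad i A h then (SOME h. bad i (A i) h) else (\<lambda>_. 0))" for i
  have AE: "\<exists>h. bad i (A i) h" if "\<exists>A h. bad i A h" for i
    using someI_ex[OF that] that by (simp add: A_def)
  have Ah: "bad i (A i) (h i)" if "\<exists>A h. bad i A h" for i
    using someI_ex[OF AE[OF that]] that by (simp add: h_def)
  have pA: "past s (mi i) (A i)" and lip: "\<bar>h i x - h i y\<bar> \<le> K' * \<bar>x - y\<bar>" and bdd: "\<bar>h i x\<bar> \<le> B"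
    and pos: "0 < (\<integral>x. (of_bool (A i x) :: real) \<partial>M)" for i x y
  proof -
    have "past s (mi i) (A i) \<and> \<bar>h i x - h i y\<bar> \<le> K' * \<bar>x - y\<bar> \<and> \<bar>h i x\<bar> \<le> B \<and> 0 < (\<integral>x. (of_bool (A i x) :: real) \<partial>M)"
    proof (cases "\<exists>A h. bad i A h")
      case True
      then show ?thesis using Ah[OF True] bad_pos[OF Ah[OF True]] by (auto simp: bad_def)
    next
      case False
      then show ?thesis using B by (auto simp: A_def h_def past_const prob_space K'_def)
    qed
    then show "past s (mi i) (A i)" "\<bar>h i x - h i y\<bar> \<le> K' * \<bar>x - y\<bar>" "\<bar>h i x\<bar> \<le> B" "0 < (\<integral>x. (of_bool (A i x) :: real) \<partial>M)" by auto
  qed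
  define P where "P i = (\<integral>x. (of_bool (A i x) :: real) \<partial>M)" for i
  define Z where "Z i x = (W (ni i) x - W (mi i) x) / sqrt (U (N i)) / sqrt v" for i x
  define \<nu> where "\<nu> i = density M (\<lambda>x. ennreal (of_bool (A i x) / P i))" for i
  define \<mu> where "\<mu> i = distr (\<nu> i) borel (Z i)" for i
  have Pp: "0 < P i" for i using pos by (simp add: P_def)
  have Am [measurable]: "(\<lambda>x. of_bool (A i x) / P i) \<in> borel_measurable M" for i
    by (intro past_measurable[of "mi i"] past_comp[OF pA])
  have Zm [measurable]: "Z i \<in> borel_measurable M" for i unfolding Z_def by measurable
  have "emeasure (\<nu> i) (space (\<nu> i)) = 1" for i
  proof -
    have "emeasure (\<nu> i) (space (\<nu> i)) = (\<integral>\<^sup>+x. ennreal (of_bool (A i x) / P i) \<partial>M)"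
      by (simp add: \<nu>_def emeasure_density cong: nn_integral_cong)
    also have "\<dots> = ennreal (\<integral>x. of_bool (A i x) / P i \<partial>M)"
      using Pp[of i] by (intro nn_integral_eq_integral past_integrable[of "mi i"] past_comp[OF pA]) auto
    also have "(\<integral>x. of_bool (A i x) / P i \<partial>M) = 1"
      using Pp[of i] by (simp add: P_def)
    finally show ?thesis by simp
  qed
  then have ps: "prob_space (\<nu> i)" for i by (intro prob_spaceI)
  have Zm': "Z i \<in> borel_measurable (\<nu> i)" for i by (simp add: \<nu>_def)
  have rd: "real_distribution (\<mu> i)" for i
    unfolding \<mu>_def by (rule prob_space.real_distribution_distr[OF ps Zm'])
  have int\<mu>: "(\<integral>z. g z \<partial>\<mu> i) = (\<integral>x. (of_bool (A i x) / P i) *\<^sub>R g (Z i x) \<partial>M)"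
    if g: "g \<in> borel_measurable borel" for g :: "real \<Rightarrow> 'b::{banach, second_countable_topology}" and i
  proof -
    have "(\<integral>z. g z \<partial>\<mu> i) = (\<integral>x. g (Z i x) \<partial>\<nu> i)" unfolding \<mu>_def by (rule integral_distr[OF Zm' g])
    also have "\<dots> = (\<integral>x. (of_bool (A i x) / P i) *\<^sub>R g (Z i x) \<partial>M)"
      unfolding \<nu>_def using g Pp[of i] by (intro integral_density) auto
    finally show ?thesis .
  qed
  have "weak_conv_m \<mu> std_normal_distribution"
  proof (rule levy_continuity[OF rd real_dist_normal_dist])
    fix t
    have "(\<lambda>i. (\<integral>x. of_bool (A i x) * iexp (t / sqrt v * ((W (ni i) x - W (mi i) x) / sqrt (U (N i)))) \<partial>M)
       / complex_of_real (P i)) \<longlonglongrightarrow> exp (- of_real ((t / sqrt v)\<^sup>2 * v / 2))"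
      unfolding P_def by (rule char_limit[OF idx N v(1) pA pos])
    moreover have "exp (- complex_of_real ((t / sqrt v)\<^sup>2 * v / 2)) = char std_normal_distribution t"
      using v(2) by (simp add: char_std_normal_distribution power_divide flip: exp_of_real)
    moreover have "(\<integral>x. of_bool (A i x) * iexp (t / sqrt v * ((W (ni i) x - W (mi i) x) / sqrt (U (N i)))) \<partial>M) / complex_of_real (P i) = char (\<mu> i) t" for i
    proof -
      have "char (\<mu> i) t = (\<integral>x. (of_bool (A i x) / P i) *\<^sub>R iexp (t * Z i x) \<partial>M)"
        unfolding char_def by (rule int\<mu>) measurable
      also have "\<dots> = (\<integral>x. (of_bool (A i x) * iexp (t / sqrt v * ((W (ni i) x - W (mi i) x) / sqrt (U (N i))))) / complex_of_real (P i) \<partial>M)"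
        by (intro Bochner_Integration.integral_cong) (auto simp: Z_def scaleR_conv_of_real mult_ac)
      finally show ?thesis by simp
    qed
    ultimately show "(\<lambda>n. char (\<mu> n) t) \<longlonglongrightarrow> char std_normal_distribution t" by simp
  qed
  moreover have lip': "\<bar>h n (sqrt v * x) - h n (sqrt v * y)\<bar> \<le> (K' * sqrt v) * \<bar>x - y\<bar>" for n x y
  proof -
    have "\<bar>sqrt v * x - sqrt v * y\<bar> = sqrt v * \<bar>x - y\<bar>" using v(2) by (simp add: abs_mult flip: right_diff_distrib)
    then show ?thesis using lip[of n "sqrt v * x" "sqrt v * y"] by simp
  qed
  ultimately have "(\<lambda>n. (\<integral>x. h n (sqrt v * x) \<partial>\<mu> n) - (\<integral>x. h n (sqrt v * x) \<partial>std_normal_distribution)) \<longlonglongrightarrow> 0"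
    by (intro weak_conv_Lipschitz_uniform[OF rd real_dist_normal_dist _ lip' bdd])
  then have "\<forall>\<^sub>F n in sequentially. norm ((\<integral>x. h n (sqrt v * x) \<partial>\<mu> n) - (\<integral>x. h n (sqrt v * x) \<partial>std_normal_distribution)) < e"
    using e by (simp add: tendsto_iff dist_real_def)
  then show ?thesis
  proof eventually_elim
    case (elim i)
    have "\<not> (\<exists>A h. bad i A h)"
    proof
      assume ex: "\<exists>A h. bad i A h"
      have hm: "(\<lambda>x. h i (sqrt v * x)) \<in> borel_measurable borel"
      proof -
        have "continuous_on UNIV (\<lambda>x. h i (sqrt v * x))"
          by (rule lipschitz_on_continuous_on[of "K' * sqrt v"])
            (use lip' v(2) in \<open>auto simp: lipschitz_on_def dist_real_def K'_def\<close>)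
        then show ?thesis by (rule borel_measurable_continuous_onI)
      qed
      have "(\<integral>x. h i (sqrt v * x) \<partial>\<mu> i) = (\<integral>x. (of_bool (A i x) * h i ((W (ni i) x - W (mi i) x) / sqrt (U (N i)))) / P i \<partial>M)"
        unfolding int\<mu>[OF hm] using v(2) by (intro Bochner_Integration.integral_cong) (auto simp: Z_def)
      then have *: "(\<integral>x. of_bool (A i x) * h i ((W (ni i) x - W (mi i) x) / sqrt (U (N i))) \<partial>M) = P i * (\<integral>x. h i (sqrt v * x) \<partial>\<mu> i)"
        using Pp[of i] by (simp add: field_simps)
      have "e * P i < \<bar>P i * (\<integral>x. h i (sqrt v * x) \<partial>\<mu> i) - P i * (\<integral>z. h i (sqrt v * z) \<partial>std_normal_distribution)\<bar>"
        using Ah[OF ex] unfolding bad_def * P_def[symmetric] by blast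
      also have "\<dots> = P i * \<bar>(\<integral>x. h i (sqrt v * x) \<partial>\<mu> i) - (\<integral>z. h i (sqrt v * z) \<partial>std_normal_distribution)\<bar>"
        using Pp[of i] by (simp add: abs_mult flip: right_diff_distrib)
      also have "\<dots> \<le> P i * e" using elim Pp[of i] by (intro mult_left_mono) auto
      finally show False by simp
    qed
    show ?case
    proof (intro allI impI)
      fix A :: "'a \<Rightarrow> bool" and h :: "real \<Rightarrow> real"
      assume "past s (mi i) A" and l: "\<forall>x y. \<bar>h x - h y\<bar> \<le> K * \<bar>x - y\<bar>" and "\<forall>x. \<bar>h x\<bar> \<le> B"
      moreover have "\<bar>h x - h y\<bar> \<le> K' * \<bar>x - y\<bar>" for x y
      proof -
        have "K * \<bar>x - y\<bar> \<le> K' * \<bar>x - y\<bar>" by (intro mult_right_mono) (auto simp: K'_def)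
        then show ?thesis using l order_trans by blast
      qed
      ultimately show "\<bar>(\<integral>x. of_bool (A x) * h ((W (ni i) x - W (mi i) x) / sqrt (U (N i))) \<partial>M)
        - (\<integral>x. of_bool (A x) \<partial>M) * (\<integral>z. h (sqrt v * z) \<partial>std_normal_distribution)\<bar> \<le> e * (\<integral>x. of_bool (A x) \<partial>M)"
        using \<open>\<not> (\<exists>A h. bad i A h)\<close> unfolding bad_def by (meson not_less)
    qed
  qed
qed

end

section \<open>Gaussian expectations as iterated integrals\<close>

primrec gauss_fold :: "nat \<Rightarrow> real \<Rightarrow> ((nat \<Rightarrow> real) \<Rightarrow> real) \<Rightarrow> nat \<Rightarrow> (nat \<Rightarrow> real) \<Rightarrow> real" where
  "gauss_fold p v f 0 y = f y"
| "gauss_fold p v f (Suc i) y = (\<integral>z. gauss_fold p v f i (y(p - Suc i := sqrt v * z)) \<partial>std_normal_distribution)"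

text \<open>\<open>gauss_fold\<close> integrates the coordinates from the last to the first, the
  order in which the conditional limit theorem replaces increments by normal variables. The
  Lipschitz bound in the first \<open>p\<close> coordinates also says that \<open>f\<close> depends
  on these alone, and it survives each integration.\<close>

locale lipschitz_fun =
  fixes p :: nat and v K B :: real and f :: "(nat \<Rightarrow> real) \<Rightarrow> real"
  assumes lip: "\<bar>f y - f y'\<bar> \<le> K * (\<Sum>l<p. \<bar>y l - y' l\<bar>)" and bdd: "\<bar>f y\<bar> \<le> B" and K: "0 \<le> K"
begin

abbreviation "G \<equiv> gauss_fold p v f"

lemma G_props:
  "(\<forall>y y'. \<bar>G i y - G i y'\<bar> \<le> K * (\<Sum>l<p. \<bar>y l - y' l\<bar>)) \<and> (\<forall>y. \<bar>G i y\<bar> \<le> B)"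
proof (induction i)
  case 0 then show ?case using lip bdd by simp
next
  case (Suc i)
  interpret N: real_distribution std_normal_distribution by (rule real_dist_normal_dist)
  define k where "k = p - Suc i"
  have lipi: "\<bar>G i y - G i y'\<bar> \<le> K * (\<Sum>l<p. \<bar>y l - y' l\<bar>)" and bi: "\<bar>G i y\<bar> \<le> B" for y y' using Suc by auto
  have cont: "continuous_on UNIV (\<lambda>z. G i (y(k := sqrt v * z)))" for y
  proof (rule lipschitz_on_continuous_on[of "K * \<bar>sqrt v\<bar>"], rule lipschitz_onI)
    fix z w :: real
    have "(\<Sum>l<p. \<bar>(y(k := sqrt v * z)) l - (y(k := sqrt v * w)) l\<bar>) = (\<Sum>l<p. if l = k then \<bar>sqrt v * z - sqrt v * w\<bar> else 0)"
      by (intro sum.cong) auto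
    also have "\<dots> \<le> \<bar>sqrt v * z - sqrt v * w\<bar>" by simp
    also have "\<dots> = \<bar>sqrt v\<bar> * \<bar>z - w\<bar>" by (simp add: abs_mult flip: right_diff_distrib)
    finally have "K * (\<Sum>l<p. \<bar>(y(k := sqrt v * z)) l - (y(k := sqrt v * w)) l\<bar>) \<le> K * (\<bar>sqrt v\<bar> * \<bar>z - w\<bar>)"
      using K by (rule mult_left_mono)
    then show "dist (G i (y(k := sqrt v * z))) (G i (y(k := sqrt v * w))) \<le> K * \<bar>sqrt v\<bar> * dist z w"
      using lipi[of "y(k := sqrt v * z)" "y(k := sqrt v * w)"] unfolding dist_real_def by (simp only: mult.assoc)
  qed (use K in simp)
  have int: "integrable std_normal_distribution (\<lambda>z. G i (y(k := sqrt v * z)))" for y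
    using bi borel_measurable_continuous_onI[OF cont[of y]] by (intro N.integrable_const_bound[of _ B]) auto
  show ?case
  proof (intro conjI allI)
    fix y y' :: "nat \<Rightarrow> real"
    have "\<bar>G (Suc i) y - G (Suc i) y'\<bar> = \<bar>\<integral>z. G i (y(k := sqrt v * z)) - G i (y'(k := sqrt v * z)) \<partial>std_normal_distribution\<bar>"
      using int by (simp add: k_def)
    also have "\<dots> \<le> (\<integral>z. \<bar>G i (y(k := sqrt v * z)) - G i (y'(k := sqrt v * z))\<bar> \<partial>std_normal_distribution)"
      by (rule integral_abs_bound)
    also have "\<dots> \<le> K * (\<Sum>l<p. \<bar>y l - y' l\<bar>)"
    proof (intro N.integral_le_const AE_I2)
      show "integrable std_normal_distribution (\<lambda>z. \<bar>G i (y(k := sqrt v * z)) - G i (y'(k := sqrt v * z))\<bar>)"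
        by (intro integrable_abs Bochner_Integration.integrable_diff int)
      fix z
      have "(\<Sum>l<p. \<bar>(y(k := sqrt v * z)) l - (y'(k := sqrt v * z)) l\<bar>) \<le> (\<Sum>l<p. \<bar>y l - y' l\<bar>)"
        by (intro sum_mono) auto
      then show "\<bar>G i (y(k := sqrt v * z)) - G i (y'(k := sqrt v * z))\<bar> \<le> K * (\<Sum>l<p. \<bar>y l - y' l\<bar>)"
        using lipi[of "y(k := sqrt v * z)" "y'(k := sqrt v * z)"] K by (meson mult_left_mono order_trans)
    qed
    finally show "\<bar>G (Suc i) y - G (Suc i) y'\<bar> \<le> K * (\<Sum>l<p. \<bar>y l - y' l\<bar>)" .
  next
    fix y :: "nat \<Rightarrow> real"
    have "\<bar>G (Suc i) y\<bar> \<le> (\<integral>z. \<bar>G i (y(k := sqrt v * z))\<bar> \<partial>std_normal_distribution)"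
      unfolding k_def gauss_fold.simps by (rule integral_abs_bound)
    also have "\<dots> \<le> B" using bi int by (intro N.integral_le_const AE_I2 integrable_abs) auto
    finally show "\<bar>G (Suc i) y\<bar> \<le> B" .
  qed
qed

lemma G_lip: "\<bar>G i y - G i y'\<bar> \<le> K * (\<Sum>l<p. \<bar>y l - y' l\<bar>)" and G_bdd: "\<bar>G i y\<bar> \<le> B"
  using G_props by auto

lemma G_dep: "i \<le> p \<Longrightarrow> (\<And>l. l < p - i \<Longrightarrow> y l = y' l) \<Longrightarrow> G i y = G i y'"
proof (induction i arbitrary: y y')
  case 0
  then have "\<bar>f y - f y'\<bar> \<le> 0" using lip[of y y'] by simp
  then show ?case by simp
next
  case (Suc i)
  have "G i (y(p - Suc i := sqrt v * z)) = G i (y'(p - Suc i := sqrt v * z))" for z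
  proof (rule Suc.IH)
    fix l assume "l < p - i"
    then have "l < p - Suc i \<or> l = p - Suc i" using Suc.prems(1) by linarith
    then show "(y(p - Suc i := sqrt v * z)) l = (y'(p - Suc i := sqrt v * z)) l" using Suc.prems(2) by auto
  qed (use Suc.prems in simp)
  then show ?case by simp
qed

lemma G_continuous: "continuous_on UNIV (G i)"
proof -
  have "(G i \<longlongrightarrow> G i y) (at y)" for y
  proof -
    have "((\<lambda>y'. K * (\<Sum>l<p. \<bar>y' l - y l\<bar>)) \<longlongrightarrow> K * (\<Sum>l<p. \<bar>y l - y l\<bar>)) (at y)"
      by (intro tendsto_intros continuous_on_product_coordinates[THEN continuous_on_eq_continuous_at[THEN iffD1, OF open_UNIV], THEN bspec, unfolded isCont_def] UNIV_I)
    then have "((\<lambda>y'. K * (\<Sum>l<p. \<bar>y' l - y l\<bar>)) \<longlongrightarrow> 0) (at y)" by simp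
    then have "((\<lambda>y'. G i y' - G i y) \<longlongrightarrow> 0) (at y)"
      by (rule Lim_null_comparison[rotated]) (use G_lip in auto)
    then show ?thesis by (simp add: LIM_zero_iff)
  qed
  then show ?thesis by (simp add: continuous_on_def)
qed

text \<open>Points of the finite product are sequences that are \<open>undefined\<close> from
  \<open>q\<close> on; they embed measurably into the full product, where \<open>G i\<close> is
  continuous.\<close>

lemma G_measurable_PiM: "G i \<in> borel_measurable (PiM {..<q} (\<lambda>_. borel))"
proof -
  define E where "E y = (\<lambda>l. if l < q then y l else (undefined :: real))" for y :: "nat \<Rightarrow> real"
  have "E \<in> PiM {..<q} (\<lambda>_. borel) \<rightarrow>\<^sub>M PiM UNIV (\<lambda>_. borel)"
  proof -
    have "(\<lambda>y l. E y l) \<in> PiM {..<q} (\<lambda>_. borel) \<rightarrow>\<^sub>M PiM UNIV (\<lambda>_. borel)"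
    proof (rule measurable_PiM_single')
      show "(\<lambda>y. E y l) \<in> borel_measurable (PiM {..<q} (\<lambda>_. borel))" for l
        by (cases "l < q") (auto simp: E_def)
    qed auto
    then show ?thesis by simp
  qed
  then have "E \<in> borel_measurable (PiM {..<q} (\<lambda>_. borel))"
    by (simp cong: measurable_cong_sets add: sets_PiM_equal_borel)
  then have "(\<lambda>y. G i (E y)) \<in> borel_measurable (PiM {..<q} (\<lambda>_. borel))"
    by (rule measurable_compose[OF _ borel_measurable_continuous_onI[OF G_continuous]])
  then show ?thesis
  proof (rule measurable_cong[THEN iffD1, rotated])
    fix y :: "nat \<Rightarrow> real" assume "y \<in> space (PiM {..<q} (\<lambda>_. borel))"
    then have "E y = y" by (auto simp: space_PiM PiE_def extensional_def E_def fun_eq_iff)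
    then show "G i (E y) = G i y" by simp
  qed
qed

text \<open>Independence makes the joint law a product of normal laws; integrating the product one
  coordinate at a time by Fubini's theorem is what \<open>gauss_fold\<close> does.\<close>

lemma G_gaussian:
  assumes P: "prob_space P" and v: "0 < v"
    and ind: "prob_space.indep_vars P (\<lambda>_. borel) X {..<p}"
    and X: "\<And>l. l < p \<Longrightarrow> distributed P lborel (X l) (normal_density 0 (sqrt v))"
  shows "(\<integral>\<omega>. f (\<lambda>l. X l \<omega>) \<partial>P) = G p y"
proof -
  interpret P: prob_space P by fact
  interpret N: real_distribution std_normal_distribution by (rule real_dist_normal_dist)
  define N' where "N' = density lborel (normal_density 0 (sqrt v))"
  have psN': "prob_space N'" unfolding N'_def using v by (intro prob_space_normal_density) simp
  interpret PN: product_prob_space "\<lambda>_::nat. N'" UNIV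
    by (simp add: product_prob_space_def product_prob_space_axioms_def product_sigma_finite_def psN' prob_space_imp_sigma_finite)
  have Xm: "\<And>l. l < p \<Longrightarrow> X l \<in> borel_measurable P" using X by (auto simp: distributed_def)
  have dX: "distr P borel (X l) = N'" if "l < p" for l
  proof -
    have "distr P borel (X l) = distr P lborel (X l)" by (rule distr_cong) auto
    also have "\<dots> = N'" using X[OF that] by (simp add: distributed_def N'_def)
    finally show ?thesis .
  qed
  have sN': "sets N' = sets borel" by (simp add: N'_def)
  have step: "(\<integral>z. h z \<partial>N') = (\<integral>z. h (sqrt v * z) \<partial>std_normal_distribution)" if [measurable]: "h \<in> borel_measurable borel" for h :: "real \<Rightarrow> real"
  proof -
    have "(\<integral>z. h z \<partial>N') = (\<integral>z. normal_density 0 (sqrt v) z * h z \<partial>lborel)"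
      unfolding N'_def by (subst integral_density) auto
    also have "\<dots> = sqrt v * (\<integral>z. normal_density 0 (sqrt v) (0 + sqrt v * z) * h (0 + sqrt v * z) \<partial>lborel)"
      using v by (subst lborel_integral_real_affine[of "sqrt v" _ 0]) auto
    also have "\<dots> = (\<integral>z. sqrt v * (normal_density 0 (sqrt v) (sqrt v * z) * h (sqrt v * z)) \<partial>lborel)" by simp
    also have "\<dots> = (\<integral>z. std_normal_density z * h (sqrt v * z) \<partial>lborel)"
      using v by (intro Bochner_Integration.integral_cong) (auto simp: normal_density_def power_mult_distrib real_sqrt_mult)
    also have "\<dots> = (\<integral>z. h (sqrt v * z) \<partial>std_normal_distribution)"
      by (subst integral_density) auto
    finally show ?thesis .
  qed
  have fold: "(\<integral>y. f y \<partial>PiM {..<p} (\<lambda>_. N')) = (\<integral>y. G i y \<partial>PiM {..<p - i} (\<lambda>_. N'))" if "i \<le> p" for i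
    using that
  proof (induction i)
    case (Suc i)
    define k where "k = p - Suc i"
    have ins: "{..<p - i} = insert k {..<k}" using Suc.prems by (auto simp: k_def)
    have sP: "sets (PiM J (\<lambda>_. N')) = sets (PiM J (\<lambda>_. borel))" for J :: "nat set" by (intro sets_PiM_cong sN' refl)
    have "integrable (PiM (insert k {..<k}) (\<lambda>_. N')) (G i)"
    proof -
      interpret PP: prob_space "PiM (insert k {..<k}) (\<lambda>_. N')" by (rule prob_space_PiM) (rule psN')
      have "G i \<in> borel_measurable (PiM (insert k {..<k}) (\<lambda>_. N'))"
        using G_measurable_PiM[of i "p - i"] unfolding ins[symmetric] by (simp cong: measurable_cong_sets add: sP)
      then show ?thesis using G_bdd by (intro PP.integrable_const_bound[of _ B]) auto
    qed
    then have "(\<integral>y. G i y \<partial>PiM (insert k {..<k}) (\<lambda>_. N')) = (\<integral>y. (\<integral>z. G i (y(k := z)) \<partial>N') \<partial>PiM {..<k} (\<lambda>_. N'))"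
      by (intro PN.product_integral_insert) auto
    also have "\<dots> = (\<integral>y. G (Suc i) y \<partial>PiM {..<k} (\<lambda>_. N'))"
    proof (rule Bochner_Integration.integral_cong[OF refl])
      fix y :: "nat \<Rightarrow> real"
      have "continuous_on UNIV (\<lambda>z::real. y(k := z))"
      proof (rule continuous_on_coordinatewise_then_product)
        fix l show "continuous_on UNIV (\<lambda>z::real. (y(k := z)) l)" by (cases "l = k") (auto intro: continuous_intros)
      qed
      then have "continuous_on UNIV (\<lambda>z::real. G i (y(k := z)))" by (rule continuous_on_compose2[OF G_continuous]) auto
      then have "(\<lambda>z. G i (y(k := z))) \<in> borel_measurable borel" by (rule borel_measurable_continuous_onI)
      from step[OF this] show "(\<integral>z. G i (y(k := z)) \<partial>N') = G (Suc i) y" by (simp add: k_def)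
    qed
    finally show ?case using Suc by (simp add: ins k_def[symmetric])
  next
    case 0
    have "G 0 = f" by (rule ext) simp
    then show ?case by simp
  qed
  have "distr P (PiM {..<p} (\<lambda>_. borel)) (\<lambda>\<omega>. \<lambda>l\<in>{..<p}. X l \<omega>) = PiM {..<p} (\<lambda>l. distr P borel (X l))"
  proof (cases "p = 0")
    case False
    then show ?thesis using ind Xm by (subst (asm) P.indep_vars_iff_distr_eq_PiM') auto
  next
    \<comment> \<open>Without increments both measures are the unit mass on a one-point
      space.\<close>
    case True
    show ?thesis
    proof (rule measure_eqI)
      fix S assume "S \<in> sets (distr P (PiM {..<p} (\<lambda>_. borel)) (\<lambda>\<omega>. \<lambda>l\<in>{..<p}. X l \<omega>))"
      then have "S = {} \<or> S = {\<lambda>_. undefined}" using True by (auto simp: sets_PiM_empty)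
      then show "emeasure (distr P (PiM {..<p} (\<lambda>_. borel)) (\<lambda>\<omega>. \<lambda>l\<in>{..<p}. X l \<omega>)) S = emeasure (PiM {..<p} (\<lambda>l. distr P borel (X l))) S"
        using True by (auto simp: emeasure_distr P.emeasure_space_1 emeasure_PiM_empty restrict_def sets_PiM_empty)
    qed (simp add: True sets_PiM_empty)
  qed
  also have "PiM {..<p} (\<lambda>l. distr P borel (X l)) = PiM {..<p} (\<lambda>_. N')"
    by (intro PiM_cong refl) (auto simp: dX)
  finally have dd: "distr P (PiM {..<p} (\<lambda>_. borel)) (\<lambda>\<omega>. \<lambda>l\<in>{..<p}. X l \<omega>) = PiM {..<p} (\<lambda>_. N')" .
  have G0: "G 0 = f" by (rule ext) simp
  have fm: "f \<in> borel_measurable (PiM {..<p} (\<lambda>_. borel))" using G_measurable_PiM[of 0 p] unfolding G0 .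
  have fdep: "f y = f y'" if "\<And>l. l < p \<Longrightarrow> y l = y' l" for y y'
    using G_dep[of 0 y y'] that by simp
  have "(\<integral>\<omega>. f (\<lambda>l. X l \<omega>) \<partial>P) = (\<integral>\<omega>. f (\<lambda>l\<in>{..<p}. X l \<omega>) \<partial>P)"
  proof (rule Bochner_Integration.integral_cong[OF refl])
    fix \<omega> show "f (\<lambda>l. X l \<omega>) = f (\<lambda>l\<in>{..<p}. X l \<omega>)" by (rule fdep) simp
  qed
  also have "\<dots> = (\<integral>y. f y \<partial>PiM {..<p} (\<lambda>_. N'))"
  proof -
    have "(\<lambda>\<omega>. \<lambda>l\<in>{..<p}. X l \<omega>) \<in> P \<rightarrow>\<^sub>M PiM {..<p} (\<lambda>_. borel)"
      by (rule measurable_restrict) (use Xm in simp)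
    then show ?thesis unfolding dd[symmetric] by (rule integral_distr[symmetric]) (rule fm)
  qed
  also have "\<dots> = (\<integral>y. G p y \<partial>PiM {} (\<lambda>_. N'))" using fold[of p] by simp
  also have "\<dots> = G p (\<lambda>_. undefined)" by (simp add: PiM_empty lebesgue_integral_count_space_finite)
  also have "\<dots> = G p y" by (rule G_dep) auto
  finally show ?thesis .
qed

end

context mart_growth begin

text \<open>Lindeberg's replacement scheme, starting from the last increment. Given the signs up to
  \<open>\<kappa> n k\<close> the earlier increments are constants, so the functional is a Lipschitz
  function of one increment, which \<open>conditional_CLT\<close> replaces by a normal variable. The
  uniformity over past events is essential, because the number of sign histories may grow with
  \<open>n\<close>.\<close>

lemma increments_converge:
  fixes f :: "(nat \<Rightarrow> real) \<Rightarrow> real" and \<kappa> :: "nat \<Rightarrow> nat \<Rightarrow> nat" and N :: "nat \<Rightarrow> nat"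
  assumes f: "lipschitz_fun p K B f"
    and mono: "\<And>n j. \<kappa> n j \<le> \<kappa> n (Suc j)" and le: "\<And>n j. j \<le> p \<Longrightarrow> \<kappa> n j \<le> N n"
    and N: "filterlim N at_top sequentially" and v: "0 < v"
    and lim: "\<And>j. j < p \<Longrightarrow> (\<lambda>n. (U (\<kappa> n (Suc j)) - U (\<kappa> n j)) / U (N n)) \<longlonglongrightarrow> v"
  shows "(\<lambda>n. \<integral>x. f (\<lambda>j. (W (\<kappa> n (Suc j)) x - W (\<kappa> n j) x) / sqrt (U (N n))) \<partial>M) \<longlonglongrightarrow> gauss_fold p v f p y"
proof -
  interpret lipschitz_fun p v K B f by (rule f)
  define Y where "Y n x j = (W (\<kappa> n (Suc j)) x - W (\<kappa> n j) x) / sqrt (U (N n))" for n x j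
  have kmono: "\<kappa> n i \<le> \<kappa> n j" if "i \<le> j" for n i j
    using that by (rule lift_Suc_mono_le[of "\<kappa> n", rotated]) (rule mono)
  have step: "(\<lambda>n. (\<integral>x. G i (Y n x) \<partial>M) - (\<integral>x. G (Suc i) (Y n x) \<partial>M)) \<longlonglongrightarrow> 0" if i: "i < p" for i
  proof (rule tendstoI)
    fix e :: real assume e: "0 < e"
    define k where "k = p - Suc i"
    have kp: "k < p" "Suc k \<le> p" using i by (auto simp: k_def)
    have "\<forall>\<^sub>F n in sequentially. \<forall>A h. past s (\<kappa> n k) A \<longrightarrow> (\<forall>x y. \<bar>h x - h y\<bar> \<le> K * \<bar>x - y\<bar>) \<longrightarrow> (\<forall>x. \<bar>h x\<bar> \<le> B) \<longrightarrow>
      \<bar>(\<integral>x. of_bool (A x) * h ((W (\<kappa> n (Suc k)) x - W (\<kappa> n k) x) / sqrt (U (N n))) \<partial>M)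
      - (\<integral>x. of_bool (A x) \<partial>M) * (\<integral>z. h (sqrt v * z) \<partial>std_normal_distribution)\<bar> \<le> (e/2) * (\<integral>x. of_bool (A x) \<partial>M)"
      using e by (intro conditional_CLT mono le kp N lim v) auto
    then show "\<forall>\<^sub>F n in sequentially. dist ((\<integral>x. G i (Y n x) \<partial>M) - (\<integral>x. G (Suc i) (Y n x) \<partial>M)) 0 < e"
    proof eventually_elim
      case (elim n)
      define m where "m = \<kappa> n k"
      \<comment> \<open>The sign history up to the start of the increment; its finitely many values
        cut the space into cells on which all earlier increments are constant.\<close>
      define S where "S x = map (\<lambda>i. s i x) [0..<Suc m]" for x
      have pS: "past s m S"
      proof -
        have "S x = S y" if "\<forall>i\<le>m. s i x = s i y" for x y using that by (auto simp: S_def)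
        then show ?thesis unfolding past_def by blast
      qed
      have Seq: "s i x = s i y" if "S x = S y" "i \<le> m" for x y i
        using that by (auto simp: S_def simp del: upt_Suc)
      define L where "L = range S"
      have Lfin: "finite L"
      proof -
        have "L \<subseteq> {w. set w \<subseteq> {0, 1, -1} \<and> length w = Suc m}"
        proof
          fix w assume "w \<in> L"
          then obtain x where w: "w = S x" by (auto simp: L_def)
          have "s i x \<in> {0, 1, -1}" for i using s_cases[of i x] by auto
          then show "w \<in> {w. set w \<subseteq> {0, 1, -1} \<and> length w = Suc m}" unfolding w S_def by (auto simp del: upt_Suc insert_iff)
        qed
        then show ?thesis by (rule finite_subset) (intro finite_lists_length_eq, simp)
      qed
      \<comment> \<open>A representative of each cell, used to freeze the earlier
        coordinates.\<close>
      define x0 where "x0 l = (SOME x. S x = l)" for l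
      have x0: "S (x0 l) = l" if "l \<in> L" for l
        using that unfolding L_def x0_def by (metis (mono_tags) imageE someI_ex)
      define h where "h l u = G i ((Y n (x0 l))(k := u))" for l u
      have pY: "past s (\<kappa> n (Suc j)) (\<lambda>x. Y n x j)" for j
        unfolding Y_def by (rule past_comp2[OF past_mart past_mart]) (use mono in auto)
      have Yeq: "Y n x j = Y n (x0 (S x)) j" if "j < k" for x j
      proof -
        have "S (x0 (S x)) = S x" by (rule x0) (simp add: L_def)
        moreover have "\<kappa> n (Suc j) \<le> m" unfolding m_def using that by (intro kmono) simp
        ultimately have "\<forall>i\<le>\<kappa> n (Suc j). s i x = s i (x0 (S x))" using Seq by (metis order_trans)
        then show ?thesis using pY[of j] unfolding past_def by blast
      qed
      have Gi: "G i (Y n x) = h (S x) (Y n x k)" for x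
        unfolding h_def
      proof (rule G_dep)
        fix l assume "l < p - i"
        then have "l < k \<or> l = k" by (auto simp: k_def)
        then show "Y n x l = ((Y n (x0 (S x)))(k := Y n x k)) l" using Yeq[of l x] by auto
      qed (use i in simp)
      have GSi: "G (Suc i) (Y n x) = (\<integral>z. h (S x) (sqrt v * z) \<partial>std_normal_distribution)" for x
      proof -
        have "G (Suc i) (Y n x) = G (Suc i) (Y n (x0 (S x)))"
        proof (rule G_dep)
          fix l assume "l < p - Suc i"
          then show "Y n x l = Y n (x0 (S x)) l" by (intro Yeq) (simp add: k_def)
        qed (use i in simp)
        then show ?thesis by (simp add: h_def k_def)
      qed
      have hl: "\<bar>h l u - h l w\<bar> \<le> K * \<bar>u - w\<bar>" for l u w
      proof -
        have "(\<Sum>j<p. \<bar>((Y n (x0 l))(k := u)) j - ((Y n (x0 l))(k := w)) j\<bar>) = (\<Sum>j<p. if j = k then \<bar>u - w\<bar> else 0)"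
          by (intro sum.cong) auto
        also have "\<dots> = \<bar>u - w\<bar>" using kp by simp
        finally show ?thesis unfolding h_def using G_lip[of i "(Y n (x0 l))(k := u)" "(Y n (x0 l))(k := w)"] by simp
      qed
      have hb: "\<bar>h l u\<bar> \<le> B" for l u unfolding h_def by (rule G_bdd)
      have pA: "past s m (\<lambda>x. S x = l)" for l by (rule past_comp[OF pS])
      have part: "(\<integral>x. F x \<partial>M) = (\<Sum>l\<in>L. \<integral>x. of_bool (S x = l) * F x \<partial>M)" if F: "past s (\<kappa> n (Suc k)) F" for F :: "'a \<Rightarrow> real"
      proof -
        have "F x = (\<Sum>l\<in>L. of_bool (S x = l) * F x)" for x
        proof -
          have "(\<Sum>l\<in>L. of_bool (S x = l) * F x) = (\<Sum>l\<in>L. if l = S x then F x else 0)" by (intro sum.cong) auto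
          also have "\<dots> = F x" using Lfin by (simp add: L_def)
          finally show ?thesis ..
        qed
        then have "(\<integral>x. F x \<partial>M) = (\<integral>x. (\<Sum>l\<in>L. of_bool (S x = l) * F x) \<partial>M)" by (rule Bochner_Integration.integral_cong[OF refl])
        also have "\<dots> = (\<Sum>l\<in>L. \<integral>x. of_bool (S x = l) * F x \<partial>M)"
        proof (rule Bochner_Integration.integral_sum)
          fix l
          show "integrable M (\<lambda>x. of_bool (S x = l) * F x)"
            by (rule past_integrable[OF past_comp2[OF past_mono[OF pA] F]]) (use mono in \<open>simp add: m_def\<close>)
        qed
        finally show ?thesis .
      qed
      have pG: "past s (\<kappa> n (Suc k)) (\<lambda>x. h (S x) (Y n x k))"
        by (rule past_comp2[OF past_mono[OF pS] pY]) (use mono in \<open>simp add: m_def\<close>)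
      have pG2: "past s (\<kappa> n (Suc k)) (\<lambda>x. \<integral>z. h (S x) (sqrt v * z) \<partial>std_normal_distribution)"
        by (rule past_comp[OF past_mono[OF pS]]) (use mono in \<open>simp add: m_def\<close>)
      have "(\<integral>x. G i (Y n x) \<partial>M) = (\<Sum>l\<in>L. \<integral>x. of_bool (S x = l) * h l (Y n x k) \<partial>M)"
        unfolding Gi part[OF pG] by (intro sum.cong Bochner_Integration.integral_cong) auto
      moreover have "(\<integral>x. G (Suc i) (Y n x) \<partial>M) = (\<Sum>l\<in>L. (\<integral>x. of_bool (S x = l) \<partial>M) * (\<integral>z. h l (sqrt v * z) \<partial>std_normal_distribution))"
      proof -
        have "(\<integral>x. G (Suc i) (Y n x) \<partial>M) = (\<Sum>l\<in>L. \<integral>x. of_bool (S x = l) * (\<integral>z. h l (sqrt v * z) \<partial>std_normal_distribution) \<partial>M)"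
          unfolding GSi part[OF pG2] by (intro sum.cong Bochner_Integration.integral_cong) auto
        then show ?thesis by simp
      qed
      ultimately have "\<bar>(\<integral>x. G i (Y n x) \<partial>M) - (\<integral>x. G (Suc i) (Y n x) \<partial>M)\<bar> \<le>
        (\<Sum>l\<in>L. \<bar>(\<integral>x. of_bool (S x = l) * h l (Y n x k) \<partial>M) - (\<integral>x. of_bool (S x = l) \<partial>M) * (\<integral>z. h l (sqrt v * z) \<partial>std_normal_distribution)\<bar>)"
        by (simp only: sum_subtractf[symmetric] sum_abs)
      \<comment> \<open>The errors are proportional to the probabilities of the cells and hence add
        up to \<open>e / 2\<close>, however many cells there are.\<close>
      also have "\<dots> \<le> (\<Sum>l\<in>L. (e/2) * (\<integral>x. of_bool (S x = l) \<partial>M))"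
        using elim hl hb pA unfolding Y_def m_def by (intro sum_mono) blast
      also have "\<dots> = (e/2) * (\<Sum>l\<in>L. \<integral>x. of_bool (S x = l) * 1 \<partial>M)" by (simp add: sum_distrib_left)
      also have "\<dots> = e/2 * (\<integral>x. 1 \<partial>M)" by (subst part[of "\<lambda>_. 1"]) (auto simp: past_const)
      also have "\<dots> = e/2" by (simp add: prob_space)
      finally show ?case using e by (simp add: dist_real_def)
    qed
  qed
  have tele: "(\<lambda>n. (\<integral>x. G 0 (Y n x) \<partial>M) - (\<integral>x. G i (Y n x) \<partial>M)) \<longlonglongrightarrow> 0" if "i \<le> p" for i
    using that
  proof (induction i)
    case (Suc i)
    have "(\<lambda>n. ((\<integral>x. G 0 (Y n x) \<partial>M) - (\<integral>x. G i (Y n x) \<partial>M)) + ((\<integral>x. G i (Y n x) \<partial>M) - (\<integral>x. G (Suc i) (Y n x) \<partial>M))) \<longlonglongrightarrow> 0 + 0"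
      using Suc by (intro tendsto_add step) auto
    then show ?case by (simp del: gauss_fold.simps)
  qed simp
  have "G p (Y n x) = G p y" for n x by (rule G_dep) auto
  then have "(\<integral>x. G p (Y n x) \<partial>M) = G p y" for n by (simp add: prob_space)
  then have "(\<lambda>n. (\<integral>x. f (Y n x) \<partial>M) - G p y) \<longlonglongrightarrow> 0" using tele[of p] by simp
  then have "(\<lambda>n. \<integral>x. f (Y n x) \<partial>M) \<longlonglongrightarrow> G p y" by (rule LIM_zero_cancel)
  then show ?thesis by (simp add: Y_def[abs_def])
qed

end

section \<open>Slopes of the tent functions\<close>

lemma nearest_int_dist_frac: "nearest_int_dist x = min (frac x) (1 - frac x)"
proof -
  have f: "x = of_int \<lfloor>x\<rfloor> + frac x" "0 \<le> frac x" "frac x < 1" by (simp_all add: frac_def frac_lt_1[unfolded frac_def])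
  show ?thesis
  proof (cases "frac x < 1/2")
    case True
    have "round x = \<lfloor>x\<rfloor>" using f True by (intro round_unique') linarith
    then show ?thesis using True f by (simp add: nearest_int_dist_def frac_def[symmetric])
  next
    case False
    have "round x = \<lfloor>x\<rfloor> + 1" using f False by (simp add: round_def floor_eq_iff)
    then have "nearest_int_dist x = \<bar>frac x - 1\<bar>" by (simp add: nearest_int_dist_def frac_def algebra_simps)
    then show ?thesis using False f(3) by simp
  qed
qed

lemma nearest_int_dist_nonneg: "0 \<le> nearest_int_dist x"
  by (simp add: nearest_int_dist_def)

lemma nearest_int_dist_le: "nearest_int_dist x \<le> 1/2"
  by (simp add: nearest_int_dist_frac min_def)

lemma nearest_int_dist_le_abs: "nearest_int_dist x \<le> \<bar>x - of_int n\<bar>"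
  unfolding nearest_int_dist_def by (rule round_diff_minimal)

lemma nearest_int_dist_Lipschitz: "\<bar>nearest_int_dist x - nearest_int_dist y\<bar> \<le> \<bar>x - y\<bar>"
  using nearest_int_dist_le_abs[of x "round y"] nearest_int_dist_le_abs[of y "round x"]
  unfolding nearest_int_dist_def by linarith

lemma frac_add_of_nat: "frac (x + of_nat n) = frac x"
  using frac_unique_iff[of "x + of_nat n" "frac x"] frac_ge_0[of x] frac_lt_1[of x] by (simp add: frac_def)

lemma nearest_int_dist_add_nat: "nearest_int_dist (x + of_nat n) = nearest_int_dist x"
  by (simp add: nearest_int_dist_frac frac_add_of_nat)

lemma continuous_on_nearest_int_dist [continuous_intros]:
  "continuous_on S f \<Longrightarrow> continuous_on S (\<lambda>x. nearest_int_dist (f x))"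
proof -
  have "continuous_on UNIV nearest_int_dist"
    by (rule lipschitz_on_continuous_on[of 1]) (use nearest_int_dist_Lipschitz in \<open>auto simp: lipschitz_on_def dist_real_def\<close>)
  then show "continuous_on S f \<Longrightarrow> continuous_on S (\<lambda>x. nearest_int_dist (f x))"
    by (rule continuous_on_compose2) auto
qed

lemma nearest_int_dist_measurable [measurable]: "nearest_int_dist \<in> borel_measurable borel"
  using continuous_on_nearest_int_dist[of UNIV id] by (intro borel_measurable_continuous_onI) (simp add: id_def)

text \<open>The right-hand derivative of \<open>nearest_int_dist\<close>; the strict inequality
  settles its value at the kinks.\<close>

definition tent_slope :: "real \<Rightarrow> real" where
  "tent_slope u = (if frac u < 1/2 then 1 else -1)"

lemma tent_slope_cases: "tent_slope u = 1 \<or> tent_slope u = -1"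
  by (simp add: tent_slope_def)

lemma tent_slope_add_nat: "tent_slope (u + of_nat n) = tent_slope u"
  by (simp add: tent_slope_def frac_add_of_nat)

lemma tent_slope_measurable [measurable]: "tent_slope \<in> borel_measurable borel"
  unfolding tent_slope_def frac_def by measurable

lemma nearest_int_dist_shift:
  "of_int n \<le> u \<Longrightarrow> u \<le> of_int n + 1/2 \<Longrightarrow> nearest_int_dist u = u - of_int n"
  "of_int n + 1/2 \<le> u \<Longrightarrow> u \<le> of_int n + 1 \<Longrightarrow> nearest_int_dist u = of_int n + 1 - u"
proof -
  show "nearest_int_dist u = u - of_int n" if "of_int n \<le> u" "u \<le> of_int n + 1/2"
  proof -
    have "\<lfloor>u\<rfloor> = n" using that by linarith
    then show ?thesis using that by (simp add: nearest_int_dist_frac frac_def)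
  qed
  show "nearest_int_dist u = of_int n + 1 - u" if "of_int n + 1/2 \<le> u" "u \<le> of_int n + 1"
  proof (cases "u = of_int n + 1")
    case True
    then have "frac u = 0" by simp
    then show ?thesis using True by (simp add: nearest_int_dist_frac)
  next
    case False
    then have "\<lfloor>u\<rfloor> = n" using that by linarith
    then show ?thesis using that by (simp add: nearest_int_dist_frac frac_def)
  qed
qed

lemma nearest_int_dist_right:
  "\<exists>d>0. \<forall>t\<in>{0..d}. nearest_int_dist (u + t) = nearest_int_dist u + tent_slope u * t"
proof -
  define n where "n = \<lfloor>u\<rfloor>"
  have n: "of_int n \<le> u" "u < of_int n + 1" by (auto simp: n_def)
  show ?thesis
  proof (cases "u < of_int n + 1/2")
    case True
    then have "tent_slope u = 1" by (simp add: tent_slope_def frac_def n_def)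
    then show ?thesis using n True
      by (intro exI[of _ "of_int n + 1/2 - u"]) (auto simp: nearest_int_dist_shift(1)[of n])
  next
    case False
    then have "tent_slope u = -1" by (simp add: tent_slope_def frac_def n_def)
    then show ?thesis using n False
      by (intro exI[of _ "of_int n + 1 - u"]) (auto simp: nearest_int_dist_shift(2)[of n])
  qed
qed

text \<open>The kinks of the tent function are the half-integers, hence the zeros of the distance of \<open>2u\<close> to
  the integers.\<close>

lemma nearest_int_dist_no_kink:
  assumes "2 * \<bar>t\<bar> < nearest_int_dist (2 * u)"
  shows "nearest_int_dist (u + t) = nearest_int_dist u + tent_slope u * t"
proof -
  define n where "n = \<lfloor>u\<rfloor>"
  have n: "of_int n \<le> u" "u < of_int n + 1" by (auto simp: n_def)
  have k: "2 * \<bar>t\<bar> < \<bar>2 * u - of_int j\<bar>" for j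
    using assms nearest_int_dist_le_abs[of "2 * u" j] by linarith
  show ?thesis
  proof (cases "u < of_int n + 1/2")
    case True
    then have "tent_slope u = 1" by (simp add: tent_slope_def frac_def n_def)
    moreover have "of_int n \<le> u + t" "u + t \<le> of_int n + 1/2"
      using k[of "2 * n"] k[of "2 * n + 1"] n True by auto
    ultimately show ?thesis using n True by (simp add: nearest_int_dist_shift(1)[of n])
  next
    case False
    then have "tent_slope u = -1" by (simp add: tent_slope_def frac_def n_def)
    moreover have "of_int n + 1/2 \<le> u + t" "u + t \<le> of_int n + 1"
      using k[of "2 * n + 1"] k[of "2 * n + 2"] n False by auto
    ultimately show ?thesis using n False by (simp add: nearest_int_dist_shift(2)[of n])
  qed
qed

lemma psi_right_deriv_eq:
  assumes "r \<ge> 1"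
  shows "psi_right_deriv r k x = tent_slope (real r ^ (k - 1) * x)"
proof -
  define q where "q = real r ^ (k - 1)"
  have q: "0 < q" using assms by (simp add: q_def)
  obtain d where d: "d > 0" "\<And>t. t \<in> {0..d} \<Longrightarrow> nearest_int_dist (q * x + t) = nearest_int_dist (q * x) + tent_slope (q * x) * t"
    using nearest_int_dist_right by blast
  have "\<forall>\<^sub>F y in at_right x. y < x + d / q" 
    using d q by (intro eventually_at_right_real[of x "x + d / q", THEN eventually_mono]) auto
  then have ev: "\<forall>\<^sub>F y in at_right x. (psi r k y - psi r k x) / (y - x) = tent_slope (q * x)"
    using eventually_at_right_less[of x]
  proof eventually_elim
    case (elim y)
    have "q * y = q * x + q * (y - x)" by (simp add: algebra_simps)
    moreover have "q * (y - x) \<in> {0..d}" using elim q by (auto simp: field_simps)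
    ultimately have "nearest_int_dist (q * y) = nearest_int_dist (q * x) + tent_slope (q * x) * (q * (y - x))"
      using d(2) by simp
    moreover have "psi r k y - psi r k x = (nearest_int_dist (q * y) - nearest_int_dist (q * x)) / q"
      by (simp add: psi_def q_def diff_divide_distrib)
    ultimately have "psi r k y - psi r k x = tent_slope (q * x) * (y - x)"
      using q by simp
    then show ?case using elim by simp
  qed
  have "((\<lambda>y. (psi r k y - psi r k x) / (y - x)) \<longlongrightarrow> tent_slope (q * x)) (at_right x)"
    by (rule tendsto_eventually[OF ev])
  then have "(psi r k has_vector_derivative tent_slope (q * x)) (at_right x)"
    by (simp add: has_real_derivative_iff_has_vector_derivative[symmetric] has_field_derivative_iff)
  then show ?thesis unfolding psi_right_deriv_def q_def[symmetric]
    by (intro vector_derivative_within) (auto simp: trivial_limit_at_right_real)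
qed

section \<open>Lebesgue measure on the circle under multiplication by r\<close>

lemma circle_measure_integral:
  fixes K :: "real \<Rightarrow> 'b::{banach, second_countable_topology}"
  assumes "K \<in> borel_measurable borel"
  shows "(\<integral>x. K x \<partial>circle_measure) = (\<integral>x. indicator {0..<1} x *\<^sub>R K x \<partial>lborel)"
proof -
  have "(\<integral>x. K x \<partial>circle_measure) = (\<integral>x. indicator {0..<1} x *\<^sub>R K x \<partial>lebesgue)"
    unfolding circle_measure_def by (rule integral_restrict_space) simp
  also have "\<dots> = (\<integral>x. indicator {0..<1} x *\<^sub>R K x \<partial>lborel)"
    using assms by (intro integral_completion) measurable
  finally show ?thesis .
qed

lemma space_circle_measure [simp]: "space circle_measure = {0..<1}"
  by (simp add: circle_measure_def)

lemma prob_space_circle_measure: "prob_space circle_measure"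
  by (rule prob_spaceI) (simp add: circle_measure_def emeasure_restrict_space)

lemma borel_measurable_circle: "f \<in> borel_measurable borel \<Longrightarrow> f \<in> borel_measurable circle_measure"
  unfolding circle_measure_def by (intro measurable_restrict_space1 measurable_completion) auto

lemma circle_integrable:
  fixes K :: "real \<Rightarrow> 'b::{banach, second_countable_topology}"
  assumes "K \<in> borel_measurable borel" "\<And>x. norm (K x) \<le> B"
  shows "integrable circle_measure K"
proof -
  interpret prob_space circle_measure by (rule prob_space_circle_measure)
  show ?thesis using assms borel_measurable_circle by (intro integrable_const_bound[of _ B]) auto
qed

text \<open>Each of the \<open>r\<close> intervals of length \<open>1 / r\<close> is mapped affinely
  onto the circle. In dynamical terms the right-hand side is the transfer operator of multiplication
  by \<open>r\<close>: an average over the inverse branches.\<close>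

lemma circle_measure_branches:
  fixes K :: "real \<Rightarrow> 'b::{banach, second_countable_topology}"
  assumes K [measurable]: "K \<in> borel_measurable borel" and B: "\<And>x. norm (K x) \<le> B" and r: "r \<ge> 1"
  shows "(\<integral>x. K x \<partial>circle_measure) = (1 / real r) *\<^sub>R (\<Sum>i<r. \<integral>y. K ((y + real i) / real r) \<partial>circle_measure)"
proof -
  let ?I = "\<lambda>i. {real i / real r..<(real i + 1) / real r}"
  have rp: "0 < real r" using r by simp
  have ind: "indicator {0..<1} x = (\<Sum>i<r. indicator (?I i) x :: real)" for x
  proof (cases "x \<in> {0..<1}")
    case True
    define j where "j = nat \<lfloor>real r * x\<rfloor>"
    have j: "real j \<le> real r * x" "real r * x < real j + 1" using True rp by (auto simp: j_def)
    have "real r * x < real r" using True rp by simp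
    then have "j < r" using j by linarith
    have "x \<in> ?I i \<longleftrightarrow> i = j" for i
    proof
      assume "x \<in> ?I i"
      then have "real i \<le> real r * x" "real r * x < real i + 1" using rp by (auto simp: field_simps)
      with j show "i = j" by linarith
    qed (use j rp in \<open>auto simp: field_simps\<close>)
    then have "(\<Sum>i<r. indicator (?I i) x :: real) = (\<Sum>i<r. if i = j then 1 else 0)"
      by (intro sum.cong) (auto simp: indicator_def)
    then show ?thesis using True \<open>j < r\<close> by simp
  next
    case False
    have "x \<notin> ?I i" if "i < r" for i
    proof
      assume "x \<in> ?I i"
      then have "0 \<le> x" "x < (real i + 1) / real r" by (auto intro: order_trans[rotated])
      moreover have "(real i + 1) / real r \<le> 1" using that rp by (simp add: field_simps)
      ultimately show False using False by simp
    qed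
    then show ?thesis using False by simp
  qed
  have int: "integrable lborel (\<lambda>x. indicator (?I i) x *\<^sub>R K x)" for i
    using B by (intro integrableI_bounded_set_indicator[where B = B]) (auto simp: emeasure_lborel_Ico divide_right_mono)
  have "(\<integral>x. K x \<partial>circle_measure) = (\<integral>x. (\<Sum>i<r. indicator (?I i) x *\<^sub>R K x) \<partial>lborel)"
    by (simp add: circle_measure_integral ind scaleR_sum_left)
  also have "\<dots> = (\<Sum>i<r. \<integral>x. indicator (?I i) x *\<^sub>R K x \<partial>lborel)"
    by (rule Bochner_Integration.integral_sum) (rule int)
  also have "\<dots> = (\<Sum>i<r. (1 / real r) *\<^sub>R (\<integral>y. K ((y + real i) / real r) \<partial>circle_measure))"
  proof (rule sum.cong[OF refl])
    fix i
    have "(\<integral>x. indicator (?I i) x *\<^sub>R K x \<partial>lborel) =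
      \<bar>1 / real r\<bar> *\<^sub>R (\<integral>y. indicator (?I i) (real i / real r + 1 / real r * y) *\<^sub>R K (real i / real r + 1 / real r * y) \<partial>lborel)"
      using rp by (intro lborel_integral_real_affine) simp
    also have "(\<lambda>y. indicator (?I i) (real i / real r + 1 / real r * y) *\<^sub>R K (real i / real r + 1 / real r * y)) =
      (\<lambda>y. indicator {0..<1} y *\<^sub>R K ((y + real i) / real r))"
    proof
      fix y
      have "real i / real r + 1 / real r * y = (y + real i) / real r" by (simp add: add_divide_distrib)
      moreover have "(y + real i) / real r \<in> ?I i \<longleftrightarrow> y \<in> {0..<1}" using rp by (auto simp: divide_le_cancel divide_less_cancel)
      ultimately show "indicator (?I i) (real i / real r + 1 / real r * y) *\<^sub>R K (real i / real r + 1 / real r * y) = indicator {0..<1} y *\<^sub>R K ((y + real i) / real r)"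
        by (simp add: indicator_def)
    qed
    also have "(\<integral>y. indicator {0..<1} y *\<^sub>R K ((y + real i) / real r) \<partial>lborel) = (\<integral>y. K ((y + real i) / real r) \<partial>circle_measure)"
      by (rule circle_measure_integral[symmetric]) measurable
    finally show "(\<integral>x. indicator (?I i) x *\<^sub>R K x \<partial>lborel) = (1 / real r) *\<^sub>R (\<integral>y. K ((y + real i) / real r) \<partial>circle_measure)"
      using rp by simp
  qed
  finally show ?thesis by (simp add: scaleR_sum_right)
qed

lemma circle_measure_mult:
  fixes H :: "real \<Rightarrow> 'b::{banach, second_countable_topology}"
  assumes H: "H \<in> borel_measurable borel" and B: "\<And>x. norm (H x) \<le> B" and r: "r \<ge> 1"
    and per: "\<And>x n. H (x + of_nat n) = H x"
  shows "(\<integral>x. H (real r * x) \<partial>circle_measure) = (\<integral>x. H x \<partial>circle_measure)"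
proof -
  note [measurable] = H
  have "(\<integral>x. H (real r * x) \<partial>circle_measure) = (1 / real r) *\<^sub>R (\<Sum>i<r. \<integral>y. H (real r * ((y + real i) / real r)) \<partial>circle_measure)"
    by (rule circle_measure_branches[OF _ B r]) measurable
  also have "\<dots> = (\<integral>x. H x \<partial>circle_measure)"
    using r by (simp add: per scaleR_conv_of_real sum_constant_scaleR)
  finally show ?thesis .
qed

definition chain_corr :: "nat \<Rightarrow> real" where
  "chain_corr r = (if even r then 0 else 1 / real r)"

text \<open>For even \<open>r\<close> half of the branches have slope 1 and half slope -1. For odd
  \<open>r\<close> the middle branch is left over; it lies in the first half of the circle exactly
  when \<open>y\<close> does and so reproduces the slope of \<open>y\<close>. Thus
  \<open>tent_slope\<close> is an eigenfunction of the transfer operator with eigenvalue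
  \<open>chain_corr r\<close>.\<close>

lemma sum_tent_slope:
  assumes y: "y \<in> {0..<1}" and r: "r \<ge> 1"
  shows "(\<Sum>i<r. tent_slope ((y + real i) / real r)) = real r * chain_corr r * tent_slope y"
proof -
  have rp: "0 < real r" using r by simp
  have sl: "tent_slope ((y + real i) / real r) = (if 2 * (y + real i) < real r then 1 else -1)" if "i < r" for i
  proof -
    have "real i + 1 \<le> real r" using that by linarith
    then have "(y + real i) / real r < 1" "0 \<le> (y + real i) / real r" using y rp by (auto simp: field_simps)
    then have "frac ((y + real i) / real r) = (y + real i) / real r" by (simp add: frac_eq)
    then show ?thesis unfolding tent_slope_def using rp by (simp only:) (simp add: field_simps)
  qed
  have sy: "tent_slope y = (if y < 1/2 then 1 else -1)" using y by (simp add: tent_slope_def frac_eq)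
  obtain m where m: "r = 2 * m \<or> r = 2 * m + 1" by (metis oddE evenE)
  have s1: "(\<Sum>i<m. tent_slope ((y + real i) / real r)) = real m"
  proof -
    have "tent_slope ((y + real i) / real r) = 1" if "i < m" for i
    proof -
      have "real i + 1 \<le> real m" using that by linarith
      then show ?thesis using sl[of i] m that y by auto
    qed
    then show ?thesis by simp
  qed
  from m show ?thesis
  proof
    assume r2: "r = 2 * m"
    have "tent_slope ((y + real i) / real r) = -1" if "i \<in> {m..<r}" for i
    proof -
      have "real m \<le> real i" using that by simp
      then show ?thesis using sl[of i] r2 that y by auto
    qed
    then have "(\<Sum>i\<in>{m..<r}. tent_slope ((y + real i) / real r)) = - real m" using r2 by simp
    moreover have "(\<Sum>i<r. tent_slope ((y + real i) / real r)) = (\<Sum>i<m. tent_slope ((y + real i) / real r)) + (\<Sum>i\<in>{m..<r}. tent_slope ((y + real i) / real r))"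
      unfolding lessThan_atLeast0 using r2 by (intro sum.atLeastLessThan_concat[symmetric]) auto
    ultimately show ?thesis using s1 r2 by (simp add: chain_corr_def)
  next
    assume r2: "r = 2 * m + 1"
    have "tent_slope ((y + real i) / real r) = -1" if "i \<in> {Suc m..<r}" for i
    proof -
      have "real m + 1 \<le> real i" using that by (simp add: less_eq_Suc_le flip: of_nat_Suc)
      then show ?thesis using sl[of i] r2 that y by auto
    qed
    then have "(\<Sum>i\<in>{Suc m..<r}. tent_slope ((y + real i) / real r)) = - real m" using r2 by simp
    moreover have "tent_slope ((y + real m) / real r) = tent_slope y" using sl[of m] r2 sy by auto
    moreover have "(\<Sum>i<r. tent_slope ((y + real i) / real r)) = (\<Sum>i<Suc m. tent_slope ((y + real i) / real r)) + (\<Sum>i\<in>{Suc m..<r}. tent_slope ((y + real i) / real r))"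
      unfolding lessThan_atLeast0 using r2 by (intro sum.atLeastLessThan_concat[symmetric]) auto
    ultimately show ?thesis using s1 r2 rp by (simp add: chain_corr_def)
  qed
qed

lemma circle_measure_slope_mult:
  fixes H :: "real \<Rightarrow> complex"
  assumes H: "H \<in> borel_measurable borel" and B: "\<And>x. norm (H x) \<le> B" and r: "r \<ge> 1"
    and per: "\<And>x n. H (x + of_nat n) = H x"
  shows "(\<integral>x. of_real (tent_slope x) * H (real r * x) \<partial>circle_measure)
    = of_real (chain_corr r) * (\<integral>x. of_real (tent_slope x) * H x \<partial>circle_measure)"
proof -
  note [measurable] = H
  have nB: "norm (of_real (tent_slope x) * H z) \<le> B" for x z
    using B[of z] tent_slope_cases[of x] by (auto simp: norm_mult)
  have "(\<integral>x. of_real (tent_slope x) * H (real r * x) \<partial>circle_measure)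
    = (1 / real r) *\<^sub>R (\<Sum>i<r. \<integral>y. of_real (tent_slope ((y + real i) / real r)) * H (real r * ((y + real i) / real r)) \<partial>circle_measure)"
    by (rule circle_measure_branches[OF _ nB r]) measurable
  also have "\<dots> = (1 / real r) *\<^sub>R (\<Sum>i<r. \<integral>y. of_real (tent_slope ((y + real i) / real r)) * H y \<partial>circle_measure)"
    using r by (simp add: per)
  also have "(\<Sum>i<r. \<integral>y. of_real (tent_slope ((y + real i) / real r)) * H y \<partial>circle_measure)
    = (\<integral>y. (\<Sum>i<r. of_real (tent_slope ((y + real i) / real r)) * H y) \<partial>circle_measure)"
    by (intro Bochner_Integration.integral_sum[symmetric] circle_integrable[OF _ nB]) measurable
  also have "\<dots> = (\<integral>y. of_real (real r * chain_corr r) * (of_real (tent_slope y) * H y) \<partial>circle_measure)"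
  proof (rule Bochner_Integration.integral_cong[OF refl])
    fix y assume "y \<in> space circle_measure"
    then have "(\<Sum>i<r. tent_slope ((y + real i) / real r)) = real r * chain_corr r * tent_slope y"
      using r by (intro sum_tent_slope) auto
    from arg_cong[OF this, of complex_of_real]
    show "(\<Sum>i<r. of_real (tent_slope ((y + real i) / real r)) * H y) = of_real (real r * chain_corr r) * (of_real (tent_slope y) * H y)"
      by (simp flip: sum_distrib_right)
  qed
  finally show ?thesis using r by (simp add: scaleR_conv_of_real)
qed

definition slope_seq :: "nat \<Rightarrow> nat \<Rightarrow> real \<Rightarrow> real" where
  "slope_seq r k x = (case k of 0 \<Rightarrow> 0 | Suc j \<Rightarrow> tent_slope (real r ^ j * x))"

text \<open>The slopes of \<open>slope_seq\<close> as a list, because its recursion at the head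
  follows the dynamics: dropping the first slope moves the point from \<open>x\<close> to
  \<open>r * x\<close>.\<close>

definition slope_list :: "nat \<Rightarrow> nat \<Rightarrow> real \<Rightarrow> real list" where
  "slope_list r k x = map (\<lambda>i. tent_slope (real r ^ i * x)) [0..<k]"

lemma slope_list_0 [simp]: "slope_list r 0 x = []"
  by (simp add: slope_list_def)

lemma slope_list_Suc: "slope_list r (Suc k) x = tent_slope x # slope_list r k (real r * x)"
  by (simp add: slope_list_def map_upt_Suc mult_ac del: upt_Suc)

lemma slope_list_periodic: "slope_list r k (x + of_nat n) = slope_list r k x"
proof -
  have "tent_slope (real r ^ i * (x + of_nat n)) = tent_slope (real r ^ i * x)" for i
    using tent_slope_add_nat[of "real r ^ i * x" "r ^ i * n"] by (simp add: algebra_simps)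
  then show ?thesis by (simp add: slope_list_def)
qed

lemma slope_list_measurable:
  fixes F :: "real list \<Rightarrow> 'b::real_normed_vector"
  shows "(\<lambda>x. F (slope_list r k x)) \<in> borel_measurable borel \<and> (\<exists>B. \<forall>x. norm (F (slope_list r k x)) \<le> B)"
proof (induction k arbitrary: F)
  case (Suc k)
  from Suc.IH[of "\<lambda>l. F (1 # l)"] Suc.IH[of "\<lambda>l. F (-1 # l)"]
  obtain B B' where m [measurable]: "(\<lambda>x. F (1 # slope_list r k x)) \<in> borel_measurable borel" "(\<lambda>x. F (-1 # slope_list r k x)) \<in> borel_measurable borel"
    and B: "\<And>x. norm (F (1 # slope_list r k x)) \<le> B" "\<And>x. norm (F (-1 # slope_list r k x)) \<le> B'" by blast
  have eq: "F (slope_list r (Suc k) x) = (if tent_slope x = 1 then F (1 # slope_list r k (real r * x)) else F (-1 # slope_list r k (real r * x)))" for x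
    using tent_slope_cases[of x] by (auto simp: slope_list_Suc)
  have "(\<lambda>x. F (slope_list r (Suc k) x)) \<in> borel_measurable borel"
    unfolding eq using measurable_compose[OF _ m(1), of "\<lambda>x. real r * x" borel] measurable_compose[OF _ m(2), of "\<lambda>x. real r * x" borel]
    by (intro measurable_If) auto
  moreover have "norm (F (slope_list r (Suc k) x)) \<le> max B B'" for x
    unfolding eq using B[of "real r * x"] by auto
  ultimately show ?case by blast
qed auto

lemma tent_slope_mean: "(\<integral>x. complex_of_real (tent_slope x) \<partial>circle_measure) = 0"
proof -
  have "(\<integral>x. complex_of_real (tent_slope x) * 1 \<partial>circle_measure) = (1 / real 2) *\<^sub>R (\<Sum>i<2. \<integral>y. complex_of_real (tent_slope ((y + real i) / real 2)) * 1 \<partial>circle_measure)"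
    by (rule circle_measure_branches[where B = 1]) (measurable, auto simp: norm_mult tent_slope_def)
  also have "(\<Sum>i<2. \<integral>y. complex_of_real (tent_slope ((y + real i) / real 2)) * 1 \<partial>circle_measure) = (\<integral>y. (\<Sum>i<2. complex_of_real (tent_slope ((y + real i) / real 2)) * 1) \<partial>circle_measure)"
    by (intro Bochner_Integration.integral_sum[symmetric] circle_integrable[where B = 1]) (measurable, auto simp: norm_mult tent_slope_def)
  also have "\<dots> = (\<integral>y. 0 \<partial>circle_measure)"
  proof (rule Bochner_Integration.integral_cong[OF refl])
    fix y :: real assume "y \<in> space circle_measure"
    from arg_cong[OF sum_tent_slope[of y 2], of complex_of_real] this
    show "(\<Sum>i<2. complex_of_real (tent_slope ((y + real i) / real 2)) * 1) = 0" by (simp add: chain_corr_def)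
  qed
  finally show ?thesis by simp
qed

text \<open>Induction along the dynamics. Split as \<open>F0 + tent_slope x * F1\<close>, the
  function of the slopes has a part that depends on \<open>r * x\<close> only, treated by the
  invariance of the measure, and a part that carries the first slope, which the eigenvalue relation
  turns into a multiple of the slope at the next point.\<close>

lemma slope_chain_list:
  fixes F :: "real list \<Rightarrow> complex"
  assumes r: "r \<ge> 1"
  shows "(\<integral>x. F (slope_list r (Suc k) x) * of_real (tent_slope (real r ^ Suc k * x) - chain_corr r * tent_slope (real r ^ k * x)) \<partial>circle_measure) = 0"
proof (induction k arbitrary: F)
  note mb = slope_list_measurable
  have split: "F (tent_slope x # l) = (F (1 # l) + F (-1 # l)) / 2 + of_real (tent_slope x) * ((F (1 # l) - F (-1 # l)) / 2)" for F :: "real list \<Rightarrow> complex" and l x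
    using tent_slope_cases[of x] by (auto simp: field_simps)
  interpret prob_space circle_measure by (rule prob_space_circle_measure)
  have meas: "(\<lambda>x. of_real (tent_slope (c * x)) :: complex) \<in> borel_measurable borel" for c by measurable
  note mean = tent_slope_mean
  have meanR: "expectation tent_slope = 0" using mean by simp
  {
    case 0
    let ?c = "complex_of_real (chain_corr r)"
    have one: "(\<integral>x. complex_of_real (tent_slope (real r * x)) \<partial>circle_measure) = (\<integral>x. complex_of_real (tent_slope x) \<partial>circle_measure)"
      by (rule circle_measure_mult[where B = 1]) (measurable, simp add: tent_slope_def, rule r, rule arg_cong[OF tent_slope_add_nat])
    \<comment> \<open>The correlation of consecutive slopes, which the subtracted multiple of the
      earlier slope is there to cancel.\<close>
    have two: "(\<integral>x. complex_of_real (tent_slope x) * complex_of_real (tent_slope (real r * x)) \<partial>circle_measure) = ?c * (\<integral>x. complex_of_real (tent_slope x) * complex_of_real (tent_slope x) \<partial>circle_measure)"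
      by (rule circle_measure_slope_mult[where B = 1]) (measurable, simp add: tent_slope_def, rule r, rule arg_cong[OF tent_slope_add_nat])
    have sq: "complex_of_real (tent_slope x) * complex_of_real (tent_slope x) = 1" for x by (simp add: tent_slope_def)
    define A D where "A = (F [1] + F [-1]) / 2" and "D = (F [1] - F [-1]) / 2"
    have int1: "integrable circle_measure (\<lambda>x. a * complex_of_real (tent_slope (c * x)))" for a c
      by (rule circle_integrable[where B = "norm a"]) (measurable, simp add: norm_mult tent_slope_def)
    have int2: "integrable circle_measure (\<lambda>x. a * (complex_of_real (tent_slope x) * complex_of_real (tent_slope (c * x))))" for a c
      by (rule circle_integrable[where B = "norm a"]) (measurable, simp add: norm_mult tent_slope_def)
    note int = int1 int2
    have "(\<integral>x. F (slope_list r (Suc 0) x) * of_real (tent_slope (real r ^ Suc 0 * x) - chain_corr r * tent_slope (real r ^ 0 * x)) \<partial>circle_measure)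
      = (\<integral>x. A * complex_of_real (tent_slope (real r * x)) + D * (complex_of_real (tent_slope x) * complex_of_real (tent_slope (real r * x)))
         - A * ?c * complex_of_real (tent_slope (1 * x)) - D * ?c \<partial>circle_measure)"
    proof (rule Bochner_Integration.integral_cong[OF refl])
      fix x
      show "F (slope_list r (Suc 0) x) * of_real (tent_slope (real r ^ Suc 0 * x) - chain_corr r * tent_slope (real r ^ 0 * x))
        = A * complex_of_real (tent_slope (real r * x)) + D * (complex_of_real (tent_slope x) * complex_of_real (tent_slope (real r * x)))
         - A * ?c * complex_of_real (tent_slope (1 * x)) - D * ?c"
        using tent_slope_cases[of x] by (auto simp: slope_list_Suc A_def D_def field_simps)
    qed
    also have "\<dots> = A * (\<integral>x. complex_of_real (tent_slope (real r * x)) \<partial>circle_measure) + D * (\<integral>x. complex_of_real (tent_slope x) * complex_of_real (tent_slope (real r * x)) \<partial>circle_measure)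
         - A * ?c * (\<integral>x. complex_of_real (tent_slope (1 * x)) \<partial>circle_measure) - D * ?c"
      using int(1)[of A "real r"] int(2)[of D "real r"] int(1)[of "A * ?c" 1] by (simp add: prob_space[unfolded space_circle_measure])
    also have "\<dots> = 0" unfolding one two sq mean by (simp add: meanR prob_space[unfolded space_circle_measure])
    finally show ?case .
  next
    case (Suc k)
    define G where "G y = complex_of_real (tent_slope (real r ^ Suc k * y) - chain_corr r * tent_slope (real r ^ k * y))" for y
    have Gm [measurable]: "G \<in> borel_measurable borel" unfolding G_def by measurable
    have Gper: "G (x + of_nat n) = G x" for x n
    proof -
      have "tent_slope (real r ^ i * (x + of_nat n)) = tent_slope (real r ^ i * x)" for i
        using tent_slope_add_nat[of "real r ^ i * x" "r ^ i * n"] by (simp add: algebra_simps)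
      then show ?thesis unfolding G_def by presburger
    qed
    define BG where "BG = 1 + \<bar>chain_corr r\<bar>"
    have GB: "norm (G x) \<le> BG" for x
    proof -
      have "norm (G x) = \<bar>tent_slope (real r ^ Suc k * x) - chain_corr r * tent_slope (real r ^ k * x)\<bar>"
        unfolding G_def by (rule norm_of_real)
      also have "\<dots> \<le> \<bar>tent_slope (real r ^ Suc k * x)\<bar> + \<bar>chain_corr r * tent_slope (real r ^ k * x)\<bar>" by (rule abs_triangle_ineq4)
      also have "\<dots> \<le> 1 + \<bar>chain_corr r\<bar>" by (simp add: abs_mult tent_slope_def)
      finally show ?thesis by (simp add: BG_def)
    qed
    define F0 F1 where "F0 l = (F (1 # l) + F (-1 # l)) / 2" and "F1 l = (F (1 # l) - F (-1 # l)) / 2" for l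
    define H0 H1 where "H0 y = F0 (slope_list r (Suc k) y) * G y" and "H1 y = F1 (slope_list r (Suc k) y) * G y" for y
    obtain B0 B1 where B: "\<And>x. norm (F0 (slope_list r (Suc k) x)) \<le> B0" "\<And>x. norm (F1 (slope_list r (Suc k) x)) \<le> B1"
      using mb[of F0 r "Suc k"] mb[of F1 r "Suc k"] by blast
    have m0 [measurable]: "H0 \<in> borel_measurable borel" "H1 \<in> borel_measurable borel"
      unfolding H0_def H1_def using mb[of F0 r "Suc k"] mb[of F1 r "Suc k"] by auto
    have b0: "norm (H0 x) \<le> B0 * BG" "norm (H1 x) \<le> B1 * BG" for x
      unfolding H0_def H1_def norm_mult using B[of x] GB[of x] by (intro mult_mono order_trans[OF norm_ge_zero B(1)] order_trans[OF norm_ge_zero B(2)]; simp)+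
    have per: "H0 (x + of_nat n) = H0 x" "H1 (x + of_nat n) = H1 x" for x n
      unfolding H0_def H1_def by (simp_all add: slope_list_periodic Gper)
    have "F (slope_list r (Suc (Suc k)) x) * of_real (tent_slope (real r ^ Suc (Suc k) * x) - chain_corr r * tent_slope (real r ^ Suc k * x))
      = H0 (real r * x) + of_real (tent_slope x) * H1 (real r * x)" for x
    proof -
      have "of_real (tent_slope (real r ^ Suc (Suc k) * x) - chain_corr r * tent_slope (real r ^ Suc k * x)) = G (real r * x)"
        by (simp add: G_def mult_ac)
      moreover have "F (slope_list r (Suc (Suc k)) x) = F0 (slope_list r (Suc k) (real r * x)) + of_real (tent_slope x) * F1 (slope_list r (Suc k) (real r * x))"
        unfolding slope_list_Suc[of r "Suc k"] F0_def F1_def by (rule split)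
      ultimately show ?thesis by (simp only: H0_def H1_def distrib_right mult.assoc)
    qed
    then have "(\<integral>x. F (slope_list r (Suc (Suc k)) x) * of_real (tent_slope (real r ^ Suc (Suc k) * x) - chain_corr r * tent_slope (real r ^ Suc k * x)) \<partial>circle_measure)
      = (\<integral>x. H0 (real r * x) + of_real (tent_slope x) * H1 (real r * x) \<partial>circle_measure)" by simp
    also have "\<dots> = (\<integral>x. H0 (real r * x) \<partial>circle_measure) + (\<integral>x. of_real (tent_slope x) * H1 (real r * x) \<partial>circle_measure)"
    proof (rule Bochner_Integration.integral_add)
      show "integrable circle_measure (\<lambda>x. H0 (real r * x))"
        by (rule circle_integrable[of _ "B0 * BG"]) (measurable, rule b0)
      show "integrable circle_measure (\<lambda>x. of_real (tent_slope x) * H1 (real r * x))"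
        by (rule circle_integrable[of _ "B1 * BG"]) (measurable, use b0 in \<open>simp add: norm_mult tent_slope_def\<close>)
    qed
    also have "\<dots> = (\<integral>x. H0 x \<partial>circle_measure) + of_real (chain_corr r) * (\<integral>x. of_real (tent_slope x) * H1 x \<partial>circle_measure)"
      by (simp only: circle_measure_mult[OF m0(1) b0(1) r per(1)] circle_measure_slope_mult[OF m0(2) b0(2) r per(2)])
    also have "(\<integral>x. H0 x \<partial>circle_measure) = 0" unfolding H0_def G_def by (rule Suc.IH)
    also have "(\<integral>x. of_real (tent_slope x) * H1 x \<partial>circle_measure) = 0"
    proof -
      \<comment> \<open>The slope at the current point is the head of its list, so this factor is
        absorbed into the function to which the induction hypothesis is applied.\<close>
      have "of_real (tent_slope x) * H1 x = (\<lambda>l. of_real (hd l) * F1 l) (slope_list r (Suc k) x) * G x" for x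
        by (simp add: H1_def slope_list_Suc)
      then show ?thesis unfolding G_def using Suc.IH[of "\<lambda>l. of_real (hd l) * F1 l"] by simp
    qed
    finally show ?case by simp
  }
qed

lemma slope_seq_0 [simp]: "slope_seq r 0 x = 0"
  and slope_seq_Suc: "slope_seq r (Suc k) x = tent_slope (real r ^ k * x)"
  by (simp_all add: slope_seq_def)

lemma slope_seq_measurable: "slope_seq r k \<in> borel_measurable borel"
  by (cases k) (simp_all add: slope_seq_def[abs_def])

lemma slope_list_eq_iff: "slope_list r k x = slope_list r k y \<longleftrightarrow> (\<forall>i\<le>k. slope_seq r i x = slope_seq r i y)"
proof -
  have "slope_list r k x = slope_list r k y \<longleftrightarrow> (\<forall>j<k. tent_slope (real r ^ j * x) = tent_slope (real r ^ j * y))"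
    by (auto simp: slope_list_def)
  also have "\<dots> \<longleftrightarrow> (\<forall>i\<le>k. slope_seq r i x = slope_seq r i y)"
    unfolding less_Suc_eq_le[symmetric] All_less_Suc2 by (simp add: slope_seq_Suc)
  finally show ?thesis .
qed

lemma sign_chain_slope:
  assumes r: "r \<ge> 2"
  shows "sign_chain circle_measure (slope_seq r) (chain_corr r)"
proof (intro sign_chain.intro prob_space_circle_measure sign_chain_axioms.intro)
  show "slope_seq r k \<in> borel_measurable circle_measure" for k
    by (rule borel_measurable_circle[OF slope_seq_measurable])
  show "slope_seq r (Suc k) x = 1 \<or> slope_seq r (Suc k) x = -1" for k x
    by (simp add: slope_seq_Suc tent_slope_cases)
  show "0 \<le> chain_corr r" "chain_corr r \<le> 1/2" using r by (auto simp: chain_corr_def field_simps)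
  fix k and G :: "real \<Rightarrow> complex" assume G: "past (slope_seq r) k G"
  show "(\<integral>x. G x * complex_of_real (slope_seq r (Suc k) x - chain_corr r * slope_seq r k x) \<partial>circle_measure) = 0"
  proof (cases k)
    case 0
    then have "G x = G 0" for x using G by (auto simp: past_def)
    then have "G x * complex_of_real (slope_seq r (Suc k) x - chain_corr r * slope_seq r k x) = G 0 * complex_of_real (tent_slope x)" for x
      using 0 by (simp add: slope_seq_Suc)
    then show ?thesis using tent_slope_mean by simp
  next
    case (Suc j)
    \<comment> \<open>\<open>G\<close> read as a function of the list of slopes, through a chosen
      point with the given list.\<close>
    define F where "F l = G (SOME y. slope_list r (Suc j) y = l)" for l
    have GF: "G x = F (slope_list r (Suc j) x)" for x
    proof -
      obtain y where y: "y = (SOME y. slope_list r (Suc j) y = slope_list r (Suc j) x)" by simp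
      have "slope_list r (Suc j) y = slope_list r (Suc j) x"
        unfolding y by (rule someI[of _ x]) simp
      then have "\<forall>i\<le>k. slope_seq r i y = slope_seq r i x" unfolding slope_list_eq_iff Suc .
      then have "G y = G x" using G unfolding past_def by blast
      then show ?thesis by (simp add: F_def y)
    qed
    show ?thesis unfolding Suc slope_seq_Suc GF by (rule slope_chain_list) (use r in simp)
  qed
qed simp_all

section \<open>Second moments and growth of the coefficients\<close>

context sign_chain begin

lemma mart_second_moment: "(\<integral>x. (mart b n x)\<^sup>2 \<partial>M) = quad b n"
proof (induction n)
  case (Suc n)
  let ?b = "b (Suc n)"
  have p: "past s n (mart b n)" "past s n (\<lambda>x. (mart b n x)\<^sup>2)"
    by (rule past_mart past_comp[OF past_mart]; simp)+
  have m0: "(\<integral>x. mart b n x * mdiff (Suc n) x \<partial>M) = 0"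
    unfolding integral_next_real[OF p(1), of "\<lambda>u. u"] by (simp add: field_simps)
  have m2: "(\<integral>x. 1 * (mdiff (Suc n) x)\<^sup>2 \<partial>M) = cvar (Suc n)"
  proof -
    have "(\<integral>x. 1 * (mdiff (Suc n) x)\<^sup>2 \<partial>M) = (\<integral>x. 1 * ((1 + \<rho> * s n x) / 2 * (1 - \<rho> * s n x)\<^sup>2 + (1 - \<rho> * s n x) / 2 * (- 1 - \<rho> * s n x)\<^sup>2) \<partial>M)"
      by (rule integral_next_real[OF past_const])
    also have "\<dots> = (\<integral>x. cvar (Suc n) \<partial>M)"
    proof (rule Bochner_Integration.integral_cong[OF refl])
      fix x
      show "1 * ((1 + \<rho> * s n x) / 2 * (1 - \<rho> * s n x)\<^sup>2 + (1 - \<rho> * s n x) / 2 * (- 1 - \<rho> * s n x)\<^sup>2) = cvar (Suc n)"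
        unfolding cvar_eq[of n x] by (simp add: field_simps power2_eq_square)
    qed
    finally show ?thesis by (simp add: prob_space)
  qed
  have int: "integrable M (\<lambda>x. (mart b n x)\<^sup>2)" "integrable M (\<lambda>x. mart b n x * mdiff (Suc n) x)" "integrable M (\<lambda>x. (mdiff (Suc n) x)\<^sup>2)"
    by (rule past_integrable[of "Suc n"], rule past_comp[OF past_mart], simp)
      (rule past_integrable[of "Suc n"], rule past_comp2[OF past_mart past_mdiff], simp, simp,
       rule past_integrable[of "Suc n"], rule past_comp[OF past_mdiff], simp)
  have "(mart b (Suc n) x)\<^sup>2 = (mart b n x)\<^sup>2 + 2 * ?b * (mart b n x * mdiff (Suc n) x) + ?b\<^sup>2 * (mdiff (Suc n) x)\<^sup>2" for x
    by (simp add: mart_Suc power2_sum power_mult_distrib mult_ac)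
  then have "(\<integral>x. (mart b (Suc n) x)\<^sup>2 \<partial>M) = quad b n + 2 * ?b * 0 + ?b\<^sup>2 * cvar (Suc n)"
    using int m0 m2 Suc by simp
  then show ?case by (simp add: quad_Suc)
qed simp

end

locale takagi =
  fixes r :: nat and a :: "nat \<Rightarrow> real" and \<delta> :: real
  assumes r: "r \<ge> 2"
    and A_top: "filterlim (\<lambda>n. \<Sum>k=1..n. (a k)\<^sup>2) at_top sequentially"
    and delta: "0 < \<delta>" "\<delta> \<le> 1"
    and a_bigo: "(\<lambda>n. (a n)\<^sup>2) \<in> O(\<lambda>n. (\<Sum>k=1..n. (a k)\<^sup>2) powr (1 - \<delta>))"
begin

definition A :: "nat \<Rightarrow> real" where "A n = (\<Sum>k=1..n. (a k)\<^sup>2)"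

definition g :: real where "g = (1 - \<delta>) / 2"

text \<open>One series for two uses: it dominates \<open>b n\<close> because
  \<open>chain_corr r \<le> 1/2\<close>, and the terms of a difference quotient beyond the level
  \<open>n\<close> because \<open>r \<ge> 2\<close>.\<close>

definition tail :: "nat \<Rightarrow> real" where "tail n = (\<Sum>j. \<bar>a (n + j)\<bar> / 2 ^ j)"

definition b :: "nat \<Rightarrow> real" where "b n = (\<Sum>j. a (n + j) * chain_corr r ^ j)"

sublocale chain: sign_chain circle_measure "slope_seq r" "chain_corr r"
  by (rule sign_chain_slope[OF r])

lemma g: "0 \<le> g" "g < 1/2"
  using delta by (auto simp: g_def)

lemma A_Suc: "A (Suc n) = A n + (a (Suc n))\<^sup>2"
  by (simp add: A_def)

lemma A_mono: "m \<le> n \<Longrightarrow> A m \<le> A n"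
  unfolding A_def by (intro sum_mono2) auto

lemma A_nonneg: "0 \<le> A n"
  by (simp add: A_def sum_nonneg)

lemma A_lim: "filterlim A at_top sequentially"
  using A_top by (simp add: A_def[abs_def])

lemma A_ev: "eventually P at_top \<Longrightarrow> \<forall>\<^sub>F n in sequentially. P (A n)"
  by (rule filterlim_iff[THEN iffD1, OF A_lim, rule_format])

lemma a_le: "\<exists>C>0. \<forall>\<^sub>F n in sequentially. \<bar>a n\<bar> \<le> C * A n powr g"
proof -
  from a_bigo obtain c where c: "c > 0" "\<forall>\<^sub>F n in sequentially. norm ((a n)\<^sup>2) \<le> c * norm (A n powr (1 - \<delta>))"
    unfolding A_def by (rule landau_o.bigE)
  from c(2) have "\<forall>\<^sub>F n in sequentially. \<bar>a n\<bar> \<le> sqrt c * A n powr g"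
  proof eventually_elim
    case (elim n)
    have "A n powr (1 - \<delta>) = (A n powr g)\<^sup>2" by (simp add: g_def power2_eq_square flip: powr_add)
    then have "(a n)\<^sup>2 \<le> c * (A n powr g)\<^sup>2" using elim by simp
    then have "sqrt ((a n)\<^sup>2) \<le> sqrt (c * (A n powr g)\<^sup>2)" by (rule real_sqrt_le_mono)
    then show ?case by (simp add: real_sqrt_mult)
  qed
  then show ?thesis using c(1) by (intro exI[of _ "sqrt c"]) simp
qed

text \<open>Since \<open>2 * g < 1\<close>, the last square is at most a ninth of \<open>A\<close>
  for large indices. What matters is a ratio below 2, for it makes the series \<open>tail\<close>
  converge geometrically.\<close>

lemma A_growth: "\<forall>\<^sub>F n in sequentially. A (Suc n) \<le> 9/8 * A n"
proof -
  obtain C where C: "C > 0" "\<forall>\<^sub>F n in sequentially. \<bar>a n\<bar> \<le> C * A n powr g" using a_le by blast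
  have "\<forall>\<^sub>F u in at_top. (C * u powr g)\<^sup>2 \<le> 1/9 * u" using C g by real_asymp
  from A_ev[OF this] C(2) have "\<forall>\<^sub>F n in sequentially. (a n)\<^sup>2 \<le> 1/9 * A n"
  proof eventually_elim
    case (elim n)
    have "(a n)\<^sup>2 \<le> (C * A n powr g)\<^sup>2" using elim(2) C(1) by (intro abs_le_square_iff[THEN iffD1]) simp
    then show ?case using elim by linarith
  qed
  then have "\<forall>\<^sub>F n in sequentially. (a (Suc n))\<^sup>2 \<le> 1/9 * A (Suc n)"
    by (subst eventually_sequentially_Suc)
  then show ?thesis by eventually_elim (simp add: A_Suc)
qed

text \<open>The growth factor 9/8 against the weight 1/2 leaves a geometric series of ratio 9/16,
  with sum 16/7.\<close>

lemma tail_bound: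
  "\<exists>C>0. \<forall>\<^sub>F n in sequentially. summable (\<lambda>j. \<bar>a (n + j)\<bar> / 2 ^ j) \<and> tail n \<le> C * A n powr g"
proof -
  obtain C where C: "C > 0" "\<forall>\<^sub>F n in sequentially. \<bar>a n\<bar> \<le> C * A n powr g" using a_le by blast
  from eventually_conj[OF C(2) A_growth] obtain n0 where
    n0: "\<And>n. n0 \<le> n \<Longrightarrow> \<bar>a n\<bar> \<le> C * A n powr g" "\<And>n. n0 \<le> n \<Longrightarrow> A (Suc n) \<le> 9/8 * A n"
    unfolding eventually_sequentially by blast
  have "summable (\<lambda>j. \<bar>a (n + j)\<bar> / 2 ^ j) \<and> tail n \<le> 16/7 * C * A n powr g" if n: "n0 \<le> n" for n
  proof -
    have Aj: "A (n + j) \<le> (9/8) ^ j * A n" for j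
    proof (induction j)
      case (Suc j)
      have "A (Suc (n + j)) \<le> 9/8 * A (n + j)" using n by (intro n0(2)) simp
      then show ?case using Suc by simp
    qed simp
    have le: "\<bar>a (n + j)\<bar> / 2 ^ j \<le> C * A n powr g * (9/16) ^ j" for j
    proof -
      have "\<bar>a (n + j)\<bar> \<le> C * A (n + j) powr g" using n by (intro n0(1)) simp
      also have "\<dots> \<le> C * ((9/8) ^ j * A n) powr g"
        using C Aj[of j] A_nonneg g by (intro mult_left_mono powr_mono2) auto
      also have "\<dots> = C * (((9/8) ^ j) powr g * A n powr g)" using A_nonneg by (simp add: powr_mult)
      also have "((9/8) ^ j) powr g \<le> ((9/8::real) ^ j) powr 1" using g by (intro powr_mono) auto
      then have "C * (((9/8) ^ j) powr g * A n powr g) \<le> C * ((9/8) ^ j * A n powr g)"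
        using C by (intro mult_left_mono mult_right_mono) auto
      finally have "\<bar>a (n + j)\<bar> / 2 ^ j \<le> C * ((9/8) ^ j * A n powr g) / 2 ^ j" by (rule divide_right_mono) simp
      also have "\<dots> = C * A n powr g * (9/16) ^ j" by (simp add: power_divide field_simps flip: power_mult_distrib)
      finally show ?thesis .
    qed
    have geo: "(\<lambda>j. C * A n powr g * (9/16) ^ j) sums (C * A n powr g * (1 / (1 - 9/16)))"
      by (intro sums_mult geometric_sums) simp
    have sm: "summable (\<lambda>j. \<bar>a (n + j)\<bar> / 2 ^ j)"
      by (rule summable_comparison_test'[OF sums_summable[OF geo], of 0]) (use le in simp)
    have "tail n \<le> (\<Sum>j. C * A n powr g * (9/16) ^ j)"
      unfolding tail_def by (intro suminf_le le sm sums_summable[OF geo])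
    also have "\<dots> = 16/7 * C * A n powr g" using sums_unique[OF geo] by simp
    finally show ?thesis using sm by simp
  qed
  then show ?thesis using C(1) unfolding eventually_sequentially by (intro exI[of _ "16/7 * C"]) auto
qed

lemma a_summable: "summable (\<lambda>j. \<bar>a (n + j)\<bar> / 2 ^ j)"
proof -
  obtain N where "summable (\<lambda>j. \<bar>a (N + j)\<bar> / 2 ^ j)"
    using tail_bound by (metis (mono_tags, lifting) eventually_sequentially order_refl)
  then have "summable (\<lambda>j. (1 / 2 ^ N) * (\<bar>a (N + j)\<bar> / 2 ^ j))" by (rule summable_mult)
  then have "summable (\<lambda>j. \<bar>a (j + N)\<bar> / 2 ^ (j + N))" by (simp add: power_add add.commute mult.commute)
  then have "summable (\<lambda>j. \<bar>a j\<bar> / 2 ^ j)" by (subst (asm) summable_iff_shift)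
  then have "summable (\<lambda>j. \<bar>a (j + n)\<bar> / 2 ^ (j + n))" by (subst summable_iff_shift)
  then have "summable (\<lambda>j. 2 ^ n * (\<bar>a (j + n)\<bar> / 2 ^ (j + n)))" by (rule summable_mult)
  then show ?thesis by (simp add: power_add add.commute)
qed

lemma chain_corr_bounds: "0 \<le> chain_corr r" "chain_corr r \<le> 1/2"
  using chain.rho .

lemma b_term: "norm (a (n + j) * chain_corr r ^ j) \<le> \<bar>a (n + j)\<bar> / 2 ^ j"
proof -
  have "chain_corr r ^ j \<le> (1/2) ^ j" using chain_corr_bounds by (intro power_mono) auto
  then have "\<bar>a (n + j)\<bar> * chain_corr r ^ j \<le> \<bar>a (n + j)\<bar> * (1/2) ^ j" by (intro mult_left_mono) auto
  then show ?thesis using chain_corr_bounds by (simp add: abs_mult power_abs power_divide)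
qed

lemma b_summable: "summable (\<lambda>j. a (n + j) * chain_corr r ^ j)"
  by (rule summable_comparison_test'[OF a_summable, of 0]) (use b_term in simp)

lemma b_le_tail: "\<bar>b n\<bar> \<le> tail n"
proof -
  have sn: "summable (\<lambda>j. norm (a (n + j) * chain_corr r ^ j))"
    by (rule summable_comparison_test'[OF a_summable[of n], of 0]) (use b_term in simp)
  have "\<bar>b n\<bar> \<le> (\<Sum>j. norm (a (n + j) * chain_corr r ^ j))"
    unfolding b_def using summable_norm[OF sn] by simp
  also have "\<dots> \<le> tail n" unfolding tail_def by (intro suminf_le b_term sn a_summable)
  finally show ?thesis .
qed

lemma b_rec: "b n = a n + chain_corr r * b (Suc n)"
proof -
  have "b n = (\<Sum>j. a (n + Suc j) * chain_corr r ^ Suc j) + a (n + 0) * chain_corr r ^ 0"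
    unfolding b_def by (subst suminf_split_head[OF b_summable]) simp
  also have "(\<Sum>j. a (n + Suc j) * chain_corr r ^ Suc j) = (\<Sum>j. chain_corr r * (a (Suc n + j) * chain_corr r ^ j))"
    by (simp add: mult_ac)
  also have "\<dots> = chain_corr r * b (Suc n)" unfolding b_def by (rule suminf_mult[OF b_summable])
  finally show ?thesis by simp
qed

text \<open>Abel summation: inserting \<open>a n = b n - chain_corr r * b (Suc n)\<close> regroups
  the sum into martingale differences and one boundary term.\<close>

lemma w_sum_eq: "w_sum r a n x = chain.mart b n x - chain_corr r * b (Suc n) * slope_seq r n x"
proof -
  have "(\<Sum>k=1..n. a k * slope_seq r k x) = chain.mart b n x - chain_corr r * b (Suc n) * slope_seq r n x"
  proof (induction n)
    case (Suc n)
    have "a (Suc n) * slope_seq r (Suc n) x = b (Suc n) * slope_seq r (Suc n) x - chain_corr r * b (Suc (Suc n)) * slope_seq r (Suc n) x"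
      unfolding b_rec[of "Suc n"] by (simp add: distrib_right)
    moreover have "b (Suc n) * chain.mdiff (Suc n) x = b (Suc n) * slope_seq r (Suc n) x - chain_corr r * b (Suc n) * slope_seq r n x"
      by (simp add: chain.mdiff_def right_diff_distrib)
    ultimately show ?case using Suc by (simp add: chain.mart_Suc)
  qed simp
  moreover have "w_sum r a n x = (\<Sum>k=1..n. a k * slope_seq r k x)"
    unfolding w_sum_def
  proof (rule sum.cong[OF refl])
    fix k assume "k \<in> {1..n}"
    then obtain j where "k = Suc j" by (cases k) auto
    then show "a k * psi_right_deriv r k x = a k * slope_seq r k x"
      using r by (simp add: psi_right_deriv_eq slope_seq_Suc)
  qed
  ultimately show ?thesis by simp
qed

lemma tail_Suc_bound: "\<exists>C>0. \<forall>\<^sub>F n in sequentially. tail n \<le> C * A n powr g \<and> tail (Suc n) \<le> C * A n powr g"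
proof -
  obtain C where C: "C > 0" "\<forall>\<^sub>F n in sequentially. summable (\<lambda>j. \<bar>a (n + j)\<bar> / 2 ^ j) \<and> tail n \<le> C * A n powr g"
    using tail_bound by (elim exE conjE) (rule that)
  have t2: "tail (Suc n) \<le> 2 * tail n" for n
  proof -
    have "tail n = (\<Sum>j. \<bar>a (n + Suc j)\<bar> / 2 ^ Suc j) + \<bar>a (n + 0)\<bar> / 2 ^ 0"
      unfolding tail_def by (subst suminf_split_head[OF a_summable]) simp
    moreover have "(\<Sum>j. \<bar>a (n + Suc j)\<bar> / 2 ^ Suc j) = (\<Sum>j. 1/2 * (\<bar>a (Suc n + j)\<bar> / 2 ^ j))" by simp
    moreover have "\<dots> = 1/2 * tail (Suc n)" unfolding tail_def by (rule suminf_mult[OF a_summable])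
    ultimately show ?thesis by simp
  qed
  from C(2) have "\<forall>\<^sub>F n in sequentially. tail n \<le> 2 * C * A n powr g \<and> tail (Suc n) \<le> 2 * C * A n powr g"
  proof eventually_elim
    case (elim n)
    have "0 \<le> C * A n powr g" using C(1) by simp
    then show ?case using t2[of n] elim by linarith
  qed
  then show ?thesis using C(1) by (intro exI[of _ "2 * C"]) simp
qed

lemma b_Suc_small: "0 < e \<Longrightarrow> \<forall>\<^sub>F n in sequentially. (b (Suc n))\<^sup>2 \<le> e * A n"
proof -
  assume e: "0 < e"
  obtain C where C: "C > 0" "\<forall>\<^sub>F n in sequentially. tail n \<le> C * A n powr g \<and> tail (Suc n) \<le> C * A n powr g"
    using tail_Suc_bound by blast
  have "\<forall>\<^sub>F u in at_top. (C * u powr g)\<^sup>2 \<le> e * u" using C g e by real_asymp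
  from A_ev[OF this] C(2) show ?thesis
  proof eventually_elim
    case (elim n)
    have "\<bar>b (Suc n)\<bar> \<le> \<bar>C * A n powr g\<bar>" using b_le_tail[of "Suc n"] elim by linarith
    then have "(b (Suc n))\<^sup>2 \<le> (C * A n powr g)\<^sup>2" by (simp only: abs_le_square_iff)
    then show ?case using elim by linarith
  qed
qed

text \<open>The recursion \<open>b_rec\<close> bounds the sums of \<open>(a k)\<^sup>2\<close> and
  \<open>(b k)\<^sup>2\<close> by each other, because the squared correlation is at most 1/4; the
  boundary term \<open>b (Suc n)\<close> is negligible.\<close>

lemma quad_A: "\<forall>\<^sub>F n in sequentially. A n / 5 \<le> chain.quad b n \<and> chain.quad b n \<le> 5 * A n"
proof -
  have "\<forall>\<^sub>F n in sequentially. (b (Suc n))\<^sup>2 \<le> 1/2 * A n" by (rule b_Suc_small) simp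
  then show ?thesis
  proof eventually_elim
    case (elim n)
    define B where "B = (\<Sum>k=1..n. (b k)\<^sup>2)"
    define B' where "B' = (\<Sum>k=1..n. (b (Suc k))\<^sup>2)"
    have B': "B' \<le> B + (b (Suc n))\<^sup>2"
    proof -
      have "B' = (\<Sum>k=Suc 1..Suc n. (b k)\<^sup>2)" unfolding B'_def by (rule sum.shift_bounds_cl_Suc_ivl[symmetric])
      also have "\<dots> \<le> (\<Sum>k=1..Suc n. (b k)\<^sup>2)" by (intro sum_mono2) auto
      finally show ?thesis by (simp add: B_def)
    qed
    have sq: "(u + v)\<^sup>2 \<le> 2 * u\<^sup>2 + 2 * v\<^sup>2" for u v :: real
      using sum_squares_bound[of u v] by (simp add: power2_sum)
    have cc: "(chain_corr r * z)\<^sup>2 \<le> 1/4 * z\<^sup>2" for z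
      unfolding power_mult_distrib by (intro mult_right_mono chain.rho_sq) auto
    have "A n \<le> (\<Sum>k=1..n. 2 * (b k)\<^sup>2 + 1/2 * (b (Suc k))\<^sup>2)"
      unfolding A_def
    proof (rule sum_mono)
      fix k
      have "a k = b k + (- (chain_corr r * b (Suc k)))" using b_rec[of k] by simp
      then have "(a k)\<^sup>2 \<le> 2 * (b k)\<^sup>2 + 2 * (chain_corr r * b (Suc k))\<^sup>2" using sq[of "b k" "- (chain_corr r * b (Suc k))"] by simp
      then show "(a k)\<^sup>2 \<le> 2 * (b k)\<^sup>2 + 1/2 * (b (Suc k))\<^sup>2" using cc[of "b (Suc k)"] by simp
    qed
    then have 1: "A n \<le> 2 * B + 1/2 * B'" by (simp add: B_def B'_def sum.distrib sum_distrib_left)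
    have "B \<le> (\<Sum>k=1..n. 2 * (a k)\<^sup>2 + 1/2 * (b (Suc k))\<^sup>2)"
      unfolding B_def
    proof (rule sum_mono)
      fix k
      have "(b k)\<^sup>2 \<le> 2 * (a k)\<^sup>2 + 2 * (chain_corr r * b (Suc k))\<^sup>2" unfolding b_rec[of k] by (rule sq)
      then show "(b k)\<^sup>2 \<le> 2 * (a k)\<^sup>2 + 1/2 * (b (Suc k))\<^sup>2" using cc[of "b (Suc k)"] by simp
    qed
    then have 2: "B \<le> 2 * A n + 1/2 * B'" by (simp add: A_def B'_def sum.distrib sum_distrib_left)
    have 3: "3/4 * B \<le> chain.quad b n" "chain.quad b n \<le> B"
      unfolding B_def by (rule chain.quad_lower chain.quad_upper)+
    show ?case using 1 2 3 B' elim A_nonneg[of n] by linarith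
  qed
qed

lemma quad_lim: "filterlim (chain.quad b) at_top sequentially"
proof (rule filterlim_at_top_mono)
  show "filterlim (\<lambda>n. 1/5 * A n) at_top sequentially"
    by (rule filterlim_tendsto_pos_mult_at_top[OF tendsto_const _ A_lim]) simp
  show "\<forall>\<^sub>F n in sequentially. 1/5 * A n \<le> chain.quad b n"
    using quad_A by eventually_elim simp
qed

lemma b_small_ex: "\<exists>C>0. \<forall>\<^sub>F n in sequentially. \<forall>k\<in>{1..n}. \<bar>b k\<bar> \<le> C * chain.quad b n powr g"
proof -
  obtain C where C: "C > 0" "\<forall>\<^sub>F n in sequentially. tail n \<le> C * A n powr g \<and> tail (Suc n) \<le> C * A n powr g"
    using tail_Suc_bound by blast
  obtain n0 where n0: "\<And>n. n0 \<le> n \<Longrightarrow> tail n \<le> C * A n powr g" using C(2) unfolding eventually_sequentially by blast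
  define K where "K = (\<Sum>k\<le>n0. \<bar>b k\<bar>)"
  have K0: "0 \<le> K" by (simp add: K_def sum_nonneg)
  have "\<forall>\<^sub>F n in sequentially. 1 \<le> chain.quad b n" using quad_lim unfolding filterlim_at_top by blast
  with quad_A have "\<forall>\<^sub>F n in sequentially. \<forall>k\<in>{1..n}. \<bar>b k\<bar> \<le> (5 * C + K) * chain.quad b n powr g"
  proof eventually_elim
    case (elim n)
    have q1: "1 \<le> chain.quad b n powr g" using elim(2) g by (simp add: ge_one_powr_ge_zero)
    show ?case
    proof
      fix k assume k: "k \<in> {1..n}"
      show "\<bar>b k\<bar> \<le> (5 * C + K) * chain.quad b n powr g"
      proof (cases "k \<le> n0")
        case True
        have "\<bar>b k\<bar> \<le> K" unfolding K_def using True by (intro member_le_sum) auto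
        also have "\<dots> \<le> K * chain.quad b n powr g" using K0 q1 by (simp add: mult_le_cancel_left1)
        also have "\<dots> \<le> (5 * C + K) * chain.quad b n powr g" using C(1) by (intro mult_right_mono) auto
        finally show ?thesis .
      next
        case False
        have "\<bar>b k\<bar> \<le> C * A k powr g" using b_le_tail[of k] n0[of k] False by simp
        also have "\<dots> \<le> C * (5 * chain.quad b n) powr g"
          using k elim A_mono[of k n] A_nonneg g C(1) by (intro mult_left_mono powr_mono2) auto
        also have "\<dots> = C * (5 powr g * chain.quad b n powr g)" using chain.quad_nonneg by (simp add: powr_mult)
        also have "5 powr g \<le> 5 powr (1::real)" using g by (intro powr_mono) auto
        then have "C * (5 powr g * chain.quad b n powr g) \<le> C * (5 * chain.quad b n powr g)"
          using C(1) by (intro mult_left_mono mult_right_mono) auto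
        also have "\<dots> \<le> (5 * C + K) * chain.quad b n powr g" using K0 q1 by (simp add: algebra_simps)
        finally show ?thesis .
      qed
    qed
  qed
  then show ?thesis using C(1) K0 by (intro exI[of _ "5 * C + K"]) auto
qed

text \<open>A choice of the constant in \<open>b_small_ex\<close>, so that
  \<open>mart_growth\<close> can be instantiated with it.\<close>

definition Cb :: real where
  "Cb = (SOME C. C > 0 \<and> (\<forall>\<^sub>F n in sequentially. \<forall>k\<in>{1..n}. \<bar>b k\<bar> \<le> C * chain.quad b n powr g))"

lemma Cb: "Cb > 0" "\<forall>\<^sub>F n in sequentially. \<forall>k\<in>{1..n}. \<bar>b k\<bar> \<le> Cb * chain.quad b n powr g"
  using someI_ex[OF b_small_ex] by (auto simp: Cb_def)

sublocale mart_growth circle_measure "slope_seq r" "chain_corr r" b Cb g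
  by unfold_locales (rule quad_lim Cb g)+

text \<open>\<open>w_sum\<close> differs from the martingale by the boundary term, which is at most
  \<open>\<bar>b (Suc n)\<bar>\<close>; expanding the square leaves its own square and a cross
  term.\<close>

lemma V_bound: "\<bar>V_seq r a n - U n\<bar> \<le> 2 * \<bar>b (Suc n)\<bar> * sqrt (U n) + (b (Suc n))\<^sup>2"
proof -
  define c where "c = chain_corr r * b (Suc n)"
  have c: "\<bar>c\<bar> \<le> \<bar>b (Suc n)\<bar>" using chain_corr_bounds by (simp add: c_def abs_mult mult_left_le_one_le)
  define Y where "Y x = c\<^sup>2 * (slope_seq r n x)\<^sup>2 - 2 * c * (W n x * slope_seq r n x)" for x
  have s1: "\<bar>slope_seq r n x\<bar> \<le> 1" for x using chain.s_cases[of n x] by auto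
  have pY: "past (slope_seq r) n Y"
    unfolding Y_def by (rule past_comp2[OF chain.past_mart past_s]) auto
  have pW: "past (slope_seq r) n (\<lambda>x. (W n x)\<^sup>2)" by (rule past_comp[OF chain.past_mart]) simp
  have "V_seq r a n = (\<integral>x. (W n x)\<^sup>2 + Y x \<partial>circle_measure)"
    unfolding V_seq_def w_sum_eq by (simp add: Y_def c_def power2_diff power_mult_distrib algebra_simps)
  also have "\<dots> = U n + (\<integral>x. Y x \<partial>circle_measure)"
    by (simp add: chain.past_integrable[OF pY] chain.past_integrable[OF pW] chain.mart_second_moment)
  finally have "\<bar>V_seq r a n - U n\<bar> = \<bar>\<integral>x. Y x \<partial>circle_measure\<bar>" by simp
  also have "\<dots> \<le> (\<integral>x. \<bar>Y x\<bar> \<partial>circle_measure)" by (rule integral_abs_bound)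
  also have "\<dots> \<le> 2 * \<bar>c\<bar> * sqrt (U n) + c\<^sup>2"
  proof (cases "U n = 0")
    case False
    then have U: "0 < U n" using chain.quad_nonneg[of b n] by simp
    have "(\<integral>x. \<bar>Y x\<bar> \<partial>circle_measure) \<le> (\<integral>x. \<bar>c\<bar> * (sqrt (U n) + (W n x)\<^sup>2 / sqrt (U n)) + c\<^sup>2 \<partial>circle_measure)"
    proof (rule integral_mono)
      show "integrable circle_measure (\<lambda>x. \<bar>Y x\<bar>)" by (rule chain.past_integrable[OF past_comp[OF pY]])
      show "integrable circle_measure (\<lambda>x. \<bar>c\<bar> * (sqrt (U n) + (W n x)\<^sup>2 / sqrt (U n)) + c\<^sup>2)"
        by (rule chain.past_integrable[OF past_comp[OF pW]])
      fix x
      \<comment> \<open>The inequality between arithmetic and geometric mean does the work of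
        Cauchy-Schwarz: the integral of the right-hand side is
        \<open>2 * sqrt (U n)\<close>.\<close>
      have "2 * \<bar>W n x\<bar> \<le> sqrt (U n) + (W n x)\<^sup>2 / sqrt (U n)"
      proof -
        have "2 * sqrt (U n) * \<bar>W n x\<bar> \<le> (sqrt (U n))\<^sup>2 + \<bar>W n x\<bar>\<^sup>2" by (rule sum_squares_bound)
        then show ?thesis using U by (simp add: field_simps)
      qed
      moreover have "\<bar>W n x * slope_seq r n x\<bar> \<le> \<bar>W n x\<bar>" using s1[of x] by (simp add: abs_mult mult_left_le)
      ultimately have "\<bar>c\<bar> * (2 * \<bar>W n x * slope_seq r n x\<bar>) \<le> \<bar>c\<bar> * (sqrt (U n) + (W n x)\<^sup>2 / sqrt (U n))"
        by (intro mult_left_mono) auto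
      moreover have "c\<^sup>2 * (slope_seq r n x)\<^sup>2 \<le> c\<^sup>2" using s1[of x] by (simp add: mult_left_le abs_square_le_1)
      moreover have "\<bar>Y x\<bar> \<le> c\<^sup>2 * (slope_seq r n x)\<^sup>2 + \<bar>c\<bar> * (2 * \<bar>W n x * slope_seq r n x\<bar>)"
        unfolding Y_def by (rule order_trans[OF abs_triangle_ineq4]) (simp add: abs_mult)
      ultimately show "\<bar>Y x\<bar> \<le> \<bar>c\<bar> * (sqrt (U n) + (W n x)\<^sup>2 / sqrt (U n)) + c\<^sup>2" by linarith
    qed
    also have "\<dots> = \<bar>c\<bar> * (sqrt (U n) + U n / sqrt (U n)) + c\<^sup>2"
      using chain.past_integrable[OF pW] by (simp add: chain.mart_second_moment chain.prob_space[unfolded space_circle_measure])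
    also have "\<dots> = 2 * \<bar>c\<bar> * sqrt (U n) + c\<^sup>2" using U by (simp add: real_div_sqrt)
    finally show ?thesis .
  next
    case True
    have "(\<integral>x. (W n x)\<^sup>2 \<partial>circle_measure) = 0" using True chain.mart_second_moment by simp
    then have "AE x in circle_measure. (W n x)\<^sup>2 = 0"
      by (subst (asm) integral_nonneg_eq_0_iff_AE) (auto intro: chain.past_integrable[OF pW])
    then have "AE x in circle_measure. \<bar>Y x\<bar> \<le> c\<^sup>2"
      by eventually_elim (use s1 in \<open>simp add: Y_def abs_mult mult_left_le abs_square_le_1\<close>)
    then have "(\<integral>x. \<bar>Y x\<bar> \<partial>circle_measure) \<le> c\<^sup>2"
      by (intro chain.integral_le_const chain.past_integrable[OF past_comp[OF pY]])
    then show ?thesis using True by simp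
  qed
  also have "\<dots> \<le> 2 * \<bar>b (Suc n)\<bar> * sqrt (U n) + (b (Suc n))\<^sup>2"
    using c chain.quad_nonneg[of b n] by (intro add_mono mult_right_mono mult_left_mono) (auto simp: abs_le_square_iff)
  finally show ?thesis .
qed

lemma V_U_ratio: "(\<lambda>n. V_seq r a n / U n) \<longlonglongrightarrow> 1"
proof (rule tendstoI)
  fix e :: real assume e: "0 < e"
  define d where "d = min (e / 20) 1"
  have d: "0 < d" "d \<le> 1" "d \<le> e / 20" using e by (auto simp: d_def)
  have "\<forall>\<^sub>F n in sequentially. (b (Suc n))\<^sup>2 \<le> d\<^sup>2 / 5 * A n" using d by (intro b_Suc_small) simp
  moreover have "\<forall>\<^sub>F n in sequentially. 1 \<le> U n" using quad_lim unfolding filterlim_at_top by blast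
  ultimately show "\<forall>\<^sub>F n in sequentially. dist (V_seq r a n / U n) 1 < e"
    using quad_A
  proof eventually_elim
    case (elim n)
    have "(b (Suc n))\<^sup>2 \<le> d\<^sup>2 / 5 * (5 * U n)" using elim by (intro order_trans[OF elim(1)] mult_left_mono) auto
    then have b2: "(b (Suc n))\<^sup>2 \<le> (d * sqrt (U n))\<^sup>2" using elim by (simp add: power_mult_distrib)
    then have "\<bar>b (Suc n)\<bar> \<le> d * sqrt (U n)" by (intro power2_le_imp_le[of "\<bar>b (Suc n)\<bar>"]) (use b2 d elim in simp_all)
    then have "2 * \<bar>b (Suc n)\<bar> * sqrt (U n) \<le> 2 * (d * sqrt (U n)) * sqrt (U n)" using elim by (intro mult_right_mono mult_left_mono) auto
    also have "\<dots> = 2 * d * U n" using elim by simp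
    finally have "\<bar>V_seq r a n - U n\<bar> \<le> 2 * d * U n + d\<^sup>2 * U n"
      using V_bound[of n] b2 elim by (simp add: power_mult_distrib)
    also have "\<dots> \<le> 3 * d * U n"
    proof -
      have "d * (d * U n) \<le> 1 * (d * U n)" using d elim by (intro mult_right_mono) auto
      then show ?thesis by (simp add: power2_eq_square mult.assoc)
    qed
    finally have "\<bar>V_seq r a n - U n\<bar> / U n \<le> 3 * d" using elim by (simp add: pos_divide_le_eq)
    moreover have "V_seq r a n / U n - 1 = (V_seq r a n - U n) / U n" using elim by (simp add: diff_divide_distrib)
    ultimately show ?case using d e elim by (simp add: dist_real_def abs_divide)
  qed
qed

section \<open>Kinks near a point and the error of difference quotients\<close>

definition kink :: "nat \<Rightarrow> nat \<Rightarrow> real \<Rightarrow> bool" where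
  "kink j n x \<longleftrightarrow> nearest_int_dist (2 * (real r ^ j * x)) \<le> 2 * real r ^ j / real r ^ n"

lemma kink_measurable [measurable]: "Measurable.pred borel (kink j n)"
  unfolding kink_def[abs_def] by measurable

lemma rpos: "0 < real r" "1 \<le> real r" "2 \<le> real r"
  using r by auto

lemma small_dist_integral:
  assumes e: "0 \<le> e"
  shows "(\<integral>x. of_bool (nearest_int_dist (2 * x) \<le> e) \<partial>circle_measure) \<le> 2 * e"
proof -
  define J where "J x = (indicator {0..e/2} x + indicator {1/2 - e/2..1/2 + e/2} x + indicator {1 - e/2..1} x :: real)" for x
  have int: "integrable lborel (\<lambda>x. indicator {u..v} x :: real)" for u v :: real
    by (rule integrable_real_indicator) (auto simp: emeasure_lborel_Icc_eq)
  have "(\<integral>x. of_bool (nearest_int_dist (2 * x) \<le> e) \<partial>circle_measure) = (\<integral>x. indicator {0..<1} x *\<^sub>R (of_bool (nearest_int_dist (2 * x) \<le> e) :: real) \<partial>lborel)"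
    by (rule circle_measure_integral) measurable
  also have "\<dots> \<le> (\<integral>x. J x \<partial>lborel)"
  proof (rule integral_mono)
    show "integrable lborel (\<lambda>x. indicator {0..<1} x *\<^sub>R (of_bool (nearest_int_dist (2 * x) \<le> e) :: real))"
      by (rule integrableI_bounded_set_indicator[where B = 1]) auto
    show "integrable lborel J" unfolding J_def by (intro Bochner_Integration.integrable_add int)
    fix x :: real
    show "indicator {0..<1} x *\<^sub>R of_bool (nearest_int_dist (2 * x) \<le> e) \<le> J x"
    proof (cases "x \<in> {0..<1} \<and> nearest_int_dist (2 * x) \<le> e")
      case True
      define m where "m = round (2 * x)"
      have m: "\<bar>2 * x - of_int m\<bar> \<le> e" "\<bar>of_int m - 2 * x\<bar> \<le> 1/2" using True of_int_round_abs_le[of "2 * x"] by (auto simp: nearest_int_dist_def m_def)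
      then have "- 1 < (of_int m :: real)" "(of_int m :: real) < 3" using True by (simp_all, linarith+)
      then have "m = 0 \<or> m = 1 \<or> m = 2" by linarith
      then have "x \<in> {0..e/2} \<or> x \<in> {1/2 - e/2..1/2 + e/2} \<or> x \<in> {1 - e/2..1}"
        using m(1) True by (auto simp: abs_le_iff)
      then show ?thesis by (auto simp: J_def indicator_def)
    qed (auto simp: J_def)
  qed
  also have "\<dots> = e/2 + e + e/2"
    unfolding J_def using e by (simp add: int)
  finally show ?thesis by simp
qed

text \<open>The event is that the tent of frequency \<open>real r ^ j\<close> has a kink within
  distance \<open>1 / real r ^ n\<close> of \<open>x\<close>. Invariance of the measure reduces it
  to the tent itself, whose kinks in \<open>[0, 1]\<close> are 0, 1/2 and 1.\<close>

lemma kink_prob: "(\<integral>x. of_bool (kink j n x) \<partial>circle_measure) \<le> 4 * real r ^ j / real r ^ n"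
proof -
  define e where "e = 2 * real r ^ j / real r ^ n"
  define H where "H y = (of_bool (nearest_int_dist (2 * y) \<le> e) :: real)" for y
  have per: "H (x + of_nat n) = H x" for x n
    using nearest_int_dist_add_nat[of "2 * x" "2 * n"] by (simp add: H_def distrib_left)
  have "(\<integral>x. of_bool (kink j n x) \<partial>circle_measure) = (\<integral>x. H (real (r ^ j) * x) \<partial>circle_measure)"
    by (simp add: H_def kink_def e_def)
  also have "\<dots> = (\<integral>x. H x \<partial>circle_measure)"
    using r by (intro circle_measure_mult[where B = 1] per) (auto simp: H_def[abs_def])
  also have "\<dots> \<le> 2 * e" unfolding H_def using rpos by (intro small_dist_integral) (simp add: e_def)
  finally show ?thesis by (simp add: e_def)
qed

text \<open>At least 1, so that bounds valid for large indices extend to all indices by enlarging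
  the constant.\<close>

definition D :: "nat \<Rightarrow> real" where "D n = 1 + A n"

lemma D_ge: "1 \<le> D n"
  using A_nonneg by (simp add: D_def)

lemma D_mono: "m \<le> n \<Longrightarrow> D m \<le> D n"
  using A_mono by (simp add: D_def)

lemma D_Suc: "D (Suc n) = D n + (a (Suc n))\<^sup>2"
  by (simp add: D_def A_Suc)

lemma eventually_powr_bound:
  assumes "\<exists>C>0. \<forall>\<^sub>F n in sequentially. q n \<le> C * A n powr g" and p: "g \<le> p"
  shows "\<exists>C\<ge>0. \<forall>n. q n \<le> C * D n powr p"
proof -
  obtain C where C: "C > 0" and "\<forall>\<^sub>F n in sequentially. q n \<le> C * A n powr g" using assms(1) by auto
  then obtain n0 where n0: "\<And>n. n0 \<le> n \<Longrightarrow> q n \<le> C * A n powr g" unfolding eventually_sequentially by auto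
  define K where "K = (\<Sum>k\<le>n0. \<bar>q k\<bar>)"
  have K0: "0 \<le> K" by (simp add: K_def sum_nonneg)
  have "q n \<le> (C + K) * D n powr p" for n
  proof (cases "n \<le> n0")
    case True
    have "q n \<le> K * 1" unfolding K_def using member_le_sum[of n "{..n0}" "\<lambda>k. \<bar>q k\<bar>"] True by auto
    also have "\<dots> \<le> (C + K) * D n powr p" using K0 C D_ge[of n] p g by (intro mult_mono ge_one_powr_ge_zero) auto
    finally show ?thesis .
  next
    case False
    then have "q n \<le> C * A n powr g" by (intro n0) simp
    also have "\<dots> \<le> C * D n powr p"
    proof (rule mult_left_mono)
      have "A n powr g \<le> D n powr g" using A_nonneg[of n] g by (intro powr_mono2) (auto simp: D_def)
      also have "\<dots> \<le> D n powr p" using p D_ge[of n] by (intro powr_mono) auto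
      finally show "A n powr g \<le> D n powr p" .
    qed (use C in simp)
    also have "\<dots> \<le> (C + K) * D n powr p" using K0 by (intro mult_right_mono) auto
    finally show ?thesis .
  qed
  then show ?thesis using C K0 by (intro exI[of _ "C + K"]) auto
qed

text \<open>The exponent is a compromise. As \<open>(a n)\<^sup>2\<close> is of order at most
  \<open>D n powr (1 - \<delta>)\<close>, the weight at \<open>j\<close> is at most a multiple of
  \<open>(a (Suc j))\<^sup>2 / D (Suc j) powr (1 + \<delta> / 2)\<close> and hence summable; and the
  fourth root of \<open>D n powr (2 - \<delta> / 2)\<close> is \<open>D n powr gp\<close> with
  \<open>gp < 1/2\<close>.\<close>

definition wt :: "nat \<Rightarrow> real" where
  "wt j = (a (Suc j)) ^ 4 / D (Suc j) powr (2 - \<delta> / 2)"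

lemma wt_nonneg: "0 \<le> wt j"
  by (simp add: wt_def)

text \<open>The Abel--Dini argument: increments of \<open>D\<close> divided by \<open>D\<^sup>1\<^sup>+\<^sup>\<eta>\<close> telescope.\<close>

lemma wt_summable: "summable wt"
proof -
  define \<eta> where "\<eta> = \<delta> / 2"
  have eta: "0 < \<eta>" using delta by (simp add: \<eta>_def)
  obtain C where C: "C \<ge> 0" "\<And>n. \<bar>a n\<bar> \<le> C * D n powr g"
    using eventually_powr_bound[OF a_le, of g] by auto
  have dini: "(a (Suc j))\<^sup>2 * D (Suc j) powr (- 1 - \<eta>) \<le> (D j powr (- \<eta>) - D (Suc j) powr (- \<eta>)) / \<eta>" for j
  proof (cases "D j < D (Suc j)")
    case True
    have "\<exists>z>D j. z < D (Suc j) \<and> D (Suc j) powr (- \<eta>) - D j powr (- \<eta>) = (D (Suc j) - D j) * (- \<eta> * z powr (- \<eta> - 1))"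
    proof (rule MVT2[OF True])
      fix z assume "D j \<le> z" "z \<le> D (Suc j)"
      then have "0 < z" using D_ge[of j] by linarith
      then show "((\<lambda>z. z powr (- \<eta>)) has_real_derivative - \<eta> * z powr (- \<eta> - 1)) (at z)"
        by (auto intro!: derivative_eq_intros)
    qed
    then obtain z where z: "D j < z" "z < D (Suc j)" "D (Suc j) powr (- \<eta>) - D j powr (- \<eta>) = (D (Suc j) - D j) * (- \<eta> * z powr (- \<eta> - 1))"
      by blast
    have "D (Suc j) powr (- 1 - \<eta>) \<le> z powr (- \<eta> - 1)"
    proof -
      have e: "- 1 - \<eta> = - \<eta> - 1" by simp
      show ?thesis unfolding e using z D_ge[of j] eta by (intro powr_mono2') auto
    qed
    then have "(D (Suc j) - D j) * D (Suc j) powr (- 1 - \<eta>) \<le> (D (Suc j) - D j) * z powr (- \<eta> - 1)"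
      using True by (intro mult_left_mono) auto
    moreover have "(D (Suc j) - D j) * z powr (- \<eta> - 1) = (D j powr (- \<eta>) - D (Suc j) powr (- \<eta>)) / \<eta>"
      using z(3) eta by (simp add: field_simps)
    ultimately show ?thesis by (simp add: D_Suc)
  next
    case False
    then have "a (Suc j) = 0" using D_Suc[of j] zero_less_power2[of "a (Suc j)"] by (metis less_add_same_cancel1)
    then show ?thesis by (simp add: D_Suc)
  qed
  have le: "wt j \<le> C\<^sup>2 * ((D j powr (- \<eta>) - D (Suc j) powr (- \<eta>)) / \<eta>)" for j
  proof -
    let ?d = "D (Suc j)"
    have dp: "0 < ?d" using D_ge[of "Suc j"] by linarith
    have pe: "?d powr (1 - \<delta>) / ?d powr (2 - \<delta> / 2) = ?d powr (- 1 - \<eta>)"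
      using dp by (simp add: \<eta>_def flip: powr_diff)
    have "(a (Suc j))\<^sup>2 \<le> (C * ?d powr g)\<^sup>2"
      using C(2)[of "Suc j"] C(1) by (intro abs_le_square_iff[THEN iffD1]) simp
    also have "\<dots> = C\<^sup>2 * ?d powr (1 - \<delta>)" using dp by (simp add: power_mult_distrib power2_eq_square g_def flip: powr_add)
    finally have "(a (Suc j))\<^sup>2 * (a (Suc j))\<^sup>2 / ?d powr (2 - \<delta> / 2) \<le> (a (Suc j))\<^sup>2 * (C\<^sup>2 * ?d powr (1 - \<delta>)) / ?d powr (2 - \<delta> / 2)"
      by (intro divide_right_mono mult_left_mono) auto
    also have "\<dots> = C\<^sup>2 * ((a (Suc j))\<^sup>2 * (?d powr (1 - \<delta>) / ?d powr (2 - \<delta> / 2)))" by simp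
    also have "\<dots> = C\<^sup>2 * ((a (Suc j))\<^sup>2 * ?d powr (- 1 - \<eta>))" unfolding pe ..
    also have "\<dots> \<le> C\<^sup>2 * ((D j powr (- \<eta>) - D (Suc j) powr (- \<eta>)) / \<eta>)"
      by (intro mult_left_mono dini) simp
    finally show ?thesis by (simp add: wt_def power4_eq_xxxx power2_eq_square mult.assoc)
  qed
  have "filterlim D at_top sequentially"
    unfolding D_def[abs_def] by (rule filterlim_tendsto_add_at_top[OF tendsto_const A_lim])
  then have "(\<lambda>j. D j powr (- \<eta>)) \<longlonglongrightarrow> 0"
    using eta by (intro tendsto_neg_powr) auto
  then have "summable (\<lambda>j. D j powr (- \<eta>) - D (Suc j) powr (- \<eta>))" by (rule telescope_summable')
  then have "summable (\<lambda>j. C\<^sup>2 * ((D j powr (- \<eta>) - D (Suc j) powr (- \<eta>)) / \<eta>))"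
    by (intro summable_mult summable_divide)
  then show ?thesis by (rule summable_comparison_test'[of _ 0]) (use le wt_nonneg in auto)
qed

text \<open>The inverse sixth power of 19/20, left over from the Cauchy-Schwarz weights in
  \<open>Qsum_power4\<close>. It has to be below 2: then the kink probabilities, which decay at
  least like powers of 1/2, outweigh its powers.\<close>

definition kc :: real where "kc = (20/19) ^ 6"

text \<open>A tent without a kink inside the step contributes its slope exactly; this is the total
  weight of the other tents.\<close>

definition Qsum :: "nat \<Rightarrow> real \<Rightarrow> real" where
  "Qsum n x = (\<Sum>j<n. \<bar>a (Suc j)\<bar> * of_bool (kink j n x))"

lemma Qsum_nonneg: "0 \<le> Qsum n x"
  unfolding Qsum_def by (intro sum_nonneg) auto

text \<open>Two applications of the Cauchy--Schwarz inequality with geometric weights.\<close>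

lemma Qsum_power4:
  "(Qsum n x) ^ 4 \<le> 11 ^ 3 * (\<Sum>j<n. (a (Suc j)) ^ 4 * kc ^ (n - Suc j) * of_bool (kink j n x))"
proof -
  define s :: real where "s = 19/20"
  have s: "0 < s" "s < 1" by (auto simp: s_def)
  define l where "l j = n - Suc j" for j
  define u where "u j = \<bar>a (Suc j)\<bar> * (of_bool (kink j n x) :: real)" for j
  have u0: "0 \<le> u j" for j by (simp add: u_def)
  define G where "G = (\<Sum>j<n. (s ^ l j)\<^sup>2)"
  have G: "0 \<le> G" "G \<le> 11"
  proof -
    show "0 \<le> G" by (simp add: G_def sum_nonneg)
    have "G = (\<Sum>i<n. (s\<^sup>2) ^ (n - Suc i))" by (simp add: G_def l_def power_mult[symmetric] mult.commute)
    also have "\<dots> = (\<Sum>i<n. (s\<^sup>2) ^ i)" by (rule sum.nat_diff_reindex)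
    also have "\<dots> \<le> (\<Sum>i. (s\<^sup>2) ^ i)" by (intro sum_le_suminf summable_geometric) (auto simp: s_def power2_eq_square)
    also have "\<dots> = 1 / (1 - s\<^sup>2)" by (rule suminf_geometric) (simp add: s_def power2_eq_square)
    \<comment> \<open>The sum of the geometric series is 400/39.\<close>
    also have "\<dots> \<le> 11" by (simp add: s_def power2_eq_square)
    finally show "G \<le> 11" .
  qed
  define S2 where "S2 = (\<Sum>j<n. (u j)\<^sup>2 / (s ^ l j)\<^sup>2)"
  define S4 where "S4 = (\<Sum>j<n. (u j) ^ 4 / (s ^ l j) ^ 6)"
  have S0: "0 \<le> S2" "0 \<le> S4" by (auto simp: S2_def S4_def intro!: sum_nonneg)
  have "Qsum n x = (\<Sum>j<n. s ^ l j * (u j / s ^ l j))" using s by (simp add: Qsum_def u_def)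
  then have "(Qsum n x)\<^sup>2 \<le> (\<Sum>j<n. (s ^ l j)\<^sup>2) * (\<Sum>j<n. (u j / s ^ l j)\<^sup>2)"
    using Cauchy_Schwarz_ineq_sum[of "\<lambda>j. s ^ l j" "\<lambda>j. u j / s ^ l j" "{..<n}"] by simp
  then have 1: "(Qsum n x)\<^sup>2 \<le> G * S2" by (simp add: G_def S2_def power_divide)
  have "S2 = (\<Sum>j<n. s ^ l j * ((u j)\<^sup>2 / (s ^ l j) ^ 3))"
    unfolding S2_def using s by (intro sum.cong) (auto simp: power2_eq_square power3_eq_cube)
  then have "S2\<^sup>2 \<le> (\<Sum>j<n. (s ^ l j)\<^sup>2) * (\<Sum>j<n. ((u j)\<^sup>2 / (s ^ l j) ^ 3)\<^sup>2)"
    using Cauchy_Schwarz_ineq_sum[of "\<lambda>j. s ^ l j" "\<lambda>j. (u j)\<^sup>2 / (s ^ l j) ^ 3" "{..<n}"] by simp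
  also have "(\<Sum>j<n. ((u j)\<^sup>2 / (s ^ l j) ^ 3)\<^sup>2) = S4"
    unfolding S4_def by (intro sum.cong) (auto simp: power_divide power_mult[symmetric] mult.commute)
  finally have 2: "S2\<^sup>2 \<le> G * S4" by (simp add: G_def)
  have "(Qsum n x) ^ 4 = ((Qsum n x)\<^sup>2)\<^sup>2" by (simp flip: power_mult)
  also have "\<dots> \<le> (G * S2)\<^sup>2" using 1 by (intro power_mono) auto
  also have "\<dots> = G\<^sup>2 * S2\<^sup>2" by (simp add: power_mult_distrib)
  also have "\<dots> \<le> G\<^sup>2 * (G * S4)" using 2 by (intro mult_left_mono) auto
  also have "\<dots> = G ^ 3 * S4" by (simp add: power2_eq_square power3_eq_cube)
  also have "\<dots> \<le> 11 ^ 3 * S4" using G S0 by (intro mult_right_mono power_mono) auto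
  also have "S4 = (\<Sum>j<n. (a (Suc j)) ^ 4 * kc ^ (n - Suc j) * of_bool (kink j n x))"
    unfolding S4_def
  proof (intro sum.cong refl)
    fix j
    have "(s ^ l j) ^ 6 = (s ^ 6) ^ l j" by (simp add: mult.commute flip: power_mult)
    moreover have "1 / (s ^ 6) ^ l j = kc ^ l j"
      by (simp add: kc_def s_def power_divide flip: power_mult)
    ultimately have "(u j) ^ 4 / (s ^ l j) ^ 6 = (u j) ^ 4 * kc ^ l j" by (metis (no_types, lifting) mult.right_neutral times_divide_eq_right)
    then show "(u j) ^ 4 / (s ^ l j) ^ 6 = (a (Suc j)) ^ 4 * kc ^ (n - Suc j) * of_bool (kink j n x)"
      by (simp add: u_def l_def power_mult_distrib)
  qed
  finally show ?thesis .
qed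

text \<open>A single random variable for all scales, where \<open>l = n - Suc j\<close> is the
  distance between the scale \<open>n\<close> and the level of the kink. With values in
  \<open>ennreal\<close> it needs no prior convergence, and a finite integral makes it finite almost
  everywhere.\<close>

definition Zsum :: "real \<Rightarrow> ennreal" where
  "Zsum x = (\<Sum>j. \<Sum>l. ennreal (wt j * kc ^ l * of_bool (kink j (Suc j + l) x)))"

lemma Zsum_finite: "AE x in circle_measure. Zsum x \<noteq> \<infinity>"
proof (rule nn_integral_PInf_AE)
  have [measurable]: "Measurable.pred circle_measure (kink j n)" for j n
    using borel_measurable_circle[of "\<lambda>x. of_bool (kink j n x) :: real"]
  proof -
    have "(\<lambda>x. of_bool (kink j n x) :: real) \<in> borel_measurable circle_measure" by (rule borel_measurable_circle) measurable
    then have "Measurable.pred circle_measure (\<lambda>x. (of_bool (kink j n x) :: real) = 1)" by measurable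
    then show ?thesis by simp
  qed
  show "Zsum \<in> borel_measurable circle_measure" unfolding Zsum_def[abs_def] by measurable
  have kc: "1 < kc" "kc < 2" by (auto simp: kc_def power_divide)
  have k1: "(\<integral>\<^sup>+x. ennreal (wt j * kc ^ l * of_bool (kink j (Suc j + l) x)) \<partial>circle_measure) \<le> ennreal (wt j) * ennreal (2 * (kc / 2) ^ l)" for j l
  proof -
    have "(\<integral>\<^sup>+x. ennreal (wt j * kc ^ l * of_bool (kink j (Suc j + l) x)) \<partial>circle_measure) = ennreal (\<integral>x. wt j * kc ^ l * of_bool (kink j (Suc j + l) x) \<partial>circle_measure)"
    proof (rule nn_integral_eq_integral)
      show "integrable circle_measure (\<lambda>x. wt j * kc ^ l * of_bool (kink j (Suc j + l) x))"
        using wt_nonneg[of j] kc by (intro circle_integrable[of _ "wt j * kc ^ l"]) auto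
    qed (use wt_nonneg[of j] kc in auto)
    also have "\<dots> \<le> ennreal (wt j * (2 * (kc / 2) ^ l))"
    proof (rule ennreal_leI)
      have "(\<integral>x. wt j * kc ^ l * of_bool (kink j (Suc j + l) x) \<partial>circle_measure) = wt j * kc ^ l * (\<integral>x. of_bool (kink j (Suc j + l) x) \<partial>circle_measure)" by simp
      also have "\<dots> \<le> wt j * kc ^ l * (4 * real r ^ j / real r ^ (Suc j + l))"
        using wt_nonneg[of j] kc by (intro mult_left_mono kink_prob) auto
      also have "4 * real r ^ j / real r ^ (Suc j + l) = 4 / (real r * real r ^ l)" using rpos by (simp add: power_add)
      also have "\<dots> \<le> 4 / (2 * 2 ^ l)" using rpos by (intro divide_left_mono mult_mono power_mono) auto
      finally have "(\<integral>x. wt j * kc ^ l * of_bool (kink j (Suc j + l) x) \<partial>circle_measure) \<le> wt j * kc ^ l * (4 / (2 * 2 ^ l))"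
        using wt_nonneg[of j] kc by (simp add: mult_left_mono)
      also have "\<dots> = wt j * (2 * (kc / 2) ^ l)" by (simp add: power_divide)
      finally show "(\<integral>x. wt j * kc ^ l * of_bool (kink j (Suc j + l) x) \<partial>circle_measure) \<le> wt j * (2 * (kc / 2) ^ l)" .
    qed
    finally show ?thesis using wt_nonneg[of j] by (simp add: ennreal_mult')
  qed
  have "(\<integral>\<^sup>+x. Zsum x \<partial>circle_measure) = (\<Sum>j. \<Sum>l. \<integral>\<^sup>+x. ennreal (wt j * kc ^ l * of_bool (kink j (Suc j + l) x)) \<partial>circle_measure)"
    unfolding Zsum_def by (simp add: nn_integral_suminf)
  also have "\<dots> \<le> (\<Sum>j. \<Sum>l. ennreal (wt j) * ennreal (2 * (kc / 2) ^ l))"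
    by (intro suminf_le k1) auto
  also have "\<dots> = (\<Sum>j. ennreal (wt j)) * (\<Sum>l. ennreal (2 * (kc / 2) ^ l))"
    by (simp add: ennreal_suminf_cmult ennreal_suminf_multc)
  also have "\<dots> = ennreal (\<Sum>j. wt j) * ennreal (\<Sum>l. 2 * (kc / 2) ^ l)"
    using wt_nonneg wt_summable kc by (subst (1 2) suminf_ennreal2) (auto intro!: summable_mult summable_geometric)
  finally show "(\<integral>\<^sup>+x. Zsum x \<partial>circle_measure) \<noteq> \<infinity>" by (metis ennreal_mult_less_top ennreal_less_top infinity_ennreal_def leD top.not_eq_extremum)
qed

definition gp :: real where "gp = 1/2 - \<delta> / 8"

lemma gp: "g \<le> gp" "0 \<le> gp" "gp < 1/2"
  using delta by (auto simp: gp_def g_def)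

lemma Qsum_bound: "AE x in circle_measure. \<exists>C\<ge>0. \<forall>n. Qsum n x \<le> C * D n powr gp"
  using Zsum_finite
proof eventually_elim
  case (elim x)
  define z where "z = enn2real (Zsum x)"
  have z: "Zsum x = ennreal z" "0 \<le> z" using elim by (auto simp: z_def top.not_eq_extremum)
  have kc: "0 < kc" by (simp add: kc_def)
  have "Qsum n x \<le> (11 ^ 3 * z) powr (1/4) * D n powr gp" for n
  proof -
    have wz: "(\<Sum>j<n. wt j * kc ^ (n - Suc j) * of_bool (kink j n x)) \<le> z"
    proof -
      have "ennreal (\<Sum>j<n. wt j * kc ^ (n - Suc j) * of_bool (kink j n x)) = (\<Sum>j<n. ennreal (wt j * kc ^ (n - Suc j) * of_bool (kink j n x)))"
        using wt_nonneg kc by (subst sum_ennreal) auto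
      also have "\<dots> \<le> (\<Sum>j<n. \<Sum>l. ennreal (wt j * kc ^ l * of_bool (kink j (Suc j + l) x)))"
      proof (rule sum_mono)
        fix j assume "j \<in> {..<n}"
        then have n: "Suc j + (n - Suc j) = n" by simp
        have "(\<Sum>l\<in>{n - Suc j}. ennreal (wt j * kc ^ l * of_bool (kink j (Suc j + l) x))) \<le> (\<Sum>l. ennreal (wt j * kc ^ l * of_bool (kink j (Suc j + l) x)))"
          by (rule sum_le_suminf) auto
        then show "ennreal (wt j * kc ^ (n - Suc j) * of_bool (kink j n x)) \<le> (\<Sum>l. ennreal (wt j * kc ^ l * of_bool (kink j (Suc j + l) x)))"
          using n by simp
      qed
      also have "\<dots> \<le> Zsum x" unfolding Zsum_def by (rule sum_le_suminf) auto
      finally show ?thesis using z by simp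
    qed
    have dp: "0 < D n" using D_ge[of n] by linarith
    \<comment> \<open>\<open>D\<close> is monotone, so the denominators of the weights before
      \<open>n\<close> are traded for one power of \<open>D n\<close>.\<close>
    have "(\<Sum>j<n. (a (Suc j)) ^ 4 * kc ^ (n - Suc j) * of_bool (kink j n x)) \<le> D n powr (2 - \<delta> / 2) * (\<Sum>j<n. wt j * kc ^ (n - Suc j) * of_bool (kink j n x))"
      unfolding sum_distrib_left
    proof (rule sum_mono)
      fix j assume "j \<in> {..<n}"
      then have Dj: "D (Suc j) powr (2 - \<delta> / 2) \<le> D n powr (2 - \<delta> / 2)"
        using D_mono[of "Suc j" n] D_ge[of "Suc j"] delta by (intro powr_mono2) auto
      have "(a (Suc j)) ^ 4 = D (Suc j) powr (2 - \<delta> / 2) * wt j" using D_ge[of "Suc j"] by (simp add: wt_def)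
      also have "\<dots> \<le> D n powr (2 - \<delta> / 2) * wt j" by (intro mult_right_mono Dj wt_nonneg)
      finally have "(a (Suc j)) ^ 4 * (kc ^ (n - Suc j) * of_bool (kink j n x)) \<le> D n powr (2 - \<delta> / 2) * wt j * (kc ^ (n - Suc j) * of_bool (kink j n x))"
        using kc by (intro mult_right_mono) auto
      then show "(a (Suc j)) ^ 4 * kc ^ (n - Suc j) * of_bool (kink j n x) \<le> D n powr (2 - \<delta> / 2) * (wt j * kc ^ (n - Suc j) * of_bool (kink j n x))"
        by (simp only: mult.assoc)
    qed
    also have "\<dots> \<le> D n powr (2 - \<delta> / 2) * z" using wz by (intro mult_left_mono) auto
    finally have S: "(\<Sum>j<n. (a (Suc j)) ^ 4 * kc ^ (n - Suc j) * of_bool (kink j n x)) \<le> D n powr (2 - \<delta> / 2) * z" .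
    have "(Qsum n x) ^ 4 \<le> 11 ^ 3 * (D n powr (2 - \<delta> / 2) * z)"
      by (rule order_trans[OF Qsum_power4 mult_left_mono[OF S]]) simp
    then have q4: "(Qsum n x) ^ 4 \<le> (11 ^ 3 * z) * D n powr (2 - \<delta> / 2)" by (simp add: mult_ac)
    show ?thesis
    proof (cases "Qsum n x = 0")
      case False
      then have Qp: "0 < Qsum n x" using Qsum_nonneg[of n x] by simp
      have "Qsum n x = ((Qsum n x) ^ 4) powr (1/4)"
        using Qp by (simp add: powr_powr flip: powr_numeral)
      also have "\<dots> \<le> ((11 ^ 3 * z) * D n powr (2 - \<delta> / 2)) powr (1/4)"
        using q4 by (intro powr_mono2) auto
      also have "\<dots> = (11 ^ 3 * z) powr (1/4) * D n powr ((2 - \<delta> / 2) * (1/4))"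
        using z(2) by (simp add: powr_mult powr_powr)
      also have "(2 - \<delta> / 2) * (1/4) = gp" by (simp add: gp_def field_simps)
      finally show ?thesis .
    qed simp
  qed
  then show ?case by (intro exI[of _ "(11 ^ 3 * z) powr (1/4)"]) auto
qed

lemma takagi_term_summable: "summable (\<lambda>j. a (Suc j) / real r ^ j * nearest_int_dist (real r ^ j * x))"
proof (rule summable_comparison_test'[OF a_summable[of 1], of 0])
  fix j :: nat
  have "norm (a (Suc j) / real r ^ j * nearest_int_dist (real r ^ j * x)) = \<bar>a (Suc j)\<bar> / real r ^ j * nearest_int_dist (real r ^ j * x)"
    using nearest_int_dist_nonneg[of "real r ^ j * x"] by (simp add: abs_mult)
  also have "\<dots> \<le> \<bar>a (Suc j)\<bar> / real r ^ j * 1"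
    using nearest_int_dist_le[of "real r ^ j * x"] by (intro mult_left_mono) auto
  also have "\<dots> \<le> \<bar>a (Suc j)\<bar> / 2 ^ j" using rpos by (simp, intro divide_left_mono power_mono) auto
  finally show "norm (a (Suc j) / real r ^ j * nearest_int_dist (real r ^ j * x)) \<le> \<bar>a (1 + j)\<bar> / 2 ^ j" by simp
qed

text \<open>The series is cut at \<open>n\<close>. Beyond \<open>n\<close> the increments of the
  tents are bounded, and dividing by \<open>h\<close> costs a factor \<open>real r\<close> because
  \<open>\<bar>h\<bar> > 1 / real r ^ Suc n\<close>. Before \<open>n\<close> a tent without a kink
  near \<open>x\<close> has difference quotient equal to its slope, and any other errs by at most 2.
  The last \<open>tail (Suc n)\<close> is the boundary term between \<open>w_sum\<close> and
  \<open>W\<close>.\<close>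

lemma increment_approx:
  assumes h: "1 / real r ^ Suc n < \<bar>h\<bar>" "\<bar>h\<bar> \<le> 1 / real r ^ n"
  shows "\<bar>(takagi_vdw r a (x + h) - takagi_vdw r a x) / h - W n x\<bar> \<le> 2 * Qsum n x + (real r + 1) * tail (Suc n)"
proof -
  have rp: "0 < real r ^ j" for j using rpos by simp
  have "0 < 1 / real r ^ Suc n" by (simp only: divide_pos_pos rp zero_less_one)
  then have h0: "h \<noteq> 0" using h(1) by auto
  define T where "T j = (a (Suc j) / real r ^ j * nearest_int_dist (real r ^ j * (x + h)) - a (Suc j) / real r ^ j * nearest_int_dist (real r ^ j * x)) / h" for j
  have T: "T j = a (Suc j) * ((nearest_int_dist (real r ^ j * x + real r ^ j * h) - nearest_int_dist (real r ^ j * x)) / (real r ^ j * h))" for j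
    by (simp add: T_def diff_divide_distrib right_diff_distrib distrib_left)
  have smT: "summable T" unfolding T_def by (intro summable_divide summable_diff takagi_term_summable)
  have quot: "(takagi_vdw r a (x + h) - takagi_vdw r a x) / h = (\<Sum>j. T j)"
  proof -
    have "T sums ((takagi_vdw r a (x + h) - takagi_vdw r a x) / h)"
      unfolding T_def takagi_vdw_def by (intro sums_divide sums_diff summable_sums takagi_term_summable)
    then show ?thesis by (rule sums_unique)
  qed
  also have "\<dots> = (\<Sum>j. T (j + n)) + (\<Sum>j<n. T j)" by (rule suminf_split_initial_segment[OF smT])
  finally have split: "(takagi_vdw r a (x + h) - takagi_vdw r a x) / h = (\<Sum>j. T (j + n)) + (\<Sum>j<n. T j)" .
  have tailb: "norm (T (j + n)) \<le> real r * (\<bar>a (Suc n + j)\<bar> / 2 ^ j)" for j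
  proof -
    let ?d = "nearest_int_dist (real r ^ (j + n) * x + real r ^ (j + n) * h) - nearest_int_dist (real r ^ (j + n) * x)"
    have d: "\<bar>?d\<bar> \<le> 1"
      using nearest_int_dist_nonneg[of "real r ^ (j + n) * x + real r ^ (j + n) * h"] nearest_int_dist_nonneg[of "real r ^ (j + n) * x"]
        nearest_int_dist_le[of "real r ^ (j + n) * x + real r ^ (j + n) * h"] nearest_int_dist_le[of "real r ^ (j + n) * x"] by linarith
    have "real r ^ (j + n) * (1 / real r ^ Suc n) \<le> real r ^ (j + n) * \<bar>h\<bar>" using h(1) rp by (intro mult_left_mono) auto
    moreover have "real r ^ (j + n) * (1 / real r ^ Suc n) = real r ^ j / real r" using rpos by (simp add: power_add)
    moreover have "2 ^ j / real r \<le> real r ^ j / real r" using rpos by (intro divide_right_mono power_mono) auto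
    ultimately have lo: "2 ^ j / real r \<le> real r ^ (j + n) * \<bar>h\<bar>" by linarith
    have "norm (T (j + n)) = \<bar>a (Suc (j + n))\<bar> * (\<bar>?d\<bar> / (real r ^ (j + n) * \<bar>h\<bar>))"
      unfolding T using rpos by (simp add: abs_mult abs_divide)
    also have "\<dots> \<le> \<bar>a (Suc (j + n))\<bar> * (1 / (2 ^ j / real r))"
      using d lo rpos by (intro mult_left_mono frac_le) auto
    finally show ?thesis by (simp add: add.commute mult_ac)
  qed
  have tail_sum: "\<bar>\<Sum>j. T (j + n)\<bar> \<le> real r * tail (Suc n)"
  proof -
    have sm: "summable (\<lambda>j. real r * (\<bar>a (Suc n + j)\<bar> / 2 ^ j))" by (intro summable_mult a_summable)
    have smn: "summable (\<lambda>j. norm (T (j + n)))" by (rule summable_comparison_test'[OF sm, of 0]) (use tailb in simp)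
    have "\<bar>\<Sum>j. T (j + n)\<bar> \<le> (\<Sum>j. norm (T (j + n)))" using summable_norm[OF smn] by simp
    also have "\<dots> \<le> (\<Sum>j. real r * (\<bar>a (Suc n + j)\<bar> / 2 ^ j))" by (intro suminf_le tailb smn sm)
    also have "\<dots> = real r * tail (Suc n)" unfolding tail_def by (rule suminf_mult[OF a_summable])
    finally show ?thesis .
  qed
  have head: "\<bar>(\<Sum>j<n. T j) - (\<Sum>j<n. a (Suc j) * tent_slope (real r ^ j * x))\<bar> \<le> 2 * Qsum n x"
  proof -
    have "\<bar>(\<Sum>j<n. T j) - (\<Sum>j<n. a (Suc j) * tent_slope (real r ^ j * x))\<bar> \<le> (\<Sum>j<n. \<bar>T j - a (Suc j) * tent_slope (real r ^ j * x)\<bar>)"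
      unfolding sum_subtractf[symmetric] by (rule sum_abs)
    also have "\<dots> \<le> (\<Sum>j<n. 2 * (\<bar>a (Suc j)\<bar> * of_bool (kink j n x)))"
    proof (rule sum_mono)
      fix j
      let ?d = "nearest_int_dist (real r ^ j * x + real r ^ j * h) - nearest_int_dist (real r ^ j * x)"
      show "\<bar>T j - a (Suc j) * tent_slope (real r ^ j * x)\<bar> \<le> 2 * (\<bar>a (Suc j)\<bar> * of_bool (kink j n x))"
      proof (cases "kink j n x")
        case True
        have "\<bar>?d\<bar> \<le> \<bar>real r ^ j * h\<bar>" using nearest_int_dist_Lipschitz[of "real r ^ j * x + real r ^ j * h" "real r ^ j * x"] by simp
        then have "\<bar>?d / (real r ^ j * h)\<bar> \<le> 1" unfolding abs_divide using h0 rpos by (simp add: divide_le_eq_1)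
        moreover have "\<bar>tent_slope (real r ^ j * x)\<bar> = 1" by (simp add: tent_slope_def)
        ultimately have "\<bar>?d / (real r ^ j * h) - tent_slope (real r ^ j * x)\<bar> \<le> 2" by linarith
        then have "\<bar>a (Suc j)\<bar> * \<bar>?d / (real r ^ j * h) - tent_slope (real r ^ j * x)\<bar> \<le> \<bar>a (Suc j)\<bar> * 2" by (intro mult_left_mono) auto
        moreover have ob: "(of_bool (kink j n x) :: real) = 1" using True by simp
        ultimately show ?thesis unfolding T right_diff_distrib[symmetric] abs_mult ob by linarith
      next
        case False
        have "2 * \<bar>real r ^ j * h\<bar> \<le> 2 * (real r ^ j * (1 / real r ^ n))"
          using mult_left_mono[OF h(2), of "real r ^ j"] by (simp add: abs_mult)
        also have "\<dots> < nearest_int_dist (2 * (real r ^ j * x))" using False by (simp add: kink_def)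
        finally have "?d = tent_slope (real r ^ j * x) * (real r ^ j * h)" by (subst nearest_int_dist_no_kink) auto
        then show ?thesis unfolding T using h0 rpos by simp
      qed
    qed
    finally show ?thesis by (simp only: Qsum_def sum_distrib_left)
  qed
  have w: "(\<Sum>j<n. a (Suc j) * tent_slope (real r ^ j * x)) = w_sum r a n x"
  proof -
    have "w_sum r a n x = (\<Sum>j<n. a (Suc j) * psi_right_deriv r (Suc j) x)"
      unfolding w_sum_def by (rule sum.reindex_bij_witness[of _ Suc "\<lambda>k. k - 1"]) auto
    then show ?thesis using r by (simp add: psi_right_deriv_eq)
  qed
  have "\<bar>w_sum r a n x - W n x\<bar> \<le> tail (Suc n)"
  proof -
    have "\<bar>slope_seq r n x\<bar> \<le> 1" using chain.s_cases[of n x] by auto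
    then have "\<bar>chain_corr r * b (Suc n) * slope_seq r n x\<bar> \<le> 1 * \<bar>b (Suc n)\<bar> * 1"
      unfolding abs_mult using chain_corr_bounds by (intro mult_mono) auto
    then show ?thesis using b_le_tail[of "Suc n"] by (simp add: w_sum_eq)
  qed
  then show ?thesis using head tail_sum unfolding split w by (simp add: distrib_right)
qed

theorem increment_error:
  "AE x in circle_measure. \<exists>C\<ge>0. \<forall>n h. 1 / real r ^ Suc n < \<bar>h\<bar> \<and> \<bar>h\<bar> \<le> 1 / real r ^ n \<longrightarrow>
     \<bar>(takagi_vdw r a (x + h) - takagi_vdw r a x) / h - W n x\<bar> \<le> C * D n powr gp"
  using Qsum_bound
proof eventually_elim
  case (elim x)
  then obtain C where C: "C \<ge> 0" "\<And>n. Qsum n x \<le> C * D n powr gp" by blast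
  have "\<exists>C>0. \<forall>\<^sub>F n in sequentially. tail (Suc n) \<le> C * A n powr g"
    using tail_Suc_bound by (auto elim: eventually_mono)
  then obtain C' where C': "C' \<ge> 0" "\<And>n. tail (Suc n) \<le> C' * D n powr gp"
    using eventually_powr_bound[of "\<lambda>n. tail (Suc n)" gp] gp by blast
  have "\<bar>(takagi_vdw r a (x + h) - takagi_vdw r a x) / h - W n x\<bar> \<le> (2 * C + (real r + 1) * C') * D n powr gp"
    if h: "1 / real r ^ Suc n < \<bar>h\<bar>" "\<bar>h\<bar> \<le> 1 / real r ^ n" for n h
  proof -
    have "(real r + 1) * tail (Suc n) \<le> (real r + 1) * (C' * D n powr gp)" by (intro mult_left_mono C') auto
    then show ?thesis using increment_approx[OF h, of x] C(2)[of n] by (simp add: distrib_right mult.assoc)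
  qed
  then show ?case using C(1) C'(1) by (intro exI[of _ "2 * C + (real r + 1) * C'"]) auto
qed

end

section \<open>Convergence in distribution in the Skorokhod space\<close>

lemma measurable_borel_algebraI:
  assumes "f \<in> space M \<rightarrow> topspace T" "\<And>U. openin T U \<Longrightarrow> {x \<in> space M. f x \<in> U} \<in> sets M"
  shows "f \<in> M \<rightarrow>\<^sub>M borel_algebra T"
  unfolding borel_algebra_def using assms
  by (intro measurable_measure_of) (auto simp: vimage_def Int_def conj_commute dest: openin_subset)

lemma sets_borel_algebra_open: "openin T U \<Longrightarrow> U \<in> sets (borel_algebra T)"
  unfolding borel_algebra_def by (subst sets_measure_of) (auto dest: openin_subset)

lemma space_borel_algebra [simp]: "space (borel_algebra T) = topspace T"
  unfolding borel_algebra_def by (rule space_measure_of) (auto dest: openin_subset)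

lemma measurable_borel_algebra_open:
  assumes "f \<in> M \<rightarrow>\<^sub>M borel_algebra T" "openin T U"
  shows "{x \<in> space M. f x \<in> U} \<in> sets M"
  using measurable_sets[OF assms(1) sets_borel_algebra_open[OF assms(2)]]
  by (simp add: vimage_def Int_def conj_commute)

lemma continuous_map_measurable_borel_algebra:
  assumes "continuous_map T euclidean \<Phi>"
  shows "\<Phi> \<in> borel_algebra T \<rightarrow>\<^sub>M (borel :: real measure)"
proof (rule borel_measurableI)
  fix S :: "real set" assume "open S"
  then have "openin T {x \<in> topspace T. \<Phi> x \<in> S}"
    using assms by (auto simp: continuous_map_def)
  then have "{x \<in> topspace T. \<Phi> x \<in> S} \<in> sets (borel_algebra T)" by (rule sets_borel_algebra_open)
  then show "\<Phi> -` S \<inter> space (borel_algebra T) \<in> sets (borel_algebra T)"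
    by (simp add: vimage_def Int_def conj_commute)
qed

context Metric_space begin

lemma continuous_map_Lipschitz:
  assumes lip: "\<And>x y. x \<in> M \<Longrightarrow> y \<in> M \<Longrightarrow> \<bar>\<Phi> x - \<Phi> y\<bar> \<le> K * d x y"
  shows "continuous_map mtopology euclidean (\<Phi> :: 'a \<Rightarrow> real)"
proof -
  define K' where "K' = \<bar>K\<bar> + 1"
  have K': "0 < K'" by (simp add: K'_def)
  have lip': "\<bar>\<Phi> x - \<Phi> y\<bar> \<le> K' * d x y" if "x \<in> M" "y \<in> M" for x y
  proof -
    have "K * d x y \<le> K' * d x y" by (intro mult_right_mono) (auto simp: K'_def)
    then show ?thesis using lip[OF that] by linarith
  qed
  show ?thesis
    unfolding continuous_map_def
  proof (intro conjI allI impI)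
    fix S :: "real set" assume S: "openin euclidean S"
    show "openin mtopology {x \<in> topspace mtopology. \<Phi> x \<in> S}"
      unfolding openin_mtopology
    proof (intro conjI allI impI)
      fix x assume x: "x \<in> {x \<in> topspace mtopology. \<Phi> x \<in> S}"
      then obtain e where e: "0 < e" "\<And>u. dist u (\<Phi> x) < e \<Longrightarrow> u \<in> S" using S by (auto simp: open_dist)
      have "mball x (e / K') \<subseteq> {x \<in> topspace mtopology. \<Phi> x \<in> S}"
      proof
        fix y assume y: "y \<in> mball x (e / K')"
        then have xy: "x \<in> M" "y \<in> M" "d x y < e / K'" by auto
        have "\<bar>\<Phi> y - \<Phi> x\<bar> \<le> K' * d x y" using lip'[OF xy(2,1)] by (simp add: commute)
        also have "\<dots> < e" using xy(3) K' by (simp add: pos_less_divide_eq mult.commute)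
        finally have "\<Phi> y \<in> S" using e(2) by (simp add: dist_real_def)
        then show "y \<in> {x \<in> topspace mtopology. \<Phi> x \<in> S}" using xy by simp
      qed
      then show "\<exists>r>0. mball x r \<subseteq> {x \<in> topspace mtopology. \<Phi> x \<in> S}" using e(1) K' by (intro exI[of _ "e / K'"]) simp
    qed auto
  qed auto
qed

text \<open>The inf-convolution of \<Phi> with \<open>k\<close> times the metric, for bounded \<Phi>
  the largest \<open>k\<close>-Lipschitz function below it.\<close>

definition Lipschitz_minorant :: "('a \<Rightarrow> real) \<Rightarrow> nat \<Rightarrow> 'a \<Rightarrow> real" where
  "Lipschitz_minorant \<Phi> k x = (INF y\<in>M. \<Phi> y + real k * d x y)"

lemma Lipschitz_minorant:
  assumes B: "\<And>y. y \<in> M \<Longrightarrow> \<bar>\<Phi> y\<bar> \<le> B" and cont: "continuous_map mtopology euclidean \<Phi>"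
  shows "x \<in> M \<Longrightarrow> Lipschitz_minorant \<Phi> k x \<le> \<Phi> x"
    and "x \<in> M \<Longrightarrow> \<bar>Lipschitz_minorant \<Phi> k x\<bar> \<le> B"
    and "x \<in> M \<Longrightarrow> y \<in> M \<Longrightarrow> \<bar>Lipschitz_minorant \<Phi> k x - Lipschitz_minorant \<Phi> k y\<bar> \<le> real k * d x y"
    and "x \<in> M \<Longrightarrow> (\<lambda>k. Lipschitz_minorant \<Phi> k x) \<longlonglongrightarrow> \<Phi> x"
proof -
  have lo: "- B \<le> \<Phi> y + real k * d x y" if "y \<in> M" for x y k
  proof -
    have "0 \<le> real k * d x y" by simp
    then show ?thesis using B[OF that] by linarith
  qed
  have bdd: "bdd_below ((\<lambda>y. \<Phi> y + real k * d x y) ` M)" for x k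
    by (rule bdd_belowI2[of _ "- B"]) (rule lo)
  have le: "Lipschitz_minorant \<Phi> k x \<le> \<Phi> x" if "x \<in> M" for x k
    unfolding Lipschitz_minorant_def using cINF_lower[OF bdd[of k x] that] that by simp
  then show "x \<in> M \<Longrightarrow> Lipschitz_minorant \<Phi> k x \<le> \<Phi> x" .
  show "\<bar>Lipschitz_minorant \<Phi> k x\<bar> \<le> B" if x: "x \<in> M"
  proof -
    have "- B \<le> Lipschitz_minorant \<Phi> k x"
      unfolding Lipschitz_minorant_def using x by (intro cINF_greatest lo) auto
    then show ?thesis using le[OF x, of k] B[OF x] by (simp add: abs_le_iff)
  qed
  have half: "Lipschitz_minorant \<Phi> k x \<le> Lipschitz_minorant \<Phi> k y + real k * d x y" if "x \<in> M" "y \<in> M" for x y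
  proof -
    have "Lipschitz_minorant \<Phi> k x - real k * d x y \<le> Lipschitz_minorant \<Phi> k y"
      unfolding Lipschitz_minorant_def[of _ _ y]
    proof (rule cINF_greatest)
      fix z assume z: "z \<in> M"
      have "Lipschitz_minorant \<Phi> k x \<le> \<Phi> z + real k * d x z"
        unfolding Lipschitz_minorant_def by (rule cINF_lower[OF bdd z])
      also have "real k * d x z \<le> real k * (d x y + d y z)" using that z by (intro mult_left_mono triangle) auto
      finally show "Lipschitz_minorant \<Phi> k x - real k * d x y \<le> \<Phi> z + real k * d y z" by (simp add: distrib_left)
    qed (use that in auto)
    then show ?thesis by simp
  qed
  show "\<bar>Lipschitz_minorant \<Phi> k x - Lipschitz_minorant \<Phi> k y\<bar> \<le> real k * d x y" if "x \<in> M" "y \<in> M"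
    using half[OF that] half[OF that(2,1)] by (simp add: commute abs_le_iff)
  show "(\<lambda>k. Lipschitz_minorant \<Phi> k x) \<longlonglongrightarrow> \<Phi> x" if x: "x \<in> M"
  proof (rule LIMSEQ_I)
    fix e :: real assume e: "0 < e"
    have "openin mtopology {y \<in> topspace mtopology. \<Phi> y \<in> {\<Phi> x - e/2<..}}"
    proof -
      have *: "openin mtopology {y \<in> topspace mtopology. \<Phi> y \<in> S}" if "open S" for S
        using cont that by (auto simp: continuous_map_def)
      show ?thesis by (rule *) (rule open_greaterThan)
    qed
    moreover have "x \<in> {y \<in> topspace mtopology. \<Phi> y \<in> {\<Phi> x - e/2<..}}" using x e by simp
    ultimately obtain r where r: "0 < r" "mball x r \<subseteq> {y \<in> topspace mtopology. \<Phi> y \<in> {\<Phi> x - e/2<..}}"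
      unfolding openin_mtopology by blast
    obtain k0 :: nat where k0: "2 * B / r \<le> real k0" using real_arch_simple by blast
    have "norm (Lipschitz_minorant \<Phi> k x - \<Phi> x) < e" if k: "k0 \<le> k" for k
    proof -
      have "\<Phi> x - e/2 \<le> Lipschitz_minorant \<Phi> k x"
        unfolding Lipschitz_minorant_def
      proof (rule cINF_greatest)
        fix y assume y: "y \<in> M"
        show "\<Phi> x - e/2 \<le> \<Phi> y + real k * d x y"
        proof (cases "d x y < r")
          case True
          then have "y \<in> mball x r" using x y by simp
          then have "\<Phi> x - e/2 < \<Phi> y" using r(2) by auto
          moreover have "0 \<le> real k * d x y" by simp
          ultimately show ?thesis by linarith
        next
          case False
          have "2 * B \<le> real k0 * r" using k0 r(1) by (simp add: pos_divide_le_eq)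
          also have "\<dots> \<le> real k * d x y" using k False r(1) by (intro mult_mono) auto
          finally show ?thesis using B[OF x] B[OF y] e by linarith
        qed
      qed (use x in auto)
      then show ?thesis using le[OF x, of k] e by simp
    qed
    then show "\<exists>no. \<forall>k\<ge>no. norm (Lipschitz_minorant \<Phi> k x - \<Phi> x) < e" by blast
  qed
qed

text \<open>Bounded Lipschitz functions suffice as test functions: approximation of \<Phi> from
  below by its Lipschitz minorants gives the lower inequality for the limit, and the same argument
  for \<open>- \<Phi>\<close> gives the upper one.\<close>

lemma converges_in_distribution_Lipschitz:
  assumes P: "prob_space P" "prob_space N"
    and X: "\<And>n. X n \<in> P \<rightarrow>\<^sub>M borel_algebra mtopology" and Y: "Y \<in> N \<rightarrow>\<^sub>M borel_algebra mtopology"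
    and lim: "\<And>\<Phi> K B. (\<And>x y. x \<in> M \<Longrightarrow> y \<in> M \<Longrightarrow> \<bar>\<Phi> x - \<Phi> y\<bar> \<le> K * d x y) \<Longrightarrow> (\<And>x. x \<in> M \<Longrightarrow> \<bar>\<Phi> x\<bar> \<le> B) \<Longrightarrow> 0 \<le> K \<Longrightarrow>
      (\<lambda>n. \<integral>\<omega>. \<Phi> (X n \<omega>) \<partial>P) \<longlonglongrightarrow> (\<integral>\<omega>. (\<Phi> (Y \<omega>) :: real) \<partial>N)"
  shows "converges_in_distribution mtopology P X N Y"
proof -
  interpret P: prob_space P by fact
  interpret N: prob_space N by fact
  have XM: "X n \<omega> \<in> M" if "\<omega> \<in> space P" for n \<omega> using measurable_space[OF X that] by simp
  have YM: "Y \<omega> \<in> M" if "\<omega> \<in> space N" for \<omega> using measurable_space[OF Y that] by simp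
  have lower: "\<forall>\<^sub>F n in sequentially. (\<integral>\<omega>. \<Phi> (Y \<omega>) \<partial>N) - e < (\<integral>\<omega>. \<Phi> (X n \<omega>) \<partial>P)"
    if cont: "continuous_map mtopology euclidean \<Phi>" and B: "\<And>x. x \<in> M \<Longrightarrow> \<bar>\<Phi> x\<bar> \<le> B" and e: "0 < e" for \<Phi> B and e :: real
  proof -
    have Lm1: "Lipschitz_minorant \<Phi> k x \<le> \<Phi> x" if "x \<in> M" for k x
      by (rule Lipschitz_minorant(1)[OF _ cont that]) (rule B)
    have Lm2: "\<bar>Lipschitz_minorant \<Phi> k x\<bar> \<le> B" if "x \<in> M" for k x
      by (rule Lipschitz_minorant(2)[OF _ cont that]) (rule B)
    have Lm3: "\<bar>Lipschitz_minorant \<Phi> k x - Lipschitz_minorant \<Phi> k y\<bar> \<le> real k * d x y" if "x \<in> M" "y \<in> M" for k x y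
      by (rule Lipschitz_minorant(3)[OF _ cont that]) (rule B)
    have Lm4: "(\<lambda>k. Lipschitz_minorant \<Phi> k x) \<longlonglongrightarrow> \<Phi> x" if "x \<in> M" for x
      by (rule Lipschitz_minorant(4)[OF _ cont that]) (rule B)
    have Lc: "continuous_map mtopology euclidean (Lipschitz_minorant \<Phi> k)" for k
      by (rule continuous_map_Lipschitz[of _ "real k"]) (rule Lm3)
    have mY: "(\<lambda>\<omega>. F (Y \<omega>)) \<in> borel_measurable N" if "continuous_map mtopology euclidean F" for F :: "'a \<Rightarrow> real"
      using measurable_compose[OF Y continuous_map_measurable_borel_algebra[OF that]] .
    have mX: "(\<lambda>\<omega>. F (X n \<omega>)) \<in> borel_measurable P" if "continuous_map mtopology euclidean F" for F :: "'a \<Rightarrow> real" and n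
      using measurable_compose[OF X continuous_map_measurable_borel_algebra[OF that]] .
    have "(\<lambda>k. \<integral>\<omega>. Lipschitz_minorant \<Phi> k (Y \<omega>) \<partial>N) \<longlonglongrightarrow> (\<integral>\<omega>. \<Phi> (Y \<omega>) \<partial>N)"
      by (rule integral_dominated_convergence[where w = "\<lambda>_. B"]) (auto intro!: mY Lc cont AE_I2 Lm4 Lm2 YM)
    then have "\<forall>\<^sub>F k in sequentially. (\<integral>\<omega>. \<Phi> (Y \<omega>) \<partial>N) - e / 2 < (\<integral>\<omega>. Lipschitz_minorant \<Phi> k (Y \<omega>) \<partial>N)"
      using e by (intro order_tendstoD) auto
    then obtain k where k: "(\<integral>\<omega>. \<Phi> (Y \<omega>) \<partial>N) - e / 2 < (\<integral>\<omega>. Lipschitz_minorant \<Phi> k (Y \<omega>) \<partial>N)"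
      unfolding eventually_sequentially by blast
    have "(\<lambda>n. \<integral>\<omega>. Lipschitz_minorant \<Phi> k (X n \<omega>) \<partial>P) \<longlonglongrightarrow> (\<integral>\<omega>. Lipschitz_minorant \<Phi> k (Y \<omega>) \<partial>N)"
      by (rule lim[of _ "real k" B]) (auto intro: Lm2 Lm3)
    then have "\<forall>\<^sub>F n in sequentially. (\<integral>\<omega>. Lipschitz_minorant \<Phi> k (Y \<omega>) \<partial>N) - e / 2 < (\<integral>\<omega>. Lipschitz_minorant \<Phi> k (X n \<omega>) \<partial>P)"
      using e by (intro order_tendstoD) auto
    then show ?thesis
    proof eventually_elim
      case (elim n)
      have "(\<integral>\<omega>. Lipschitz_minorant \<Phi> k (X n \<omega>) \<partial>P) \<le> (\<integral>\<omega>. \<Phi> (X n \<omega>) \<partial>P)"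
      proof (rule integral_mono)
        show "integrable P (\<lambda>\<omega>. Lipschitz_minorant \<Phi> k (X n \<omega>))"
          by (rule P.integrable_const_bound[of _ B]) (auto intro!: mX Lc AE_I2 Lm2 XM)
        show "integrable P (\<lambda>\<omega>. \<Phi> (X n \<omega>))"
          by (rule P.integrable_const_bound[of _ B]) (auto intro!: mX cont AE_I2 B XM)
      qed (rule Lm1[OF XM])
      then show ?case using elim k by linarith
    qed
  qed
  have "(\<lambda>n. \<integral>\<omega>. \<Phi> (X n \<omega>) \<partial>P) \<longlonglongrightarrow> (\<integral>\<omega>. \<Phi> (Y \<omega>) \<partial>N)"
    if cont: "continuous_map mtopology euclidean \<Phi>" and bdd: "bounded (\<Phi> ` topspace mtopology)" for \<Phi> :: "'a \<Rightarrow> real"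
  proof (rule tendstoI)
    fix e :: real assume e: "0 < e"
    obtain B where B: "\<And>x. x \<in> M \<Longrightarrow> \<bar>\<Phi> x\<bar> \<le> B" using bdd by (auto simp: bounded_iff)
    have cont': "continuous_map mtopology euclidean (\<lambda>x. - \<Phi> x)" by (rule continuous_map_minus[OF cont])
    have "\<forall>\<^sub>F n in sequentially. (\<integral>\<omega>. - \<Phi> (Y \<omega>) \<partial>N) - e < (\<integral>\<omega>. - \<Phi> (X n \<omega>) \<partial>P)"
      by (rule lower[OF cont' _ e, of B]) (use B in simp)
    moreover have "\<forall>\<^sub>F n in sequentially. (\<integral>\<omega>. \<Phi> (Y \<omega>) \<partial>N) - e < (\<integral>\<omega>. \<Phi> (X n \<omega>) \<partial>P)"
      by (rule lower[OF cont _ e, of B]) (use B in simp)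
    ultimately show "\<forall>\<^sub>F n in sequentially. dist (\<integral>\<omega>. \<Phi> (X n \<omega>) \<partial>P) (\<integral>\<omega>. \<Phi> (Y \<omega>) \<partial>N) < e"
      by eventually_elim (auto simp: dist_real_def)
  qed
  then show ?thesis unfolding converges_in_distribution_def using X Y by blast
qed

text \<open>An open set is exhausted by the sets \<open>V p\<close> of points within
  \<open>1 / (p + 1)\<close> of a centre whose ball of twice that radius stays inside. The gap
  between the two radii carries membership from the approximants to the limit, and points around the
  limit serve as centres for the converse.\<close>

lemma measurable_limit:
  assumes X: "\<And>n. X n \<in> P \<rightarrow>\<^sub>M borel_algebra mtopology" and Y: "\<And>\<omega>. \<omega> \<in> space P \<Longrightarrow> Y \<omega> \<in> M"
    and lim: "\<And>\<omega>. \<omega> \<in> space P \<Longrightarrow> (\<lambda>n. d (X n \<omega>) (Y \<omega>)) \<longlonglongrightarrow> 0"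
  shows "Y \<in> P \<rightarrow>\<^sub>M borel_algebra mtopology"
proof (rule measurable_borel_algebraI)
  show "Y \<in> space P \<rightarrow> topspace mtopology" using Y by auto
  fix U assume U: "openin mtopology U"
  define V where "V p = \<Union>{mball y (1 / real (Suc p)) | y. y \<in> M \<and> mball y (2 / real (Suc p)) \<subseteq> U}" for p
  have Oo: "openin mtopology (V p)" for p unfolding V_def by (rule openin_Union) auto
  have XM: "X n \<omega> \<in> M" if "\<omega> \<in> space P" for n \<omega> using measurable_space[OF X that] by simp
  have "Y \<omega> \<in> U \<longleftrightarrow> (\<exists>p q. \<forall>n\<in>{q..}. X n \<omega> \<in> V p)" if w: "\<omega> \<in> space P" for \<omega>
  proof
    assume "Y \<omega> \<in> U"
    then obtain e where e: "0 < e" "mball (Y \<omega>) e \<subseteq> U" using U unfolding openin_mtopology by blast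
    obtain p where p: "2 / e < real p" using reals_Archimedean2 by blast
    have "2 / real (Suc p) < e" using p e(1) by (simp add: field_simps)
    then have sub: "mball (Y \<omega>) (2 / real (Suc p)) \<subseteq> U" using e(2) mball_subset_concentric[of "2 / real (Suc p)" e] by force
    have "\<forall>\<^sub>F n in sequentially. d (X n \<omega>) (Y \<omega>) < 1 / real (Suc p)" using lim[OF w] by (rule order_tendstoD) simp
    then obtain q where "\<forall>n\<ge>q. d (X n \<omega>) (Y \<omega>) < 1 / real (Suc p)" unfolding eventually_sequentially by blast
    then have "X n \<omega> \<in> V p" if "n \<in> {q..}" for n
      using that sub XM[OF w, of n] Y[OF w] unfolding V_def
      by (intro UnionI[of "mball (Y \<omega>) (1 / real (Suc p))"]) (auto simp: commute)
    then show "\<exists>p q. \<forall>n\<in>{q..}. X n \<omega> \<in> V p" by blast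
  next
    assume "\<exists>p q. \<forall>n\<in>{q..}. X n \<omega> \<in> V p"
    then obtain p q where pq: "\<And>n. q \<le> n \<Longrightarrow> X n \<omega> \<in> V p" by auto
    have "\<forall>\<^sub>F n in sequentially. d (X n \<omega>) (Y \<omega>) < 1 / real (Suc p)" using lim[OF w] by (rule order_tendstoD) simp
    then obtain q' where q': "\<forall>n\<ge>q'. d (X n \<omega>) (Y \<omega>) < 1 / real (Suc p)" unfolding eventually_sequentially by blast
    define n where "n = max q q'"
    have "X n \<omega> \<in> V p" using pq[of n] by (simp add: n_def)
    then obtain y where y: "y \<in> M" "mball y (2 / real (Suc p)) \<subseteq> U" "X n \<omega> \<in> mball y (1 / real (Suc p))"
      unfolding V_def by auto
    have "d (X n \<omega>) (Y \<omega>) < 1 / real (Suc p)" using q' by (simp add: n_def)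
    moreover have "d y (Y \<omega>) \<le> d y (X n \<omega>) + d (X n \<omega>) (Y \<omega>)" using y Y[OF w] by (intro triangle) auto
    moreover have "2 / real (Suc p) = 1 / real (Suc p) + 1 / real (Suc p)" by (simp add: field_simps)
    ultimately have "Y \<omega> \<in> mball y (2 / real (Suc p))" using y Y[OF w] by auto
    then show "Y \<omega> \<in> U" using y(2) by blast
  qed
  then have "{\<omega> \<in> space P. Y \<omega> \<in> U} = (\<Union>p. \<Union>q. \<Inter>n\<in>{q..}. {\<omega> \<in> space P. X n \<omega> \<in> V p})" by auto
  also have "\<dots> \<in> sets P"
    by (intro sets.countable_UN sets.countable_INT'' image_subsetI sets.countable_INT) (auto intro: measurable_borel_algebra_open[OF X Oo])
  finally show "{\<omega> \<in> space P. Y \<omega> \<in> U} \<in> sets P" .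
qed

end

lemma skorokhod_dist_uniform:
  assumes "\<And>t. t \<in> {0..1} \<Longrightarrow> \<bar>x t - y t\<bar> \<le> e" "0 \<le> e"
  shows "skorokhod_dist x y \<le> e"
proof -
  have "skorokhod_edist x y \<le> ennreal e"
    by (rule skorokhod_edist_leI[OF time_changes_id]) (use assms in \<open>auto intro: ennreal_leI\<close>)
  then show ?thesis unfolding skorokhod_dist_def
    using assms(2) by (metis enn2real_ennreal enn2real_mono ennreal_less_top)
qed

text \<open>A path that jumps only at finitely many times depends continuously on its finitely many values.\<close>

lemma step_path_measurable:
  fixes y :: "nat \<Rightarrow> 'b \<Rightarrow> real" and T :: "real \<Rightarrow> nat"
  assumes y: "\<And>i. y i \<in> borel_measurable P" and T: "\<And>t. t \<in> {0..1} \<Longrightarrow> T t \<le> N"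
    and D: "\<And>v :: nat \<Rightarrow> real. (\<lambda>t\<in>{0..1}. v (T t)) \<in> skorokhod_space"
  shows "(\<lambda>\<omega>. (\<lambda>t\<in>{0..1}. y (T t) \<omega>)) \<in> P \<rightarrow>\<^sub>M borel_algebra skorokhod.mtopology"
proof (rule measurable_borel_algebraI)
  define S where "S v = (\<lambda>t\<in>{0..1}. v (T t))" for v :: "nat \<Rightarrow> real"
  show "(\<lambda>\<omega>. (\<lambda>t\<in>{0..1}. y (T t) \<omega>)) \<in> space P \<rightarrow> topspace skorokhod.mtopology"
    using D[of "\<lambda>i. y i _"] by auto
  fix U assume U: "openin skorokhod.mtopology U"
  have op: "open {v. S v \<in> U}"
  proof (subst open_subopen, intro ballI)
    fix v assume "v \<in> {v. S v \<in> U}"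
    then obtain e where e: "0 < e" "skorokhod.mball (S v) e \<subseteq> U" using U unfolding skorokhod.openin_mtopology by blast
    define V where "V = {w. \<forall>i\<in>{..N}. \<bar>w i - v i\<bar> < e / 2}"
    have "open V"
    proof -
      have "V = (\<Inter>i\<in>{..N}. {w. \<bar>w i - v i\<bar> < e / 2})" by (auto simp: V_def)
      moreover have "open {w :: nat \<Rightarrow> real. \<bar>w i - v i\<bar> < e / 2}" for i
        by (intro open_Collect_less continuous_intros) (auto intro: continuous_on_product_coordinates)
      ultimately show ?thesis by auto
    qed
    moreover have "v \<in> V" using e by (simp add: V_def)
    moreover have "V \<subseteq> {v. S v \<in> U}"
    proof
      fix w assume w: "w \<in> V"
      have "skorokhod_dist (S v) (S w) \<le> e / 2"
      proof (rule skorokhod_dist_uniform)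
        fix t :: real assume t: "t \<in> {0..1}"
        then have "\<bar>w (T t) - v (T t)\<bar> < e / 2" using w T[OF t] by (simp add: V_def)
        then show "\<bar>S v t - S w t\<bar> \<le> e / 2" using t by (simp add: S_def abs_minus_commute)
      qed (use e in simp)
      then have "S w \<in> skorokhod.mball (S v) e" using D e by (simp add: S_def)
      then show "w \<in> {v. S v \<in> U}" using e by blast
    qed
    ultimately show "\<exists>T. open T \<and> v \<in> T \<and> T \<subseteq> {v. S v \<in> U}" by blast
  qed
  have "(\<lambda>\<omega> i. y i \<omega>) \<in> P \<rightarrow>\<^sub>M PiM UNIV (\<lambda>_. borel)"
    using y by (intro measurable_PiM_single') auto
  then have "(\<lambda>\<omega> i. y i \<omega>) \<in> borel_measurable P"
    by (simp cong: measurable_cong_sets add: sets_PiM_equal_borel)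
  then have "(\<lambda>\<omega> i. y i \<omega>) -` {v. S v \<in> U} \<inter> space P \<in> sets P"
    by (rule measurable_sets) (use op in simp)
  then show "{\<omega> \<in> space P. (\<lambda>t\<in>{0..1}. y (T t) \<omega>) \<in> U} \<in> sets P"
    by (simp add: vimage_def Int_def conj_commute S_def)
qed

text \<open>The floor of \<tau> is an integer-valued monotone function. Continuity of \<tau> makes
  it constant just to the right of each point; to the left, monotonicity and boundedness already
  do.\<close>

lemma step_path_in_skorokhod_space:
  fixes \<tau> :: "real \<Rightarrow> real" and v :: "nat \<Rightarrow> real"
  assumes mono: "\<And>s t. 0 \<le> s \<Longrightarrow> s \<le> t \<Longrightarrow> t \<le> 1 \<Longrightarrow> \<tau> s \<le> \<tau> t"
    and cont: "continuous_on {0..1} \<tau>" and pos: "\<And>t. t \<in> {0..1} \<Longrightarrow> 0 \<le> \<tau> t"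
  shows "(\<lambda>t\<in>{0..1}. v (nat \<lfloor>\<tau> t\<rfloor>)) \<in> skorokhod_space"
  unfolding skorokhod_space_def
proof (intro CollectI conjI ballI)
  define x where "x = (\<lambda>t\<in>{0..1}. v (nat \<lfloor>\<tau> t\<rfloor>))"
  show "(\<lambda>t\<in>{0..1}. v (nat \<lfloor>\<tau> t\<rfloor>)) \<in> extensional {0..1}" by simp
  show "((\<lambda>t\<in>{0..1}. v (nat \<lfloor>\<tau> t\<rfloor>)) \<longlongrightarrow> (\<lambda>t\<in>{0..1}. v (nat \<lfloor>\<tau> t\<rfloor>)) t) (at_right t)" if t: "t \<in> {0..<1}" for t
  proof (rule tendsto_eventually)
    have "(\<tau> \<longlongrightarrow> \<tau> t) (at t within {0..1})" using cont t by (auto simp: continuous_on_def)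
    then have "(\<tau> \<longlongrightarrow> \<tau> t) (at t within {t<..1})"
      by (rule tendsto_within_subset) (use t in auto)
    moreover have "at t within {t<..1} = at_right t" using t by (intro at_within_nhd[of _ "{..<1}"]) auto
    ultimately have lim: "(\<tau> \<longlongrightarrow> \<tau> t) (at_right t)" by simp
    have "\<forall>\<^sub>F u in at_right t. \<tau> u < of_int \<lfloor>\<tau> t\<rfloor> + 1" using lim by (rule order_tendstoD) linarith
    moreover have "\<forall>\<^sub>F u in at_right t. u \<in> {t<..<1}" using t by (intro eventually_at_right_real) auto
    ultimately show "\<forall>\<^sub>F u in at_right t. (\<lambda>t\<in>{0..1}. v (nat \<lfloor>\<tau> t\<rfloor>)) u = (\<lambda>t\<in>{0..1}. v (nat \<lfloor>\<tau> t\<rfloor>)) t"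
    proof eventually_elim
      case (elim u)
      have "\<tau> t \<le> \<tau> u" using mono[of t u] elim t by auto
      then have "\<lfloor>\<tau> u\<rfloor> = \<lfloor>\<tau> t\<rfloor>" using elim by (intro floor_unique) linarith+
      then show ?case using elim t by auto
    qed
  qed
  show "\<exists>l. ((\<lambda>t\<in>{0..1}. v (nat \<lfloor>\<tau> t\<rfloor>)) \<longlongrightarrow> l) (at_left t)" if t: "t \<in> {0<..1}" for t
  proof -
    \<comment> \<open>The least bound that holds near \<open>t\<close> from the left. By minimality
      it is attained there, so it is the left limit of the index.\<close>
    define m where "m = (LEAST m. \<exists>u\<in>{0..<t}. \<forall>w\<in>{u..<t}. nat \<lfloor>\<tau> w\<rfloor> \<le> m)"
    have t0: "0 \<in> {0..<t}" using t by simp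
    have "\<exists>m. \<exists>u\<in>{0..<t}. \<forall>w\<in>{u..<t}. nat \<lfloor>\<tau> w\<rfloor> \<le> m"
    proof (intro exI bexI[OF _ t0] ballI)
      fix w assume "w \<in> {0..<t}"
      then have "\<tau> w \<le> \<tau> t" using mono[of w t] t by auto
      then show "nat \<lfloor>\<tau> w\<rfloor> \<le> nat \<lfloor>\<tau> t\<rfloor>" by (intro nat_mono floor_mono)
    qed
    then have "\<exists>u\<in>{0..<t}. \<forall>w\<in>{u..<t}. nat \<lfloor>\<tau> w\<rfloor> \<le> m" unfolding m_def by (rule LeastI_ex)
    then obtain u where u: "u \<in> {0..<t}" "\<And>w. w \<in> {u..<t} \<Longrightarrow> nat \<lfloor>\<tau> w\<rfloor> \<le> m" by blast
    have "\<exists>u'\<in>{u..<t}. nat \<lfloor>\<tau> u'\<rfloor> = m"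
    proof (rule ccontr)
      assume no: "\<not> (\<exists>u'\<in>{u..<t}. nat \<lfloor>\<tau> u'\<rfloor> = m)"
      have uu: "u \<in> {u..<t}" using u(1) by simp
      then have "nat \<lfloor>\<tau> u\<rfloor> \<noteq> m" using no by blast
      then have "m \<noteq> 0" using u(2)[OF uu] by linarith
      have "\<forall>w\<in>{u..<t}. nat \<lfloor>\<tau> w\<rfloor> \<le> m - 1" using no u(2) by (metis Suc_pred' \<open>m \<noteq> 0\<close> bot_nat_0.not_eq_extremum le_SucE)
      then have "m \<le> m - 1" unfolding m_def using u(1) by (intro Least_le) (auto simp: m_def)
      then show False using \<open>m \<noteq> 0\<close> by simp
    qed
    then obtain u' where u': "u' \<in> {u..<t}" "nat \<lfloor>\<tau> u'\<rfloor> = m" by blast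
    have "\<forall>\<^sub>F w in at_left t. w \<in> {u'<..<t}" using u' by (intro eventually_at_left_real) auto
    then have "\<forall>\<^sub>F w in at_left t. (\<lambda>t\<in>{0..1}. v (nat \<lfloor>\<tau> t\<rfloor>)) w = v m"
    proof eventually_elim
      case (elim w)
      have "\<tau> u' \<le> \<tau> w" using mono[of u' w] elim u' u t by auto
      then have "m \<le> nat \<lfloor>\<tau> w\<rfloor>" using u'(2) by (metis floor_mono nat_mono)
      moreover have "nat \<lfloor>\<tau> w\<rfloor> \<le> m" using u(2)[of w] elim u' by auto
      ultimately show ?case using elim u' u t by auto
    qed
    then show ?thesis by (intro exI[of _ "v m"] tendsto_eventually)
  qed
qed

lemma continuous_in_skorokhod_space:
  assumes "continuous_on {0..1} f"
  shows "(\<lambda>t\<in>{0..1}. f t) \<in> skorokhod_space"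
proof -
  have lim: "((\<lambda>t\<in>{0..1}. f t) \<longlongrightarrow> f t) (at t within {0..1})" if "t \<in> {0..1}" for t
  proof -
    have "(f \<longlongrightarrow> f t) (at t within {0..1})" using assms that by (auto simp: continuous_on_def)
    then show ?thesis by (rule Lim_transform_eventually) (auto simp: eventually_at_filter)
  qed
  show ?thesis unfolding skorokhod_space_def
  proof (intro CollectI conjI ballI)
    fix t :: real assume t: "t \<in> {0..<1}"
    have "((\<lambda>t\<in>{0..1}. f t) \<longlongrightarrow> f t) (at t within {t<..1})"
      by (rule tendsto_within_subset[OF lim[of t]]) (use t in auto)
    moreover have "at t within {t<..1} = at_right t" using t by (intro at_within_nhd[of _ "{..<1}"]) auto
    ultimately show "((\<lambda>t\<in>{0..1}. f t) \<longlongrightarrow> (\<lambda>t\<in>{0..1}. f t) t) (at_right t)" using t by simp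
  next
    fix t :: real assume t: "t \<in> {0<..1}"
    have "((\<lambda>t\<in>{0..1}. f t) \<longlongrightarrow> f t) (at t within {0..<t})"
      by (rule tendsto_within_subset[OF lim[of t]]) (use t in auto)
    moreover have "at t within {0..<t} = at_left t" using t by (intro at_within_nhd[of _ "{0<..}"]) auto
    ultimately show "\<exists>l. ((\<lambda>t\<in>{0..1}. f t) \<longlongrightarrow> l) (at_left t)" by auto
  qed simp
qed

section \<open>Difference quotients of the Takagi--van der Waerden function\<close>

text \<open>The double logarithm does not feel constant factors: eventually \<open>v\<close> lies
  between \<open>u / 2\<close> and \<open>2 * u\<close>, which is enough.\<close>

lemma lnln_ratio:
  fixes u v :: "'a \<Rightarrow> real"
  assumes u: "filterlim u at_top F" and r: "((\<lambda>n. v n / u n) \<longlongrightarrow> 1) F"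
  shows "((\<lambda>n. ln (ln (v n)) / ln (ln (u n))) \<longlongrightarrow> 1) F"
proof (rule tendsto_sandwich)
  have l: "((\<lambda>u::real. ln (ln (u / 2)) / ln (ln u)) \<longlongrightarrow> 1) at_top" "((\<lambda>u::real. ln (ln (2 * u)) / ln (ln u)) \<longlongrightarrow> 1) at_top"
    by real_asymp+
  show "((\<lambda>n. ln (ln (u n / 2)) / ln (ln (u n))) \<longlongrightarrow> 1) F" "((\<lambda>n. ln (ln (2 * u n)) / ln (ln (u n))) \<longlongrightarrow> 1) F"
    by (rule filterlim_compose[OF l(1) u], rule filterlim_compose[OF l(2) u])
  have "\<forall>\<^sub>F u::real in at_top. 8 < u \<and> 1 < ln (u / 2) \<and> 0 < ln (ln u)" by (intro eventually_conj) real_asymp+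
  note 1 = filterlim_iff[THEN iffD1, OF u, rule_format, OF this]
  have 2: "\<forall>\<^sub>F n in F. 1/2 < v n / u n" using r by (rule order_tendstoD) simp
  have 3: "\<forall>\<^sub>F n in F. v n / u n < 2" using r by (rule order_tendstoD) simp
  from 1 2 3 have ev: "\<forall>\<^sub>F n in F. 1 < ln (u n / 2) \<and> 0 < ln (ln (u n)) \<and> u n / 2 \<le> v n \<and> v n \<le> 2 * u n \<and> 0 < u n \<and> 0 < v n"
  proof eventually_elim
    case (elim n)
    then have u: "8 < u n" "1 < ln (u n / 2)" "0 < ln (ln (u n))" by blast+
    have "1/2 * u n < v n / u n * u n" "v n / u n * u n < 2 * u n" using elim u by (intro mult_strict_right_mono; linarith)+
    moreover have "v n / u n * u n = v n" using u by simp
    ultimately show ?case using u by (intro conjI) linarith+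
  qed
  show "\<forall>\<^sub>F n in F. ln (ln (u n / 2)) / ln (ln (u n)) \<le> ln (ln (v n)) / ln (ln (u n))"
    using ev
  proof eventually_elim
    case (elim n)
    have "ln (u n / 2) \<le> ln (v n)" using elim by (intro ln_mono) auto
    then have "ln (ln (u n / 2)) \<le> ln (ln (v n))" using elim by (intro ln_mono) linarith+
    then show ?case using elim by (intro divide_right_mono) auto
  qed
  show "\<forall>\<^sub>F n in F. ln (ln (v n)) / ln (ln (u n)) \<le> ln (ln (2 * u n)) / ln (ln (u n))"
    using ev
  proof eventually_elim
    case (elim n)
    have "ln (u n / 2) \<le> ln (v n)" "ln (v n) \<le> ln (2 * u n)" using elim by (auto intro!: ln_mono)
    then have "ln (ln (v n)) \<le> ln (ln (2 * u n))" using elim by (intro ln_mono) linarith+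
    then show ?case using elim by (intro divide_right_mono) auto
  qed
qed

lemma std_normal_cdf: "cdf std_normal_distribution y = (LINT t:{..y}|lborel. 1 / sqrt (2 * pi) * exp (- (t\<^sup>2 / 2)))"
proof -
  interpret N: real_distribution std_normal_distribution by (rule real_dist_normal_dist)
  have "cdf std_normal_distribution y = (\<integral>t. indicator {..y} t \<partial>std_normal_distribution)"
    by (simp add: cdf_def)
  also have "\<dots> = (\<integral>t. std_normal_density t * indicator {..y} t \<partial>lborel)"
    by (subst integral_density) auto
  also have "\<dots> = (LINT t:{..y}|lborel. 1 / sqrt (2 * pi) * exp (- (t\<^sup>2 / 2)))"
    unfolding set_lebesgue_integral_def
    by (intro Bochner_Integration.integral_cong) (auto simp: std_normal_density_def indicator_def)
  finally show ?thesis .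
qed

lemma isCont_std_normal_cdf: "isCont (cdf std_normal_distribution) y"
proof -
  interpret N: real_distribution std_normal_distribution by (rule real_dist_normal_dist)
  have "emeasure std_normal_distribution {y} = 0"
    by (subst emeasure_density) (auto simp: nn_integral_0_iff_AE AE_lborel_singleton[THEN AE_mp])
  then show ?thesis by (simp add: N.isCont_cdf measure_def)
qed

locale takagi_sigma = takagi +
  fixes \<sigma> :: "real \<Rightarrow> real"
  assumes sig_anti: "antimono_on {0<..<1} \<sigma>" and sig_cont: "continuous_on {0<..<1} \<sigma>"
    and sig_V: "\<forall>n\<ge>1. \<sigma> (1 / real r ^ n) = V_seq r a n"
begin

abbreviation "f \<equiv> takagi_vdw r a"
abbreviation "V \<equiv> V_seq r a"

definition inc :: "real \<Rightarrow> real \<Rightarrow> real" where "inc x h = (f (x + h) - f x) / h"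

lemma f_continuous: "continuous_on UNIV f"
proof -
  have "uniform_limit UNIV (\<lambda>n x. \<Sum>k<n. a (Suc k) / real r ^ k * nearest_int_dist (real r ^ k * x)) (\<lambda>x. \<Sum>k. a (Suc k) / real r ^ k * nearest_int_dist (real r ^ k * x)) sequentially"
  proof (rule Weierstrass_m_test)
    show "summable (\<lambda>j. \<bar>a (1 + j)\<bar> / 2 ^ j)" by (rule a_summable)
    fix j x
    have "norm (a (Suc j) / real r ^ j * nearest_int_dist (real r ^ j * x)) = \<bar>a (Suc j)\<bar> / real r ^ j * nearest_int_dist (real r ^ j * x)"
      using nearest_int_dist_nonneg[of "real r ^ j * x"] by (simp add: abs_mult)
    also have "\<dots> \<le> \<bar>a (Suc j)\<bar> / real r ^ j * 1"
      using nearest_int_dist_le[of "real r ^ j * x"] by (intro mult_left_mono) auto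
    also have "\<dots> \<le> \<bar>a (Suc j)\<bar> / 2 ^ j" using rpos by (simp, intro divide_left_mono power_mono) auto
    finally show "norm (a (Suc j) / real r ^ j * nearest_int_dist (real r ^ j * x)) \<le> \<bar>a (1 + j)\<bar> / 2 ^ j" by simp
  qed
  then show ?thesis unfolding takagi_vdw_def
    by (rule uniform_limit_theorem[rotated]) (use rpos in \<open>auto intro!: always_eventually continuous_intros\<close>)
qed

lemma inc_measurable: "(\<lambda>x. inc x h) \<in> borel_measurable circle_measure"
proof -
  have [measurable]: "f \<in> borel_measurable borel" by (rule borel_measurable_continuous_onI[OF f_continuous])
  show ?thesis unfolding inc_def by (rule borel_measurable_circle) measurable
qed

text \<open>The level \<open>n\<close> with \<open>r\<^sup>-\<^sup>n\<^sup>-\<^sup>1 < u \<le> r\<^sup>-\<^sup>n\<close>, for \<open>0 < u \<le> 1\<close>.\<close>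

definition lev :: "real \<Rightarrow> nat" where "lev u = (LEAST n. 1 / real r ^ Suc n < u)"

lemma inv_power_lim: "(\<lambda>n. 1 / real r ^ n) \<longlonglongrightarrow> 0"
  using rpos LIMSEQ_inverse_realpow_zero[of "real r"] by (simp add: inverse_eq_divide)

lemma lev:
  assumes "0 < u" "u \<le> 1"
  shows "1 / real r ^ Suc (lev u) < u" "u \<le> 1 / real r ^ lev u"
proof -
  have "\<forall>\<^sub>F n in sequentially. 1 / real r ^ n < u" using inv_power_lim assms(1) by (rule order_tendstoD)
  then have "\<exists>n. 1 / real r ^ Suc n < u" unfolding eventually_sequentially by (meson le_SucI order_refl)
  then show "1 / real r ^ Suc (lev u) < u" unfolding lev_def by (rule LeastI_ex)
  show "u \<le> 1 / real r ^ lev u"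
  proof (cases "lev u")
    case (Suc m)
    then have "\<not> 1 / real r ^ Suc m < u" unfolding lev_def by (metis lessI not_less_Least)
    then show ?thesis using Suc by simp
  qed (use assms in simp)
qed

lemma inv_power_mono: "m \<le> n \<Longrightarrow> 1 / real r ^ n \<le> 1 / real r ^ m"
  using rpos by (intro divide_left_mono power_increasing) auto

lemma lev_ge: "0 < u \<Longrightarrow> u \<le> 1 / real r ^ n \<Longrightarrow> n \<le> lev u"
proof (rule ccontr)
  assume u: "0 < u" "u \<le> 1 / real r ^ n" and "\<not> n \<le> lev u"
  then have "1 / real r ^ n \<le> 1 / real r ^ Suc (lev u)" by (intro inv_power_mono) simp
  moreover have "u \<le> 1" using u(2) inv_power_mono[of 0 n] by simp
  ultimately show False using lev(1)[of u] u by simp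
qed

lemma lev_mono: "0 < u \<Longrightarrow> u \<le> v \<Longrightarrow> v \<le> 1 \<Longrightarrow> lev v \<le> lev u"
  by (rule lev_ge) (use lev(2)[of v] in auto)

lemma lev_inv_power: "lev (1 / real r ^ n) = n"
proof (rule antisym)
  have p: "0 < 1 / real r ^ n" using rpos by simp
  show "n \<le> lev (1 / real r ^ n)" using p by (rule lev_ge) simp
  show "lev (1 / real r ^ n) \<le> n"
    unfolding lev_def by (rule Least_le) (use rpos in \<open>simp add: field_simps\<close>)
qed

lemma lev_top: "filterlim lev at_top (at_right 0)"
  unfolding filterlim_at_top
proof
  fix n
  have "0 < 1 / real r ^ n" using rpos by simp
  then have "\<forall>\<^sub>F u in at_right 0. u \<in> {0<..<1 / real r ^ n}" by (rule eventually_at_right_real)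
  then show "\<forall>\<^sub>F u in at_right 0. n \<le> lev u" by eventually_elim (auto intro: lev_ge)
qed

lemma U_Suc_ratio: "(\<lambda>n. U (Suc n) / U n) \<longlonglongrightarrow> 1"
proof (rule tendstoI)
  fix e :: real assume e: "0 < e"
  have "\<forall>\<^sub>F n in sequentially. (b (Suc n))\<^sup>2 \<le> e / 10 * A n" using e by (intro b_Suc_small) simp
  moreover have "\<forall>\<^sub>F n in sequentially. 1 \<le> U n" using quad_lim unfolding filterlim_at_top by blast
  ultimately show "\<forall>\<^sub>F n in sequentially. dist (U (Suc n) / U n) 1 < e"
    using quad_A
  proof eventually_elim
    case (elim n)
    have "e / 10 * A n \<le> e / 10 * (5 * U n)" using elim e by (intro mult_left_mono) auto
    moreover have "(b (Suc n))\<^sup>2 * chain.cvar (Suc n) \<le> (b (Suc n))\<^sup>2" using chain.cvar_bounds(2) by (simp add: mult_left_le)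
    ultimately have "U (Suc n) - U n \<le> e / 2 * U n" using elim by (simp add: chain.quad_Suc)
    then have "(U (Suc n) - U n) / U n \<le> e / 2" using elim by (simp add: pos_divide_le_eq)
    moreover have "U (Suc n) / U n - 1 = (U (Suc n) - U n) / U n" using elim by (simp add: diff_divide_distrib)
    moreover have "0 \<le> (U (Suc n) - U n) / U n" using chain.quad_mono[of n "Suc n" b] elim by (intro divide_nonneg_nonneg) auto
    ultimately show ?case using e unfolding dist_real_def by linarith
  qed
qed

lemma V_Suc_ratio: "(\<lambda>n. V (Suc n) / U n) \<longlonglongrightarrow> 1"
proof -
  have "(\<lambda>n. V (Suc n) / U (Suc n) * (U (Suc n) / U n)) \<longlonglongrightarrow> 1 * 1"
    by (intro tendsto_mult U_Suc_ratio LIMSEQ_Suc[OF V_U_ratio])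
  moreover have "\<forall>\<^sub>F n in sequentially. 1 \<le> U (Suc n)"
    using quad_lim unfolding filterlim_at_top eventually_sequentially by (meson le_SucI)
  then have "\<forall>\<^sub>F n in sequentially. V (Suc n) / U (Suc n) * (U (Suc n) / U n) = V (Suc n) / U n"
    by eventually_elim auto
  ultimately show ?thesis using Lim_transform_eventually by fastforce
qed

text \<open>Monotonicity pins \<sigma> between its prescribed values at the two neighbouring grid
  points. With \<open>V_U_ratio\<close> and \<open>V_Suc_ratio\<close> this lets
  \<open>U (lev u)\<close> stand in for \<open>\<sigma> u\<close> in the limit theorems.\<close>

lemma sigma_bounds:
  assumes "0 < u" "u < 1" "1 \<le> lev u" shows "V (lev u) \<le> \<sigma> u" "\<sigma> u \<le> V (Suc (lev u))"
proof -
  have in01: "1 / real r ^ n \<in> {0<..<1}" if "1 \<le> n" for n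
    using rpos that by (simp add: divide_less_eq)
  have anti: "\<sigma> v \<le> \<sigma> u" if "u \<in> {0<..<1}" "v \<in> {0<..<1}" "u \<le> v" for u v
    using sig_anti that by (auto simp: monotone_on_def)
  show "V (lev u) \<le> \<sigma> u"
    using anti[of u "1 / real r ^ lev u"] lev(2)[of u] in01[OF assms(3)] assms sig_V by auto
  show "\<sigma> u \<le> V (Suc (lev u))"
    using anti[of "1 / real r ^ Suc (lev u)" u] lev(1)[of u] in01[of "Suc (lev u)"] assms sig_V[rule_format, of "Suc (lev u)"] by auto
qed

lemma eventually_small: "\<forall>\<^sub>F u in at_right 0. 0 < u \<and> u < (1::real) \<and> n \<le> lev u"
proof -
  have "\<forall>\<^sub>F u in at_right 0. u \<in> {0<..<1::real}" by (rule eventually_at_right_real) simp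
  moreover have "\<forall>\<^sub>F u in at_right 0. n \<le> lev u" using lev_top unfolding filterlim_at_top by blast
  ultimately show ?thesis by eventually_elim auto
qed

lemma sigma_ratio: "((\<lambda>u. \<sigma> u / U (lev u)) \<longlongrightarrow> 1) (at_right 0)"
proof (rule tendsto_sandwich)
  show "((\<lambda>u. V (lev u) / U (lev u)) \<longlongrightarrow> 1) (at_right 0)" by (rule filterlim_compose[OF V_U_ratio lev_top])
  show "((\<lambda>u. V (Suc (lev u)) / U (lev u)) \<longlongrightarrow> 1) (at_right 0)" by (rule filterlim_compose[OF V_Suc_ratio lev_top])
  show "\<forall>\<^sub>F u in at_right 0. V (lev u) / U (lev u) \<le> \<sigma> u / U (lev u)" "\<forall>\<^sub>F u in at_right 0. \<sigma> u / U (lev u) \<le> V (Suc (lev u)) / U (lev u)"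
    using eventually_small[of 1] by (eventually_elim, use sigma_bounds chain.quad_nonneg in \<open>auto intro!: divide_right_mono\<close>)+
qed

lemma U_lev_top: "filterlim (\<lambda>u. U (lev u)) at_top (at_right 0)"
  by (rule filterlim_compose[OF quad_lim lev_top])

lemma sigma_top: "filterlim \<sigma> at_top (at_right 0)"
proof (rule filterlim_at_top_mono)
  show "filterlim (\<lambda>u. 1/2 * U (lev u)) at_top (at_right 0)"
    by (rule filterlim_tendsto_pos_mult_at_top[OF tendsto_const _ U_lev_top]) simp
  have "\<forall>\<^sub>F u in at_right 0. 0 < U (lev u)" using U_lev_top unfolding filterlim_at_top_dense by blast
  moreover have "\<forall>\<^sub>F u in at_right 0. 1/2 < \<sigma> u / U (lev u)" using sigma_ratio by (rule order_tendstoD) simp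
  ultimately show "\<forall>\<^sub>F u in at_right 0. 1/2 * U (lev u) \<le> \<sigma> u"
  proof eventually_elim
    case (elim u)
    then have "1/2 * U (lev u) < \<sigma> u / U (lev u) * U (lev u)" by (intro mult_strict_right_mono) auto
    then show ?case using elim by auto
  qed
qed

lemma err_small: "(\<lambda>n. C * D n powr gp * sqrt (ln (ln (U n))) / sqrt (U n)) \<longlonglongrightarrow> 0"
proof (rule Lim_null_comparison)
  have "((\<lambda>u::real. u powr gp * sqrt (ln (ln u)) / sqrt u) \<longlongrightarrow> 0) at_top" using gp by real_asymp
  then have "(\<lambda>n. U n powr gp * sqrt (ln (ln (U n))) / sqrt (U n)) \<longlonglongrightarrow> 0" by (rule filterlim_compose[OF _ quad_lim])
  then show "(\<lambda>n. \<bar>C\<bar> * 6 * (U n powr gp * sqrt (ln (ln (U n))) / sqrt (U n))) \<longlonglongrightarrow> 0" by (rule tendsto_mult_right_zero)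
  have "\<forall>\<^sub>F u::real in at_top. 0 \<le> ln (ln u) \<and> 1 \<le> u" by (intro eventually_conj) real_asymp+
  from filterlim_iff[THEN iffD1, OF quad_lim, rule_format, OF this] quad_A
  show "\<forall>\<^sub>F n in sequentially. norm (C * D n powr gp * sqrt (ln (ln (U n))) / sqrt (U n)) \<le> \<bar>C\<bar> * 6 * (U n powr gp * sqrt (ln (ln (U n))) / sqrt (U n))"
  proof eventually_elim
    case (elim n)
    \<comment> \<open>By \<open>quad_A\<close>, \<open>D n = 1 + A n\<close> is at most
      \<open>6 * U n\<close> as soon as \<open>U n \<ge> 1\<close>.\<close>
    have "D n powr gp \<le> (6 * U n) powr gp" using elim D_ge[of n] gp by (intro powr_mono2) (auto simp: D_def)
    also have "\<dots> = 6 powr gp * U n powr gp" using elim by (simp add: powr_mult)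
    also have "\<dots> \<le> 6 powr 1 * U n powr gp" using gp by (intro mult_right_mono powr_mono) auto
    finally have "D n powr gp \<le> 6 * U n powr gp" by simp
    then have "\<bar>C\<bar> * D n powr gp * (sqrt (ln (ln (U n))) / sqrt (U n)) \<le> \<bar>C\<bar> * (6 * U n powr gp) * (sqrt (ln (ln (U n))) / sqrt (U n))"
      using elim by (intro mult_right_mono mult_left_mono) auto
    then show ?case using elim by (simp add: abs_mult mult.assoc)
  qed
qed

lemma err_small_sqrt: "(\<lambda>n. C * D n powr gp / sqrt (U n)) \<longlonglongrightarrow> 0"
proof (rule Lim_null_comparison[OF _ err_small[of "\<bar>C\<bar>"]])
  have "\<forall>\<^sub>F u::real in at_top. 1 \<le> ln (ln u) \<and> 1 \<le> u" by (intro eventually_conj) real_asymp+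
  from filterlim_iff[THEN iffD1, OF quad_lim, rule_format, OF this]
  show "\<forall>\<^sub>F n in sequentially. norm (C * D n powr gp / sqrt (U n)) \<le> \<bar>C\<bar> * D n powr gp * sqrt (ln (ln (U n))) / sqrt (U n)"
  proof eventually_elim
    case (elim n)
    have "\<bar>C\<bar> * D n powr gp * 1 \<le> \<bar>C\<bar> * D n powr gp * sqrt (ln (ln (U n)))" using elim by (intro mult_left_mono) auto
    then show ?case using elim by (simp add: abs_mult divide_right_mono)
  qed
qed

lemma inc_error: "AE x in circle_measure. \<exists>C\<ge>0. \<forall>h. 0 < \<bar>h\<bar> \<and> \<bar>h\<bar> \<le> 1 \<longrightarrow> \<bar>inc x h - W (lev \<bar>h\<bar>) x\<bar> \<le> C * D (lev \<bar>h\<bar>) powr gp"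
  using increment_error
proof eventually_elim
  case (elim x)
  then obtain C where C: "C \<ge> 0" "\<And>n h. 1 / real r ^ Suc n < \<bar>h\<bar> \<and> \<bar>h\<bar> \<le> 1 / real r ^ n \<Longrightarrow>
     \<bar>(f (x + h) - f x) / h - W n x\<bar> \<le> C * D n powr gp" by blast
  then show ?case using lev unfolding inc_def by (intro exI[of _ C]) auto
qed

text \<open>Along any sequence \<open>h i\<close> the normalised quotient is
  \<open>c i * Z i x + \<eta> i x\<close>, where \<open>c i\<close> tends to 1 and
  \<open>\<eta> i x\<close> to 0 almost everywhere, so its characteristic function has the same
  limit as that of \<open>Z i\<close>. The level depends on \<open>\<bar>h i\<bar>\<close> only,
  which covers negative steps.\<close>

lemma CLT:
  "((\<lambda>h. \<P>(x in circle_measure. inc x h / sqrt (\<sigma> \<bar>h\<bar>) \<le> y)) \<longlongrightarrow> cdf std_normal_distribution y) (at 0)"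
  unfolding tendsto_at_iff_sequentially
proof (intro allI impI)
  fix h :: "nat \<Rightarrow> real" assume h: "\<forall>i. h i \<in> UNIV - {0}" "h \<longlonglongrightarrow> 0"
  define N where "N i = lev \<bar>h i\<bar>" for i
  define q where "q i x = inc x (h i) / sqrt (\<sigma> \<bar>h i\<bar>)" for i x
  define Z where "Z i x = W (N i) x / sqrt (U (N i))" for i x
  define c where "c i = sqrt (U (N i)) / sqrt (\<sigma> \<bar>h i\<bar>)" for i
  define \<eta> where "\<eta> i x = (inc x (h i) - W (N i) x) / sqrt (\<sigma> \<bar>h i\<bar>)" for i x
  have h0: "filterlim (\<lambda>i. \<bar>h i\<bar>) (at_right 0) sequentially"
    using h by (auto simp: filterlim_at intro!: tendsto_rabs_zero)
  have Ntop: "filterlim N at_top sequentially" unfolding N_def by (rule filterlim_compose[OF lev_top h0])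
  have [measurable]: "inc' \<in> borel_measurable circle_measure" if "inc' = (\<lambda>x. inc x (h i))" for inc' i
    using inc_measurable that by simp
  have qm [measurable]: "q i \<in> borel_measurable circle_measure" for i unfolding q_def using inc_measurable by measurable
  have Zm [measurable]: "Z i \<in> borel_measurable circle_measure" for i unfolding Z_def by measurable
  have sr: "(\<lambda>i. \<sigma> \<bar>h i\<bar> / U (N i)) \<longlonglongrightarrow> 1" unfolding N_def by (rule filterlim_compose[OF sigma_ratio h0])
  have Upos: "\<forall>\<^sub>F i in sequentially. 0 < U (N i)"
    using filterlim_compose[OF quad_lim Ntop] unfolding filterlim_at_top_dense by blast
  have spos: "\<forall>\<^sub>F i in sequentially. 0 < \<sigma> \<bar>h i\<bar>"
    using filterlim_compose[OF sigma_top h0] unfolding filterlim_at_top_dense by blast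
  have c1: "c \<longlonglongrightarrow> 1"
  proof -
    have "(\<lambda>i. 1 / sqrt (\<sigma> \<bar>h i\<bar> / U (N i))) \<longlonglongrightarrow> 1 / sqrt 1" by (intro tendsto_intros sr) auto
    then show ?thesis by (simp add: c_def[abs_def] real_sqrt_divide)
  qed
  have eta0: "AE x in circle_measure. (\<lambda>i. \<eta> i x) \<longlonglongrightarrow> 0"
    using inc_error
  proof eventually_elim
    case (elim x)
    then obtain C where C: "C \<ge> 0" "\<And>h. 0 < \<bar>h\<bar> \<and> \<bar>h\<bar> \<le> 1 \<Longrightarrow> \<bar>inc x h - W (lev \<bar>h\<bar>) x\<bar> \<le> C * D (lev \<bar>h\<bar>) powr gp" by blast
    have "(\<lambda>i. C * D (N i) powr gp / sqrt (U (N i)) * c i) \<longlonglongrightarrow> 0 * 1"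
      by (intro tendsto_mult c1 filterlim_compose[OF err_small_sqrt Ntop])
    then have lim: "(\<lambda>i. C * D (N i) powr gp / sqrt (U (N i)) * c i) \<longlonglongrightarrow> 0" by simp
    have h1: "\<forall>\<^sub>F i in sequentially. \<bar>h i\<bar> < 1" using order_tendstoD(2)[OF tendsto_rabs_zero[OF h(2)], of 1] by simp
    show ?case
    proof (rule Lim_null_comparison[OF _ lim])
      show "\<forall>\<^sub>F i in sequentially. norm (\<eta> i x) \<le> C * D (N i) powr gp / sqrt (U (N i)) * c i"
        using Upos spos h1
      proof eventually_elim
        case (elim i)
        have "\<bar>inc x (h i) - W (N i) x\<bar> \<le> C * D (N i) powr gp" unfolding N_def using C(2)[of "h i"] h(1) elim by auto
        then have "norm (\<eta> i x) \<le> C * D (N i) powr gp / sqrt (\<sigma> \<bar>h i\<bar>)"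
          unfolding \<eta>_def using elim by (simp add: abs_divide divide_right_mono)
        also have "\<dots> = C * D (N i) powr gp / sqrt (U (N i)) * c i" using elim by (simp add: c_def)
        finally show ?case .
      qed
    qed
  qed
  define \<mu> where "\<mu> i = distr circle_measure borel (q i)" for i
  have "weak_conv_m \<mu> std_normal_distribution"
  proof (rule levy_continuity)
    show "real_distribution (\<mu> i)" for i unfolding \<mu>_def by (rule chain.real_distribution_distr) (rule qm)
    show "real_distribution std_normal_distribution" by (rule real_dist_normal_dist)
    fix t
    \<comment> \<open>The conditional limit with the sure event and a block that starts at
      0.\<close>
    have "(\<lambda>i. (\<integral>x. of_bool True * iexp (t * ((W (N i) x - W 0 x) / sqrt (U (N i)))) \<partial>circle_measure)
       / complex_of_real (\<integral>x. of_bool True \<partial>circle_measure)) \<longlonglongrightarrow> exp (- of_real (t\<^sup>2 * 1 / 2))"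
    proof (rule char_limit)
      show "(\<lambda>i. (U (N i) - U 0) / U (N i)) \<longlonglongrightarrow> 1"
        by (rule tendsto_eventually) (use Upos in eventually_elim, simp)
    qed (use Ntop in \<open>auto simp: past_const chain.prob_space[unfolded space_circle_measure]\<close>)
    then have Zlim: "(\<lambda>i. \<integral>x. iexp (t * Z i x) \<partial>circle_measure) \<longlonglongrightarrow> char std_normal_distribution t"
      by (simp add: Z_def char_std_normal_distribution chain.prob_space[unfolded space_circle_measure] flip: exp_of_real)
    have ie: "cmod (iexp u - iexp w) \<le> \<bar>u - w\<bar>" for u w :: real
    proof -
      have "iexp u - iexp w = iexp w * (iexp (u - w) - 1)" by (simp add: algebra_simps flip: exp_add)
      then have "cmod (iexp u - iexp w) = cmod (iexp (u - w) - 1)" by (simp add: norm_mult)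
      also have "\<dots> \<le> \<bar>u - w\<bar>" using iexp_approx1[of "u - w" 0] by simp
      finally show ?thesis .
    qed
    have ie2: "cmod (iexp u - iexp w) \<le> 2" for u w :: real
      using norm_triangle_ineq4[of "iexp u" "iexp w"] by simp
    define v where "v i x = t * (c i * Z i x)" for i x
    have vm [measurable]: "v i \<in> borel_measurable circle_measure" for i unfolding v_def by measurable
    have im: "(\<lambda>x. iexp (g x)) \<in> borel_measurable circle_measure" if [measurable]: "g \<in> borel_measurable circle_measure" for g :: "real \<Rightarrow> real"
      by measurable
    have int: "integrable circle_measure (\<lambda>x. iexp (g x))" if "g \<in> borel_measurable circle_measure" for g :: "real \<Rightarrow> real"
      using im[OF that] by (intro chain.integrable_const_bound[of _ 1]) auto
    have tm: "(\<lambda>x. t * q i x) \<in> borel_measurable circle_measure" "(\<lambda>x. t * Z i x) \<in> borel_measurable circle_measure" for i by measurable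
    have L1: "(\<lambda>i. \<integral>x. iexp (t * q i x) - iexp (v i x) \<partial>circle_measure) \<longlonglongrightarrow> (\<integral>x. 0 \<partial>circle_measure)"
    proof (rule integral_dominated_convergence[where w = "\<lambda>_. 2"])
      show "AE x in circle_measure. (\<lambda>i. iexp (t * q i x) - iexp (v i x)) \<longlonglongrightarrow> 0"
        using eta0
      proof eventually_elim
        case (elim x)
        have "(\<lambda>i. \<bar>t\<bar> * \<bar>\<eta> i x\<bar>) \<longlonglongrightarrow> 0" by (intro tendsto_mult_right_zero tendsto_rabs_zero elim)
        then show ?case
        proof (rule Lim_null_comparison[rotated])
          show "\<forall>\<^sub>F i in sequentially. norm (iexp (t * q i x) - iexp (v i x)) \<le> \<bar>t\<bar> * \<bar>\<eta> i x\<bar>"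
            using Upos
          proof eventually_elim
            case (elim i)
            have "t * q i x - v i x = t * \<eta> i x" using elim by (simp add: q_def v_def \<eta>_def c_def Z_def diff_divide_distrib right_diff_distrib)
            then show ?case using ie[of "t * q i x" "v i x"] by (simp add: abs_mult)
          qed
        qed
      qed
      show "AE x in circle_measure. norm (iexp (t * q i x) - iexp (v i x)) \<le> 2" for i by (intro AE_I2 ie2)
    qed (use im[OF tm(1)] im[OF vm] in \<open>auto intro!: borel_measurable_diff\<close>)
    \<comment> \<open>\<open>Z i\<close> is bounded in mean and not pointwise: its second moment is
      1.\<close>
    have L2: "(\<lambda>i. \<integral>x. iexp (v i x) - iexp (t * Z i x) \<partial>circle_measure) \<longlonglongrightarrow> 0"
    proof (rule Lim_null_comparison)
      show "(\<lambda>i. \<bar>t\<bar> * \<bar>c i - 1\<bar>) \<longlonglongrightarrow> 0" by (intro tendsto_mult_right_zero tendsto_rabs_zero LIM_zero c1)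
      show "\<forall>\<^sub>F i in sequentially. norm (\<integral>x. iexp (v i x) - iexp (t * Z i x) \<partial>circle_measure) \<le> \<bar>t\<bar> * \<bar>c i - 1\<bar>"
        using Upos
      proof eventually_elim
        case (elim i)
        have pZ: "past (slope_seq r) (N i) (\<lambda>x. \<bar>t\<bar> * \<bar>c i - 1\<bar> * ((1 + (Z i x)\<^sup>2) / 2))"
          unfolding Z_def by (rule past_comp[OF chain.past_mart]) simp
        have pZ2: "past (slope_seq r) (N i) (\<lambda>x. (W (N i) x)\<^sup>2)" by (rule past_comp[OF chain.past_mart]) simp
        have "norm (\<integral>x. iexp (v i x) - iexp (t * Z i x) \<partial>circle_measure) \<le> (\<integral>x. norm (iexp (v i x) - iexp (t * Z i x)) \<partial>circle_measure)"
          by (rule integral_norm_bound)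
        also have "\<dots> \<le> (\<integral>x. \<bar>t\<bar> * \<bar>c i - 1\<bar> * ((1 + (Z i x)\<^sup>2) / 2) \<partial>circle_measure)"
        proof (rule integral_mono)
          show "integrable circle_measure (\<lambda>x. norm (iexp (v i x) - iexp (t * Z i x)))"
            by (intro integrable_norm Bochner_Integration.integrable_diff int vm tm)
          show "integrable circle_measure (\<lambda>x. \<bar>t\<bar> * \<bar>c i - 1\<bar> * ((1 + (Z i x)\<^sup>2) / 2))" by (rule chain.past_integrable[OF pZ])
          fix x
          have "v i x - t * Z i x = t * (c i - 1) * Z i x" by (simp add: v_def algebra_simps)
          then have "norm (iexp (v i x) - iexp (t * Z i x)) \<le> \<bar>t\<bar> * \<bar>c i - 1\<bar> * \<bar>Z i x\<bar>"
            using ie[of "v i x" "t * Z i x"] by (simp add: abs_mult)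
          also have "\<bar>Z i x\<bar> \<le> (1 + (Z i x)\<^sup>2) / 2" using sum_squares_bound[of 1 "\<bar>Z i x\<bar>"] by simp
          finally show "norm (iexp (v i x) - iexp (t * Z i x)) \<le> \<bar>t\<bar> * \<bar>c i - 1\<bar> * ((1 + (Z i x)\<^sup>2) / 2)"
            by (simp add: mult_left_mono)
        qed
        also have "\<dots> = \<bar>t\<bar> * \<bar>c i - 1\<bar>"
        proof -
          have "(\<integral>x. (1 + (Z i x)\<^sup>2) / 2 \<partial>circle_measure) = 1"
            unfolding Z_def power_divide using elim chain.past_integrable[OF pZ2]
            by (simp add: chain.mart_second_moment chain.prob_space[unfolded space_circle_measure])
          then show ?thesis by simp
        qed
        finally show ?case .
      qed
    qed
    have "(\<lambda>i. (\<integral>x. iexp (t * q i x) - iexp (v i x) \<partial>circle_measure) + (\<integral>x. iexp (v i x) - iexp (t * Z i x) \<partial>circle_measure) + (\<integral>x. iexp (t * Z i x) \<partial>circle_measure)) \<longlonglongrightarrow> (\<integral>x. 0 \<partial>circle_measure) + 0 + char std_normal_distribution t"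
      by (intro tendsto_add L1 L2 Zlim)
    moreover have "(\<integral>x. iexp (t * q i x) - iexp (v i x) \<partial>circle_measure) + (\<integral>x. iexp (v i x) - iexp (t * Z i x) \<partial>circle_measure) + (\<integral>x. iexp (t * Z i x) \<partial>circle_measure) = char (\<mu> i) t" for i
    proof -
      have "char (\<mu> i) t = (\<integral>x. iexp (t * q i x) \<partial>circle_measure)"
        unfolding char_def \<mu>_def by (rule integral_distr) (auto simp: qm)
      then show ?thesis
        by (simp only: Bochner_Integration.integral_diff[OF int[OF tm(1)] int[OF vm]] Bochner_Integration.integral_diff[OF int[OF vm] int[OF tm(2)]]) simp
    qed
    ultimately show "(\<lambda>i. char (\<mu> i) t) \<longlonglongrightarrow> char std_normal_distribution t" by simp
  qed
  then have "(\<lambda>i. cdf (\<mu> i) y) \<longlonglongrightarrow> cdf std_normal_distribution y"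
    unfolding weak_conv_m_def weak_conv_def using isCont_std_normal_cdf by blast
  moreover have "cdf (\<mu> i) y = \<P>(x in circle_measure. inc x (h i) / sqrt (\<sigma> \<bar>h i\<bar>) \<le> y)" for i
    unfolding cdf_def \<mu>_def by (subst measure_distr) (auto simp: qm q_def intro!: arg_cong2[where f = measure])
  ultimately show "((\<lambda>h. \<P>(x in circle_measure. inc x h / sqrt (\<sigma> \<bar>h\<bar>) \<le> y)) \<circ> h) \<longlonglongrightarrow> cdf std_normal_distribution y"
    by (simp add: comp_def)
qed

text \<open>This is not the upper half of the law: it is the lower half for the coefficients
  \<open>- b n\<close>, which have the same variances and the opposite martingale.\<close>

lemma LIL_upper:
  "AE x in circle_measure. \<forall>e>0. \<exists>\<^sub>F n in sequentially. W n x \<le> - (1 - e) * sqrt (2 * U n * ln (ln (U n)))"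
proof -
  have q: "chain.quad (\<lambda>n. - b n) = U" by (simp add: fun_eq_iff chain.quad_def)
  have m: "chain.mart (\<lambda>n. - b n) n x = - W n x" for n x
    by (simp add: chain.mart_def sum_negf)
  interpret neg: mart_growth circle_measure "slope_seq r" "chain_corr r" "\<lambda>n. - b n" Cb g
    by unfold_locales (use U_top C_pos gamma b_small in \<open>simp_all add: q\<close>)
  show ?thesis using neg.LIL_lower
  proof eventually_elim
    case (elim x)
    show ?case
    proof (intro allI impI)
      fix e :: real assume "0 < e"
      from elim[rule_format, OF this]
      show "\<exists>\<^sub>F n in sequentially. W n x \<le> - (1 - e) * sqrt (2 * U n * ln (ln (U n)))"
        by (rule frequently_elim1) (simp add: q m algebra_simps)
    qed
  qed
qed

lemma large_U: "\<forall>\<^sub>F n in sequentially. 3 < U n \<and> 1 < ln (ln (U n))"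
proof -
  have "\<forall>\<^sub>F u::real in at_top. 3 < u \<and> 1 < ln (ln u)" by (intro eventually_conj) real_asymp+
  then show ?thesis using filterlim_iff[THEN iffD1, OF quad_lim] by blast
qed

lemma sigma_inv_power: "1 \<le> n \<Longrightarrow> \<sigma> (1 / real r ^ n) = V n"
  using sig_V by blast

lemma inv_power_pos: "0 < 1 / real r ^ n"
  using rpos by simp

lemma inv_power_at_right: "filterlim (\<lambda>n. 1 / real r ^ n) (at_right 0) sequentially"
  unfolding filterlim_at using inv_power_lim inv_power_pos by auto

definition \<phi> :: "real \<Rightarrow> real \<Rightarrow> real" where
  "\<phi> x h = inc x h / sqrt (2 * \<sigma> h * ln (ln (\<sigma> h)))"

text \<open>On the grid \<open>1 / real r ^ n\<close> the normalisation \<sigma> equals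
  \<open>V n\<close> exactly, so \<phi> can be compared with the normalised \<open>W n\<close>
  directly.\<close>

lemma phi_approx:
  assumes C: "C \<ge> 0" "\<And>h. 0 < \<bar>h\<bar> \<and> \<bar>h\<bar> \<le> 1 \<Longrightarrow> \<bar>inc x h - W (lev \<bar>h\<bar>) x\<bar> \<le> C * D (lev \<bar>h\<bar>) powr gp"
  obtains \<eta> c where "\<eta> \<longlonglongrightarrow> 0" "c \<longlonglongrightarrow> (1::real)"
    "\<forall>\<^sub>F n in sequentially. 0 < sqrt (2 * U n * ln (ln (U n))) \<and> \<phi> x (1 / real r ^ n) = (W n x / sqrt (2 * U n * ln (ln (U n))) + \<eta> n) * c n"
proof
  define q where "q n = sqrt (2 * U n * ln (ln (U n)))" for n
  define s where "s n = sqrt (2 * V n * ln (ln (V n)))" for n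
  define \<eta> where "\<eta> n = (inc x (1 / real r ^ n) - W n x) / q n" for n
  define c where "c n = q n / s n" for n
  have q0: "\<forall>\<^sub>F n in sequentially. 0 < q n \<and> sqrt (U n) \<le> q n"
    using large_U
  proof eventually_elim
    case (elim n)
    then have "U n * 1 \<le> 2 * U n * ln (ln (U n))" by (intro mult_mono) auto
    then have "sqrt (U n) \<le> q n" "0 < sqrt (U n)" using elim by (auto simp: q_def)
    then show ?case by linarith
  qed
  show "\<eta> \<longlonglongrightarrow> 0"
  proof (rule Lim_null_comparison[OF _ err_small_sqrt[of C]])
    show "\<forall>\<^sub>F n in sequentially. norm (\<eta> n) \<le> C * D n powr gp / sqrt (U n)"
      using q0 large_U
    proof eventually_elim
      case (elim n)
      have "\<bar>inc x (1 / real r ^ n) - W n x\<bar> \<le> C * D n powr gp"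
        using C(2)[of "1 / real r ^ n"] inv_power_pos[of n] inv_power_mono[of 0 n] by (simp add: lev_inv_power)
      then have "norm (\<eta> n) \<le> C * D n powr gp / q n" using elim by (simp add: \<eta>_def divide_right_mono)
      also have "\<dots> \<le> C * D n powr gp / sqrt (U n)" using elim C(1) by (intro divide_left_mono mult_nonneg_nonneg mult_pos_pos) auto
      finally show ?case .
    qed
  qed
  have "(\<lambda>n. sqrt (V n / U n * (ln (ln (V n)) / ln (ln (U n))))) \<longlonglongrightarrow> sqrt (1 * 1)"
    by (intro tendsto_real_sqrt tendsto_mult V_U_ratio lnln_ratio[OF quad_lim V_U_ratio])
  moreover have "\<forall>\<^sub>F n in sequentially. sqrt (V n / U n * (ln (ln (V n)) / ln (ln (U n)))) = s n / q n"
    using large_U by eventually_elim (simp add: s_def q_def flip: real_sqrt_divide)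
  ultimately have lim: "(\<lambda>n. s n / q n) \<longlonglongrightarrow> 1" using Lim_transform_eventually by fastforce
  have "(\<lambda>n. inverse (s n / q n)) \<longlonglongrightarrow> inverse 1" by (intro tendsto_inverse lim) simp
  then show c: "c \<longlonglongrightarrow> 1" by (simp add: c_def[abs_def])
  show "\<forall>\<^sub>F n in sequentially. 0 < sqrt (2 * U n * ln (ln (U n))) \<and> \<phi> x (1 / real r ^ n) = (W n x / sqrt (2 * U n * ln (ln (U n))) + \<eta> n) * c n"
    using q0 eventually_ge_at_top[of 1]
  proof eventually_elim
    case (elim n)
    have "\<phi> x (1 / real r ^ n) = inc x (1 / real r ^ n) / s n" using elim by (simp add: \<phi>_def s_def sigma_inv_power)
    also have "inc x (1 / real r ^ n) = (W n x / q n + \<eta> n) * q n" using elim by (simp add: \<eta>_def field_simps)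
    finally show ?case using elim by (simp add: c_def q_def)
  qed
qed

lemma frequently_inv_power:
  assumes "\<exists>\<^sub>F n in sequentially. P (1 / real r ^ n)" "0 < d"
  shows "\<exists>u\<in>{0<..<d}. P u"
proof -
  have "\<forall>\<^sub>F n in sequentially. 1 / real r ^ n < d" using inv_power_lim assms(2) by (rule order_tendstoD)
  from frequently_ex[OF frequently_eventually_conj[OF assms(1) this]] show ?thesis using inv_power_pos by (auto simp del: divide_pos_pos)
qed

text \<open>On grid points arbitrarily near 0, \<open>\<phi> x\<close> comes arbitrarily close to 1
  and to -1. It is continuous between them, so the intermediate value theorem gives every value in
  between at arbitrarily small steps.\<close>

lemma LIL_cluster:
  "AE x in circle_measure. \<forall>y\<in>{-1..1}. \<exists>h :: nat \<Rightarrow> real. (\<forall>n. 0 < h n \<and> h n < 1) \<and> h \<longlonglongrightarrow> 0 \<and> (\<lambda>n. \<phi> x (h n)) \<longlonglongrightarrow> y"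
  using LIL_lower LIL_upper inc_error
proof eventually_elim
  case (elim x)
  then obtain C where C: "C \<ge> 0" "\<And>h. 0 < \<bar>h\<bar> \<and> \<bar>h\<bar> \<le> 1 \<Longrightarrow> \<bar>inc x h - W (lev \<bar>h\<bar>) x\<bar> \<le> C * D (lev \<bar>h\<bar>) powr gp" by blast
  from phi_approx[OF C] obtain \<eta> c where \<eta>: "\<eta> \<longlonglongrightarrow> 0" and c: "c \<longlonglongrightarrow> (1::real)"
    and phi: "\<forall>\<^sub>F n in sequentially. 0 < sqrt (2 * U n * ln (ln (U n))) \<and> \<phi> x (1 / real r ^ n) = (W n x / sqrt (2 * U n * ln (ln (U n))) + \<eta> n) * c n"
    by blast
  have ev: "\<forall>\<^sub>F n in sequentially. - e / 4 < \<eta> n \<and> \<eta> n < e / 4 \<and> 1 - e / 4 < c n \<and> c n < 2" if "0 < e" for e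
    using order_tendstoD(1)[OF \<eta>, of "- e / 4"] order_tendstoD(2)[OF \<eta>, of "e / 4"] order_tendstoD(1)[OF c, of "1 - e / 4"] order_tendstoD(2)[OF c, of 2] that
    by (auto intro!: eventually_conj)
  have hi: "\<exists>\<^sub>F n in sequentially. 1 - e \<le> \<phi> x (1 / real r ^ n)" and lo: "\<exists>\<^sub>F n in sequentially. \<phi> x (1 / real r ^ n) \<le> - (1 - e)" if e: "0 < e" "e < 1" for e
  proof -
    have pr: "1 - e \<le> u * v" if "1 - e / 2 \<le> u" "1 - e / 4 \<le> v" for u v
    proof -
      have "(1 - e / 2) * (1 - e / 4) \<le> u * v" using that e by (intro mult_mono) auto
      moreover have "(1 - e / 2) * (1 - e / 4) = 1 - 3 / 4 * e + e\<^sup>2 / 8" by (simp add: field_simps power2_eq_square)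
      ultimately show ?thesis using e zero_le_power2[of e] by linarith
    qed
    have e4: "0 < e / 4" using e by simp
    from elim(1)[rule_format, OF e4] ev[OF e(1)] phi
    have "\<exists>\<^sub>F n in sequentially. (1 - e / 4) * sqrt (2 * U n * ln (ln (U n))) \<le> W n x \<and> (- e / 4 < \<eta> n \<and> \<eta> n < e / 4 \<and> 1 - e / 4 < c n \<and> c n < 2)
      \<and> 0 < sqrt (2 * U n * ln (ln (U n))) \<and> \<phi> x (1 / real r ^ n) = (W n x / sqrt (2 * U n * ln (ln (U n))) + \<eta> n) * c n"
      by (rule frequently_eventually_frequently[OF _ eventually_conj])
    then show "\<exists>\<^sub>F n in sequentially. 1 - e \<le> \<phi> x (1 / real r ^ n)"
    proof (rule frequently_elim1, elim conjE, goal_cases)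
      case (1 n)
      then have "1 - e / 4 \<le> W n x / sqrt (2 * U n * ln (ln (U n)))" by (subst pos_le_divide_eq) auto
      then show ?case unfolding 1 using 1 by (intro pr) auto
    qed
    from elim(2)[rule_format, OF e4] ev[OF e(1)] phi
    have "\<exists>\<^sub>F n in sequentially. W n x \<le> - (1 - e / 4) * sqrt (2 * U n * ln (ln (U n))) \<and> (- e / 4 < \<eta> n \<and> \<eta> n < e / 4 \<and> 1 - e / 4 < c n \<and> c n < 2)
      \<and> 0 < sqrt (2 * U n * ln (ln (U n))) \<and> \<phi> x (1 / real r ^ n) = (W n x / sqrt (2 * U n * ln (ln (U n))) + \<eta> n) * c n"
      by (rule frequently_eventually_frequently[OF _ eventually_conj])
    then show "\<exists>\<^sub>F n in sequentially. \<phi> x (1 / real r ^ n) \<le> - (1 - e)"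
    proof (rule frequently_elim1, elim conjE, goal_cases)
      case (1 n)
      then have "W n x / sqrt (2 * U n * ln (ln (U n))) \<le> - (1 - e / 4)" by (subst pos_divide_le_eq) auto
      then have "1 - e \<le> - (W n x / sqrt (2 * U n * ln (ln (U n))) + \<eta> n) * c n" using 1 by (intro pr) auto
      then show ?case unfolding 1 by (simp add: algebra_simps)
    qed
  qed
  have "\<forall>\<^sub>F u::real in at_top. 3 < u \<and> 1 < ln (ln u)" by (intro eventually_conj) real_asymp+
  then have "\<forall>\<^sub>F u in at_right 0. 3 < \<sigma> u \<and> 1 < ln (ln (\<sigma> u))" using filterlim_iff[THEN iffD1, OF sigma_top] by blast
  \<comment> \<open>Below \<open>d0\<close> the denominator of \<phi> does not vanish.\<close>
  then obtain d0 where d0: "0 < d0" "\<And>u. 0 < u \<Longrightarrow> u < d0 \<Longrightarrow> 3 < \<sigma> u \<and> 1 < ln (ln (\<sigma> u))"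
    unfolding eventually_at_right_field by blast
  have cont: "continuous_on {0<..<d} (\<phi> x)" if d: "d \<le> d0" "d \<le> 1" for d
  proof -
    have s: "continuous_on {0<..<d} \<sigma>" by (rule continuous_on_subset[OF sig_cont]) (use d in auto)
    have ff: "continuous_on {0<..<d} (\<lambda>h. f (x + h))"
      by (rule continuous_on_compose2[OF f_continuous]) (auto intro!: continuous_intros)
    show ?thesis unfolding \<phi>_def[abs_def] inc_def
    proof (intro continuous_intros s ff ballI)
      fix u assume "u \<in> {0<..<d}"
      then have u: "3 < \<sigma> u" "1 < ln (ln (\<sigma> u))" "u \<noteq> 0" using d0(2)[of u] d by auto
      show "u \<noteq> 0" "\<sigma> u \<noteq> 0" using u by auto
      show "ln (\<sigma> u) \<noteq> 0" using u(2) by auto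
      have "ln (\<sigma> u) \<noteq> 1" using u(2) by auto
      then show "sqrt (2 * \<sigma> u * ln (ln (\<sigma> u))) \<noteq> 0" using u by simp
    qed
  qed
  show ?case
  proof
    fix y :: real assume y: "y \<in> {-1..1}"
    \<comment> \<open>The values 1 and -1 are only approached, so the target \<open>y\<close> is
      shrunk by a factor that tends to 1.\<close>
    have "\<exists>h. 0 < h \<and> h < 1 / real (k + 2) \<and> \<phi> x h = (1 - 1 / real (k + 2)) * y" for k
    proof -
      define d where "d = min d0 (1 / real (k + 2))"
      have d: "0 < d" "d \<le> d0" "d \<le> 1 / real (k + 2)" "1 / real (k + 2) < 1" using d0 by (auto simp: d_def)
      let ?e = "1 / real (k + 2)"
      have e: "0 < ?e" "?e < 1" by auto
      obtain u where u: "u \<in> {0<..<d}" "1 - ?e \<le> \<phi> x u" using frequently_inv_power[OF hi[OF e] d(1)] by blast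
      obtain v where v: "v \<in> {0<..<d}" "\<phi> x v \<le> - (1 - ?e)" using frequently_inv_power[OF lo[OF e] d(1)] by blast
      have con: "connected (\<phi> x ` {0<..<d})" by (rule connected_continuous_image[OF cont]) (use d in \<open>linarith | simp\<close>)+
      have "\<bar>(1 - ?e) * y\<bar> \<le> (1 - ?e) * 1" unfolding abs_mult using y e by (intro mult_mono) (auto simp: abs_le_iff)
      then have "- (1 - ?e) \<le> (1 - ?e) * y" "(1 - ?e) * y \<le> 1 - ?e" by (auto simp: abs_le_iff)
      moreover have "\<phi> x v \<in> \<phi> x ` {0<..<d}" "\<phi> x u \<in> \<phi> x ` {0<..<d}" using u(1) v(1) by blast+
      ultimately have "(1 - ?e) * y \<in> \<phi> x ` {0<..<d}"
        using u(2) v(2) connectedD_interval[OF con, of "\<phi> x v" "\<phi> x u" "(1 - ?e) * y"] by linarith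
      then obtain w where w: "(1 - ?e) * y = \<phi> x w" "w \<in> {0<..<d}" by (rule imageE)
      then have "0 < w" "w < ?e" using d(3) by auto
      then show ?thesis using w(1)[symmetric] by blast
    qed
    then obtain h where h: "\<And>k. 0 < h k" "\<And>k. h k < 1 / real (k + 2)" "\<And>k. \<phi> x (h k) = (1 - 1 / real (k + 2)) * y" by metis
    have l: "(\<lambda>k. 1 / real (k + 2)) \<longlonglongrightarrow> 0" by real_asymp
    have "h \<longlonglongrightarrow> 0" by (rule Lim_null_comparison[OF _ l]) (use h in \<open>auto intro!: always_eventually less_imp_le simp: abs_of_pos\<close>)
    moreover have "(\<lambda>k. \<phi> x (h k)) \<longlonglongrightarrow> (1 - 0) * y" unfolding h(3) by (rule tendsto_mult[OF tendsto_diff[OF tendsto_const l] tendsto_const])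
    moreover have "h k < 1" for k
    proof -
      have "1 / real (k + 2) \<le> 1" by simp
      then show ?thesis using h(2)[of k] by linarith
    qed
    ultimately show "\<exists>h :: nat \<Rightarrow> real. (\<forall>n. 0 < h n \<and> h n < 1) \<and> h \<longlonglongrightarrow> 0 \<and> (\<lambda>n. \<phi> x (h n)) \<longlonglongrightarrow> y"
      using h(1) by (intro exI[of _ h]) auto
  qed
qed

definition pref :: "real \<Rightarrow> real" where "pref s = sqrt (ln (ln s) / s)"

text \<open>Stated for a general index, because the lower bound in Chung's law uses the level
  \<open>lev h - 1\<close> and the upper bound the grid itself.\<close>

lemma pref_limits:
  assumes N: "filterlim N at_top F" and s: "((\<lambda>i. s i / U (N i)) \<longlongrightarrow> 1) F"
  shows "((\<lambda>i. pref (s i) * sqrt (U (N i) / ln (ln (U (N i))))) \<longlongrightarrow> 1) F"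
    and "((\<lambda>i. pref (s i) * (C * D (N i) powr gp)) \<longlongrightarrow> 0) F"
proof -
  note UN = filterlim_compose[OF quad_lim N]
  have big: "\<forall>\<^sub>F i in F. 3 < U (N i) \<and> 1 < ln (ln (U (N i)))" using large_U filterlim_iff[THEN iffD1, OF N] by blast
  have "((\<lambda>i. sqrt ((ln (ln (s i)) / ln (ln (U (N i)))) / (s i / U (N i)))) \<longlongrightarrow> sqrt (1 / 1)) F"
    by (intro tendsto_real_sqrt tendsto_divide s lnln_ratio[OF UN s]) simp
  moreover have "\<forall>\<^sub>F i in F. sqrt ((ln (ln (s i)) / ln (ln (U (N i)))) / (s i / U (N i))) = pref (s i) * sqrt (U (N i) / ln (ln (U (N i))))"
    using big by eventually_elim (simp add: pref_def mult_ac flip: real_sqrt_mult)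
  ultimately show 1: "((\<lambda>i. pref (s i) * sqrt (U (N i) / ln (ln (U (N i))))) \<longlongrightarrow> 1) F"
    using Lim_transform_eventually by fastforce
  have "((\<lambda>i. pref (s i) * sqrt (U (N i) / ln (ln (U (N i)))) * (C * D (N i) powr gp * sqrt (ln (ln (U (N i)))) / sqrt (U (N i)))) \<longlongrightarrow> 1 * 0) F"
    by (intro tendsto_mult 1 filterlim_compose[OF err_small N])
  moreover have "\<forall>\<^sub>F i in F. pref (s i) * sqrt (U (N i) / ln (ln (U (N i)))) * (C * D (N i) powr gp * sqrt (ln (ln (U (N i)))) / sqrt (U (N i))) = pref (s i) * (C * D (N i) powr gp)"
    using big
  proof eventually_elim
    case (elim i)
    then have "ln (U (N i)) \<noteq> 1" by auto
    then show ?case using elim by (simp add: real_sqrt_divide)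
  qed
  ultimately show "((\<lambda>i. pref (s i) * (C * D (N i) powr gp)) \<longlongrightarrow> 0) F"
    using Lim_transform_eventually by fastforce
qed

lemma D_powr_mono: "0 \<le> C \<Longrightarrow> m \<le> n \<Longrightarrow> C * D m powr gp \<le> C * D n powr gp"
  using D_ge[of m] D_mono[of m n] gp by (intro mult_left_mono powr_mono2) auto

text \<open>One level lower than \<open>sigma_ratio\<close>, because the supremum in Chung's law
  runs over \<open>T > h\<close>: a grid point of index at most \<open>lev h - 1\<close> is
  certainly larger than \<open>h\<close>.\<close>

lemma sigma_ratio_pred: "((\<lambda>u. \<sigma> u / U (lev u - 1)) \<longlongrightarrow> 1) (at_right 0)"
proof -
  have lp: "filterlim (\<lambda>u. lev u - 1) at_top (at_right 0)"
    by (rule filterlim_compose[OF filterlim_minus_const_nat_at_top lev_top])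
  have "((\<lambda>u. \<sigma> u / U (lev u) * (U (Suc (lev u - 1)) / U (lev u - 1))) \<longlongrightarrow> 1 * 1) (at_right 0)"
    by (intro tendsto_mult sigma_ratio filterlim_compose[OF U_Suc_ratio lp])
  moreover have "\<forall>\<^sub>F u in at_right 0. 0 < U (lev u)" using U_lev_top unfolding filterlim_at_top_dense by blast
  with eventually_small[of 1] have "\<forall>\<^sub>F u in at_right 0. \<sigma> u / U (lev u) * (U (Suc (lev u - 1)) / U (lev u - 1)) = \<sigma> u / U (lev u - 1)"
    by eventually_elim auto
  ultimately show ?thesis using Lim_transform_eventually by fastforce
qed

text \<open>The supremum over \<open>T\<close> corresponds to the maximum of
  \<open>\<bar>W k x\<bar>\<close>: a large value at \<open>k\<close> is seen by the step
  \<open>T = 1 / real r ^ k\<close>, and conversely every \<open>T\<close> in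
  \<open>{h<..<1}\<close> has a level at most that of \<open>h\<close>. To bound a lower limit from
  above, grid points \<open>h\<close> are enough.\<close>

lemma Chung:
  "AE x in circle_measure. Liminf (at_right 0) (\<lambda>h. ereal (pref (\<sigma> h)) * (SUP T\<in>{h<..<1}. ereal \<bar>inc x T\<bar>)) = ereal (pi / sqrt 8)"
  using Chung_lower Chung_upper inc_error
proof eventually_elim
  case (elim x)
  then obtain C where C: "C \<ge> 0" "\<And>h. 0 < \<bar>h\<bar> \<and> \<bar>h\<bar> \<le> 1 \<Longrightarrow> \<bar>inc x h - W (lev \<bar>h\<bar>) x\<bar> \<le> C * D (lev \<bar>h\<bar>) powr gp" by blast
  define L where "L = pi / sqrt 8"
  have L: "0 < L" by (simp add: L_def)
  define S where "S h = (SUP T\<in>{h<..<1}. ereal \<bar>inc x T\<bar>)" for h :: real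
  define Q where "Q n = sqrt (U n / ln (ln (U n)))" for n
  have lp: "filterlim (\<lambda>u. lev u - 1) at_top (at_right 0)"
    by (rule filterlim_compose[OF filterlim_minus_const_nat_at_top lev_top])
  have pp: "\<forall>\<^sub>F u in at_right 0. 0 < pref (\<sigma> u)"
  proof -
    have "\<forall>\<^sub>F u::real in at_top. 0 < sqrt (ln (ln u) / u)" by real_asymp
    then show ?thesis unfolding pref_def using filterlim_iff[THEN iffD1, OF sigma_top] by blast
  qed
  let ?Li = "Liminf (at_right 0) (\<lambda>h. ereal (pref (\<sigma> h)) * S h)"
  have low: "ereal ((1 - 2 * e) * L) \<le> ?Li" if e: "0 < e" "e < 1" for e
  proof (rule Liminf_bounded)
    define q where "q h = pref (\<sigma> h) * ((1 - e) * L * Q (lev h - 1) - C * D (lev h - 1) powr gp)" for h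
    have "((\<lambda>h. (1 - e) * L * (pref (\<sigma> h) * Q (lev h - 1)) - pref (\<sigma> h) * (C * D (lev h - 1) powr gp)) \<longlongrightarrow> (1 - e) * L * 1 - 0) (at_right 0)"
      unfolding Q_def by (intro tendsto_intros pref_limits[OF lp sigma_ratio_pred])
    then have "(q \<longlongrightarrow> (1 - e) * L) (at_right 0)" unfolding q_def by (simp add: algebra_simps)
    then have 1: "\<forall>\<^sub>F h in at_right 0. (1 - 2 * e) * L < q h" by (rule order_tendstoD) (use e L in simp)
    have 2: "\<forall>\<^sub>F h in at_right 0. \<exists>k\<le>lev h - 1. (1 - e) * L * Q (lev h - 1) \<le> \<bar>W k x\<bar>"
      using elim(1) e(1) filterlim_iff[THEN iffD1, OF lp] unfolding Q_def L_def by blast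
    have 3: "\<forall>\<^sub>F h in at_right 0. 3 < U (lev h - 1) \<and> 1 < ln (ln (U (lev h - 1)))"
      using large_U filterlim_iff[THEN iffD1, OF lp] by blast
    show "\<forall>\<^sub>F h in at_right 0. ereal ((1 - 2 * e) * L) \<le> ereal (pref (\<sigma> h)) * S h"
      using 1 2 3 eventually_small[of 1] pp
    proof eventually_elim
      case (elim h)
      then obtain k where k: "k \<le> lev h - 1" "(1 - e) * L * Q (lev h - 1) \<le> \<bar>W k x\<bar>" by blast
      have u: "3 < U (lev h - 1)" "1 < ln (ln (U (lev h - 1)))" using elim by blast+
      have "0 < Q (lev h - 1)" unfolding Q_def using u by (intro real_sqrt_gt_zero divide_pos_pos) linarith+
      then have "0 < (1 - e) * L * Q (lev h - 1)" using e L by (intro mult_pos_pos) auto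
      \<comment> \<open>\<open>W 0 x = 0\<close>, so a large value occurs at a positive level, which
        gives \<open>T < 1\<close>.\<close>
      then have k0: "k \<noteq> 0" using k(2) by (metis chain.mart_0 abs_zero not_less)
      define T where "T = 1 / real r ^ k"
      have "1 / real r ^ lev h < 1 / real r ^ k"
        using rpos k elim by (intro divide_strict_left_mono power_strict_increasing) auto
      then have hT: "h < T" using lev(2)[of h] elim by (simp add: T_def)
      have T1: "T < 1" using k0 rpos by (simp add: T_def divide_less_eq)
      have "\<bar>inc x T - W k x\<bar> \<le> C * D k powr gp"
        using C(2)[of T] hT T1 elim rpos by (simp add: T_def lev_inv_power)
      moreover have "C * D k powr gp \<le> C * D (lev h - 1) powr gp" using C(1) k(1) by (rule D_powr_mono)
      ultimately have "(1 - e) * L * Q (lev h - 1) - C * D (lev h - 1) powr gp \<le> \<bar>inc x T\<bar>" using k(2) by linarith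
      then have "q h \<le> pref (\<sigma> h) * \<bar>inc x T\<bar>" unfolding q_def using elim by (intro mult_left_mono) auto
      then have "ereal ((1 - 2 * e) * L) \<le> ereal (pref (\<sigma> h)) * ereal \<bar>inc x T\<bar>" using elim by simp
      also have "\<dots> \<le> ereal (pref (\<sigma> h)) * S h"
        unfolding S_def using hT T1 elim by (intro ereal_mult_left_mono SUP_upper) auto
      finally show ?case .
    qed
  qed
  have "ereal L \<le> ?Li"
  proof (rule tendsto_upperbound)
    have "(\<lambda>k. (1 - 2 * (1 / real (k + 2))) * L) \<longlonglongrightarrow> L" by real_asymp
    then show "(\<lambda>k. ereal ((1 - 2 * (1 / real (k + 2))) * L)) \<longlonglongrightarrow> ereal L" by simp
    show "\<forall>\<^sub>F k in sequentially. ereal ((1 - 2 * (1 / real (k + 2))) * L) \<le> ?Li" by (intro always_eventually allI low) auto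
  qed simp
  moreover have "?Li \<le> ereal L"
  proof (rule ccontr)
    assume "\<not> ?Li \<le> ereal L"
    then have "ereal L < ?Li" by simp
    from ereal_dense2[OF this] obtain c where c: "ereal L < ereal c" "ereal c < ?Li" by auto
    \<comment> \<open>Makes \<open>(1 + e) * L\<close> the midpoint between \<open>L\<close> and
      \<open>c\<close>.\<close>
    define e where "e = (c - L) / (2 * L)"
    have e: "0 < e" "(1 + e) * L < c" using c(1) L by (auto simp: e_def field_simps)
    let ?h = "\<lambda>n. 1 / real r ^ n"
    have 1: "\<forall>\<^sub>F n in sequentially. ereal c < ereal (pref (\<sigma> (?h n))) * S (?h n)"
      using less_LiminfD[OF c(2)] filterlim_iff[THEN iffD1, OF inv_power_at_right] by blast
    have 2: "\<forall>\<^sub>F n in sequentially. 0 < pref (\<sigma> (?h n))" using pp filterlim_iff[THEN iffD1, OF inv_power_at_right] by blast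
    have sr: "(\<lambda>n. \<sigma> (?h n) / U n) \<longlonglongrightarrow> 1"
      using filterlim_compose[OF sigma_ratio inv_power_at_right] by (simp add: lev_inv_power)
    have "(\<lambda>n. (1 + e) * L * (pref (\<sigma> (?h n)) * Q n) + pref (\<sigma> (?h n)) * (C * D n powr gp)) \<longlonglongrightarrow> (1 + e) * L * 1 + 0"
      unfolding Q_def by (intro tendsto_intros pref_limits[OF filterlim_ident sr])
    then have "(\<lambda>n. pref (\<sigma> (?h n)) * ((1 + e) * L * Q n + C * D n powr gp)) \<longlonglongrightarrow> (1 + e) * L" by (simp add: algebra_simps)
    then have 3: "\<forall>\<^sub>F n in sequentially. pref (\<sigma> (?h n)) * ((1 + e) * L * Q n + C * D n powr gp) < c" using e(2) by (rule order_tendstoD)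
    have "\<exists>\<^sub>F n in sequentially. \<forall>k\<le>n. \<bar>W k x\<bar> \<le> (1 + e) * L * Q n" using elim(2) e(1) unfolding Q_def L_def by blast
    from frequently_ex[OF frequently_eventually_conj[OF this eventually_conj[OF 1 eventually_conj[OF 2 3]]]]
    obtain n where n: "\<And>k. k \<le> n \<Longrightarrow> \<bar>W k x\<bar> \<le> (1 + e) * L * Q n" "ereal c < ereal (pref (\<sigma> (?h n))) * S (?h n)"
      "0 < pref (\<sigma> (?h n))" "pref (\<sigma> (?h n)) * ((1 + e) * L * Q n + C * D n powr gp) < c" by blast
    have "S (?h n) \<le> ereal ((1 + e) * L * Q n + C * D n powr gp)"
      unfolding S_def
    proof (rule SUP_least)
      fix T assume T: "T \<in> {?h n<..<1}"
      have "?h n < T" "T < 1" using T by auto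
      then have T0: "0 < T" "T \<le> 1" "?h n \<le> T" using inv_power_pos[of n] by linarith+
      have lT: "lev T \<le> n" using lev_mono[OF inv_power_pos T0(3,2)] by (simp add: lev_inv_power)
      have "\<bar>inc x T\<bar> \<le> \<bar>W (lev T) x\<bar> + C * D (lev T) powr gp" using C(2)[of T] T0 by auto
      also have "\<dots> \<le> (1 + e) * L * Q n + C * D n powr gp" by (intro add_mono n(1) D_powr_mono lT C(1))
      finally show "ereal \<bar>inc x T\<bar> \<le> ereal ((1 + e) * L * Q n + C * D n powr gp)" by simp
    qed
    then have "ereal (pref (\<sigma> (?h n))) * S (?h n) \<le> ereal (pref (\<sigma> (?h n))) * ereal ((1 + e) * L * Q n + C * D n powr gp)"
      using n(3) by (intro ereal_mult_left_mono) auto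
    also have "\<dots> < ereal c" using n(4) by simp
    finally show False using n(2) by simp
  qed
  ultimately show ?case unfolding S_def L_def by (rule antisym[rotated])
qed

end

section \<open>The functional limit theorem\<close>

definition sum_path :: "nat \<Rightarrow> (nat \<Rightarrow> real) \<Rightarrow> real \<Rightarrow> real" where
  "sum_path p y = (\<lambda>t\<in>{0..1}. \<Sum>j<nat \<lfloor>real p * t\<rfloor>. y j)"

lemma nat_floor_mult_le: "t \<in> {0..1} \<Longrightarrow> nat \<lfloor>real p * t\<rfloor> \<le> p"
proof -
  assume t: "t \<in> {0..1}"
  then have "real p * t \<le> real p * 1" by (intro mult_left_mono) auto
  then have "\<lfloor>real p * t\<rfloor> \<le> int p" by linarith
  then show ?thesis by linarith
qed

lemma linear_step_path: "(\<lambda>t\<in>{0..1}. v (nat \<lfloor>real p * t\<rfloor>)) \<in> skorokhod_space"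
  by (rule step_path_in_skorokhod_space[of "\<lambda>t. real p * t"]) (auto intro!: continuous_intros mult_left_mono)

lemma sum_path_in_skorokhod_space: "sum_path p y \<in> skorokhod_space"
  unfolding sum_path_def by (rule linear_step_path)

lemma sum_path_dist: "skorokhod_dist (sum_path p y) (sum_path p y') \<le> (\<Sum>l<p. \<bar>y l - y' l\<bar>)"
proof (rule skorokhod_dist_uniform)
  fix t :: real assume t: "t \<in> {0..1}"
  have "\<bar>sum_path p y t - sum_path p y' t\<bar> = \<bar>\<Sum>j<nat \<lfloor>real p * t\<rfloor>. y j - y' j\<bar>"
    using t by (simp add: sum_path_def sum_subtractf)
  also have "\<dots> \<le> (\<Sum>j<nat \<lfloor>real p * t\<rfloor>. \<bar>y j - y' j\<bar>)" by (rule sum_abs)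
  also have "\<dots> \<le> (\<Sum>l<p. \<bar>y l - y' l\<bar>)" using nat_floor_mult_le[OF t] by (intro sum_mono2) auto
  finally show "\<bar>sum_path p y t - sum_path p y' t\<bar> \<le> (\<Sum>l<p. \<bar>y l - y' l\<bar>)" .
qed (simp add: sum_nonneg)

lemma sum_path_measurable:
  assumes "\<And>j. j < p \<Longrightarrow> y j \<in> borel_measurable P"
  shows "(\<lambda>\<omega>. sum_path p (\<lambda>j. y j \<omega>)) \<in> P \<rightarrow>\<^sub>M borel_algebra skorokhod.mtopology"
proof -
  \<comment> \<open>The sum is capped at \<open>p\<close>, since only the increments below
    \<open>p\<close> are known to be measurable.\<close>
  have "(\<lambda>\<omega>. (\<lambda>t\<in>{0..1}. (\<lambda>i \<omega>. \<Sum>j<min i p. y j \<omega>) (nat \<lfloor>real p * t\<rfloor>) \<omega>)) \<in> P \<rightarrow>\<^sub>M borel_algebra skorokhod.mtopology"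
    by (rule step_path_measurable[where N = p]) (use assms nat_floor_mult_le linear_step_path in \<open>auto intro!: borel_measurable_sum\<close>)
  moreover have "(\<lambda>t\<in>{0..1}. (\<lambda>i \<omega>. \<Sum>j<min i p. y j \<omega>) (nat \<lfloor>real p * t\<rfloor>) \<omega>) = sum_path p (\<lambda>j. y j \<omega>)" for \<omega>
    unfolding sum_path_def using nat_floor_mult_le by (intro restrict_ext) (simp add: min_absorb1)
  ultimately show ?thesis by simp
qed

text \<open>This is uniform continuity. The \<open>min 1\<close> keeps the argument in
  \<open>[0, 1]\<close> for every index, so that for Brownian motion the sampled values form a
  sequence of random variables as in \<open>step_path_measurable\<close>.\<close>

lemma continuous_step_approx:
  assumes "continuous_on {0..1} h"
  shows "(\<lambda>q. skorokhod_dist (\<lambda>t\<in>{0..1}. h (min 1 (real (nat \<lfloor>real (Suc q) * t\<rfloor>) / real (Suc q)))) (\<lambda>t\<in>{0..1}. h t)) \<longlonglongrightarrow> 0"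
proof (rule tendstoI)
  fix e :: real assume e: "0 < e"
  have "uniformly_continuous_on {0..1} h" using assms by (intro compact_uniformly_continuous) auto
  then obtain d where d: "0 < d" "\<And>s t. s \<in> {0..1} \<Longrightarrow> t \<in> {0..1} \<Longrightarrow> dist s t < d \<Longrightarrow> dist (h s) (h t) < e / 2"
    unfolding uniformly_continuous_on_def using e by (metis dist_commute half_gt_zero)
  have "(\<lambda>q. 1 / real (Suc q)) \<longlonglongrightarrow> 0" by real_asymp
  then have "\<forall>\<^sub>F q in sequentially. 1 / real (Suc q) < d" using d(1) by (rule order_tendstoD)
  then show "\<forall>\<^sub>F q in sequentially. dist (skorokhod_dist (\<lambda>t\<in>{0..1}. h (min 1 (real (nat \<lfloor>real (Suc q) * t\<rfloor>) / real (Suc q)))) (\<lambda>t\<in>{0..1}. h t)) 0 < e"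
  proof eventually_elim
    case (elim q)
    have "skorokhod_dist (\<lambda>t\<in>{0..1}. h (min 1 (real (nat \<lfloor>real (Suc q) * t\<rfloor>) / real (Suc q)))) (\<lambda>t\<in>{0..1}. h t) \<le> e / 2"
    proof (rule skorokhod_dist_uniform)
      fix t :: real assume t: "t \<in> {0..1}"
      define i where "i = nat \<lfloor>real (Suc q) * t\<rfloor>"
      have ri: "real i = of_int \<lfloor>real (Suc q) * t\<rfloor>" using t by (simp add: i_def)
      have "real i \<le> real (Suc q) * t" "real (Suc q) * t < real i + 1" unfolding ri by linarith+
      then have "real i / real (Suc q) \<le> t" "t < real i / real (Suc q) + 1 / real (Suc q)"
        by (simp_all add: field_simps)
      then have "min 1 (real i / real (Suc q)) = real i / real (Suc q)" "dist (real i / real (Suc q)) t < d" "real i / real (Suc q) \<in> {0..1}"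
        using t elim nat_floor_mult_le[OF t, of "Suc q"] by (auto simp: dist_real_def i_def)
      then have "dist (h (min 1 (real i / real (Suc q)))) (h t) < e / 2" using d(2) t by simp
      then show "\<bar>(\<lambda>t\<in>{0..1}. h (min 1 (real (nat \<lfloor>real (Suc q) * t\<rfloor>) / real (Suc q)))) t - (\<lambda>t\<in>{0..1}. h t) t\<bar> \<le> e / 2"
        using t by (simp add: i_def dist_real_def)
    qed (use e in simp)
    then show ?case using e by (simp add: skorokhod_dist_def)
  qed
qed

locale brownian_motion =
  fixes P :: "'b measure" and B :: "real \<Rightarrow> 'b \<Rightarrow> real"
  assumes BM: "standard_brownian_motion P B"
begin

lemma prob_space_P: "prob_space P" and B_measurable: "t \<in> {0..1} \<Longrightarrow> B t \<in> borel_measurable P"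
  and B_0: "AE \<omega> in P. B 0 \<omega> = 0" and B_continuous: "\<omega> \<in> space P \<Longrightarrow> continuous_on {0..1} (\<lambda>t. B t \<omega>)"
  and B_normal: "0 \<le> s \<Longrightarrow> s < t \<Longrightarrow> t \<le> 1 \<Longrightarrow> distributed P lborel (\<lambda>\<omega>. B t \<omega> - B s \<omega>) (normal_density 0 (sqrt (t - s)))"
  and B_indep: "mono_on {..m} T \<Longrightarrow> T ` {..m} \<subseteq> {0..1} \<Longrightarrow> prob_space.indep_vars P (\<lambda>_. borel) (\<lambda>i \<omega>. B (T (Suc i)) \<omega> - B (T i) \<omega>) {..<m}"
  using BM unfolding standard_brownian_motion_def by blast+

definition incr :: "nat \<Rightarrow> nat \<Rightarrow> 'b \<Rightarrow> real" where
  "incr p j \<omega> = B (real (Suc j) / real p) \<omega> - B (real j / real p) \<omega>"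

lemma sample_path_in: "\<omega> \<in> space P \<Longrightarrow> sample_path B \<omega> \<in> skorokhod_space"
  unfolding sample_path_def by (intro continuous_in_skorokhod_space B_continuous)

lemma sample_path_measurable: "sample_path B \<in> P \<rightarrow>\<^sub>M borel_algebra skorokhod.mtopology"
proof (rule skorokhod.measurable_limit)
  fix q
  show "(\<lambda>\<omega>. (\<lambda>t\<in>{0..1}. (\<lambda>i. B (min 1 (real i / real (Suc q)))) (nat \<lfloor>real (Suc q) * t\<rfloor>) \<omega>)) \<in> P \<rightarrow>\<^sub>M borel_algebra skorokhod.mtopology"
    by (rule step_path_measurable[where N = "Suc q"]) (intro B_measurable nat_floor_mult_le linear_step_path; auto)+
next
  fix \<omega> assume "\<omega> \<in> space P"
  then show "(\<lambda>q. skorokhod_dist (\<lambda>t\<in>{0..1}. (\<lambda>i. B (min 1 (real i / real (Suc q)))) (nat \<lfloor>real (Suc q) * t\<rfloor>) \<omega>) (sample_path B \<omega>)) \<longlonglongrightarrow> 0"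
    unfolding sample_path_def by (rule continuous_step_approx[OF B_continuous])
qed (rule sample_path_in)

lemma incr_measurable: "j < p \<Longrightarrow> incr p j \<in> borel_measurable P"
  unfolding incr_def[abs_def] by (intro borel_measurable_diff B_measurable) auto

lemma sum_path_incr:
  assumes "B 0 \<omega> = 0"
  shows "sum_path (Suc q) (\<lambda>j. incr (Suc q) j \<omega>) = (\<lambda>t\<in>{0..1}. B (min 1 (real (nat \<lfloor>real (Suc q) * t\<rfloor>) / real (Suc q))) \<omega>)"
  unfolding sum_path_def
proof (rule restrict_ext)
  fix t :: real assume t: "t \<in> {0..1}"
  define i where "i = nat \<lfloor>real (Suc q) * t\<rfloor>"
  have "i \<le> Suc q" unfolding i_def by (rule nat_floor_mult_le[OF t])
  then have "min 1 (real i / real (Suc q)) = real i / real (Suc q)" by (auto simp: min_def)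
  moreover have "(\<Sum>j<i. incr (Suc q) j \<omega>) = B (real i / real (Suc q)) \<omega> - B (real 0 / real (Suc q)) \<omega>"
    unfolding incr_def by (rule sum_lessThan_telescope)
  ultimately show "(\<Sum>j<nat \<lfloor>real (Suc q) * t\<rfloor>. incr (Suc q) j \<omega>) = B (min 1 (real (nat \<lfloor>real (Suc q) * t\<rfloor>) / real (Suc q))) \<omega>"
    using assms by (simp add: i_def)
qed

end

locale skorokhod_Lipschitz =
  fixes \<Phi> :: "(real \<Rightarrow> real) \<Rightarrow> real" and K B :: real
  assumes lip: "x \<in> skorokhod_space \<Longrightarrow> y \<in> skorokhod_space \<Longrightarrow> \<bar>\<Phi> x - \<Phi> y\<bar> \<le> K * skorokhod_dist x y"
    and bdd: "x \<in> skorokhod_space \<Longrightarrow> \<bar>\<Phi> x\<bar> \<le> B" and K: "0 \<le> K"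
begin

lemma B_nonneg: "0 \<le> B"
  using bdd[OF sum_path_in_skorokhod_space[of 0 undefined]] by linarith

lemma measurable: "X \<in> P \<rightarrow>\<^sub>M borel_algebra skorokhod.mtopology \<Longrightarrow> (\<lambda>\<omega>. \<Phi> (X \<omega>)) \<in> borel_measurable P"
  using continuous_map_measurable_borel_algebra[OF skorokhod.continuous_map_Lipschitz[of \<Phi> K]] lip
  by (auto intro: measurable_compose)

lemma lipschitz_sum_path: "lipschitz_fun p K B (\<lambda>y. \<Phi> (sum_path p y))"
proof
  fix y y'
  have "\<bar>\<Phi> (sum_path p y) - \<Phi> (sum_path p y')\<bar> \<le> K * skorokhod_dist (sum_path p y) (sum_path p y')"
    by (intro lip sum_path_in_skorokhod_space)
  also have "\<dots> \<le> K * (\<Sum>l<p. \<bar>y l - y' l\<bar>)" by (intro mult_left_mono sum_path_dist K)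
  finally show "\<bar>\<Phi> (sum_path p y) - \<Phi> (sum_path p y')\<bar> \<le> K * (\<Sum>l<p. \<bar>y l - y' l\<bar>)" .
qed (use bdd sum_path_in_skorokhod_space K in auto)

text \<open>The iterated normal integral is the expectation over a Brownian path sampled at
  equidistant times, and the sampled paths converge to the path itself. This identifies the limit
  from the defining properties of Brownian motion.\<close>

lemma brownian_gauss:
  assumes "standard_brownian_motion P \<beta>"
  shows "(\<lambda>q. gauss_fold (Suc q) (1 / real (Suc q)) (\<lambda>y. \<Phi> (sum_path (Suc q) y)) (Suc q) (\<lambda>_. 0)) \<longlonglongrightarrow> (\<integral>\<omega>. \<Phi> (sample_path \<beta> \<omega>) \<partial>P)"
proof -
  interpret brownian_motion P \<beta> by (rule brownian_motion.intro) fact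
  interpret P: prob_space P by (rule prob_space_P)
  have eq: "(\<integral>\<omega>. \<Phi> (sum_path p (\<lambda>j. incr p j \<omega>)) \<partial>P) = gauss_fold p (1 / real p) (\<lambda>y. \<Phi> (sum_path p y)) p (\<lambda>_. 0)" if p: "0 < p" for p
  proof -
    interpret lipschitz_fun p "1 / real p" K B "\<lambda>y. \<Phi> (sum_path p y)" by (rule lipschitz_sum_path)
    show ?thesis
    proof (rule G_gaussian[OF prob_space_P])
      show "P.indep_vars (\<lambda>_. borel) (incr p) {..<p}"
        unfolding incr_def[abs_def] using p
        by (intro B_indep[of p "\<lambda>i. real i / real p"]) (auto simp: mono_on_def divide_right_mono)
      fix l assume l: "l < p"
      have "real (Suc l) / real p - real l / real p = 1 / real p" by (simp add: diff_divide_distrib[symmetric])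
      then show "distributed P lborel (incr p l) (normal_density 0 (sqrt (1 / real p)))"
        using B_normal[of "real l / real p" "real (Suc l) / real p"] l by (simp add: incr_def[abs_def] divide_strict_right_mono)
    qed (use p in simp)
  qed
  have "(\<lambda>q. \<integral>\<omega>. \<Phi> (sum_path (Suc q) (\<lambda>j. incr (Suc q) j \<omega>)) \<partial>P) \<longlonglongrightarrow> (\<integral>\<omega>. \<Phi> (sample_path \<beta> \<omega>) \<partial>P)"
  proof (rule integral_dominated_convergence[where w = "\<lambda>_. B"])
    show "(\<lambda>\<omega>. \<Phi> (sample_path \<beta> \<omega>)) \<in> borel_measurable P" by (rule measurable[OF sample_path_measurable])
    have m: "(\<lambda>\<omega>. sum_path (Suc q) (\<lambda>j. incr (Suc q) j \<omega>)) \<in> P \<rightarrow>\<^sub>M borel_algebra skorokhod.mtopology" for q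
      by (intro sum_path_measurable incr_measurable)
    show "(\<lambda>\<omega>. \<Phi> (sum_path (Suc q) (\<lambda>j. incr (Suc q) j \<omega>))) \<in> borel_measurable P" for q
      by (rule measurable[OF m])
    show "AE \<omega> in P. norm (\<Phi> (sum_path (Suc q) (\<lambda>j. incr (Suc q) j \<omega>))) \<le> B" for q
      by (auto simp: bdd sum_path_in_skorokhod_space)
    show "AE \<omega> in P. (\<lambda>q. \<Phi> (sum_path (Suc q) (\<lambda>j. incr (Suc q) j \<omega>))) \<longlonglongrightarrow> \<Phi> (sample_path \<beta> \<omega>)"
      using B_0 AE_space
    proof eventually_elim
      case (elim \<omega>)
      have "(\<lambda>q. K * skorokhod_dist (sum_path (Suc q) (\<lambda>j. incr (Suc q) j \<omega>)) (sample_path \<beta> \<omega>)) \<longlonglongrightarrow> 0"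
        unfolding sum_path_incr[OF elim(1)] sample_path_def
        by (intro tendsto_mult_right_zero continuous_step_approx B_continuous elim)
      then have "(\<lambda>q. \<Phi> (sum_path (Suc q) (\<lambda>j. incr (Suc q) j \<omega>)) - \<Phi> (sample_path \<beta> \<omega>)) \<longlonglongrightarrow> 0"
        by (rule Lim_null_comparison[rotated])
          (use elim in \<open>auto intro!: always_eventually lip sum_path_in_skorokhod_space sample_path_in\<close>)
      then show ?case by (rule LIM_zero_cancel)
    qed
  qed simp
  then show ?thesis by (simp only: eq zero_less_Suc)
qed

end

section \<open>Rescaled paths and their finite-dimensional skeletons\<close>

context takagi_sigma begin

text \<open>The time change \<open>t powr (1 / \<beta>)\<close> undoes regular variation of index
  \<beta>, so that the clock becomes linear in \<open>t\<close> (\<open>U_kap\<close>).\<close>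

definition kap :: "real \<Rightarrow> nat \<Rightarrow> real \<Rightarrow> nat" where
  "kap \<beta> n t = nat \<lfloor>real n * t powr (1 / \<beta>)\<rfloor>"

lemma kap_mono: "0 < \<beta> \<Longrightarrow> 0 \<le> s \<Longrightarrow> s \<le> t \<Longrightarrow> kap \<beta> n s \<le> kap \<beta> n t"
  unfolding kap_def by (intro nat_mono floor_mono mult_left_mono powr_mono2) auto

lemma kap_0 [simp]: "kap \<beta> n 0 = 0" and kap_1 [simp]: "kap \<beta> n 1 = n"
  by (simp_all add: kap_def)

lemma kap_le: "0 < \<beta> \<Longrightarrow> t \<in> {0..1} \<Longrightarrow> kap \<beta> n t \<le> n"
  using kap_mono[of \<beta> t 1 n] by simp

lemma V_pos: "\<forall>\<^sub>F n in sequentially. 0 < V n"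
proof -
  have "\<forall>\<^sub>F n in sequentially. 1/2 < V n / U n" using V_U_ratio by (rule order_tendstoD) simp
  moreover have "\<forall>\<^sub>F n in sequentially. 0 < U n" using quad_lim unfolding filterlim_at_top_dense by blast
  ultimately show ?thesis
  proof eventually_elim
    case (elim n)
    then have "0 < V n / U n" by linarith
    then show ?case using elim by (simp add: zero_less_divide_iff)
  qed
qed

lemma U_kap:
  assumes \<beta>: "0 < \<beta>" and rv: "regularly_varying_seq V \<beta>" and t: "0 \<le> t"
  shows "(\<lambda>n. U (kap \<beta> n t) / U n) \<longlonglongrightarrow> t"
proof (cases "t = 0")
  case False
  define s where "s = t powr (1 / \<beta>)"
  have s: "0 < s" using t False by (simp add: s_def)
  have sp: "s powr \<beta> = t" using \<beta> t False by (simp add: s_def powr_powr)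
  have kt: "filterlim (\<lambda>n. kap \<beta> n t) at_top sequentially"
    unfolding kap_def s_def[symmetric]
    by (intro filterlim_compose[OF filterlim_nat_sequentially] filterlim_compose[OF filterlim_floor_sequentially]
        filterlim_at_top_mult_tendsto_pos[OF tendsto_const s] filterlim_real_sequentially)
  have "(\<lambda>n. V (nat \<lfloor>real n * s\<rfloor>) / V n) \<longlonglongrightarrow> s powr \<beta>"
    using rv s unfolding regularly_varying_seq_def by blast
  then have L1: "(\<lambda>n. V (kap \<beta> n t) / V n) \<longlonglongrightarrow> t" unfolding kap_def s_def[symmetric] sp .
  have L2: "(\<lambda>n. V (kap \<beta> n t) / U (kap \<beta> n t)) \<longlonglongrightarrow> 1" by (rule filterlim_compose[OF V_U_ratio kt])
  have "(\<lambda>n. V (kap \<beta> n t) / V n * (V n / U n) / (V (kap \<beta> n t) / U (kap \<beta> n t))) \<longlonglongrightarrow> t * 1 / 1"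
    by (rule tendsto_divide[OF tendsto_mult[OF L1 V_U_ratio] L2]) simp
  moreover have "\<forall>\<^sub>F n in sequentially. V (kap \<beta> n t) / V n * (V n / U n) / (V (kap \<beta> n t) / U (kap \<beta> n t)) = U (kap \<beta> n t) / U n"
    using V_pos filterlim_iff[THEN iffD1, OF kt, rule_format, OF V_pos]
    by eventually_elim simp
  ultimately show ?thesis using Lim_transform_eventually by fastforce
qed simp

text \<open>The maximum over all levels up to \<open>n\<close> makes the bound uniform in the time
  parameter of the path.\<close>

definition err :: "nat \<Rightarrow> real \<Rightarrow> real" where
  "err n x = Max ((\<lambda>k. \<bar>inc x (1 / real r ^ k) - W k x\<bar>) ` {..n}) / sqrt (V n)"

lemma err_measurable: "err n \<in> borel_measurable circle_measure"
proof -
  have "(\<lambda>x. \<bar>inc x (1 / real r ^ k) - W k x\<bar>) \<in> borel_measurable circle_measure" for k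
    by (intro borel_measurable_abs borel_measurable_diff inc_measurable chain.mart_measurable)
  then have "(\<lambda>x. Max ((\<lambda>k. \<bar>inc x (1 / real r ^ k) - W k x\<bar>) ` {..n})) \<in> borel_measurable circle_measure"
    by (intro borel_measurable_Max) auto
  then show ?thesis unfolding err_def[abs_def] by (intro borel_measurable_divide) auto
qed

lemma V_nonneg: "0 \<le> V n"
  by (simp add: V_seq_def integral_nonneg)

lemma inc_err: "k \<le> n \<Longrightarrow> \<bar>inc x (1 / real r ^ k) - W k x\<bar> / sqrt (V n) \<le> err n x"
  unfolding err_def using V_nonneg by (intro divide_right_mono Max_ge) auto

lemma err_nonneg: "0 \<le> err n x"
  using inc_err[of 0 n x] V_nonneg[of n] by (intro order_trans[OF _ inc_err[of 0 n x]]) auto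

lemma sqrt_UV: "(\<lambda>n. sqrt (U n) / sqrt (V n)) \<longlonglongrightarrow> 1"
proof -
  have "(\<lambda>n. sqrt (inverse (V n / U n))) \<longlonglongrightarrow> sqrt (inverse 1)"
    by (intro tendsto_real_sqrt tendsto_inverse V_U_ratio) simp
  then show ?thesis by (simp add: real_sqrt_divide)
qed

lemma err_lim: "AE x in circle_measure. (\<lambda>n. err n x) \<longlonglongrightarrow> 0"
  using inc_error
proof eventually_elim
  case (elim x)
  then obtain C where C: "C \<ge> 0" "\<And>h. 0 < \<bar>h\<bar> \<and> \<bar>h\<bar> \<le> 1 \<Longrightarrow> \<bar>inc x h - W (lev \<bar>h\<bar>) x\<bar> \<le> C * D (lev \<bar>h\<bar>) powr gp" by blast
  have "(\<lambda>n. C * D n powr gp / sqrt (U n) * (sqrt (U n) / sqrt (V n))) \<longlonglongrightarrow> 0 * 1"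
    by (intro tendsto_mult err_small_sqrt sqrt_UV)
  then have lim: "(\<lambda>n. C * D n powr gp / sqrt (U n) * (sqrt (U n) / sqrt (V n))) \<longlonglongrightarrow> 0" by simp
  have pos: "\<forall>\<^sub>F n in sequentially. 0 < U n" using quad_lim unfolding filterlim_at_top_dense by blast
  show ?case
  proof (rule Lim_null_comparison[OF _ lim])
    show "\<forall>\<^sub>F n in sequentially. norm (err n x) \<le> C * D n powr gp / sqrt (U n) * (sqrt (U n) / sqrt (V n))"
      using pos
    proof eventually_elim
      case (elim n)
      have "\<bar>inc x (1 / real r ^ k) - W k x\<bar> \<le> C * D n powr gp" if "k \<le> n" for k
      proof -
        have "\<bar>inc x (1 / real r ^ k) - W k x\<bar> \<le> C * D k powr gp"
          using C(2)[of "1 / real r ^ k"] rpos inv_power_mono[of 0 k] by (simp add: lev_inv_power)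
        also have "\<dots> \<le> C * D n powr gp"
          using D_ge[of k] D_mono[OF that] gp C(1) by (intro mult_left_mono powr_mono2) auto
        finally show ?thesis .
      qed
      then have "err n x \<le> C * D n powr gp / sqrt (V n)"
        unfolding err_def using V_nonneg by (intro divide_right_mono Max.boundedI) auto
      then show ?case using err_nonneg[of n x] elim by simp
    qed
  qed
qed

text \<open>Three errors add up: \<open>err\<close> for passing from \<open>f\<close> to the
  martingale, the change of the normalisation from \<open>V n\<close> to \<open>U n\<close>, and the
  oscillation \<epsilon> of the martingale between consecutive points of the skeleton.\<close>

lemma path_close:
  assumes \<beta>: "0 < \<beta>" and U: "0 < U n" and V: "0 < V n" and p: "0 < p" and \<epsilon>: "0 \<le> \<epsilon>"
    and good: "\<And>i. i < p \<Longrightarrow> chain.tube b 0 (\<epsilon> * sqrt (U n)) (kap \<beta> n (real i / real p)) (kap \<beta> n (real (Suc i) / real p)) x"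
    and t: "t \<in> {0..1}"
  shows "\<bar>inc x (1 / real r ^ kap \<beta> n t) / sqrt (V n)
      - sum_path p (\<lambda>j. (W (kap \<beta> n (real (Suc j) / real p)) x - W (kap \<beta> n (real j / real p)) x) / sqrt (U n)) t\<bar>
    \<le> err n x + real p * \<epsilon> * \<bar>sqrt (U n) / sqrt (V n) - 1\<bar> + \<epsilon>"
proof -
  define \<kappa> where "\<kappa> i = kap \<beta> n (real i / real p)" for i
  define k where "k = kap \<beta> n t"
  define i where "i = nat \<lfloor>real p * t\<rfloor>"
  define s where "s = sqrt (U n)"
  have s: "0 < s" using U by (simp add: s_def)
  have tube: "\<bar>W k x - W (\<kappa> i) x\<bar> \<le> \<epsilon> * s" if "i < p" "\<kappa> i \<le> k" "k \<le> \<kappa> (Suc i)" for i k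
    using good[OF that(1)] that(2,3) by (auto simp: chain.tube_def \<kappa>_def s_def)
  have kmono: "\<kappa> i \<le> \<kappa> (Suc i)" for i
    unfolding \<kappa>_def using \<beta> by (intro kap_mono divide_right_mono) auto
  \<comment> \<open>Chaining at most \<open>p\<close> tubes from the origin, where \<open>W\<close>
    vanishes.\<close>
  have Wi: "\<bar>W (\<kappa> i) x\<bar> \<le> real i * (\<epsilon> * s)" if "i \<le> p" for i
    using that
  proof (induction i)
    case (Suc i)
    have "\<bar>W (\<kappa> (Suc i)) x - W (\<kappa> i) x\<bar> \<le> \<epsilon> * s" using Suc.prems kmono by (intro tube) auto
    then show ?case using Suc by (simp add: algebra_simps)
  qed (simp add: \<kappa>_def)
  have ip: "i \<le> p" unfolding i_def by (rule nat_floor_mult_le[OF t])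
  have ri: "real i = of_int \<lfloor>real p * t\<rfloor>" using t by (simp add: i_def)
  have "real i \<le> real p * t" "real p * t < real (Suc i)" unfolding of_nat_Suc ri by linarith+
  then have it: "real i / real p \<le> t" "t \<le> real (Suc i) / real p" using p by (simp_all add: field_simps)
  have kk: "\<kappa> i \<le> k" "k \<le> \<kappa> (Suc i)" unfolding \<kappa>_def k_def using \<beta> it t by (auto intro!: kap_mono)
  have near: "\<bar>W k x - W (\<kappa> i) x\<bar> \<le> \<epsilon> * s"
  proof (cases "i < p")
    \<comment> \<open>This happens only for \<open>t = 1\<close>, where \<open>\<kappa> i\<close>
      and \<open>k\<close> both equal \<open>n\<close>.\<close>
    case False
    then have "\<kappa> i = n" using ip p by (simp add: \<kappa>_def)
    moreover have "k \<le> n" unfolding k_def using \<beta> t by (rule kap_le)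
    ultimately show ?thesis using kk \<epsilon> s by simp
  qed (rule tube[OF _ kk])
  have Wk: "\<bar>W k x\<bar> \<le> real p * (\<epsilon> * s)"
  proof (cases "i < p")
    case True
    have "\<bar>W k x\<bar> \<le> real i * (\<epsilon> * s) + \<epsilon> * s" using near Wi[OF ip] by linarith
    also have "\<dots> = real (Suc i) * (\<epsilon> * s)" by (simp add: algebra_simps)
    also have "\<dots> \<le> real p * (\<epsilon> * s)" using True \<epsilon> s by (intro mult_right_mono) auto
    finally show ?thesis .
  next
    case False
    then have "i = p" "\<kappa> i = n" using ip p by (simp_all add: \<kappa>_def)
    moreover have "k \<le> n" unfolding k_def using \<beta> t by (rule kap_le)
    ultimately show ?thesis using kk Wi[OF ip] by simp
  qed
  have "sum_path p (\<lambda>j. (W (\<kappa> (Suc j)) x - W (\<kappa> j) x) / s) t = (\<Sum>j<i. W (\<kappa> (Suc j)) x - W (\<kappa> j) x) / s"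
    using t by (simp add: sum_path_def i_def sum_divide_distrib)
  also have "(\<Sum>j<i. W (\<kappa> (Suc j)) x - W (\<kappa> j) x) = W (\<kappa> i) x - W (\<kappa> 0) x"
    by (rule sum_lessThan_telescope)
  also have "\<kappa> 0 = 0" by (simp add: \<kappa>_def)
  also have "(W (\<kappa> i) x - W 0 x) / s = W (\<kappa> i) x / s" by simp
  finally have sp: "sum_path p (\<lambda>j. (W (\<kappa> (Suc j)) x - W (\<kappa> j) x) / s) t = W (\<kappa> i) x / s" .
  have "k \<le> n" unfolding k_def using \<beta> t by (rule kap_le)
  then have 1: "\<bar>inc x (1 / real r ^ k) / sqrt (V n) - W k x / sqrt (V n)\<bar> \<le> err n x"
    using inc_err[of k n x] V by (simp add: abs_divide flip: diff_divide_distrib)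
  have eq: "W k x / sqrt (V n) - W k x / s = W k x / s * (s / sqrt (V n) - 1)" using s V by (simp add: field_simps)
  have "\<bar>W k x / s\<bar> \<le> real p * \<epsilon>" using Wk s by (simp add: abs_divide pos_divide_le_eq mult.assoc)
  then have 2: "\<bar>W k x / sqrt (V n) - W k x / s\<bar> \<le> real p * \<epsilon> * \<bar>s / sqrt (V n) - 1\<bar>"
    unfolding eq abs_mult by (rule mult_right_mono) simp
  have "W k x / s - W (\<kappa> i) x / s = (W k x - W (\<kappa> i) x) / s" by (simp add: diff_divide_distrib)
  then have 3: "\<bar>W k x / s - W (\<kappa> i) x / s\<bar> \<le> \<epsilon>" using near s by (simp add: abs_divide pos_divide_le_eq)
  have "\<bar>inc x (1 / real r ^ k) / sqrt (V n) - W (\<kappa> i) x / s\<bar> \<le> err n x + real p * \<epsilon> * \<bar>s / sqrt (V n) - 1\<bar> + \<epsilon>"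
    using 1 2 3 by linarith
  then show ?thesis using sp unfolding k_def s_def \<kappa>_def by simp
qed

lemma kap_step_path:
  assumes \<beta>: "0 < \<beta>"
  shows "(\<lambda>t\<in>{0..1}. v (kap \<beta> n t)) \<in> skorokhod_space"
  unfolding kap_def
proof (rule step_path_in_skorokhod_space)
  show "continuous_on {0..1} (\<lambda>t. real n * t powr (1 / \<beta>))"
    using \<beta> by (intro continuous_on_mult continuous_on_const continuous_on_powr' continuous_on_id) auto
qed (use \<beta> in \<open>auto intro!: mult_left_mono powr_mono2\<close>)

text \<open>The parameter \<open>lm = \<epsilon> * p / 12\<close> minimises the exponent
  \<open>6 * lm\<^sup>2 / p - \<epsilon> * lm\<close>, with minimum
  \<open>- \<epsilon>\<^sup>2 * p / 24\<close>; the clock advances by about \<open>U n / p\<close>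
  per block, and \<open>2 / p\<close> leaves slack. Even multiplied by the number \<open>p\<close>
  of blocks the bound tends to 0 as \<open>p\<close> grows, which takes the place of a tightness
  argument.\<close>

lemma good_prob:
  assumes \<beta>: "0 < \<beta>" and rv: "regularly_varying_seq V \<beta>" and p: "0 < p" and \<epsilon>: "0 < \<epsilon>" and i: "i < p"
  shows "\<forall>\<^sub>F n in sequentially. \<P>(x in circle_measure. \<not> chain.tube b 0 (\<epsilon> * sqrt (U n)) (kap \<beta> n (real i / real p)) (kap \<beta> n (real (Suc i) / real p)) x)
    \<le> 2 * exp (- (\<epsilon>\<^sup>2 * real p / 24))"
proof -
  define \<kappa> where "\<kappa> n i = kap \<beta> n (real i / real p)" for n i
  define lm where "lm = \<epsilon> * real p / 12"
  have lam: "0 < lm" using \<epsilon> p by (simp add: lm_def)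
  have "(\<lambda>n. U (\<kappa> n (Suc i)) / U n - U (\<kappa> n i) / U n) \<longlonglongrightarrow> real (Suc i) / real p - real i / real p"
    unfolding \<kappa>_def by (intro tendsto_diff U_kap \<beta> rv) auto
  then have "\<forall>\<^sub>F n in sequentially. U (\<kappa> n (Suc i)) / U n - U (\<kappa> n i) / U n < 2 / real p"
    by (rule order_tendstoD) (use p in \<open>simp add: field_simps\<close>)
  moreover have "\<forall>\<^sub>F n in sequentially. \<forall>k\<in>{1..n}. \<bar>b k\<bar> \<le> 2 / (3 * lm) * sqrt (U n)"
    using lam by (intro b_small_U) simp
  moreover have "\<forall>\<^sub>F n in sequentially. 0 < U n" using quad_lim unfolding filterlim_at_top_dense by blast
  ultimately show ?thesis
  proof eventually_elim
    case (elim n)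
    define l where "l = lm / sqrt (U n)"
    have l: "0 < l" using lam elim by (simp add: l_def)
    have mn: "\<kappa> n i \<le> \<kappa> n (Suc i)" unfolding \<kappa>_def using \<beta> by (intro kap_mono divide_right_mono) auto
    have kn: "\<kappa> n (Suc i) \<le> n" unfolding \<kappa>_def using \<beta> i by (intro kap_le) auto
    have "\<P>(x in circle_measure. \<not> chain.tube b 0 (\<epsilon> * sqrt (U n)) (\<kappa> n i) (\<kappa> n (Suc i)) x) \<le>
      2 * exp (3 * l\<^sup>2 * (U (\<kappa> n (Suc i)) - U (\<kappa> n i)) - l * (\<epsilon> * sqrt (U n)))"
    proof (rule chain.mart_maximal[OF mn l])
      fix k assume "k \<in> {\<kappa> n i<..\<kappa> n (Suc i)}"
      then have "\<bar>b k\<bar> \<le> 2 / (3 * lm) * sqrt (U n)" using elim kn by auto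
      then have "l * \<bar>b k\<bar> \<le> l * (2 / (3 * lm) * sqrt (U n))" using l by (intro mult_left_mono) auto
      also have "\<dots> = 2 / 3" using lam elim by (simp add: l_def)
      finally show "l * \<bar>b k\<bar> * 3 / 2 \<le> 1" by simp
    qed
    also have "\<dots> \<le> 2 * exp (- (\<epsilon>\<^sup>2 * real p / 24))"
    proof -
      have e1: "3 * l\<^sup>2 * (U (\<kappa> n (Suc i)) - U (\<kappa> n i)) = 3 * lm\<^sup>2 * (U (\<kappa> n (Suc i)) / U n - U (\<kappa> n i) / U n)"
        using elim by (simp add: l_def power_divide flip: diff_divide_distrib)
      have e2: "l * (\<epsilon> * sqrt (U n)) = lm * \<epsilon>" using elim by (simp add: l_def)
      have "3 * lm\<^sup>2 * (U (\<kappa> n (Suc i)) / U n - U (\<kappa> n i) / U n) \<le> 3 * lm\<^sup>2 * (2 / real p)"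
        using elim by (intro mult_left_mono) auto
      also have "\<dots> = \<epsilon>\<^sup>2 * real p / 24" using p by (simp add: lm_def power2_eq_square field_simps)
      finally have e3: "3 * l\<^sup>2 * (U (\<kappa> n (Suc i)) - U (\<kappa> n i)) \<le> \<epsilon>\<^sup>2 * real p / 24" unfolding e1 .
      have e4: "lm * \<epsilon> = \<epsilon>\<^sup>2 * real p / 12" by (simp add: lm_def power2_eq_square)
      show ?thesis unfolding e2 e4 using e3 by simp
    qed
    finally show ?case unfolding \<kappa>_def .
  qed
qed

lemma rescaled_path_measurable:
  assumes \<beta>: "0 < \<beta>"
  shows "(\<lambda>x. (\<lambda>t\<in>{0..1}. inc x (1 / real r ^ kap \<beta> n t) / sqrt (V n))) \<in> circle_measure \<rightarrow>\<^sub>M borel_algebra skorokhod.mtopology"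
proof (rule step_path_measurable[where y = "\<lambda>k x. inc x (1 / real r ^ k) / sqrt (V n)" and N = n])
  show "(\<lambda>x. inc x (1 / real r ^ k) / sqrt (V n)) \<in> borel_measurable circle_measure" for k
    by (intro borel_measurable_divide inc_measurable) simp
  show "kap \<beta> n t \<le> n" if "t \<in> {0..1}" for t using kap_le[OF \<beta> that] .
  show "(\<lambda>t\<in>{0..1}. v (kap \<beta> n t)) \<in> skorokhod_space" for v :: "nat \<Rightarrow> real"
    by (rule kap_step_path[OF \<beta>])
qed

text \<open>The path is compared with its skeleton at \<open>p\<close> equidistant times, whose
  increments converge for fixed \<open>p\<close>, and the skeleton of Brownian motion is close to
  the motion for large \<open>p\<close>. Accordingly \<epsilon> is chosen first, then
  \<open>p\<close>, and \<open>n\<close> last.\<close>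

theorem functional_CLT:
  assumes \<beta>: "0 < \<beta>" and rv: "regularly_varying_seq V \<beta>" and BM: "standard_brownian_motion P \<B>"
  shows "converges_in_distribution skorokhod.mtopology circle_measure
    (\<lambda>n x. (\<lambda>t\<in>{0..1}. inc x (1 / real r ^ kap \<beta> n t) / sqrt (V n))) P (sample_path \<B>)"
proof (rule skorokhod.converges_in_distribution_Lipschitz)
  interpret bm: brownian_motion P \<B> by (rule brownian_motion.intro) (rule BM)
  show "prob_space circle_measure" by (rule prob_space_circle_measure)
  show "prob_space P" by (rule bm.prob_space_P)
  show "sample_path \<B> \<in> P \<rightarrow>\<^sub>M borel_algebra skorokhod.mtopology" by (rule bm.sample_path_measurable)
  show "(\<lambda>x. (\<lambda>t\<in>{0..1}. inc x (1 / real r ^ kap \<beta> n t) / sqrt (V n))) \<in> circle_measure \<rightarrow>\<^sub>M borel_algebra skorokhod.mtopology" for n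
    by (rule rescaled_path_measurable[OF \<beta>])
  fix \<Phi> :: "(real \<Rightarrow> real) \<Rightarrow> real" and K B :: real
  assume "\<And>x y. x \<in> skorokhod_space \<Longrightarrow> y \<in> skorokhod_space \<Longrightarrow> \<bar>\<Phi> x - \<Phi> y\<bar> \<le> K * skorokhod_dist x y"
    "\<And>x. x \<in> skorokhod_space \<Longrightarrow> \<bar>\<Phi> x\<bar> \<le> B" "0 \<le> K"
  then interpret L: skorokhod_Lipschitz \<Phi> K B by unfold_locales
  define X where "X n x = (\<lambda>t\<in>{0..1}. inc x (1 / real r ^ kap \<beta> n t) / sqrt (V n))" for n x
  define \<Delta> where "\<Delta> p n x j = (W (kap \<beta> n (real (Suc j) / real p)) x - W (kap \<beta> n (real j / real p)) x) / sqrt (U n)" for p n x j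
  define Gp where "Gp p = gauss_fold p (1 / real p) (\<lambda>y. \<Phi> (sum_path p y)) p (\<lambda>_. 0)" for p
  define bad where "bad p \<epsilon> n i x \<longleftrightarrow> \<not> chain.tube b 0 (\<epsilon> * sqrt (U n)) (kap \<beta> n (real i / real p)) (kap \<beta> n (real (Suc i) / real p)) x" for p \<epsilon> n i x
  have bad_meas [measurable]: "Measurable.pred circle_measure (bad p \<epsilon> n i)" for p \<epsilon> n i
    unfolding bad_def using chain.tube_pred by measurable
  have Upos: "\<forall>\<^sub>F n in sequentially. 0 < U n" using quad_lim unfolding filterlim_at_top_dense by blast
  have XM: "X n \<in> circle_measure \<rightarrow>\<^sub>M borel_algebra skorokhod.mtopology" for n
    unfolding X_def by (rule rescaled_path_measurable[OF \<beta>])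
  have SM: "(\<lambda>x. sum_path p (\<Delta> p n x)) \<in> circle_measure \<rightarrow>\<^sub>M borel_algebra skorokhod.mtopology" for p n
    unfolding \<Delta>_def by (intro sum_path_measurable borel_measurable_divide borel_measurable_diff chain.mart_measurable) auto
  have Xin: "X n x \<in> skorokhod_space" for n x
    unfolding X_def by (rule kap_step_path[OF \<beta>, of "\<lambda>k. inc x (1 / real r ^ k) / sqrt (V n)"])
  have Glim: "(\<lambda>n. \<integral>x. \<Phi> (sum_path p (\<Delta> p n x)) \<partial>circle_measure) \<longlonglongrightarrow> Gp p" if p: "0 < p" for p
    unfolding \<Delta>_def Gp_def
  proof (rule increments_converge[where N = "\<lambda>n. n" and \<kappa> = "\<lambda>n j. kap \<beta> n (real j / real p)", OF L.lipschitz_sum_path])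
    show "kap \<beta> n (real j / real p) \<le> kap \<beta> n (real (Suc j) / real p)" for n j
      using \<beta> by (intro kap_mono divide_right_mono) auto
    show "kap \<beta> n (real j / real p) \<le> n" if "j \<le> p" for n j using that \<beta> p by (intro kap_le) auto
    show "(\<lambda>n. (U (kap \<beta> n (real (Suc j) / real p)) - U (kap \<beta> n (real j / real p))) / U n) \<longlonglongrightarrow> 1 / real p" for j
    proof -
      have "(\<lambda>n. U (kap \<beta> n (real (Suc j) / real p)) / U n - U (kap \<beta> n (real j / real p)) / U n) \<longlonglongrightarrow> real (Suc j) / real p - real j / real p"
        by (intro tendsto_diff U_kap \<beta> rv) auto
      then show ?thesis by (simp add: diff_divide_distrib[symmetric])
    qed
  qed (use p in \<open>auto simp: filterlim_ident\<close>)
  \<comment> \<open>\<open>err\<close> tends to 0 only almost everywhere. Truncation at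
    \<open>2 * B\<close>, a bound for the difference of two values of the functional, makes
    dominated convergence applicable.\<close>
  define Z where "Z n x = min (2 * B) (K * err n x)" for n x
  have Zm [measurable]: "Z n \<in> borel_measurable circle_measure" for n
    using err_measurable unfolding Z_def[abs_def] by measurable
  have Z0: "0 \<le> Z n x" "Z n x \<le> 2 * B" for n x
    using L.B_nonneg L.K err_nonneg[of n x] by (auto simp: Z_def)
  have Zlim: "(\<lambda>n. \<integral>x. Z n x \<partial>circle_measure) \<longlonglongrightarrow> (\<integral>x. 0 \<partial>circle_measure)"
  proof (rule integral_dominated_convergence[where w = "\<lambda>_. 2 * B"])
    show "AE x in circle_measure. (\<lambda>n. Z n x) \<longlonglongrightarrow> 0" using err_lim
    proof eventually_elim
      case (elim x)
      have "(\<lambda>n. min (2 * B) (K * err n x)) \<longlonglongrightarrow> min (2 * B) (K * 0)" by (intro tendsto_intros elim)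
      then show ?case using L.B_nonneg by (simp add: Z_def)
    qed
  qed (use Z0 in auto)
  have close: "\<forall>\<^sub>F n in sequentially. \<bar>(\<integral>x. \<Phi> (X n x) \<partial>circle_measure) - (\<integral>x. \<Phi> (sum_path p (\<Delta> p n x)) \<partial>circle_measure)\<bar>
      \<le> (\<integral>x. Z n x \<partial>circle_measure) + K * (real p * \<epsilon> * \<bar>sqrt (U n) / sqrt (V n) - 1\<bar> + \<epsilon>) + 2 * B * (real p * (2 * exp (- (\<epsilon>\<^sup>2 * real p / 24))))"
    if p: "0 < p" and \<epsilon>: "0 < \<epsilon>" for p \<epsilon>
  proof -
    have "\<forall>\<^sub>F n in sequentially. \<forall>i\<in>{..<p}. \<P>(x in circle_measure. bad p \<epsilon> n i x) \<le> 2 * exp (- (\<epsilon>\<^sup>2 * real p / 24))"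
      unfolding bad_def by (rule eventually_ball_finite, simp, intro ballI good_prob[OF \<beta> rv p \<epsilon>], simp)
    with Upos V_pos show ?thesis
    proof eventually_elim
      case (elim n)
      define c where "c = K * (real p * \<epsilon> * \<bar>sqrt (U n) / sqrt (V n) - 1\<bar> + \<epsilon>)"
      have c0: "0 \<le> c" using \<epsilon> L.K by (simp add: c_def)
      \<comment> \<open>When some block is bad, the difference is bounded by \<open>2 * B\<close>
        only; the sum of indicators accounts for this by a union bound.\<close>
      define R where "R x = Z n x + c + 2 * B * (\<Sum>i<p. of_bool (bad p \<epsilon> n i x))" for x
      have ptw: "\<bar>\<Phi> (X n x) - \<Phi> (sum_path p (\<Delta> p n x))\<bar> \<le> R x" for x
      proof (cases "\<exists>i<p. bad p \<epsilon> n i x")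
        case True
        then obtain i where i: "i < p" "bad p \<epsilon> n i x" by blast
        have "(1::real) \<le> (\<Sum>i<p. of_bool (bad p \<epsilon> n i x))"
          using i member_le_sum[of i "{..<p}" "\<lambda>i. of_bool (bad p \<epsilon> n i x) :: real"] by simp
        then have "2 * B * 1 \<le> 2 * B * (\<Sum>i<p. of_bool (bad p \<epsilon> n i x))" using L.B_nonneg by (intro mult_left_mono) auto
        moreover have "\<bar>\<Phi> (X n x)\<bar> \<le> B" "\<bar>\<Phi> (sum_path p (\<Delta> p n x))\<bar> \<le> B" by (intro L.bdd Xin sum_path_in_skorokhod_space)+
        ultimately show ?thesis using Z0[of n x] c0 unfolding R_def by linarith
      next
        case False
        have "skorokhod_dist (X n x) (sum_path p (\<Delta> p n x)) \<le> err n x + real p * \<epsilon> * \<bar>sqrt (U n) / sqrt (V n) - 1\<bar> + \<epsilon>"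
        proof (rule skorokhod_dist_uniform)
          fix t :: real assume t: "t \<in> {0..1}"
          have "\<bar>inc x (1 / real r ^ kap \<beta> n t) / sqrt (V n) - sum_path p (\<Delta> p n x) t\<bar> \<le> err n x + real p * \<epsilon> * \<bar>sqrt (U n) / sqrt (V n) - 1\<bar> + \<epsilon>"
            unfolding \<Delta>_def by (rule path_close) (use \<beta> elim p \<epsilon> t False in \<open>auto simp: bad_def\<close>)
          then show "\<bar>X n x t - sum_path p (\<Delta> p n x) t\<bar> \<le> err n x + real p * \<epsilon> * \<bar>sqrt (U n) / sqrt (V n) - 1\<bar> + \<epsilon>"
            using t by (simp add: X_def)
        qed (use \<epsilon> err_nonneg[of n x] in \<open>intro add_nonneg_nonneg mult_nonneg_nonneg; simp\<close>)
        then have "K * skorokhod_dist (X n x) (sum_path p (\<Delta> p n x)) \<le> K * (err n x + real p * \<epsilon> * \<bar>sqrt (U n) / sqrt (V n) - 1\<bar> + \<epsilon>)"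
          using L.K by (intro mult_left_mono)
        also have "\<dots> = K * err n x + c" by (simp add: c_def algebra_simps)
        finally have "\<bar>\<Phi> (X n x) - \<Phi> (sum_path p (\<Delta> p n x))\<bar> \<le> K * err n x + c"
          using L.lip[OF Xin sum_path_in_skorokhod_space, of n x p "\<Delta> p n x"] by linarith
        moreover have "\<bar>\<Phi> (X n x)\<bar> \<le> B" "\<bar>\<Phi> (sum_path p (\<Delta> p n x))\<bar> \<le> B" by (intro L.bdd Xin sum_path_in_skorokhod_space)+
        ultimately have "\<bar>\<Phi> (X n x) - \<Phi> (sum_path p (\<Delta> p n x))\<bar> \<le> Z n x + c" using c0 unfolding Z_def by linarith
        moreover have "(\<Sum>i<p. of_bool (bad p \<epsilon> n i x)) = (0::real)" using False by (intro sum.neutral) auto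
        ultimately show ?thesis by (simp add: R_def)
      qed
      have intX: "integrable circle_measure (\<lambda>x. \<Phi> (X n x))"
        by (rule chain.integrable_const_bound[of _ B]) (auto intro!: L.bdd Xin L.measurable[OF XM])
      have intS: "integrable circle_measure (\<lambda>x. \<Phi> (sum_path p (\<Delta> p n x)))"
        by (rule chain.integrable_const_bound[of _ B]) (auto intro!: L.bdd sum_path_in_skorokhod_space L.measurable[OF SM])
      have intZ: "integrable circle_measure (Z n)"
        by (rule chain.integrable_const_bound[of _ "2 * B"]) (use Z0 in auto)
      have intb: "integrable circle_measure (\<lambda>x. of_bool (bad p \<epsilon> n i x) :: real)" for i
        by (rule chain.integrable_const_bound[of _ 1]) auto
      have "\<bar>(\<integral>x. \<Phi> (X n x) \<partial>circle_measure) - (\<integral>x. \<Phi> (sum_path p (\<Delta> p n x)) \<partial>circle_measure)\<bar> = \<bar>\<integral>x. \<Phi> (X n x) - \<Phi> (sum_path p (\<Delta> p n x)) \<partial>circle_measure\<bar>"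
        by (simp add: intX intS)
      also have "\<dots> \<le> (\<integral>x. \<bar>\<Phi> (X n x) - \<Phi> (sum_path p (\<Delta> p n x))\<bar> \<partial>circle_measure)" by (rule integral_abs_bound)
      also have "\<dots> \<le> (\<integral>x. R x \<partial>circle_measure)"
      proof (rule integral_mono)
        show "integrable circle_measure R" unfolding R_def
          by (intro Bochner_Integration.integrable_add intZ integrable_mult_right Bochner_Integration.integrable_sum intb chain.integrable_const)
      qed (use intX intS ptw in auto)
      also have "\<dots> = (\<integral>x. Z n x \<partial>circle_measure) + c + 2 * B * (\<Sum>i<p. \<integral>x. of_bool (bad p \<epsilon> n i x) \<partial>circle_measure)"
        unfolding R_def using intZ intb by (simp add: chain.prob_space[unfolded space_circle_measure] del: sum_of_bool_eq)
      also have "\<dots> \<le> (\<integral>x. Z n x \<partial>circle_measure) + c + 2 * B * (\<Sum>i<p. 2 * exp (- (\<epsilon>\<^sup>2 * real p / 24)))"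
      proof -
        have "(\<integral>x. of_bool (bad p \<epsilon> n i x) \<partial>circle_measure) = \<P>(x in circle_measure. bad p \<epsilon> n i x)" for i
        proof -
          define S where "S = {x \<in> space circle_measure. bad p \<epsilon> n i x}"
          have "(\<integral>x. of_bool (bad p \<epsilon> n i x) \<partial>circle_measure) = (\<integral>x. indicator S x \<partial>circle_measure)"
            by (intro Bochner_Integration.integral_cong) (auto simp: indicator_def S_def)
          also have "\<dots> = measure circle_measure (S \<inter> space circle_measure)" by simp
          also have "S \<inter> space circle_measure = S" by (auto simp: S_def)
          finally show ?thesis unfolding S_def .
        qed
        then show ?thesis using elim L.B_nonneg by (intro add_left_mono mult_left_mono sum_mono) auto
      qed
      finally show ?case by (simp add: c_def)
    qed
  qed
  have Blim: "(\<lambda>q. Gp (Suc q)) \<longlonglongrightarrow> (\<integral>\<omega>. \<Phi> (sample_path \<B> \<omega>) \<partial>P)"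
    unfolding Gp_def by (rule L.brownian_gauss[OF BM])
  show "(\<lambda>n. \<integral>x. \<Phi> (\<lambda>t\<in>{0..1}. inc x (1 / real r ^ kap \<beta> n t) / sqrt (V n)) \<partial>circle_measure) \<longlonglongrightarrow> (\<integral>\<omega>. \<Phi> (sample_path \<B> \<omega>) \<partial>P)"
    unfolding X_def[symmetric]
  proof (rule tendstoI)
    fix e :: real assume e: "0 < e"
    define \<epsilon> where "\<epsilon> = e / (8 * (K + 1))"
    have eps: "0 < \<epsilon>" "K * \<epsilon> \<le> e / 8"
    proof -
      show "0 < \<epsilon>" using e L.K by (simp add: \<epsilon>_def)
      have "K * \<epsilon> \<le> (K + 1) * \<epsilon>" using \<open>0 < \<epsilon>\<close> by (simp add: algebra_simps)
      also have "\<dots> = e / 8"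
      proof -
        have "0 < 8 * (K + 1)" by (intro mult_pos_pos add_nonneg_pos L.K) simp_all
        then have "\<epsilon> * (8 * (K + 1)) = e" by (metis \<epsilon>_def nonzero_eq_divide_eq less_irrefl)
        moreover have "\<epsilon> * (8 * (K + 1)) = 8 * ((K + 1) * \<epsilon>)" by simp
        ultimately show ?thesis by linarith
      qed
      finally show "K * \<epsilon> \<le> e / 8" .
    qed
    have "0 < \<epsilon>\<^sup>2 / 24" using eps by simp
    \<comment> \<open>The linear factor is the number of blocks in the union bound; the exponential
      decay of \<open>good_prob\<close> outweighs it.\<close>
    then have "(\<lambda>q. 2 * B * (real (Suc q) * (2 * exp (- (\<epsilon>\<^sup>2 / 24 * real (Suc q)))))) \<longlonglongrightarrow> 0"
      by real_asymp
    then have "(\<lambda>q. 2 * B * (real (Suc q) * (2 * exp (- (\<epsilon>\<^sup>2 * real (Suc q) / 24))))) \<longlonglongrightarrow> 0" by simp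
    then have "\<forall>\<^sub>F q in sequentially. 2 * B * (real (Suc q) * (2 * exp (- (\<epsilon>\<^sup>2 * real (Suc q) / 24)))) < e / 8"
      by (rule order_tendstoD) (use e in simp)
    moreover have "\<forall>\<^sub>F q in sequentially. dist (Gp (Suc q)) (\<integral>\<omega>. \<Phi> (sample_path \<B> \<omega>) \<partial>P) < e / 8"
      using e by (intro tendstoD[OF Blim]) simp
    ultimately have "\<exists>q. 2 * B * (real (Suc q) * (2 * exp (- (\<epsilon>\<^sup>2 * real (Suc q) / 24)))) < e / 8 \<and> dist (Gp (Suc q)) (\<integral>\<omega>. \<Phi> (sample_path \<B> \<omega>) \<partial>P) < e / 8"
      using eventually_happens'[OF sequentially_bot eventually_conj] by blast
    then obtain p where p: "0 < p" "2 * B * (real p * (2 * exp (- (\<epsilon>\<^sup>2 * real p / 24)))) < e / 8"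
      "dist (Gp p) (\<integral>\<omega>. \<Phi> (sample_path \<B> \<omega>) \<partial>P) < e / 8" by blast
    have "(\<lambda>n. K * (real p * \<epsilon> * \<bar>sqrt (U n) / sqrt (V n) - 1\<bar> + \<epsilon>)) \<longlonglongrightarrow> K * (real p * \<epsilon> * \<bar>1 - 1\<bar> + \<epsilon>)"
      by (intro tendsto_intros sqrt_UV)
    then have "\<forall>\<^sub>F n in sequentially. K * (real p * \<epsilon> * \<bar>sqrt (U n) / sqrt (V n) - 1\<bar> + \<epsilon>) < e / 4"
      by (rule order_tendstoD) (use eps e in simp)
    moreover have "\<forall>\<^sub>F n in sequentially. (\<integral>x. Z n x \<partial>circle_measure) < e / 8"
      using Zlim by (rule order_tendstoD) (use e in simp)
    moreover have "\<forall>\<^sub>F n in sequentially. dist (\<integral>x. \<Phi> (sum_path p (\<Delta> p n x)) \<partial>circle_measure) (Gp p) < e / 8"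
      using e by (intro tendstoD[OF Glim[OF p(1)]]) simp
    ultimately show "\<forall>\<^sub>F n in sequentially. dist (\<integral>x. \<Phi> (X n x) \<partial>circle_measure) (\<integral>\<omega>. \<Phi> (sample_path \<B> \<omega>) \<partial>P) < e"
      using close[OF p(1) eps(1)]
    proof eventually_elim
      case (elim n)
      then show ?case using p(2,3) e unfolding dist_real_def by linarith
    qed
  qed
qed

end

theorem corollary2p2:
  fixes r :: nat and a :: "nat \<Rightarrow> real" and \<delta> :: real and \<sigma> :: "real \<Rightarrow> real"
  assumes "r \<ge> 2"
    and "filterlim (\<lambda>n. \<Sum>k=1..n. (a k)\<^sup>2) at_top sequentially"
    and "0 < \<delta>" and "\<delta> \<le> 1"
    and "(\<lambda>n. (a n)\<^sup>2) \<in> O(\<lambda>n. (\<Sum>k=1..n. (a k)\<^sup>2) powr (1 - \<delta>))"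
    and "antimono_on {0<..<1} \<sigma>" and "continuous_on {0<..<1} \<sigma>"
    and "\<forall>n\<ge>1. \<sigma> (1 / real r ^ n) = V_seq r a n"
  shows
    "(\<forall>y. ((\<lambda>h. \<P>(x in circle_measure.
              (takagi_vdw r a (x + h) - takagi_vdw r a x) / (h * sqrt (\<sigma> \<bar>h\<bar>)) \<le> y))
          \<longlongrightarrow> (LINT t:{..y}|lborel. 1 / sqrt (2 * pi) * exp (- (t\<^sup>2 / 2)))) (at 0))
     \<and> (AE x in circle_measure. \<forall>y\<in>{-1..1}. \<exists>h :: nat \<Rightarrow> real.
          (\<forall>n. 0 < \<bar>h n\<bar> \<and> \<bar>h n\<bar> < 1) \<and> h \<longlonglongrightarrow> 0 \<and>
          (\<lambda>n. (takagi_vdw r a (x + h n) - takagi_vdw r a x)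
               / (h n * sqrt (2 * \<sigma> \<bar>h n\<bar> * ln (ln (\<sigma> \<bar>h n\<bar>))))) \<longlonglongrightarrow> y)
     \<and> (AE x in circle_measure.
          Liminf (at_right 0) (\<lambda>h. ereal (sqrt (ln (ln (\<sigma> h)) / \<sigma> h)) *
            (SUP T\<in>{h<..<1}. ereal (\<bar>takagi_vdw r a (x + T) - takagi_vdw r a x\<bar> / T)))
          = ereal (pi / sqrt 8))
     \<and> (\<forall>\<beta>>0. regularly_varying_seq (V_seq r a) \<beta> \<longrightarrow>
          (\<forall>(W :: 'b measure) B. standard_brownian_motion W B \<longrightarrow>
            converges_in_distribution skorokhod.mtopology
              circle_measure
              (\<lambda>n. sample_path (\<lambda>t x.
                 (takagi_vdw r a (x + 1 / real r ^ nat \<lfloor>real n * t powr (1 / \<beta>)\<rfloor>) - takagi_vdw r a x)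
                 / (1 / real r ^ nat \<lfloor>real n * t powr (1 / \<beta>)\<rfloor> * sqrt (V_seq r a n))))
              W (sample_path B)))"
proof -
  interpret takagi_sigma r a \<delta> \<sigma>
    by unfold_locales (use assms in auto)
  have "((\<lambda>h. \<P>(x in circle_measure. (f (x + h) - f x) / (h * sqrt (\<sigma> \<bar>h\<bar>)) \<le> y))
      \<longlongrightarrow> (LINT t:{..y}|lborel. 1 / sqrt (2 * pi) * exp (- (t\<^sup>2 / 2)))) (at 0)" for y
    using CLT[of y] unfolding std_normal_cdf inc_def divide_divide_eq_left .
  moreover have "AE x in circle_measure. \<forall>y\<in>{-1..1}. \<exists>h :: nat \<Rightarrow> real.
      (\<forall>n. 0 < \<bar>h n\<bar> \<and> \<bar>h n\<bar> < 1) \<and> h \<longlonglongrightarrow> 0 \<and>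
      (\<lambda>n. (f (x + h n) - f x) / (h n * sqrt (2 * \<sigma> \<bar>h n\<bar> * ln (ln (\<sigma> \<bar>h n\<bar>))))) \<longlonglongrightarrow> y"
    using LIL_cluster
  proof eventually_elim
    case (elim x)
    show ?case
    proof
      fix y :: real assume "y \<in> {-1..1}"
      then obtain h :: "nat \<Rightarrow> real" where h: "\<And>n. 0 < h n" "\<And>n. h n < 1" "h \<longlonglongrightarrow> 0" "(\<lambda>n. \<phi> x (h n)) \<longlonglongrightarrow> y"
        using elim by blast
      have "\<bar>h n\<bar> = h n" for n using h(1)[of n] by simp
      then show "\<exists>h :: nat \<Rightarrow> real. (\<forall>n. 0 < \<bar>h n\<bar> \<and> \<bar>h n\<bar> < 1) \<and> h \<longlonglongrightarrow> 0 \<and>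
          (\<lambda>n. (f (x + h n) - f x) / (h n * sqrt (2 * \<sigma> \<bar>h n\<bar> * ln (ln (\<sigma> \<bar>h n\<bar>))))) \<longlonglongrightarrow> y"
        using h unfolding \<phi>_def inc_def divide_divide_eq_left by (intro exI[of _ h]) simp
    qed
  qed
  moreover have "AE x in circle_measure. Liminf (at_right 0) (\<lambda>h. ereal (sqrt (ln (ln (\<sigma> h)) / \<sigma> h)) *
      (SUP T\<in>{h<..<1}. ereal (\<bar>f (x + T) - f x\<bar> / T))) = ereal (pi / sqrt 8)"
    using Chung
  proof eventually_elim
    case (elim x)
    have S: "(SUP T\<in>{h<..<1}. ereal \<bar>inc x T\<bar>) = (SUP T\<in>{h<..<1}. ereal (\<bar>f (x + T) - f x\<bar> / T))" if "0 < h" for h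
      using that by (intro SUP_cong) (auto simp: inc_def)
    \<comment> \<open>The two functions of \<open>h\<close> agree for positive \<open>h\<close>,
      which is all that the one-sided filter sees.\<close>
    have "Liminf (at_right 0) (\<lambda>h. ereal (pref (\<sigma> h)) * (SUP T\<in>{h<..<1}. ereal \<bar>inc x T\<bar>))
      = Liminf (at_right 0) (\<lambda>h. ereal (sqrt (ln (ln (\<sigma> h)) / \<sigma> h)) * (SUP T\<in>{h<..<1}. ereal (\<bar>f (x + T) - f x\<bar> / T)))"
      by (rule Liminf_eq) (use eventually_at_right_less[of 0] in eventually_elim, simp only: S pref_def)
    then show ?case using elim by simp
  qed
  moreover have "converges_in_distribution skorokhod.mtopology circle_measure
      (\<lambda>n. sample_path (\<lambda>t x. (f (x + 1 / real r ^ nat \<lfloor>real n * t powr (1 / \<beta>)\<rfloor>) - f x)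
         / (1 / real r ^ nat \<lfloor>real n * t powr (1 / \<beta>)\<rfloor> * sqrt (V n)))) W (sample_path B)"
    if "0 < \<beta>" "regularly_varying_seq V \<beta>" "standard_brownian_motion W B" for \<beta> and W :: "'b measure" and B
    using functional_CLT[OF that] unfolding inc_def kap_def divide_divide_eq_left sample_path_def .
  ultimately show ?thesis by blast
qed

end
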